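(* Suppose that $\tau_1,\tau_2\in\mathrm{QT}_4$ are gluable (i.e. $\tau_1+\tau_2$ is defined) and of types $RI_{par}$-$RI_{par}$, $OP_{lr}$-$UP_{par}$, or $OP_{lr}$-$OP_{lr}$ (type of $\tau_1$ - type of $\tau_2$). Take generating functions $P(\tau_1),P(\tau_2)$ in active quiver form (type $UP_{par}$) resp. inactive quiver form (types $RI_{par}$, $OP_{lr}$), and expand them into generating functions in quiver form, with $a_1$ resp. $a_2$ active and $i_1$ resp. $i_2$ inactive summation indices. Then $P(\tau_1+\tau_2)$ can be brought into quiver form with a total of $(a_1+i_1)(a_2+i_2)$ summation indices.
   Context: Tangles. $\mathrm{T}_4$ is the set of framed oriented tangles in the 3-ball (two arcs, possibly closed components) with exactly four boundary points, at positions SW, NW, SE, NE, represented by planar diagrams (blackboard framing); ${}_\bullet\mathrm{T}_4\subset\mathrm{T}_4$ is the subset where the SW point is oriented inward. Boundary types in ${}_\bullet\mathrm{T}_4$: $UP$ (SW, SE in; NW, NE out), $OP$ (SW, NE in; NW, SE out), $RI$ (SW, NW in; SE, NE out). Refined types (connectivity of the arcs; closed components allowed): $UP_{par}$ (SW$\to$NW, SE$\to$NE), $UP_{cr}$ (SW$\to$NE, SE$\to$NW), $OP_{ud}$ (SW$\to$NW, NE$\to$SE), $OP_{lr}$ (SW$\to$SE, NE$\to$NW), $RI_{par}$ (SW$\to$SE, NW$\to$NE), $RI_{cr}$ (SW$\to$NE, NW$\to$SE). $\tau_1+\tau_2$ (Conway's tangle addition) joins NE of $\tau_1$ to NW of $\tau_2$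 and SE of $\tau_1$ to SW of $\tau_2$; it is defined if orientations match there. $T\tau$ attaches a crossing on top: the strand from the NW point of $\tau$ passes over to the new NE point, the strand from NE passes under to the new NW point. $R\tau$ attaches a crossing on the right: the strand from SE passes over to the new NE point, the strand from NE passes under to the new SE point. $T^{-1},R^{-1}$ attach the inverse crossings. Webs. For $0\le k\le j$ basic MOY webs with all four boundary edges labelled $j$: $UP[j,k]$ has two upward strands, joined by a lower $k$-labelled rung from right to left and an upper $k$-labelled rung from left to right (middle edges $j+k$, $j-k$); $OP[j,k]$ has an upward left and a downward right strand, a lower $k$-rung from left to right and an upper $k$-rung from right to left (middle edges $j-k$); $RI[j,k]$ has a square with left-to-right rungs labelled $k$ (top) and $2j-k$ (bottom) and vertical middle edges $j-k$ (left downward, right upward). For $\tau\in{}_\bullet\mathrm{T}_4$ of boundary type $X$, $\langle\tau\rangle_j$ is the $\wedge^j$-colored HOMFLY-PT invariant, an element of the free $\mathbb{Q}[a^{\pm1}](q)$-module on $X[j,k]$, $0\le k\le j$: all strands are labelled $j$, a positive crossing of upward strands is $\sum_{k=0}^j(-q)^{k-j}UP[j,k]$, a negative one is obtained by $q\mapsto q^{-1}$, and webs are reduced by the MOY relations with $a=q^N$ (i.e. webs are read as $U_q(\mathfrak{gl}_N)$-intertwiners of quantum exterior powers and duals, uniformly in $N\gg0$). $P(\tau)=\sum_{j\ge0}\langle\tau\rangle_j$ (formal sum). Quiver forms. $\mathbb N=\mathbb Z_{\ge0}$, $(q^2)_k=\prod_{i=1}^k(1-q^{2i})$, $\begin{bmatrix}|\mathbf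 d|\\\mathbf d\end{bmatrix}=(q^2)_{|\mathbf d|}/\prod_i(q^2)_{d_i}$, $|\mathbf d|=\sum d_i$. Let $\tau$ be of boundary type $X$ with $c$ closed components. $P(\tau)$ is in quiver form (with $m$ active and $n$ inactive, in total $m+n$, summation indices) if $$P(\tau)=\sum_{\mathbf d\in\mathbb N^{m+n}}(-q)^{S\cdot\mathbf d}a^{A\cdot\mathbf d}q^{\mathbf d\cdot Q\cdot\mathbf d^t}\begin{bmatrix}|\mathbf d_a|\\\mathbf d_a\end{bmatrix}\begin{bmatrix}|\mathbf d_i|\\\mathbf d_i\end{bmatrix}(q^2)_{|\mathbf d|}^{-c}\,X[|\mathbf d|,|\mathbf d_a|]$$ with $m,n\in\mathbb N$, $m+n\ge1$, $S,A\in\mathbb Z^{m+n}$, $Q\in\mathbb Z^{(m+n)\times(m+n)}$, where $\mathbf d=(\mathbf d_a,\mathbf d_i)$, $\mathbf d_a\in\mathbb N^m$ (active indices), $\mathbf d_i\in\mathbb N^n$ (inactive indices). $\tau\in\mathcal F_a(X)$ (active quiver form) if $P(\tau)$ has such an expression with $(q^2)_{|\mathbf d|}^{-c}$ replaced by $(q^2)_{|\mathbf d_a|}(q^2)_{|\mathbf d|}^{-c}$; $\tau\in\mathcal F_i(X)$ (inactive quiver form) if with $(q^2)_{|\mathbf d_i|}(q^2)_{|\mathbf d|}^{-c}$. Expansion into quiver form. By the identity $$\frac{(x^2;q^2)_{d_1+\dots+d_k}}{(q^2)_{d_1}\cdots(q^2)_{d_k}}=\sum_{\alpha_i+\beta_i=d_i}\frac{(-x^2q^{-1})^{\alpha_1+\dots+\alpha_k}q^{\alpha_1^2+\dots+\alpha_k^2+2\sum_{i=1}^{k-1}\alpha_{i+1}(d_1+\dots+d_i)}}{(q^2)_{\alpha_1}\cdots(q^2)_{\alpha_k}(q^2)_{\beta_1}\cdots(q^2)_{\beta_k}},\qquad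 (x^2;q^2)_k=\prod_{i=0}^{k-1}(1-x^2q^{2i}),$$ at $x=q$, the extra factor $(q^2)_{|\mathbf d_a|}$ (resp. $(q^2)_{|\mathbf d_i|}$) can be absorbed at the cost of doubling the number of active (resp. inactive) indices: an active quiver form with $m$ active and $n$ inactive indices expands into a quiver form with $2m$ active and $n$ inactive indices, and an inactive quiver form with $m$ active and $n$ inactive indices into a quiver form with $m$ active and $2n$ inactive indices. Families. ${}_\bullet\mathrm{QT}_4\subset{}_\bullet\mathrm{T}_4$ consists of the $\tau$ such that: (1) $\tau\in\mathcal F_a(UP)$ if $\tau$ has type $UP_{par}$; (2) $\tau\in\mathcal F_a(OP)$ if type $OP_{ud}$; (3) $\tau\in\mathcal F_i(OP)$ if type $OP_{lr}$; (4) $\tau\in\mathcal F_i(RI)$ if type $RI_{par}$; (5) if type $UP_{cr}$ or $RI_{cr}$: $C\tau\in{}_\bullet\mathrm{QT}_4$ for at least one $C\in\{T,T^{-1},R,R^{-1}\}$. $\mathrm{QT}_4\subset\mathrm{T}_4$ consists of the $\tau$ for which some rotation $r$ of the plane (by a multiple of $\pi/2$) satisfies $r(\tau)\in{}_\bullet\mathrm{QT}_4$. *)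

theory Defs
  imports
    "HOL-Library.Poly_Mapping"
    "HOL-Computational_Algebra.Computational_Algebra"
begin

section \<open>Tangle diagrams\<close>

text \<open>
  Blackboard-framed oriented planar diagrams are taken in Morse position and read from bottom
  to top: a diagram is a list of layers \<open>(i, g)\<close>, where the elementary piece \<open>g\<close> is placed to the
  right of \<open>i\<close> vertical strands (and to the left of all the others). Every planar diagram is planar
  isotopic to such a one. Directions are those of the strand at the place where it crosses a
  horizontal line. \<open>Cross o d e\<close> is a crossing whose lower left and lower right ends have
  directions \<open>d\<close> and \<open>e\<close>; with \<open>Slash\<close> the strand from the lower left to the upper right is the
  over-strand, with \<open>Backslash\<close> the other one.
\<close>

datatype dir = Up | Dn

fun opp :: "dir \<Rightarrow> dir" where
  "opp Up = Dn"
| "opp Dn = Up"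

datatype over = Slash | Backslash

datatype piece = Cup dir | Cap dir | Cross over dir dir

type_synonym 'g word = "(nat \<times> 'g) list"

fun source :: "piece \<Rightarrow> dir list" where
  "source (Cup d) = []"
| "source (Cap d) = [d, opp d]"
| "source (Cross x d e) = [d, e]"

fun target :: "piece \<Rightarrow> dir list" where
  "target (Cup d) = [d, opp d]"
| "target (Cap d) = []"
| "target (Cross x d e) = [e, d]"

definition shift :: "nat \<Rightarrow> 'g word \<Rightarrow> 'g word" where
  "shift n w = map (\<lambda>(i, g). (n + i, g)) w"

text \<open>The directions along the top, or \<open>None\<close> if the layers do not fit together.\<close>

fun ends :: "dir list \<Rightarrow> piece word \<Rightarrow> dir list option" where
  "ends ds [] = Some ds"
| "ends ds ((i, g) # w) =
     (if i \<le> length ds \<and> take (length (source g)) (drop i ds) = source g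
      then ends (take i ds @ target g @ drop (i + length (source g)) ds) w
      else None)"

text \<open>The first component lists the directions along the bottom.\<close>

type_synonym tangle = "dir list \<times> piece word"

definition lower :: "tangle \<Rightarrow> dir list" where
  "lower \<tau> = fst \<tau>"

definition upper :: "tangle \<Rightarrow> dir list" where
  "upper \<tau> = the (ends (fst \<tau>) (snd \<tau>))"

text \<open>
  Four-ended tangles have two bottom ends (SW, SE) and two top ends (NW, NE). An end at the bottom
  is oriented inward iff its direction is \<open>Up\<close>, one at the top iff it is \<open>Dn\<close>.
\<close>

definition T4 :: "tangle set" where
  "T4 = {(ds, w). length ds = 2 \<and> (\<exists>es. ends ds w = Some es \<and> length es = 2)}"

definition bT4 :: "tangle set" where
  "bT4 = {\<tau> \<in> T4. lower \<tau> ! 0 = Up}"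

subsection \<open>Connectivity and closed components\<close>

text \<open>
  The strands are given arc labels while the diagram is traversed upwards. A state consists of the
  next unused label, the labels at the bottom ends, the labels at the current level, and the number
  of components closed so far. A cap either closes up an arc or identifies two labels.
\<close>

type_synonym arcs = "nat \<times> nat list \<times> nat list \<times> nat"

fun trace_layer :: "nat \<times> piece \<Rightarrow> arcs \<Rightarrow> arcs" where
  "trace_layer (i, Cup d) (n, bs, ts, c) = (Suc n, bs, take i ts @ [n, n] @ drop i ts, c)"
| "trace_layer (i, Cross x d e) (n, bs, ts, c) =
     (n, bs, take i ts @ [ts ! Suc i, ts ! i] @ drop (i + 2) ts, c)"
| "trace_layer (i, Cap d) (n, bs, ts, c) =
     (let ts' = take i ts @ drop (i + 2) ts;
          f = (\<lambda>z. if z = ts ! Suc i then ts ! i else z)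
      in if ts ! i = ts ! Suc i then (n, bs, ts', Suc c)
         else (n, map f bs, map f ts', c))"

definition trace :: "tangle \<Rightarrow> arcs" where
  "trace \<tau> = (let m = length (lower \<tau>) in fold trace_layer (snd \<tau>) (m, [0..<m], [0..<m], 0))"

definition bot_arc :: "tangle \<Rightarrow> nat \<Rightarrow> nat" where
  "bot_arc \<tau> i = (case trace \<tau> of (n, bs, ts, c) \<Rightarrow> bs ! i)"

definition top_arc :: "tangle \<Rightarrow> nat \<Rightarrow> nat" where
  "top_arc \<tau> i = (case trace \<tau> of (n, bs, ts, c) \<Rightarrow> ts ! i)"

definition closed_components :: "tangle \<Rightarrow> nat" where
  "closed_components \<tau> = (case trace \<tau> of (n, bs, ts, c) \<Rightarrow> c)"

datatype btype = UP | OP | RI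

fun bottom_dirs :: "btype \<Rightarrow> dir list" where
  "bottom_dirs UP = [Up, Up]"
| "bottom_dirs OP = [Up, Dn]"
| "bottom_dirs RI = [Up, Dn]"

fun top_dirs :: "btype \<Rightarrow> dir list" where
  "top_dirs UP = [Up, Up]"
| "top_dirs OP = [Up, Dn]"
| "top_dirs RI = [Dn, Up]"

definition boundary_type :: "btype \<Rightarrow> tangle \<Rightarrow> bool" where
  "boundary_type X \<tau> \<longleftrightarrow> \<tau> \<in> bT4 \<and> lower \<tau> = bottom_dirs X \<and> upper \<tau> = top_dirs X"

datatype rtype = UP_par | UP_cr | OP_ud | OP_lr | RI_par | RI_cr

text \<open>The orientations of the arcs are determined by the boundary type.\<close>

definition connects_vertically :: "tangle \<Rightarrow> bool" where
  "connects_vertically \<tau> \<longleftrightarrow> bot_arc \<tau> 0 = top_arc \<tau> 0 \<and> bot_arc \<tau> 1 = top_arc \<tau> 1"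

definition connects_horizontally :: "tangle \<Rightarrow> bool" where
  "connects_horizontally \<tau> \<longleftrightarrow> bot_arc \<tau> 0 = bot_arc \<tau> 1 \<and> top_arc \<tau> 0 = top_arc \<tau> 1"

definition connects_diagonally :: "tangle \<Rightarrow> bool" where
  "connects_diagonally \<tau> \<longleftrightarrow> bot_arc \<tau> 0 = top_arc \<tau> 1 \<and> bot_arc \<tau> 1 = top_arc \<tau> 0"

fun has_type :: "tangle \<Rightarrow> rtype \<Rightarrow> bool" where
  "has_type \<tau> UP_par \<longleftrightarrow> boundary_type UP \<tau> \<and> connects_vertically \<tau>"
| "has_type \<tau> UP_cr \<longleftrightarrow> boundary_type UP \<tau> \<and> connects_diagonally \<tau>"
| "has_type \<tau> OP_ud \<longleftrightarrow> boundary_type OP \<tau> \<and> connects_vertically \<tau>"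
| "has_type \<tau> OP_lr \<longleftrightarrow> boundary_type OP \<tau> \<and> connects_horizontally \<tau>"
| "has_type \<tau> RI_par \<longleftrightarrow> boundary_type RI \<tau> \<and> connects_horizontally \<tau>"
| "has_type \<tau> RI_cr \<longleftrightarrow> boundary_type RI \<tau> \<and> connects_diagonally \<tau>"

subsection \<open>Operations\<close>

definition gluable :: "tangle \<Rightarrow> tangle \<Rightarrow> bool" where
  "gluable \<tau>1 \<tau>2 \<longleftrightarrow> lower \<tau>2 ! 0 = opp (lower \<tau>1 ! 1) \<and> upper \<tau>2 ! 0 = opp (upper \<tau>1 ! 1)"

text \<open>SE of the first and SW of the second tangle are joined by a cup, NE and NW by a cap.\<close>

definition tangle_add :: "tangle \<Rightarrow> tangle \<Rightarrow> tangle" where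
  "tangle_add \<tau>1 \<tau>2 =
     ([lower \<tau>1 ! 0, lower \<tau>2 ! 1],
      [(1, Cup (lower \<tau>1 ! 1))] @ snd \<tau>1 @ shift 2 (snd \<tau>2) @ [(1, Cap (upper \<tau>1 ! 1))])"

text \<open>
  \<open>twist_top Slash\<close> and \<open>twist_right Slash\<close> are \<open>T\<close> and \<open>R\<close>; with \<open>Backslash\<close> one gets their
  inverses. Attaching a crossing on the right is the addition of a one-crossing tangle.
\<close>

definition twist_top :: "over \<Rightarrow> tangle \<Rightarrow> tangle" where
  "twist_top x \<tau> = (lower \<tau>, snd \<tau> @ [(0, Cross x (upper \<tau> ! 0) (upper \<tau> ! 1))])"

definition twist_right :: "over \<Rightarrow> tangle \<Rightarrow> tangle" where
  "twist_right x \<tau> =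
     (let d = opp (lower \<tau> ! 1); e = opp (upper \<tau> ! 1) in tangle_add \<tau> ([d, e], [(0, Cross x d e)]))"

text \<open>
  Counterclockwise rotation by a quarter turn: the NW end is bent down to the new SW end, the SE
  end is bent up to the new NE end.
\<close>

definition rotate_tangle :: "tangle \<Rightarrow> tangle" where
  "rotate_tangle \<tau> =
     ([opp (upper \<tau> ! 0), lower \<tau> ! 0],
      [(2, Cup (lower \<tau> ! 1))] @ shift 1 (snd \<tau>) @ [(0, Cap (opp (upper \<tau> ! 0)))])"


section \<open>Webs\<close>

text \<open>
  Webs are in Morse position, too, with trivalent vertices \<open>Merge a b\<close> (edges \<open>a\<close>, \<open>b\<close> merge into
  \<open>a + b\<close>) and \<open>Split a b\<close> all of whose edges are directed upwards. Vertices in other positions are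
  obtained by bending edges with cups and caps.
\<close>

datatype wpiece = WCup dir nat | WCap dir nat | Merge nat nat | Split nat nat

fun arity :: "wpiece \<Rightarrow> nat" where
  "arity (WCup d k) = 0"
| "arity (WCap d k) = 2"
| "arity (Merge a b) = 2"
| "arity (Split a b) = 1"

fun out_labels :: "wpiece \<Rightarrow> nat list" where
  "out_labels (WCup d k) = [k, k]"
| "out_labels (WCap d k) = []"
| "out_labels (Merge a b) = [a + b]"
| "out_labels (Split a b) = [a, b]"

text \<open>Only meaningful for \<open>k \<le> j\<close>.\<close>

fun basic_web :: "btype \<Rightarrow> nat \<Rightarrow> nat \<Rightarrow> wpiece word" where
  "basic_web UP j k =
     [(1, Split k (j - k)), (0, Merge j k), (0, Split j k), (1, Merge k (j - k))]"
| "basic_web OP j k =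
     [(0, Split (j - k) k),
      \<comment> \<open>the lower rung joins the downward strand\<close>
      (1, WCup Dn (j - k)), (2, Merge (j - k) k), (2, WCap Up j),
      \<comment> \<open>the upper rung leaves the downward strand\<close>
      (2, WCup Up j), (2, Split (j - k) k), (1, WCap Dn (j - k)),
      (0, Merge (j - k) k)]"
| "basic_web RI j k =
     [\<comment> \<open>the NW edge is bent up and splits into the top rung and the left edge\<close>
      (0, WCup Dn j), (1, Split k (j - k)),
      \<comment> \<open>the left edge and the SW edge merge into the bottom rung, labelled \<open>2 * j - k\<close>\<close>
      (2, Merge (j - k) j),
      \<comment> \<open>the bottom rung splits into the right edge and the SE edge\<close>
      (2, Split (j - k) j), (3, WCap Up j),
      (1, Merge k (j - k))]"

subsection \<open>Evaluation of webs as intertwiners\<close>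

text \<open>
  \<open>qv\<close> is the variable \<open>q\<close> of the field \<open>\<rat>(q)\<close>. The quantum exterior power \<open>\<Lambda>\<^sup>k\<close> of the vector
  representation of \<open>U\<^sub>q(gl\<^sub>N)\<close> has a basis \<open>x\<^sub>S\<close> indexed by the \<open>k\<close>-element subsets \<open>S\<close> of
  \<open>{0..<N}\<close>; a downward edge carries the dual representation with the dual basis. Words are
  evaluated as matrices with respect to the tensor product bases.
\<close>

type_synonym qfield = "rat poly fract"

definition qv :: qfield where
  "qv = Fract [:0, 1:] 1"

definition states :: "nat \<Rightarrow> nat list \<Rightarrow> nat set list set" where
  "states N ks = listset (map (\<lambda>k. {S. S \<subseteq> {..<N} \<and> card S = k}) ks)"

definition inversions :: "nat set \<Rightarrow> nat set \<Rightarrow> nat" where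
  "inversions S T = card {(s, t). s \<in> S \<and> t \<in> T \<and> s < t}"

text \<open>The pairing of the weight of \<open>x\<^sub>S\<close> with \<open>2\<rho>\<close>, which enters the pivotal structure.\<close>

definition two_rho :: "nat \<Rightarrow> nat set \<Rightarrow> int" where
  "two_rho N S = (\<Sum>s\<in>S. int N - 1 - 2 * int s)"

text \<open>
  Merging is the product of the quantum exterior algebra,
  \<open>x\<^sub>S \<otimes> x\<^sub>T \<mapsto> (-q)\<^bsup>inversions S T\<^esup> x\<^bsub>S \<union> T\<^esub>\<close> for disjoint \<open>S\<close>, \<open>T\<close>, and splitting is
  \<open>x\<^sub>U \<mapsto> \<Sum> (-1)\<^bsup>a b\<^esup> (-q)\<^bsup>- inversions T S\<^esup> x\<^sub>S \<otimes> x\<^sub>T\<close> over all \<open>U = S \<union> T\<close>, disjoint. With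
  this normalization the digon \<open>Merge a b \<circ> Split a b\<close> is the quantum binomial coefficient
  \<open>[a + b choose a]\<close>, and a circle labelled \<open>k\<close> is \<open>[N choose k]\<close>.
\<close>

fun entry :: "nat \<Rightarrow> wpiece \<Rightarrow> nat set list \<Rightarrow> nat set list \<Rightarrow> qfield" where
  "entry N (WCup d k) xs ys =
     (case (xs, ys) of ([], [S, T]) \<Rightarrow>
        if S = T then (if d = Up then 1 else qv powi (- two_rho N S)) else 0
      | _ \<Rightarrow> 0)"
| "entry N (WCap d k) xs ys =
     (case (xs, ys) of ([S, T], []) \<Rightarrow>
        if S = T then (if d = Up then qv powi (two_rho N S) else 1) else 0
      | _ \<Rightarrow> 0)"
| "entry N (Merge a b) xs ys =
     (case (xs, ys) of ([S, T], [U]) \<Rightarrow>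
        if S \<inter> T = {} \<and> S \<union> T = U then (- qv) powi (int (inversions S T)) else 0
      | _ \<Rightarrow> 0)"
| "entry N (Split a b) xs ys =
     (case (xs, ys) of ([U], [S, T]) \<Rightarrow>
        if S \<inter> T = {} \<and> S \<union> T = U
        then (- 1) ^ (a * b) * (- qv) powi (- int (inversions T S)) else 0
      | _ \<Rightarrow> 0)"

text \<open>
  \<open>web_matrix N w xs ys\<close> is the coefficient of the basis vector \<open>ys\<close> (top) in the image of the
  basis vector \<open>xs\<close> (bottom).
\<close>

fun web_matrix :: "nat \<Rightarrow> wpiece word \<Rightarrow> nat set list \<Rightarrow> nat set list \<Rightarrow> qfield" where
  "web_matrix N [] xs ys = (if xs = ys then 1 else 0)"
| "web_matrix N ((i, g) # w) xs ys =
     (\<Sum>zs \<in> states N (out_labels g).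
        entry N g (take (arity g) (drop i xs)) zs *
        web_matrix N w (take i xs @ zs @ drop (i + arity g) xs) ys)"


section \<open>The colored HOMFLY-PT invariant\<close>

text \<open>
  A crossing of upward strands is resolved into the webs \<open>UP[j,k]\<close>. Any other crossing is first
  rotated, by cups and caps, into one of upward strands; \<open>positive\<close> is its sign.
\<close>

definition positive :: "over \<Rightarrow> dir \<Rightarrow> dir \<Rightarrow> bool" where
  "positive x d e \<longleftrightarrow> (x = Slash \<longleftrightarrow> d = e)"

fun crossing_web :: "nat \<Rightarrow> nat \<Rightarrow> dir \<Rightarrow> dir \<Rightarrow> wpiece word" where
  "crossing_web j k Up Up = basic_web UP j k"
| "crossing_web j k Up Dn =
     [(0, WCup Dn j)] @ shift 1 (basic_web UP j k) @ [(2, WCap Up j)]"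
| "crossing_web j k Dn Up =
     [(2, WCup Up j)] @ shift 1 (basic_web UP j k) @ [(0, WCap Dn j)]"
| "crossing_web j k Dn Dn =
     [(0, WCup Dn j), (1, WCup Dn j)] @ shift 2 (basic_web UP j k) @ [(3, WCap Up j), (2, WCap Up j)]"

text \<open>The \<open>\<rat>(q)\<close>-linear combination of webs obtained by labelling all strands by \<open>j\<close> and resolving
  all crossings.\<close>

fun resolve :: "nat \<Rightarrow> piece word \<Rightarrow> (qfield \<times> wpiece word) list" where
  "resolve j [] = [(1, [])]"
| "resolve j ((i, Cup d) # w) = map (\<lambda>(c, u). (c, (i, WCup d j) # u)) (resolve j w)"
| "resolve j ((i, Cap d) # w) = map (\<lambda>(c, u). (c, (i, WCap d j) # u)) (resolve j w)"
| "resolve j ((i, Cross x d e) # w) =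
     [((- qv) powi (if positive x d e then int k - int j else int j - int k) * c,
       shift i (crossing_web j k d e) @ u). k \<leftarrow> [0..<Suc j], (c, u) \<leftarrow> resolve j w]"

definition tangle_matrix :: "nat \<Rightarrow> nat \<Rightarrow> tangle \<Rightarrow> nat set list \<Rightarrow> nat set list \<Rightarrow> qfield" where
  "tangle_matrix N j \<tau> xs ys = (\<Sum>(c, u) \<leftarrow> resolve j (snd \<tau>). c * web_matrix N u xs ys)"

text \<open>
  Laurent polynomials in \<open>a\<close> over \<open>\<rat>(q)\<close> are the elements of the group algebra of \<open>\<int>\<close>, where
  \<open>Poly_Mapping.single n c\<close> is \<open>c a\<^sup>n\<close>; \<open>at_rank N\<close> is the specialization \<open>a = q\<^sup>N\<close>.
\<close>

type_synonym laurent = "int \<Rightarrow>\<^sub>0 qfield"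

definition at_rank :: "nat \<Rightarrow> laurent \<Rightarrow> qfield" where
  "at_rank N p = (\<Sum>n \<in> Poly_Mapping.keys p. Poly_Mapping.lookup p n * qv powi (int N * n))"

text \<open>
  \<open>homfly X j \<tau> c\<close> says that, for \<open>\<tau>\<close> of boundary type \<open>X\<close>, the invariant \<open>\<langle>\<tau>\<rangle>\<^sub>j\<close> is the element
  \<open>\<Sum>\<^bsub>k \<le> j\<^esub> c k X[j,k]\<close> of the free module on the basic webs: both sides are the same intertwiner
  for all large \<open>N\<close>. Since for \<open>N \<ge> 2 j\<close> the \<open>X[j,k]\<close> are linearly independent and a Laurent
  polynomial is determined by its specializations at large \<open>N\<close>, there is at most one such family
  \<open>(c k)\<^bsub>k \<le> j\<^esub>\<close>.
\<close>

definition homfly :: "btype \<Rightarrow> nat \<Rightarrow> tangle \<Rightarrow> (nat \<Rightarrow> laurent) \<Rightarrow> bool" where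
  "homfly X j \<tau> c \<longleftrightarrow>
     (\<forall>\<^sub>F N in sequentially. \<forall>xs \<in> states N [j, j]. \<forall>ys \<in> states N [j, j].
        tangle_matrix N j \<tau> xs ys =
          (\<Sum>k\<le>j. at_rank N (c k) * web_matrix N (basic_web X j k) xs ys))"


section \<open>Quiver forms\<close>

definition qfac :: "nat \<Rightarrow> qfield" where
  "qfac k = (\<Prod>i = 1..k. 1 - qv ^ (2 * i))"

definition qmultinomial :: "nat list \<Rightarrow> qfield" where
  "qmultinomial d = qfac (sum_list d) / (\<Prod>x\<leftarrow>d. qfac x)"

text \<open>The indices \<open>0..<active\<close> are active, the following \<open>inactive\<close> ones are inactive; the values
  of \<open>vecS\<close>, \<open>vecA\<close>, \<open>matQ\<close> at other indices are irrelevant.\<close>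

record quiver_data =
  active :: nat
  inactive :: nat
  vecS :: "nat \<Rightarrow> int"
  vecA :: "nat \<Rightarrow> int"
  matQ :: "nat \<Rightarrow> nat \<Rightarrow> int"

definition num_indices :: "quiver_data \<Rightarrow> nat" where
  "num_indices D = active D + inactive D"

definition lin_form :: "nat \<Rightarrow> (nat \<Rightarrow> int) \<Rightarrow> nat list \<Rightarrow> int" where
  "lin_form r v d = (\<Sum>i<r. v i * int (d ! i))"

definition quad_form :: "nat \<Rightarrow> (nat \<Rightarrow> nat \<Rightarrow> int) \<Rightarrow> nat list \<Rightarrow> int" where
  "quad_form r M d = (\<Sum>i<r. \<Sum>l<r. int (d ! i) * M i l * int (d ! l))"

text \<open>
  The coefficient of \<open>X[j,k]\<close> in the generating function given by \<open>D\<close>, for a tangle with \<open>c\<close> closed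
  components, where the summand of \<open>d = (d\<^sub>a, d\<^sub>i)\<close> has the extra factor \<open>extra |d\<^sub>a| |d\<^sub>i|\<close>.
\<close>

definition quiver_coeff ::
  "nat \<Rightarrow> (nat \<Rightarrow> nat \<Rightarrow> qfield) \<Rightarrow> quiver_data \<Rightarrow> nat \<Rightarrow> nat \<Rightarrow> laurent" where
  "quiver_coeff c extra D j k =
     (let m = active D; r = num_indices D in
      \<Sum>d \<in> {d. length d = r \<and> sum_list d = j \<and> sum_list (take m d) = k}.
        Poly_Mapping.single (lin_form r (vecA D) d)
          ((- qv) powi lin_form r (vecS D) d * qv powi quad_form r (matQ D) d *
           qmultinomial (take m d) * qmultinomial (drop m d) *
           extra (sum_list (take m d)) (sum_list (drop m d)) / qfac (sum_list d) ^ c))"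

definition form_with ::
  "(nat \<Rightarrow> nat \<Rightarrow> qfield) \<Rightarrow> btype \<Rightarrow> tangle \<Rightarrow> quiver_data \<Rightarrow> bool" where
  "form_with extra X \<tau> D \<longleftrightarrow>
     boundary_type X \<tau> \<and> num_indices D \<ge> 1 \<and>
     (\<forall>j. homfly X j \<tau> (quiver_coeff (closed_components \<tau>) extra D j))"

definition quiver_form :: "btype \<Rightarrow> tangle \<Rightarrow> quiver_data \<Rightarrow> bool" where
  "quiver_form = form_with (\<lambda>s t. 1)"

definition active_quiver_form :: "btype \<Rightarrow> tangle \<Rightarrow> quiver_data \<Rightarrow> bool" where
  "active_quiver_form = form_with (\<lambda>s t. qfac s)"

definition inactive_quiver_form :: "btype \<Rightarrow> tangle \<Rightarrow> quiver_data \<Rightarrow> bool" where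
  "inactive_quiver_form = form_with (\<lambda>s t. qfac t)"

subsection \<open>Expansion into quiver form\<close>

text \<open>
  The indices \<open>lo, \<dots>, lo + len - 1\<close>, i.e. \<open>d\<^sub>1, \<dots>, d\<^bsub>len\<^esub>\<close>, are replaced by
  \<open>\<alpha>\<^sub>1, \<dots>, \<alpha>\<^bsub>len\<^esub>, \<beta>\<^sub>1, \<dots>, \<beta>\<^bsub>len\<^esub>\<close> in this order, with \<open>d\<^sub>i = \<alpha>\<^sub>i + \<beta>\<^sub>i\<close>, and the sum picks up
  \<open>(-q)\<^bsup>\<alpha>\<^sub>1 + \<dots>\<^esup> q\<^bsup>\<alpha>\<^sub>1\<^sup>2 + \<dots> + 2 \<Sum> \<alpha>\<^bsub>i+1\<^esub> (d\<^sub>1 + \<dots> + d\<^sub>i)\<^esup>\<close>, from the case \<open>x = q\<close> of the expansion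
  of \<open>(x\<^sup>2; q\<^sup>2)\<^bsub>d\<^sub>1 + \<dots>\<^esub> / ((q\<^sup>2)\<^bsub>d\<^sub>1\<^esub> \<dots>)\<close>. The quadratic part is written as a symmetric matrix.
\<close>

definition expand_block :: "nat \<Rightarrow> nat \<Rightarrow> quiver_data \<Rightarrow> quiver_data" where
  "expand_block lo len D =
     (let old = (\<lambda>p. if p < lo + len then p else p - len);
          alpha = (\<lambda>p. lo \<le> p \<and> p < lo + len);
          block = (\<lambda>p. lo \<le> p \<and> p < lo + 2 * len)
      in D\<lparr>vecS := (\<lambda>p. vecS D (old p) + (if alpha p then 1 else 0)),
           vecA := (\<lambda>p. vecA D (old p)),
           matQ := (\<lambda>p r. matQ D (old p) (old r) +
             (if alpha p \<and> r = p \<or> alpha p \<and> block r \<and> old r < p \<or> alpha r \<and> block p \<and> old p < r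
              then 1 else 0))\<rparr>)"

definition expand_active :: "quiver_data \<Rightarrow> quiver_data" where
  "expand_active D = (expand_block 0 (active D) D)\<lparr>active := 2 * active D\<rparr>"

definition expand_inactive :: "quiver_data \<Rightarrow> quiver_data" where
  "expand_inactive D = (expand_block (active D) (inactive D) D)\<lparr>inactive := 2 * inactive D\<rparr>"


section \<open>The families\<close>

text \<open>No form is required of tangles with crossing arcs.\<close>

fun required_form :: "rtype \<Rightarrow> tangle \<Rightarrow> quiver_data \<Rightarrow> bool" where
  "required_form UP_par = active_quiver_form UP"
| "required_form OP_ud = active_quiver_form OP"
| "required_form OP_lr = inactive_quiver_form OP"
| "required_form RI_par = inactive_quiver_form RI"
| "required_form UP_cr = (\<lambda>\<tau> D. False)"
| "required_form RI_cr = (\<lambda>\<tau> D. False)"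

fun expand :: "rtype \<Rightarrow> quiver_data \<Rightarrow> quiver_data" where
  "expand UP_par = expand_active"
| "expand OP_ud = expand_active"
| "expand OP_lr = expand_inactive"
| "expand RI_par = expand_inactive"
| "expand UP_cr = id"
| "expand RI_cr = id"

inductive_set bQT4 :: "tangle set" where
  form: "\<lbrakk>\<tau> \<in> bT4; has_type \<tau> t; t \<in> {UP_par, OP_ud, OP_lr, RI_par}; required_form t \<tau> D\<rbrakk>
    \<Longrightarrow> \<tau> \<in> bQT4"
| top_crossing: "\<lbrakk>\<tau> \<in> bT4; has_type \<tau> t; t \<in> {UP_cr, RI_cr}; twist_top x \<tau> \<in> bQT4\<rbrakk>
    \<Longrightarrow> \<tau> \<in> bQT4"
| right_crossing: "\<lbrakk>\<tau> \<in> bT4; has_type \<tau> t; t \<in> {UP_cr, RI_cr}; twist_right x \<tau> \<in> bQT4\<rbrakk>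
    \<Longrightarrow> \<tau> \<in> bQT4"

definition QT4 :: "tangle set" where
  "QT4 = {\<tau> \<in> T4. \<exists>r. (rotate_tangle ^^ r) \<tau> \<in> bQT4}"

end

theory Submission
  imports Defs
begin

text \<open>
  The matrices of the basic webs are divided powers of sums over single elements of sets, which
  satisfy quantum \<open>sl\<^sub>2\<close> relations (skew Howe duality): the operators \<open>E\<close>, \<open>F\<close> move an element between
  two sets and describe \<open>UP\<close> and \<open>RI\<close>, the operators \<open>X\<close>, \<open>Y\<close> remove or add a common element and
  describe \<open>OP\<close>. Gluing two webs composes such operators, and commuting divided powers past each
  other gives the gluing coefficients, which are products of three quantum binomials.

  On the side of generating functions, the product of two forms is rewritten as a sum over
  nonnegative integer matrices with the two index vectors as row and column sums: the
  \<open>q\<close>-Vandermonde identity counts such a matrix with weight a power of \<open>q\<close> divided by the product of the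
  \<open>(q\<^sup>2)\<close>-factorials of its entries. What remains of the gluing coefficient is a product of two
  Pochhammer symbols in partial sums of the entries, and each of them is absorbed by
  doubling the entries concerned, so that \<open>(a\<^sub>1 + i\<^sub>1) (a\<^sub>2 + i\<^sub>2)\<close> indices suffice.

  The forms required of members of \<open>QT4\<close> exist because rotating a tangle rotates the basic webs up to
  powers of \<open>q\<close>: a quarter turn exchanges \<open>RI[j,k]\<close> and \<open>UP[j,j-k]\<close>, hence active and inactive
  indices; a half turn fixes \<open>OP\<close> and a full turn fixes \<open>UP\<close>.
\<close>

section \<open>Quantum integers\<close>

text \<open>The index count is exact because of multiplicities. In an expanded form every row and
  column index counts once or twice, so a table entry has to count 1, 2 or 4 times, according to its
  row and column. It does, since it is doubled once for each of the two Pochhammer symbols whose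
  length includes it. The extra factors of the given forms either cancel denominators of the gluing
  coefficient or serve as the second symbol. The obstacle is that a quiver form has linear exponents
  only for \<open>a\<close> and for \<open>-q\<close>, never for \<open>q\<close> alone. Expanding
  \<open>(x; q^2)_n\<close> produces powers of \<open>-x/q\<close>, so \<open>x\<close> has to be
  \<open>q^2\<close> times a power whose exponent is linear in the entries, possibly with a multiple
  of N added: then \<open>-x/q\<close> is \<open>-q\<close> times such a power, and only quadratic
  exponents are left over. The identity [n choose s] =
  \<open>q^(-s(n-s)) (q^(2(n-s)+2); q^2)_s / (q^2)_s\<close> supplies exactly this argument.
  Rotation acts on words, and a full turn does not return the word one started from. Forms are
  therefore carried along by comparing matrices; the leftover power of q is 1 wherever a web entry
  is nonzero.\<close>

lemma qv_power: "qv ^ n = Fract (monom 1 n) 1"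
proof (induction n)
  case 0
  then show ?case by (simp add: One_fract_def)
next
  case (Suc n)
  then show ?case by (simp add: qv_def monom_Suc)
qed

lemma qv_nonzero [simp]: "qv \<noteq> 0"
  by (simp add: qv_def Zero_fract_def eq_fract)

text \<open>The variable is no root of unity, its powers being distinct monomials. Hence all quantum
  integers except [0] are invertible and divided powers make sense.\<close>

lemma qv_power_eq_1_iff [simp]: "qv ^ n = 1 \<longleftrightarrow> n = 0"
  by (auto simp: qv_power One_fract_def eq_fract monom_eq_1_iff)

lemma qv_powi_eq_1_iff [simp]: "qv powi n = 1 \<longleftrightarrow> n = 0"
proof (cases "n \<ge> 0")
  case True
  then show ?thesis by (auto simp: power_int_def)
next
  case False
  then have "qv ^ nat (- n) \<noteq> 1" by simp
  with False show ?thesis by (auto simp: power_int_def field_simps)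
qed

lemma powi_add: "(x::qfield) \<noteq> 0 \<Longrightarrow> x powi (m + n) = x powi m * x powi n"
  by (simp add: power_int_add)

definition qint :: "int \<Rightarrow> qfield" where
  "qint n = (qv powi n - qv powi (- n)) / (qv - inverse qv)"

lemma qv_diff_nonzero [simp]: "qv - inverse qv \<noteq> 0"
proof
  assume "qv - inverse qv = 0"
  then have "qv * qv = 1" by (metis eq_iff_diff_eq_0 qv_nonzero right_inverse)
  then have "qv ^ 2 = 1" by (simp add: power2_eq_square)
  then show False by simp
qed

lemma qint_0 [simp]: "qint 0 = 0"
  by (simp add: qint_def)

lemma qint_1 [simp]: "qint 1 = 1"
  using qv_diff_nonzero by (simp add: qint_def power_int_minus)

lemma qint_minus: "qint (- n) = - qint n"
  unfolding qint_def minus_minus by (metis minus_diff_eq minus_divide_left)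

lemma qint_eq_0_iff [simp]: "qint n = 0 \<longleftrightarrow> n = 0"
proof
  assume "qint n = 0"
  then have "qv powi n = qv powi (- n)"
    using qv_diff_nonzero unfolding qint_def divide_eq_0_iff by (metis eq_iff_diff_eq_0)
  then have "qv powi n * qv powi n = qv powi (- n) * qv powi n" by (rule arg_cong)
  then have "qv powi (n + n) = 1" by (simp add: powi_add[symmetric])
  then show "n = 0" by (subst (asm) qv_powi_eq_1_iff) simp
qed simp

text \<open>After clearing denominators this is an identity of Laurent monomials in
  \<open>q^k\<close>, \<open>q^n\<close> and \<open>q^s\<close>. Both \<open>qbinom_step\<close> and
  the induction in \<open>comm_pow\<close> come down to it.\<close>

lemma qint_mult_split: "qint (k - s) * qint (n - s) + qint (n + k - s) * qint s = qint k * qint n"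
proof -
  have *: "(qv powi k / qv powi s - qv powi s / qv powi k) * (qv powi n / qv powi s - qv powi s / qv powi n)
     + (qv powi n * qv powi k / qv powi s - qv powi s / (qv powi n * qv powi k)) * (qv powi s - 1 / qv powi s)
     = (qv powi k - 1 / qv powi k) * (qv powi n - 1 / qv powi n)"
    by (simp add: field_simps)
  define c where "c = qv - inverse qv"
  have "c \<noteq> 0" by (simp only: c_def qv_diff_nonzero not_False_eq_True)
  have q: "qint m = (qv powi m - 1 / qv powi m) / c" for m
    by (simp add: qint_def c_def power_int_minus inverse_eq_divide)
  have "(qv powi (k - s) - 1 / qv powi (k - s)) * (qv powi (n - s) - 1 / qv powi (n - s))
     + (qv powi (n + k - s) - 1 / qv powi (n + k - s)) * (qv powi s - 1 / qv powi s)
     = (qv powi k - 1 / qv powi k) * (qv powi n - 1 / qv powi n)"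
    using * by (simp add: power_int_diff powi_add)
  then show ?thesis
    using \<open>c \<noteq> 0\<close> by (simp add: q add_divide_distrib[symmetric])
qed

definition qfact :: "nat \<Rightarrow> qfield" where
  "qfact k = (\<Prod>i = 1..k. qint (int i))"

lemma qfact_0 [simp]: "qfact 0 = 1"
  by (simp add: qfact_def)

lemma qfact_Suc: "qfact (Suc k) = qint (int (Suc k)) * qfact k"
  by (simp add: qfact_def atLeastAtMostSuc_conv)

lemma qfact_nonzero [simp]: "qfact k \<noteq> 0"
  by (simp add: qfact_def)

text \<open>The top is an integer because it will be a shifted weight such as N - 2j + a + b, which
  can be negative; hence the product instead of a quotient of factorials.\<close>

definition qbinom :: "int \<Rightarrow> nat \<Rightarrow> qfield" where
  "qbinom n s = (\<Prod>i<s. qint (n - int i)) / qfact s"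

lemma qbinom_0 [simp]: "qbinom n 0 = 1"
  by (simp add: qbinom_def)

lemma qbinom_zero_left: "s > 0 \<Longrightarrow> qbinom 0 s = 0"
  by (auto simp: qbinom_def intro!: prod_zero bexI[of _ 0])

lemma qbinom_Suc: "qint (int (Suc s)) * qbinom n (Suc s) = qint (n - int s) * qbinom n s"
  by (simp add: qbinom_def qfact_Suc field_simps)

lemma qbinom_Suc': "qint (int (Suc s)) * qbinom n (Suc s) = qint n * qbinom (n - 1) s"
proof -
  have "(\<Prod>i<Suc s. qint (n - int i)) = qint n * (\<Prod>i<s. qint (n - 1 - int i))"
    by (subst prod.lessThan_Suc_shift) (simp add: algebra_simps)
  then show ?thesis
    by (simp add: qbinom_def qfact_Suc)
qed

lemma qbinom_nat: "s \<le> n \<Longrightarrow> qbinom (int n) s = qfact n / (qfact s * qfact (n - s))"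
proof (induction s)
  case (Suc s)
  then have "n - s = Suc (n - Suc s)" by simp
  then have "qfact (n - s) = qint (int n - int s) * qfact (n - Suc s)"
    using Suc.prems by (simp add: qfact_Suc of_nat_diff)
  moreover have "qint (int n - int s) \<noteq> 0" "qint (int (Suc s)) \<noteq> 0" using Suc.prems by auto
  ultimately have "qint (int (Suc s)) * qbinom (int n) (Suc s) = qfact n / (qfact s * qfact (n - Suc s))"
    using Suc qbinom_Suc[of s "int n"] by simp
  with \<open>qint (int (Suc s)) \<noteq> 0\<close> show ?case
    by (simp add: qfact_Suc divide_simps mult.assoc mult.left_commute mult.commute del: of_nat_Suc)
qed simp

text \<open>The recursion of the coefficients in \<open>dpow_comm\<close> when k grows by 1: the
  first term comes from merging one more P into a divided power, the second from the commutator of P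
  with a divided power of Q. Multiplied by [s] it becomes \<open>qint_mult_split\<close>.\<close>

lemma qbinom_step:
  "qint (int k + 1 - int s) * qbinom (n - 1) s
     + (if s = 0 then 0 else qint (n + int k + 1 - int s) * qbinom (n - 1) (s - 1))
   = qint (int k + 1) * qbinom n s"
proof (cases s)
  case (Suc r)
  have 1: "qint (int s) * qbinom (n - 1) s = qint (n - int s) * qbinom (n - 1) r"
    using qbinom_Suc[of r "n - 1"] Suc by (simp add: algebra_simps)
  have 2: "qint (int s) * qbinom n s = qint n * qbinom (n - 1) r"
    using qbinom_Suc'[of r n] Suc by simp
  have 3: "qint (int k + 1 - int s) * qint (n - int s) + qint (n + int k + 1 - int s) * qint (int s)
      = qint (int k + 1) * qint n"
    using qint_mult_split[of "int k + 1" "int s" n] by (simp add: algebra_simps)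
  have "qint (int s) * (qint (int k + 1 - int s) * qbinom (n - 1) s
     + qint (n + int k + 1 - int s) * qbinom (n - 1) r)
    = (qint (int k + 1 - int s) * qint (n - int s) + qint (n + int k + 1 - int s) * qint (int s)) * qbinom (n - 1) r"
    using 1 by (simp add: algebra_simps)
  also have "\<dots> = qint (int s) * (qint (int k + 1) * qbinom n s)"
    unfolding 3 using 2 by (simp add: algebra_simps)
  finally have "qint (int k + 1 - int s) * qbinom (n - 1) s
     + qint (n + int k + 1 - int s) * qbinom (n - 1) r = qint (int k + 1) * qbinom n s"
    using Suc by simp
  then show ?thesis using Suc by simp
qed simp

text \<open>
  For operators \<open>P\<close>, \<open>Q\<close> with quantum \<open>sl\<^sub>2\<close> relations this is the coefficient of \<open>Q\<^bsup>(h)\<^esup> P\<^bsup>(h)\<^esup>\<close> in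
  \<open>Q\<^bsup>(a)\<^esup> P\<^bsup>(a)\<^esup> Q\<^bsup>(b)\<^esup> P\<^bsup>(b)\<^esup>\<close> at weight \<open>n - a - b\<close>.
\<close>

definition glue_coeff :: "int \<Rightarrow> nat \<Rightarrow> nat \<Rightarrow> nat \<Rightarrow> qfield" where
  "glue_coeff n a b h = (if a \<le> h \<and> b \<le> h \<and> h \<le> a + b then
     qbinom n (a + b - h) * qbinom (int h) a * qbinom (int h) b else 0)"

section \<open>Divided powers\<close>

text \<open>Operators act on coordinate functions. For those used below, \<open>P v\<close> at a
  state collects the values of \<open>v\<close> at the states reached from it by one move, so in a
  composition the outermost operator is the first one met on the way through a web.\<close>

type_synonym 's operator = "('s \<Rightarrow> qfield) \<Rightarrow> 's \<Rightarrow> qfield"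

definition dpow :: "'s operator \<Rightarrow> nat \<Rightarrow> 's operator" where
  "dpow P k v = (\<lambda>\<sigma>. (P ^^ k) v \<sigma> / qfact k)"

lemma dpow_0 [simp]: "dpow P 0 v = v"
  by (simp add: dpow_def)

definition linear_op :: "'s operator \<Rightarrow> bool" where
  "linear_op P \<longleftrightarrow> (\<forall>a b u v. P (\<lambda>\<sigma>. a * u \<sigma> + b * v \<sigma>) = (\<lambda>\<sigma>. a * P u \<sigma> + b * P v \<sigma>))"

lemma linear_opD: "linear_op P \<Longrightarrow> P (\<lambda>\<sigma>. a * u \<sigma> + b * v \<sigma>) = (\<lambda>\<sigma>. a * P u \<sigma> + b * P v \<sigma>)"
  by (simp add: linear_op_def)

lemma linear_op_scale: "linear_op P \<Longrightarrow> P (\<lambda>\<sigma>. a * u \<sigma>) = (\<lambda>\<sigma>. a * P u \<sigma>)"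
  using linear_opD[of P a u 0 u] by simp

lemma linear_op_div: "linear_op P \<Longrightarrow> P (\<lambda>\<sigma>. u \<sigma> / a) = (\<lambda>\<sigma>. P u \<sigma> / a)"
  using linear_op_scale[of P "inverse a" u] by (simp add: divide_inverse mult.commute)

lemma linear_op_sum:
  assumes "linear_op P" "finite I"
  shows "P (\<lambda>\<sigma>. \<Sum>i\<in>I. a i * u i \<sigma>) = (\<lambda>\<sigma>. \<Sum>i\<in>I. a i * P (u i) \<sigma>)"
  using assms(2)
proof (induction I)
  case empty
  then show ?case using linear_op_scale[OF assms(1), of 0 undefined] by simp
next
  case (insert i I)
  then show ?case
    using linear_opD[OF assms(1), of "a i" "u i" 1 "\<lambda>\<sigma>. \<Sum>i\<in>I. a i * u i \<sigma>"] by simp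
qed

lemma linear_op_funpow: "linear_op P \<Longrightarrow> linear_op (P ^^ k)"
  by (induction k) (simp_all add: linear_op_def)

lemma linear_op_dpow: "linear_op P \<Longrightarrow> linear_op (dpow P k)"
  using linear_op_funpow[of P k] by (simp add: linear_op_def dpow_def fun_eq_iff field_simps)

lemma dpow_Suc: "linear_op P \<Longrightarrow> P (dpow P k v) = (\<lambda>\<sigma>. qint (int (Suc k)) * dpow P (Suc k) v \<sigma>)"
  unfolding dpow_def by (simp add: linear_op_div qfact_Suc fun_eq_iff del: of_nat_Suc)

lemma dpow_mult:
  assumes "linear_op P"
  shows "dpow P k (dpow P l v) \<sigma> = qbinom (int (k + l)) k * dpow P (k + l) v \<sigma>"
proof -
  have "(P ^^ k) (\<lambda>\<sigma>. (P ^^ l) v \<sigma> / qfact l) = (\<lambda>\<sigma>. (P ^^ (k + l)) v \<sigma> / qfact l)"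
    by (subst linear_op_div[OF linear_op_funpow[OF assms]]) (simp add: funpow_add)
  then show ?thesis
    by (simp add: dpow_def qbinom_nat[of k "k + l", simplified])
qed

definition delta :: "'s \<Rightarrow> 's \<Rightarrow> qfield" where
  "delta \<sigma>' \<sigma> = (if \<sigma> = \<sigma>' then 1 else 0)"

text \<open>The relation is only available at states in \<open>C\<close>, and the congruence rules
  say which values of a function matter there. \<open>P\<close> reads states of weight lower by 2,
  so it raises the weight of the support of a function and plays the part of the E of quantum
  sl2.\<close>

locale qsl2 =
  fixes P Q :: "'s operator" and wt :: "'s \<Rightarrow> int" and C :: "'s set"
  assumes linP: "linear_op P" and linQ: "linear_op Q"
    and congP: "\<sigma> \<in> C \<Longrightarrow> (\<And>\<tau>. \<tau> \<in> C \<Longrightarrow> wt \<tau> = wt \<sigma> - 2 \<Longrightarrow> u \<tau> = v \<tau>) \<Longrightarrow> P u \<sigma> = P v \<sigma>"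
    and congQ: "\<sigma> \<in> C \<Longrightarrow> (\<And>\<tau>. \<tau> \<in> C \<Longrightarrow> wt \<tau> = wt \<sigma> + 2 \<Longrightarrow> u \<tau> = v \<tau>) \<Longrightarrow> Q u \<sigma> = Q v \<sigma>"
    and comm: "\<sigma> \<in> C \<Longrightarrow> P (Q v) \<sigma> = Q (P v) \<sigma> + qint (wt \<sigma>) * v \<sigma>"
begin

lemma swap: "qsl2 Q P (\<lambda>\<sigma>. - wt \<sigma>) C"
  by unfold_locales (auto intro: linP linQ congP congQ simp: comm qint_minus)

lemma cong_powP:
  "\<sigma> \<in> C \<Longrightarrow> (\<And>\<tau>. \<tau> \<in> C \<Longrightarrow> wt \<tau> = wt \<sigma> - 2 * int k \<Longrightarrow> u \<tau> = v \<tau>) \<Longrightarrow> (P ^^ k) u \<sigma> = (P ^^ k) v \<sigma>"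
proof (induction k arbitrary: \<sigma>)
  case (Suc k)
  show ?case
    by (simp, rule congP[OF Suc.prems(1)], rule Suc.IH) (auto intro: Suc.prems(2))
qed simp

lemma cong_dpowP:
  "\<sigma> \<in> C \<Longrightarrow> (\<And>\<tau>. \<tau> \<in> C \<Longrightarrow> wt \<tau> = wt \<sigma> - 2 * int k \<Longrightarrow> u \<tau> = v \<tau>) \<Longrightarrow> dpow P k u \<sigma> = dpow P k v \<sigma>"
  using cong_powP[of \<sigma> k u v] by (simp add: dpow_def)

lemma cong_dpowQ:
  "\<sigma> \<in> C \<Longrightarrow> (\<And>\<tau>. \<tau> \<in> C \<Longrightarrow> wt \<tau> = wt \<sigma> + 2 * int k \<Longrightarrow> u \<tau> = v \<tau>) \<Longrightarrow> dpow Q k u \<sigma> = dpow Q k v \<sigma>"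
  using qsl2.cong_dpowP[OF swap, of \<sigma> k u v] by fastforce

lemma comm_pow:
  "\<sigma> \<in> C \<Longrightarrow> P ((Q ^^ l) v) \<sigma> = (Q ^^ l) (P v) \<sigma>
     + qint (int l) * qint (wt \<sigma> + int l - 1) * (Q ^^ (l - 1)) v \<sigma>"
proof (induction l arbitrary: \<sigma>)
  case (Suc l)
  have "Q (P ((Q ^^ l) v)) \<sigma> = Q (\<lambda>\<tau>. 1 * (Q ^^ l) (P v) \<tau>
      + (qint (int l) * qint (wt \<sigma> + int l + 1)) * (Q ^^ (l - 1)) v \<tau>) \<sigma>"
    by (rule congQ[OF Suc.prems]) (simp add: Suc.IH algebra_simps)
  also have "\<dots> = (Q ^^ Suc l) (P v) \<sigma> + (qint (int l) * qint (wt \<sigma> + int l + 1)) * Q ((Q ^^ (l - 1)) v) \<sigma>"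
    by (subst linear_opD[OF linQ]) simp
  also have "(qint (int l) * qint (wt \<sigma> + int l + 1)) * Q ((Q ^^ (l - 1)) v) \<sigma>
      = qint (int l) * qint (wt \<sigma> + int l + 1) * (Q ^^ l) v \<sigma>"
    \<comment> \<open>For l = 0 the truncated difference l - 1 is harmless because [0] = 0.\<close>
    by (cases l) auto
  finally have 1: "Q (P ((Q ^^ l) v)) \<sigma> = (Q ^^ Suc l) (P v) \<sigma>
      + qint (int l) * qint (wt \<sigma> + int l + 1) * (Q ^^ l) v \<sigma>" .
  have 2: "qint (wt \<sigma>) + qint (int l) * qint (wt \<sigma> + int l + 1) = qint (int (Suc l)) * qint (wt \<sigma> + int l)"
    using qint_mult_split[of "int l + 1" "int l" "wt \<sigma> + int l"] by (simp add: algebra_simps)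
  have "P ((Q ^^ Suc l) v) \<sigma> = (Q ^^ Suc l) (P v) \<sigma>
      + (qint (wt \<sigma>) + qint (int l) * qint (wt \<sigma> + int l + 1)) * (Q ^^ l) v \<sigma>"
    using comm[OF Suc.prems, of "(Q ^^ l) v"] 1 by (simp add: algebra_simps)
  then show ?case unfolding 2 by simp
qed simp

lemma comm_dpow:
  assumes "\<sigma> \<in> C"
  shows "P (dpow Q l v) \<sigma> = dpow Q l (P v) \<sigma>
     + (if l = 0 then 0 else qint (wt \<sigma> + int l - 1) * dpow Q (l - 1) v \<sigma>)"
proof (cases l)
  case (Suc n)
  have "P (dpow Q l v) \<sigma> = P ((Q ^^ l) v) \<sigma> / qfact l"
    unfolding dpow_def by (subst linear_op_div[OF linP]) simp
  then show ?thesis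
    using comm_pow[OF assms, of l v] Suc
    by (simp add: dpow_def qfact_Suc add_divide_distrib del: of_nat_Suc)
qed simp

text \<open>The classical commutation formula of divided powers, with the weight taken at the state
  of evaluation. Induction on k: one P is moved through each divided power of Q, and the
  coefficients of equal products are collected by \<open>qbinom_step\<close>.\<close>

theorem dpow_comm:
  "\<sigma> \<in> C \<Longrightarrow> dpow P k (dpow Q l v) \<sigma> =
     (\<Sum>s\<le>min k l. qbinom (wt \<sigma> + int l - int k) s * dpow Q (l - s) (dpow P (k - s) v) \<sigma>)"
proof (induction k arbitrary: \<sigma>)
  case (Suc k)
  \<comment> \<open>The top of the binomial at \<sigma> for k + 1. The states read by the outer P
    have weight lower by 2 and face one P less, so the top there is n - 1.\<close>
  define n where "n = wt \<sigma> + int l - int k - 1"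
  define T where "T = (\<lambda>s. dpow Q (l - s) (dpow P (Suc k - s) v) \<sigma>)"
  have "P (dpow P k (dpow Q l v)) \<sigma> =
      P (\<lambda>\<tau>. \<Sum>s\<le>min k l. qbinom (n - 1) s * dpow Q (l - s) (dpow P (k - s) v) \<tau>) \<sigma>"
  proof (rule congP[OF Suc.prems])
    fix \<tau> assume "\<tau> \<in> C" "wt \<tau> = wt \<sigma> - 2"
    moreover from this have "wt \<tau> + int l - int k = n - 1" by (simp add: n_def)
    ultimately show "dpow P k (dpow Q l v) \<tau> =
        (\<Sum>s\<le>min k l. qbinom (n - 1) s * dpow Q (l - s) (dpow P (k - s) v) \<tau>)"
      by (simp only: Suc.IH)
  qed
  also have "\<dots> = (\<Sum>s\<le>min k l. qbinom (n - 1) s * P (dpow Q (l - s) (dpow P (k - s) v)) \<sigma>)"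
    by (subst linear_op_sum[OF linP]) simp_all
  also have "\<dots> = (\<Sum>s\<le>min k l. qbinom (n - 1) s * (qint (int k + 1 - int s) * T s)
      + (if s < l then qbinom (n - 1) s * (qint (n + int k - int s) * T (Suc s)) else 0))"
  proof (rule sum.cong[OF refl])
    fix s assume "s \<in> {..min k l}"
    then have s: "s \<le> k" "s \<le> l" by auto
    have "dpow Q (l - s) (P (dpow P (k - s) v)) \<sigma> = qint (int k + 1 - int s) * T s"
      unfolding dpow_Suc[OF linP] linear_op_scale[OF linear_op_dpow[OF linQ]] T_def
      using s by (simp add: Suc_diff_le of_nat_diff algebra_simps)
    then show "qbinom (n - 1) s * P (dpow Q (l - s) (dpow P (k - s) v)) \<sigma> =
       qbinom (n - 1) s * (qint (int k + 1 - int s) * T s)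
       + (if s < l then qbinom (n - 1) s * (qint (n + int k - int s) * T (Suc s)) else 0)"
      using s by (simp add: comm_dpow[OF Suc.prems] T_def n_def of_nat_diff algebra_simps)
  qed
  also have "\<dots> = (\<Sum>s\<le>min k l. qbinom (n - 1) s * (qint (int k + 1 - int s) * T s))
     + (\<Sum>s\<in>{..min k l} \<inter> {s. s < l}. qbinom (n - 1) s * (qint (n + int k - int s) * T (Suc s)))"
    by (simp add: sum.distrib sum.inter_restrict)
  also have "(\<Sum>s\<le>min k l. qbinom (n - 1) s * (qint (int k + 1 - int s) * T s))
     = (\<Sum>s\<le>min (Suc k) l. qbinom (n - 1) s * (qint (int k + 1 - int s) * T s))"
  \<comment> \<open>The ranges can differ only in s = k + 1, where [k + 1 - s] vanishes.\<close>
  proof (rule sum.mono_neutral_left)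
    show "\<forall>s\<in>{..min (Suc k) l} - {..min k l}. qbinom (n - 1) s * (qint (int k + 1 - int s) * T s) = 0"
    proof
      fix s assume "s \<in> {..min (Suc k) l} - {..min k l}"
      then have "int k + 1 - int s = 0" by auto
      then show "qbinom (n - 1) s * (qint (int k + 1 - int s) * T s) = 0" by simp
    qed
  qed auto
  also have "(\<Sum>s\<in>{..min k l} \<inter> {s. s < l}. qbinom (n - 1) s * (qint (n + int k - int s) * T (Suc s)))
     = (\<Sum>s\<in>{1..min (Suc k) l}. qbinom (n - 1) (s - 1) * (qint (n + int k + 1 - int s) * T s))"
    by (rule sum.reindex_bij_witness[of _ "\<lambda>s. s - 1" Suc]) (auto simp: algebra_simps of_nat_diff)
  also have "\<dots> = (\<Sum>s\<le>min (Suc k) l. if s = 0 then 0 else qbinom (n - 1) (s - 1) * (qint (n + int k + 1 - int s) * T s))"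
    by (rule sum.mono_neutral_cong_left) auto
  also have "(\<Sum>s\<le>min (Suc k) l. qbinom (n - 1) s * (qint (int k + 1 - int s) * T s)) + \<dots>
     = (\<Sum>s\<le>min (Suc k) l. (qint (int k + 1 - int s) * qbinom (n - 1) s
     + (if s = 0 then 0 else qint (n + int k + 1 - int s) * qbinom (n - 1) (s - 1))) * T s)"
    unfolding sum.distrib[symmetric] by (rule sum.cong) (auto simp: algebra_simps)
  also have "\<dots> = qint (int (Suc k)) * (\<Sum>s\<le>min (Suc k) l. qbinom n s * T s)"
    unfolding qbinom_step by (simp add: sum_distrib_left algebra_simps)
  finally have "qint (int (Suc k)) * dpow P (Suc k) (dpow Q l v) \<sigma> = \<dots>"
    unfolding dpow_Suc[OF linP] .
  then show ?case
    by (simp add: T_def n_def algebra_simps del: of_nat_Suc) (simp add: algebra_simps)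
qed simp

text \<open>All terms except s = 0 carry a binomial with top 0. For webs this lets two opposite
  rungs of equal label between equally labelled strands change places, which is what a quarter turn
  needs.\<close>

lemma dpow_comm_weight0:
  assumes "\<sigma> \<in> C" "wt \<sigma> = 0"
  shows "dpow P k (dpow Q k v) \<sigma> = dpow Q k (dpow P k v) \<sigma>"
proof -
  have "dpow P k (dpow Q k v) \<sigma> = (\<Sum>s\<le>k. qbinom 0 s * dpow Q (k - s) (dpow P (k - s) v) \<sigma>)"
    using dpow_comm[OF assms(1), of k k v] assms(2) by simp
  also have "\<dots> = (\<Sum>s\<in>{0}. qbinom 0 s * dpow Q (k - s) (dpow P (k - s) v) \<sigma>)"
    by (rule sum.mono_neutral_right) (auto simp: qbinom_zero_left)
  finally show ?thesis by simp
qed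

text \<open>Stated for an arbitrary function z because in the case OP-UP the second web is not of
  the form QP but a power of Q applied to a function on which P acts by scalars.\<close>

lemma dpow_QPQ:
  assumes "\<sigma> \<in> C"
  shows "dpow Q a (dpow P a (dpow Q b z)) \<sigma> =
    (\<Sum>s\<le>min a b. qbinom (wt \<sigma> + int a + int b) s * qbinom (int (a + b - s)) a *
        dpow Q (a + b - s) (dpow P (a - s) z) \<sigma>)"
proof -
  have "dpow Q a (dpow P a (dpow Q b z)) \<sigma> =
      dpow Q a (\<lambda>\<tau>. \<Sum>s\<le>min a b. qbinom (wt \<sigma> + int a + int b) s * dpow Q (b - s) (dpow P (a - s) z) \<tau>) \<sigma>"
  proof (rule cong_dpowQ[OF assms])
    fix \<tau> assume "\<tau> \<in> C" "wt \<tau> = wt \<sigma> + 2 * int a"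
    moreover from this have "wt \<tau> + int b - int a = wt \<sigma> + int a + int b" by simp
    ultimately show "dpow P a (dpow Q b z) \<tau> =
        (\<Sum>s\<le>min a b. qbinom (wt \<sigma> + int a + int b) s * dpow Q (b - s) (dpow P (a - s) z) \<tau>)"
      by (simp only: dpow_comm)
  qed
  also have "\<dots> = (\<Sum>s\<le>min a b. qbinom (wt \<sigma> + int a + int b) s * dpow Q a (dpow Q (b - s) (dpow P (a - s) z)) \<sigma>)"
    by (subst linear_op_sum[OF linear_op_dpow[OF linQ]]) simp_all
  also have "\<dots> = (\<Sum>s\<le>min a b. qbinom (wt \<sigma> + int a + int b) s * qbinom (int (a + b - s)) a *
        dpow Q (a + b - s) (dpow P (a - s) z) \<sigma>)"
    by (rule sum.cong) (auto simp: dpow_mult[OF linQ])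
  finally show ?thesis .
qed

lemma dpow_QPQP:
  assumes "\<sigma> \<in> C"
  shows "dpow Q a (dpow P a (dpow Q b (dpow P b v))) \<sigma> =
    (\<Sum>s\<le>min a b. qbinom (wt \<sigma> + int a + int b) s * qbinom (int (a + b - s)) a * qbinom (int (a + b - s)) b *
        dpow Q (a + b - s) (dpow P (a + b - s) v) \<sigma>)"
  unfolding dpow_QPQ[OF assms]
proof (rule sum.cong[OF refl])
  fix s assume "s \<in> {..min a b}"
  then have s: "s \<le> a" "s \<le> b" by auto
  \<comment> \<open>Merging the two divided powers of P gives the binomial with lower entry a - s;
    its complement in a + b - s is b.\<close>
  then have "qbinom (int (a + b - s)) (a - s) = qbinom (int (a + b - s)) b"
    by (simp add: qbinom_nat mult.commute del: of_nat_add of_nat_diff)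
  moreover from s have "a - s + b = a + b - s" by simp
  ultimately have "dpow P (a - s) (dpow P b v) = (\<lambda>\<tau>. qbinom (int (a + b - s)) b * dpow P (a + b - s) v \<tau>)"
    using dpow_mult[OF linP, of "a - s" b v] by (simp add: fun_eq_iff)
  then show "qbinom (wt \<sigma> + int a + int b) s * qbinom (int (a + b - s)) a *
        dpow Q (a + b - s) (dpow P (a - s) (dpow P b v)) \<sigma> =
     qbinom (wt \<sigma> + int a + int b) s * qbinom (int (a + b - s)) a * qbinom (int (a + b - s)) b *
        dpow Q (a + b - s) (dpow P (a + b - s) v) \<sigma>"
    by (simp add: linear_op_scale[OF linear_op_dpow[OF linQ]])
qed

text \<open>The values on \<open>delta \<tau>\<close> are matrix entries, and since the product
  preserves the weight, finitely many states suffice. This turns the sum over the labels of glued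
  edges into a composition of operators.\<close>

lemma dpow_QP_matrix:
  assumes "\<sigma> \<in> C" "finite K" "\<And>\<tau>. \<tau> \<in> C \<Longrightarrow> wt \<tau> = wt \<sigma> \<Longrightarrow> \<tau> \<in> K"
  shows "dpow Q a (dpow P a v) \<sigma> = (\<Sum>\<tau>\<in>K. dpow Q a (dpow P a (delta \<tau>)) \<sigma> * v \<tau>)"
proof -
  have "dpow Q a (dpow P a v) \<sigma> = dpow Q a (dpow P a (\<lambda>\<rho>. \<Sum>\<tau>\<in>K. v \<tau> * delta \<tau> \<rho>)) \<sigma>"
  proof (rule cong_dpowQ[OF assms(1)], rule cong_dpowP)
    fix \<tau> \<rho> assume "\<rho> \<in> C" "wt \<tau> = wt \<sigma> + 2 * int a" "wt \<rho> = wt \<tau> - 2 * int a"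
    then have "\<rho> \<in> K" by (intro assms) auto
    then show "v \<rho> = (\<Sum>\<tau>\<in>K. v \<tau> * delta \<tau> \<rho>)"
      using assms(2) by (simp add: delta_def if_distrib cong: if_cong)
  qed
  also have "\<dots> = (\<Sum>\<tau>\<in>K. v \<tau> * dpow Q a (dpow P a (delta \<tau>)) \<sigma>)"
    by (simp only: linear_op_sum[OF linear_op_dpow[OF linP] assms(2), where a = v]
        linear_op_sum[OF linear_op_dpow[OF linQ] assms(2), where a = v])
  finally show ?thesis by (simp add: mult.commute)
qed

end

section \<open>Operators given by sums over elements\<close>

definition elem_op :: "('s \<Rightarrow> nat set) \<Rightarrow> ('s \<Rightarrow> nat \<Rightarrow> qfield) \<Rightarrow> ('s \<Rightarrow> nat \<Rightarrow> 's) \<Rightarrow> 's operator" where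
  "elem_op U g mv v = (\<lambda>\<sigma>. \<Sum>t\<in>U \<sigma>. g \<sigma> t * v (mv \<sigma> t))"

lemma linear_elem_op: "linear_op (elem_op U g mv)"
  by (simp add: linear_op_def elem_op_def fun_eq_iff sum.distrib sum_distrib_left algebra_simps)

text \<open>By \<open>move\<close> and \<open>coeff\<close> the moves of two different elements
  commute, so these double sums cancel. What remains are the moves of one element there and back,
  which return to \<sigma> and contribute a scalar.\<close>

lemma elem_op_comm:
  assumes fin: "finite (U \<sigma>)" "finite (W \<sigma>)"
    and disj: "U \<sigma> \<inter> W \<sigma> = {}"
    and WU: "\<And>s. s \<in> U \<sigma> \<Longrightarrow> W (pm \<sigma> s) = insert s (W \<sigma>)"
    and UW: "\<And>t. t \<in> W \<sigma> \<Longrightarrow> U (qm \<sigma> t) = insert t (U \<sigma>)"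
    and move: "\<And>s t. s \<in> U \<sigma> \<Longrightarrow> t \<in> W \<sigma> \<Longrightarrow> qm (pm \<sigma> s) t = pm (qm \<sigma> t) s"
    and coeff: "\<And>s t. s \<in> U \<sigma> \<Longrightarrow> t \<in> W \<sigma> \<Longrightarrow> p \<sigma> s * r (pm \<sigma> s) t = r \<sigma> t * p (qm \<sigma> t) s"
    and return: "\<And>s. s \<in> U \<sigma> \<Longrightarrow> qm (pm \<sigma> s) s = \<sigma>" "\<And>t. t \<in> W \<sigma> \<Longrightarrow> pm (qm \<sigma> t) t = \<sigma>"
  shows "elem_op U p pm (elem_op W r qm v) \<sigma> = elem_op W r qm (elem_op U p pm v) \<sigma>
    + ((\<Sum>s\<in>U \<sigma>. p \<sigma> s * r (pm \<sigma> s) s) - (\<Sum>t\<in>W \<sigma>. r \<sigma> t * p (qm \<sigma> t) t)) * v \<sigma>"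
proof -
  have 1: "elem_op U p pm (elem_op W r qm v) \<sigma> = (\<Sum>s\<in>U \<sigma>. p \<sigma> s * r (pm \<sigma> s) s * v \<sigma>)
      + (\<Sum>s\<in>U \<sigma>. \<Sum>t\<in>W \<sigma>. p \<sigma> s * r (pm \<sigma> s) t * v (qm (pm \<sigma> s) t))"
    unfolding elem_op_def sum.distrib[symmetric]
  proof (rule sum.cong[OF refl])
    fix s assume s: "s \<in> U \<sigma>"
    then have "s \<notin> W \<sigma>" using disj by auto
    then show "p \<sigma> s * (\<Sum>t\<in>W (pm \<sigma> s). r (pm \<sigma> s) t * v (qm (pm \<sigma> s) t)) =
        p \<sigma> s * r (pm \<sigma> s) s * v \<sigma> + (\<Sum>t\<in>W \<sigma>. p \<sigma> s * r (pm \<sigma> s) t * v (qm (pm \<sigma> s) t))"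
      using fin s by (simp add: WU return sum_distrib_left algebra_simps)
  qed
  have 2: "elem_op W r qm (elem_op U p pm v) \<sigma> = (\<Sum>t\<in>W \<sigma>. r \<sigma> t * p (qm \<sigma> t) t * v \<sigma>)
      + (\<Sum>t\<in>W \<sigma>. \<Sum>s\<in>U \<sigma>. r \<sigma> t * p (qm \<sigma> t) s * v (pm (qm \<sigma> t) s))"
    unfolding elem_op_def sum.distrib[symmetric]
  proof (rule sum.cong[OF refl])
    fix t assume t: "t \<in> W \<sigma>"
    then have "t \<notin> U \<sigma>" using disj by auto
    then show "r \<sigma> t * (\<Sum>s\<in>U (qm \<sigma> t). p (qm \<sigma> t) s * v (pm (qm \<sigma> t) s)) =
        r \<sigma> t * p (qm \<sigma> t) t * v \<sigma> + (\<Sum>s\<in>U \<sigma>. r \<sigma> t * p (qm \<sigma> t) s * v (pm (qm \<sigma> t) s))"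
      using fin t by (simp add: UW return sum_distrib_left algebra_simps)
  qed
  have 3: "(\<Sum>s\<in>U \<sigma>. \<Sum>t\<in>W \<sigma>. p \<sigma> s * r (pm \<sigma> s) t * v (qm (pm \<sigma> s) t))
     = (\<Sum>t\<in>W \<sigma>. \<Sum>s\<in>U \<sigma>. r \<sigma> t * p (qm \<sigma> t) s * v (pm (qm \<sigma> t) s))"
    by (subst sum.swap) (simp add: move coeff)
  show ?thesis unfolding 1 2 3 by (simp add: sum_distrib_right left_diff_distrib)
qed

text \<open>An element together with a k-set avoiding it is the same as a (k+1)-set with a marked
  element.\<close>

lemma sum_elem_subset:
  assumes "finite U"
  shows "(\<Sum>t\<in>U. \<Sum>A | A \<subseteq> U - {t} \<and> card A = k. h t A)
       = (\<Sum>A | A \<subseteq> U \<and> card A = Suc k. \<Sum>t\<in>A. h t (A - {t}))"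
proof -
  have fA: "finite A" if "A \<subseteq> U" for A using that assms finite_subset by blast
  have "(\<Sum>t\<in>U. \<Sum>A | A \<subseteq> U - {t} \<and> card A = k. h t A)
     = (\<Sum>(t, A)\<in>Sigma U (\<lambda>t. {A. A \<subseteq> U - {t} \<and> card A = k}). h t A)"
    using assms by (subst sum.Sigma) auto
  also have "\<dots> = (\<Sum>(A, t)\<in>Sigma {A. A \<subseteq> U \<and> card A = Suc k} (\<lambda>A. A). h t (A - {t}))"
  proof (rule sum.reindex_bij_witness[of _ "\<lambda>(A, t). (t, A - {t})" "\<lambda>(t, A). (insert t A, t)"])
    fix p assume "p \<in> Sigma U (\<lambda>t. {A. A \<subseteq> U - {t} \<and> card A = k})"
    then obtain t A where p: "p = (t, A)" "t \<in> U" "A \<subseteq> U - {t}" "card A = k" by auto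
    then have "t \<notin> A" "finite A" using fA[of A] by auto
    then show "(case (case p of (t, A) \<Rightarrow> (insert t A, t)) of (A, t) \<Rightarrow> (t, A - {t})) = p"
      "(case p of (t, A) \<Rightarrow> (insert t A, t)) \<in> Sigma {A. A \<subseteq> U \<and> card A = Suc k} (\<lambda>A. A)"
      "(case case p of (t, A) \<Rightarrow> (insert t A, t) of (A, t) \<Rightarrow> h t (A - {t})) = (case p of (t, A) \<Rightarrow> h t A)"
      using p by auto
  next
    fix p assume "p \<in> Sigma {A. A \<subseteq> U \<and> card A = Suc k} (\<lambda>A. A)"
    then obtain t A where p: "p = (A, t)" "A \<subseteq> U" "t \<in> A" "card A = Suc k" by auto
    then show "(case (case p of (A, t) \<Rightarrow> (t, A - {t})) of (t, A) \<Rightarrow> (insert t A, t)) = p"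
      "(case p of (A, t) \<Rightarrow> (t, A - {t})) \<in> Sigma U (\<lambda>t. {A. A \<subseteq> U - {t} \<and> card A = k})"
      using fA[of A] by auto
  qed
  also have "\<dots> = (\<Sum>A | A \<subseteq> U \<and> card A = Suc k. \<Sum>t\<in>A. h t (A - {t}))"
    using assms by (subst sum.Sigma) (auto intro: fA)
  finally show ?thesis .
qed

text \<open>Forgets the order of k successive moves. The one-step weight times the weight of the
  remaining set is the weight of the whole set times a ratio \<open>r\<close>; by the last
  hypothesis the ratios sum to a quantum integer, which cancels a factor of [k]!.\<close>

lemma dpow_elem_op:
  assumes fin: "\<And>\<sigma>. \<sigma> \<in> C \<Longrightarrow> finite (U \<sigma>)"
    and C: "\<And>\<sigma> t. \<sigma> \<in> C \<Longrightarrow> t \<in> U \<sigma> \<Longrightarrow> mv \<sigma> t \<in> C"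
    and U: "\<And>\<sigma> t. \<sigma> \<in> C \<Longrightarrow> t \<in> U \<sigma> \<Longrightarrow> U (mv \<sigma> t) = U \<sigma> - {t}"
    and M0: "\<And>\<sigma>. M \<sigma> {} = \<sigma>" and G0: "\<And>\<sigma>. G \<sigma> {} = 1"
    and M: "\<And>\<sigma> t A. \<sigma> \<in> C \<Longrightarrow> t \<in> U \<sigma> \<Longrightarrow> A \<subseteq> U \<sigma> - {t} \<Longrightarrow> M (mv \<sigma> t) A = M \<sigma> (insert t A)"
    and G: "\<And>\<sigma> t A. \<sigma> \<in> C \<Longrightarrow> t \<in> U \<sigma> \<Longrightarrow> A \<subseteq> U \<sigma> - {t} \<Longrightarrow> finite A \<Longrightarrow>
       g \<sigma> t * G (mv \<sigma> t) A = G \<sigma> (insert t A) * r t A"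
    and r: "\<And>A. finite A \<Longrightarrow> (\<Sum>t\<in>A. r t (A - {t})) = qint (int (card A))"
  shows "\<sigma> \<in> C \<Longrightarrow> dpow (elem_op U g mv) k v \<sigma> = (\<Sum>A | A \<subseteq> U \<sigma> \<and> card A = k. G \<sigma> A * v (M \<sigma> A))"
proof (induction k arbitrary: \<sigma>)
  case 0
  have "{A. A \<subseteq> U \<sigma> \<and> card A = 0} = {{}}"
    using fin[OF 0] finite_subset by fastforce
  then show ?case by (simp add: M0 G0)
next
  case (Suc k)
  have fA: "finite A" if "A \<subseteq> U \<sigma>" for A using that fin[OF Suc.prems] finite_subset by blast
  have "qint (int (Suc k)) * dpow (elem_op U g mv) (Suc k) v \<sigma> = elem_op U g mv (dpow (elem_op U g mv) k v) \<sigma>"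
    by (simp add: dpow_Suc[OF linear_elem_op])
  also have "\<dots> = (\<Sum>t\<in>U \<sigma>. \<Sum>A | A \<subseteq> U \<sigma> - {t} \<and> card A = k. G \<sigma> (insert t A) * r t A * v (M \<sigma> (insert t A)))"
    unfolding elem_op_def[of U g mv "dpow _ _ _"]
  proof (rule sum.cong[OF refl])
    fix t assume t: "t \<in> U \<sigma>"
    have "g \<sigma> t * dpow (elem_op U g mv) k v (mv \<sigma> t)
        = (\<Sum>A | A \<subseteq> U \<sigma> - {t} \<and> card A = k. g \<sigma> t * G (mv \<sigma> t) A * v (M (mv \<sigma> t) A))"
      by (simp add: Suc.IH[OF C[OF Suc.prems t]] U[OF Suc.prems t] sum_distrib_left algebra_simps)
    also have "\<dots> = (\<Sum>A | A \<subseteq> U \<sigma> - {t} \<and> card A = k. G \<sigma> (insert t A) * r t A * v (M \<sigma> (insert t A)))"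
      by (rule sum.cong[OF refl]) (auto simp: G[OF Suc.prems t] M[OF Suc.prems t] fA subset_Diff_insert)
    finally show "g \<sigma> t * dpow (elem_op U g mv) k v (mv \<sigma> t) = \<dots>" .
  qed
  also have "\<dots> = (\<Sum>A | A \<subseteq> U \<sigma> \<and> card A = Suc k. \<Sum>t\<in>A. G \<sigma> A * r t (A - {t}) * v (M \<sigma> A))"
    by (subst sum_elem_subset[OF fin[OF Suc.prems]]) (auto simp: insert_absorb intro!: sum.cong)
  also have "\<dots> = (\<Sum>A | A \<subseteq> U \<sigma> \<and> card A = Suc k. qint (int (Suc k)) * (G \<sigma> A * v (M \<sigma> A)))"
  proof (rule sum.cong[OF refl])
    fix A assume "A \<in> {A. A \<subseteq> U \<sigma> \<and> card A = Suc k}"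
    then have A: "finite A" "card A = Suc k" using fA by auto
    have "(\<Sum>t\<in>A. G \<sigma> A * r t (A - {t}) * v (M \<sigma> A)) = G \<sigma> A * (\<Sum>t\<in>A. r t (A - {t})) * v (M \<sigma> A)"
      by (simp add: sum_distrib_left sum_distrib_right)
    then show "(\<Sum>t\<in>A. G \<sigma> A * r t (A - {t}) * v (M \<sigma> A)) = qint (int (Suc k)) * (G \<sigma> A * v (M \<sigma> A))"
      unfolding r[OF A(1)] A(2) by (simp add: ac_simps)
  qed
  also have "\<dots> = qint (int (Suc k)) * (\<Sum>A | A \<subseteq> U \<sigma> \<and> card A = Suc k. G \<sigma> A * v (M \<sigma> A))"
    by (simp add: sum_distrib_left)
  finally show ?case
    by (metis (no_types, lifting) mult_cancel_left qint_eq_0_iff of_nat_eq_0_iff nat.distinct(1))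
qed

section \<open>Inversion weights\<close>

text \<open>The coefficient of a merge vertex. Through \<open>mm_swap\<close> it also expresses the
  coefficient of a split vertex, so that a single weight occurs in all later formulas.\<close>

definition mm :: "nat set \<Rightarrow> nat set \<Rightarrow> qfield" where
  "mm S T = (- qv) ^ inversions S T"

lemma finite_inversions: "finite S \<Longrightarrow> finite T \<Longrightarrow> finite {(s, t). s \<in> S \<and> t \<in> T \<and> s < t}"
  by (rule finite_subset[of _ "S \<times> T"]) auto

lemma inversions_Un_left:
  assumes "finite A" "finite B" "finite T" "A \<inter> B = {}"
  shows "inversions (A \<union> B) T = inversions A T + inversions B T"
proof -
  have "{(s, t). s \<in> A \<union> B \<and> t \<in> T \<and> s < t}
      = {(s, t). s \<in> A \<and> t \<in> T \<and> s < t} \<union> {(s, t). s \<in> B \<and> t \<in> T \<and> s < t}" by auto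
  then show ?thesis using assms unfolding inversions_def
    by (simp only:, subst card_Un_disjoint) (auto intro: finite_inversions)
qed

lemma inversions_Un_right:
  assumes "finite A" "finite B" "finite T" "A \<inter> B = {}"
  shows "inversions T (A \<union> B) = inversions T A + inversions T B"
proof -
  have "{(s, t). s \<in> T \<and> t \<in> A \<union> B \<and> s < t}
      = {(s, t). s \<in> T \<and> t \<in> A \<and> s < t} \<union> {(s, t). s \<in> T \<and> t \<in> B \<and> s < t}" by auto
  then show ?thesis using assms unfolding inversions_def
    by (simp only:, subst card_Un_disjoint) (auto intro: finite_inversions)
qed

lemma mm_Un_left: "finite A \<Longrightarrow> finite B \<Longrightarrow> finite T \<Longrightarrow> A \<inter> B = {} \<Longrightarrow> mm (A \<union> B) T = mm A T * mm B T"
  by (simp add: mm_def inversions_Un_left power_add)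

lemma mm_Un_right: "finite A \<Longrightarrow> finite B \<Longrightarrow> finite T \<Longrightarrow> A \<inter> B = {} \<Longrightarrow> mm T (A \<union> B) = mm T A * mm T B"
  by (simp add: mm_def inversions_Un_right power_add)

lemma mm_insert_left: "finite A \<Longrightarrow> finite T \<Longrightarrow> x \<notin> A \<Longrightarrow> mm (insert x A) T = mm {x} T * mm A T"
  using mm_Un_left[of "{x}" A T] by simp

lemma mm_insert_right: "finite A \<Longrightarrow> finite T \<Longrightarrow> x \<notin> A \<Longrightarrow> mm T (insert x A) = mm T {x} * mm T A"
  using mm_Un_right[of "{x}" A T] by simp

lemma mm_empty [simp]: "mm {} T = 1" "mm S {} = 1"
  by (simp_all add: mm_def inversions_def)

lemma mm_nonzero [simp]: "mm S T \<noteq> 0"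
  by (simp add: mm_def)

lemma mm_remove_left: "finite A \<Longrightarrow> finite T \<Longrightarrow> x \<in> A \<Longrightarrow> mm (A - {x}) T = mm A T / mm {x} T"
  using mm_insert_left[of "A - {x}" T x] by (simp add: insert_absorb)

lemma mm_remove_right: "finite A \<Longrightarrow> finite T \<Longrightarrow> x \<in> A \<Longrightarrow> mm T (A - {x}) = mm T A / mm T {x}"
  using mm_insert_right[of "A - {x}" T x] by (simp add: insert_absorb)

lemma mm_swap1: "s \<noteq> t \<Longrightarrow> mm {s} {t} * mm {t} {s} = - qv"
proof -
  have "inversions {s} {t} = (if s < t then 1 else 0)" for s t
  proof -
    have "{(s', t'). s' \<in> {s} \<and> t' \<in> {t} \<and> s' < t'} = (if s < t then {(s, t)} else {})" by auto
    then show ?thesis by (simp add: inversions_def)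
  qed
  then show "s \<noteq> t \<Longrightarrow> mm {s} {t} * mm {t} {s} = - qv" by (auto simp: mm_def)
qed

text \<open>Each pair of an element of A and one of B is counted in exactly one of the two
  orders.\<close>

lemma mm_swap:
  assumes "finite A" "finite B" "A \<inter> B = {}"
  shows "mm A B * mm B A = (- qv) ^ (card A * card B)"
proof -
  have 1: "mm {x} B * mm B {x} = (- qv) ^ card B" if "finite B" "x \<notin> B" for x B
    using that
  proof (induction B)
    case (insert b B)
    have "mm {x} (insert b B) * mm (insert b B) {x} = (mm {x} {b} * mm {b} {x}) * (mm {x} B * mm B {x})"
      using insert by (simp add: mm_insert_left[of B "{x}" b] mm_insert_right[of B "{x}" b])
    also have "\<dots> = (- qv) * (- qv) ^ card B"
      using insert mm_swap1[of x b] by simp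
    finally show ?case using insert by simp
  qed simp
  show ?thesis using assms
  proof (induction A)
    case (insert a A)
    have "mm (insert a A) B * mm B (insert a A) = (mm {a} B * mm B {a}) * (mm A B * mm B A)"
      using insert by (simp add: mm_insert_left[of A B a] mm_insert_right[of A B a])
    also have "\<dots> = (- qv) ^ card B * (- qv) ^ (card A * card B)"
      using insert 1[of B a] by simp
    finally show ?case using insert by (simp add: power_add)
  qed simp
qed

section \<open>Counting elements on either side of a position, and telescoping sums\<close>

definition gt :: "nat set \<Rightarrow> nat \<Rightarrow> nat" where "gt S x = card {y \<in> S. x < y}"
definition lt :: "nat set \<Rightarrow> nat \<Rightarrow> nat" where "lt S x = card {y \<in> S. y < x}"
definition ge :: "nat set \<Rightarrow> nat \<Rightarrow> nat" where "ge S x = card {y \<in> S. x \<le> y}"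

lemma mm_single_left: "mm {x} S = (- qv) ^ gt S x"
proof -
  have "{(s, t). s \<in> {x} \<and> t \<in> S \<and> s < t} = Pair x ` {y \<in> S. x < y}" by auto
  then show ?thesis by (simp add: mm_def inversions_def gt_def card_image inj_on_def)
qed

lemma mm_single_right: "mm S {x} = (- qv) ^ lt S x"
proof -
  have "{(s, t). s \<in> S \<and> t \<in> {x} \<and> s < t} = (\<lambda>y. (y, x)) ` {y \<in> S. y < x}" by auto
  then show ?thesis by (simp add: mm_def inversions_def lt_def card_image inj_on_def)
qed

lemma gt_remove [simp]: "gt (S - {x}) x = gt S x" and lt_remove [simp]: "lt (S - {x}) x = lt S x"
  unfolding gt_def lt_def by (rule arg_cong[of _ _ card]; auto)+

lemma lt_insert [simp]: "lt (insert x S) x = lt S x"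
  unfolding lt_def by (rule arg_cong[of _ _ card]) auto

lemma ge_eq: "finite S \<Longrightarrow> ge S x = gt S x + (if x \<in> S then 1 else 0)"
proof -
  assume "finite S"
  have "{y \<in> S. x \<le> y} = (if x \<in> S then insert x {y \<in> S. x < y} else {y \<in> S. x < y})"
    by (auto simp: le_less)
  then show ?thesis using \<open>finite S\<close> by (simp add: ge_def gt_def)
qed

lemma ge_Suc: "ge S (Suc x) = gt S x"
  by (simp add: ge_def gt_def Suc_le_eq)

lemma lt_Suc: "finite S \<Longrightarrow> lt S (Suc x) = lt S x + (if x \<in> S then 1 else 0)"
proof -
  assume "finite S"
  have "{y \<in> S. y < Suc x} = (if x \<in> S then insert x {y \<in> S. y < x} else {y \<in> S. y < x})"
    by (auto simp: less_Suc_eq)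
  then show ?thesis using \<open>finite S\<close> by (simp add: lt_def)
qed

lemma ge_0: "ge S 0 = card S" and lt_0: "lt S 0 = 0"
  by (simp_all add: ge_def lt_def)

lemma ge_bound: "S \<subseteq> {..<N} \<Longrightarrow> ge S N = 0"
proof -
  assume "S \<subseteq> {..<N}"
  then have "{y \<in> S. N \<le> y} = {}" by auto
  then show ?thesis by (simp only: ge_def card.empty)
qed

lemma lt_bound: "S \<subseteq> {..<N} \<Longrightarrow> lt S N = card S"
  unfolding lt_def by (rule arg_cong[of _ _ card]) auto

text \<open>The terms are, up to the factor q - 1/q, the jumps of \<phi>, so only its two end values
  matter. The scalars in the commutators below come out of such sums over the positions 0, ..., N -
  1.\<close>

lemma telescope_qint:
  assumes "\<And>x. x < N \<Longrightarrow> \<phi> (Suc x) - \<phi> x = (qv - inverse qv) * f x"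
    and "\<phi> N = qv powi n" "\<phi> 0 = qv powi (- n)"
  shows "(\<Sum>x<N. f x) = qint n"
proof -
  have "(qv - inverse qv) * (\<Sum>x<N. f x) = (\<Sum>x<N. \<phi> (Suc x) - \<phi> x)"
    by (simp add: sum_distrib_left assms(1))
  also have "\<dots> = \<phi> N - \<phi> 0" by (rule sum_lessThan_telescope)
  finally show ?thesis
    using assms(2,3) qv_diff_nonzero unfolding qint_def
    by (metis nonzero_mult_div_cancel_left)
qed

lemma qv_step: "qv powi (n + 2) - qv powi n = (qv - inverse qv) * qv powi (n + 1)"
  by (simp add: powi_add power2_eq_square field_simps)

lemma qv_step': "m = n + 2 \<Longrightarrow> l = n + 1 \<Longrightarrow> qv powi m - qv powi n = (qv - inverse qv) * qv powi l"
  by (simp only: qv_step)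

lemma sum_exchange:
  assumes "finite S" "finite T"
  defines "\<psi> \<equiv> \<lambda>x. qv powi (1 - int (card S) - int (card T) + 2 * int (lt S x) + 2 * int (gt T x))"
  shows "(\<Sum>x\<in>S - T. \<psi> x) - (\<Sum>x\<in>T - S. \<psi> x) = qint (int (card S) - int (card T))"
proof -
  obtain N where N: "S \<union> T \<subseteq> {..<N}" using finite_nat_iff_bounded assms(1,2) by (metis finite_UnI)
  \<comment> \<open>Passing x, the exponent rises by 2 if x lies in S only, falls by 2 if x lies in
    T only, and is unchanged otherwise. It runs from |T| - |S| to |S| - |T|.\<close>
  define \<phi> where "\<phi> = (\<lambda>x. qv powi (2 * int (lt S x) + 2 * int (ge T x) - int (card S) - int (card T)))"
  have "(\<Sum>x<N. (if x \<in> S - T then \<psi> x else 0) - (if x \<in> T - S then \<psi> x else 0)) = qint (int (card S) - int (card T))"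
  proof (rule telescope_qint[of _ \<phi>])
    fix x
    show "\<phi> (Suc x) - \<phi> x = (qv - inverse qv) * ((if x \<in> S - T then \<psi> x else 0) - (if x \<in> T - S then \<psi> x else 0))"
    proof (cases "x \<in> S"; cases "x \<in> T")
      assume "x \<in> S" "x \<notin> T"
      then show ?thesis unfolding \<phi>_def \<psi>_def using assms(1,2)
        by (simp add: lt_Suc ge_Suc ge_eq) (rule qv_step'; simp)
    next
      assume "x \<notin> S" "x \<in> T"
      then have "\<phi> x - \<phi> (Suc x) = (qv - inverse qv) * \<psi> x" unfolding \<phi>_def \<psi>_def using assms(1,2)
        by (simp add: lt_Suc ge_Suc ge_eq) (rule qv_step'; simp)
      then show ?thesis using \<open>x \<notin> S\<close> \<open>x \<in> T\<close> by (simp add: algebra_simps)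
    next
      assume "x \<in> S" "x \<in> T"
      then show ?thesis unfolding \<phi>_def using assms(1,2) by (simp add: lt_Suc ge_Suc ge_eq algebra_simps)
    next
      assume "x \<notin> S" "x \<notin> T"
      then show ?thesis unfolding \<phi>_def using assms(1,2) by (simp add: lt_Suc ge_Suc ge_eq)
    qed
  qed (use N in \<open>simp_all add: \<phi>_def lt_bound ge_bound lt_0 ge_0\<close>)
  moreover have "(\<Sum>x<N. if x \<in> S - T then \<psi> x else 0) = (\<Sum>x\<in>S - T. \<psi> x)"
    "(\<Sum>x<N. if x \<in> T - S then \<psi> x else 0) = (\<Sum>x\<in>T - S. \<psi> x)"
    using N by (subst sum.inter_restrict[symmetric]; auto intro!: sum.cong)+
  ultimately show ?thesis by (simp only: sum_subtractf)
qed

lemma sum_add_remove: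
  assumes "S \<subseteq> {..<N}" "V \<subseteq> {..<N}"
  defines "\<psi> \<equiv> \<lambda>x. qv powi (2 * int x + 2 * int (gt S x) + 2 * int (gt V x) - int (card S) - int (card V) - int N + 1)"
  shows "(\<Sum>x\<in>{..<N} - (S \<union> V). \<psi> x) - (\<Sum>x\<in>S \<inter> V. qv\<^sup>2 * \<psi> x) = qint (int N - int (card S) - int (card V))"
proof -
  have fin: "finite S" "finite V" using assms finite_subset by blast+
  \<comment> \<open>Passing x raises 2x by 2 and lowers 2 times each count that includes x by 2: in
    total +2 outside both sets, 0 in exactly one, -2 in both. In the last case the midpoint of the
    jump is shifted since \<open>gt\<close> omits x itself, whence the factor
    \<open>q^2\<close>.\<close>
  define \<phi> where "\<phi> = (\<lambda>x. qv powi (2 * int x + 2 * int (ge S x) + 2 * int (ge V x) - int (card S) - int (card V) - int N))"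
  have \<psi>2: "qv\<^sup>2 * \<psi> x = qv powi (2 * int x + 2 * int (gt S x) + 2 * int (gt V x) - int (card S) - int (card V) - int N + 3)" for x
  proof -
    have "qv\<^sup>2 * qv powi (m + 1) = qv powi (m + 3)" for m
      by (simp add: powi_add power2_eq_square power3_eq_cube)
    then show ?thesis unfolding \<psi>_def .
  qed
  have "(\<Sum>x<N. (if x \<in> {..<N} - (S \<union> V) then \<psi> x else 0) - (if x \<in> S \<inter> V then qv\<^sup>2 * \<psi> x else 0))
      = qint (int N - int (card S) - int (card V))"
  proof (rule telescope_qint[of _ \<phi>])
    fix x assume x: "x < N"
    show "\<phi> (Suc x) - \<phi> x = (qv - inverse qv) *
      ((if x \<in> {..<N} - (S \<union> V) then \<psi> x else 0) - (if x \<in> S \<inter> V then qv\<^sup>2 * \<psi> x else 0))"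
    proof (cases "x \<in> S"; cases "x \<in> V")
      assume "x \<notin> S" "x \<notin> V"
      then show ?thesis unfolding \<phi>_def \<psi>_def using fin x
        by (simp add: ge_Suc ge_eq) (rule qv_step'; simp)
    next
      assume a: "x \<in> S" "x \<in> V"
      then have "\<phi> x - \<phi> (Suc x) = (qv - inverse qv) * (qv\<^sup>2 * \<psi> x)" unfolding \<phi>_def \<psi>2 using fin
        by (simp add: ge_Suc ge_eq) (rule qv_step'; simp)
      then show ?thesis using a by (simp add: algebra_simps)
    next
      assume "x \<in> S" "x \<notin> V"
      then show ?thesis unfolding \<phi>_def using fin by (simp add: ge_Suc ge_eq algebra_simps)
    next
      assume "x \<notin> S" "x \<in> V"
      then show ?thesis unfolding \<phi>_def using fin by (simp add: ge_Suc ge_eq algebra_simps)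
    qed
  qed (use assms(1,2) in \<open>simp_all add: \<phi>_def ge_bound ge_0 algebra_simps\<close>)
  moreover have "(\<Sum>x<N. if x \<in> {..<N} - (S \<union> V) then \<psi> x else 0) = (\<Sum>x\<in>{..<N} - (S \<union> V). \<psi> x)"
    "(\<Sum>x<N. if x \<in> S \<inter> V then qv\<^sup>2 * \<psi> x else 0) = (\<Sum>x\<in>S \<inter> V. qv\<^sup>2 * \<psi> x)"
    using assms(1,2) by (subst sum.inter_restrict[symmetric]; auto intro!: sum.cong)+
  ultimately show ?thesis by (simp only: sum_subtractf)
qed

lemma sum_complement:
  assumes "W \<subseteq> {..<N}"
  shows "(\<Sum>x\<in>{..<N} - W. qv powi (2 * int x + 2 * int (gt W x) - int (card W) - int N + 1)) = qint (int N - int (card W))"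
  using sum_add_remove[OF assms, of "{}"] by (simp add: gt_def)

lemma power_even_qv: "(- qv) ^ n * (- qv) ^ n = qv powi (2 * int n)"
proof -
  have "(- qv) ^ n * (- qv) ^ n = qv ^ (n + n)"
    by (metis power_add power_minus_even even_add)
  also have "\<dots> = qv powi (int (n + n))" by (simp only: power_int_of_nat)
  finally show ?thesis by (simp add: algebra_simps)
qed

text \<open>The exponents run through 1 - |A|, 3 - |A|, ..., |A| - 1. This sum and the next one
  supply the hypothesis \<open>r\<close> of \<open>dpow_elem_op\<close>.\<close>

lemma sum_lt: "finite A \<Longrightarrow> (\<Sum>x\<in>A. qv powi (- int (card (A - {x}))) * mm (A - {x}) {x} * mm (A - {x}) {x}) = qint (int (card A))"
proof -
  assume A: "finite A"
  have "(\<Sum>x\<in>A. qv powi (- int (card (A - {x}))) * mm (A - {x}) {x} * mm (A - {x}) {x})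
     = (\<Sum>x\<in>A. qv powi (1 - int (card A) + 2 * int (lt A x)))"
  proof (rule sum.cong[OF refl])
    fix x assume "x \<in> A"
    then have "- int (card (A - {x})) = 1 - int (card A)"
      using card.remove[OF A, of x] by simp
    then show "qv powi (- int (card (A - {x}))) * mm (A - {x}) {x} * mm (A - {x}) {x}
       = qv powi (1 - int (card A) + 2 * int (lt A x))"
      by (simp only: mult.assoc mm_single_right lt_remove power_even_qv powi_add[OF qv_nonzero])
  qed
  then show ?thesis using sum_exchange[OF A, of "{}"] by (simp add: gt_def)
qed

lemma sum_gt: "finite A \<Longrightarrow> (\<Sum>x\<in>A. qv powi (- int (card (A - {x}))) * mm {x} (A - {x}) * mm {x} (A - {x})) = qint (int (card A))"
proof -
  assume A: "finite A"
  have "(\<Sum>x\<in>A. qv powi (- int (card (A - {x}))) * mm {x} (A - {x}) * mm {x} (A - {x}))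
     = (\<Sum>x\<in>A. qv powi (1 - int (card A) + 2 * int (gt A x)))"
  proof (rule sum.cong[OF refl])
    fix x assume "x \<in> A"
    then have "- int (card (A - {x})) = 1 - int (card A)"
      using card.remove[OF A, of x] by simp
    then show "qv powi (- int (card (A - {x}))) * mm {x} (A - {x}) * mm {x} (A - {x})
       = qv powi (1 - int (card A) + 2 * int (gt A x))"
      by (simp only: mult.assoc mm_single_left gt_remove power_even_qv powi_add[OF qv_nonzero])
  qed
  then show ?thesis using sum_exchange[OF _ A, of "{}"] qint_minus[of "int (card A)"] by (simp add: lt_def)
qed

section \<open>Exchange of elements between two sets\<close>

type_synonym sets2 = "nat set \<times> nat set"

lemma int_card_remove: "finite S \<Longrightarrow> x \<in> S \<Longrightarrow> int (card (S - {x})) = int (card S) - 1"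
  using card.remove[of S x] by simp

text \<open>A rung of label 1 from T to S: the first two factors are the weight of splitting t off
  T, the third that of merging it with S. Likewise \<open>opF\<close> for a rung in the other
  direction.\<close>

definition opE :: "sets2 operator" where
  "opE = elem_op (\<lambda>(S, T). T - S)
     (\<lambda>(S, T) t. qv powi (1 - int (card T)) * mm {t} (T - {t}) * mm S {t}) (\<lambda>(S, T) t. (insert t S, T - {t}))"

definition opF :: "sets2 operator" where
  "opF = elem_op (\<lambda>(S, T). S - T)
     (\<lambda>(S, T) s. qv powi (1 - int (card S)) * mm (S - {s}) {s} * mm {s} T) (\<lambda>(S, T) s. (S - {s}, insert s T))"

definition finite2 :: "sets2 set" where
  "finite2 = {(S, T). finite S \<and> finite T}"

lemma opF_E_comm:
  assumes "finite S" "finite T"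
  shows "opF (opE v) (S, T) = opE (opF v) (S, T) + qint (int (card S) - int (card T)) * v (S, T)"
proof -
  define \<psi> where "\<psi> = (\<lambda>x. qv powi (1 - int (card S) - int (card T) + 2 * int (lt S x) + 2 * int (gt T x)))"
  have 1: "(\<Sum>s\<in>S - T. (qv powi (1 - int (card S)) * mm (S - {s}) {s} * mm {s} T) *
      (qv powi (1 - int (card (insert s T))) * mm {s} (insert s T - {s}) * mm (S - {s}) {s})) = sum \<psi> (S - T)"
  proof (rule sum.cong[OF refl])
    fix s assume s: "s \<in> S - T"
    then have e: "1 - int (card S) - int (card T) = (1 - int (card S)) + (1 - int (card (insert s T)))" using assms by simp
    from s have "insert s T - {s} = T" by auto
    then show "(qv powi (1 - int (card S)) * mm (S - {s}) {s} * mm {s} T) *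
      (qv powi (1 - int (card (insert s T))) * mm {s} (insert s T - {s}) * mm (S - {s}) {s}) = \<psi> s"
      unfolding \<psi>_def unfolding e unfolding powi_add[OF qv_nonzero] power_even_qv[symmetric] mm_single_left mm_single_right lt_remove
      by (simp only: ac_simps)
  qed
  have 2: "(\<Sum>t\<in>T - S. (qv powi (1 - int (card T)) * mm {t} (T - {t}) * mm S {t}) *
      (qv powi (1 - int (card (insert t S))) * mm (insert t S - {t}) {t} * mm {t} (T - {t}))) = sum \<psi> (T - S)"
  proof (rule sum.cong[OF refl])
    fix t assume t: "t \<in> T - S"
    then have e: "1 - int (card S) - int (card T) = (1 - int (card T)) + (1 - int (card (insert t S)))" using assms by simp
    from t have "insert t S - {t} = S" by auto
    then show "(qv powi (1 - int (card T)) * mm {t} (T - {t}) * mm S {t}) *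
      (qv powi (1 - int (card (insert t S))) * mm (insert t S - {t}) {t} * mm {t} (T - {t})) = \<psi> t"
      unfolding \<psi>_def unfolding e unfolding powi_add[OF qv_nonzero] power_even_qv[symmetric] mm_single_left mm_single_right gt_remove
      by (simp only: ac_simps)
  qed
  have "opF (opE v) (S, T) = opE (opF v) (S, T) + (sum \<psi> (S - T) - sum \<psi> (T - S)) * v (S, T)"
    unfolding opE_def opF_def
  proof (subst elem_op_comm, goal_cases)
    \<comment> \<open>The hypothesis \<open>coeff\<close>: both orders of the two moves pick up the
      same factor \<open>mm {t} {s} / mm {s} {t}\<close>.\<close>
    case (7 s t)
    then have *: "s \<in> S" "s \<notin> T" "t \<in> T" "t \<notin> S" "s \<noteq> t" by auto
    have T1: "insert s T - {t} = insert s (T - {t})" and S1: "insert t S - {s} = insert t (S - {s})" using * by auto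
    have c: "card (insert s T) = Suc (card T)" "card (insert t S) = Suc (card S)" using assms * by simp_all
    have m1: "mm {t} (insert s (T - {t})) = mm {t} {s} * mm {t} (T - {t})"
      using assms * by (intro mm_insert_right) auto
    have m2: "mm (insert t (S - {s})) {s} = mm {t} {s} * mm (S - {s}) {s}"
      using assms * by (intro mm_insert_left) auto
    have m3: "mm (S - {s}) {t} = mm S {t} / mm {s} {t}" using assms * by (intro mm_remove_left) auto
    have m4: "mm {s} (T - {t}) = mm {s} T / mm {s} {t}" using assms * by (intro mm_remove_right) auto
    show ?case
      by (simp only: prod.case T1 S1 c m1 m2 m3 m4) (simp add: powi_add power_int_diff power_int_minus field_simps)
  qed (use assms 1 2 in auto)
  then show ?thesis unfolding \<psi>_def sum_exchange[OF assms] .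
qed

text \<open>With the total number of elements fixed, the weight |S| - |T| determines both
  cardinalities, so the states of a given weight form a product of two sets of subsets.\<close>

definition sum2 :: "nat \<Rightarrow> nat \<Rightarrow> sets2 set" where
  "sum2 N m = {(S, T). S \<subseteq> {..<N} \<and> T \<subseteq> {..<N} \<and> card S + card T = m}"

lemma sum2_finite: "(S, T) \<in> sum2 N m \<Longrightarrow> finite S \<and> finite T"
  by (auto simp: sum2_def intro: finite_subset)

lemma qsl2_EF: "qsl2 opF opE (\<lambda>(S, T). int (card S) - int (card T)) (sum2 N m)"
proof
  show "linear_op opF" "linear_op opE" by (simp_all add: opF_def opE_def linear_elem_op)
next
  fix \<sigma> v assume "\<sigma> \<in> sum2 N m"
  then show "opF (opE v) \<sigma> = opE (opF v) \<sigma> + qint (case \<sigma> of (S, T) \<Rightarrow> int (card S) - int (card T)) * v \<sigma>"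
    using sum2_finite[of "fst \<sigma>" "snd \<sigma>"] by (cases \<sigma>) (simp add: opF_E_comm)
next
  fix \<sigma> and u v :: "sets2 \<Rightarrow> qfield" assume \<sigma>: "\<sigma> \<in> sum2 N m" and
    eq: "\<And>\<tau>. \<tau> \<in> sum2 N m \<Longrightarrow> (case \<tau> of (S, T) \<Rightarrow> int (card S) - int (card T)) =
      (case \<sigma> of (S, T) \<Rightarrow> int (card S) - int (card T)) - 2 \<Longrightarrow> u \<tau> = v \<tau>"
  obtain S T where [simp]: "\<sigma> = (S, T)" by fastforce
  have fin: "finite S" "finite T" using \<sigma> sum2_finite by auto
  have "u (S - {s}, insert s T) = v (S - {s}, insert s T)" if s: "s \<in> S - T" for s
  proof (rule eq)
    have "card S > 0" using s fin card_gt_0_iff[of S] by auto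
    then show "(S - {s}, insert s T) \<in> sum2 N m"
      "(case (S - {s}, insert s T) of (S, T) \<Rightarrow> int (card S) - int (card T)) = (case \<sigma> of (S, T) \<Rightarrow> int (card S) - int (card T)) - 2"
      using \<sigma> s fin by (auto simp: sum2_def of_nat_diff)
  qed
  then show "opF u \<sigma> = opF v \<sigma>" by (simp add: opF_def elem_op_def)
next
  fix \<sigma> and u v :: "sets2 \<Rightarrow> qfield" assume \<sigma>: "\<sigma> \<in> sum2 N m" and
    eq: "\<And>\<tau>. \<tau> \<in> sum2 N m \<Longrightarrow> (case \<tau> of (S, T) \<Rightarrow> int (card S) - int (card T)) =
      (case \<sigma> of (S, T) \<Rightarrow> int (card S) - int (card T)) + 2 \<Longrightarrow> u \<tau> = v \<tau>"
  obtain S T where [simp]: "\<sigma> = (S, T)" by fastforce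
  have fin: "finite S" "finite T" using \<sigma> sum2_finite by auto
  have "u (insert s S, T - {s}) = v (insert s S, T - {s})" if s: "s \<in> T - S" for s
  proof (rule eq)
    have "card T > 0" using s fin card_gt_0_iff[of T] by auto
    then show "(insert s S, T - {s}) \<in> sum2 N m"
      "(case (insert s S, T - {s}) of (S, T) \<Rightarrow> int (card S) - int (card T)) = (case \<sigma> of (S, T) \<Rightarrow> int (card S) - int (card T)) + 2"
      using \<sigma> s fin by (auto simp: sum2_def of_nat_diff)
  qed
  then show "opE u \<sigma> = opE v \<sigma>" by (simp add: opE_def elem_op_def)
qed

text \<open>A rung of label k carries a whole k-set from T to S: its weight is that of splitting A
  off T and merging it with S at once.\<close>

lemma dpow_opE:
  assumes "finite S" "finite T"
  shows "dpow opE k v (S, T) = (\<Sum>A | A \<subseteq> T - S \<and> card A = k.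
    qv powi (- int k * (int (card T) - int k)) * mm A (T - A) * mm S A * v (S \<union> A, T - A))"
proof -
  define G where "G = (\<lambda>(S, T) A. qv powi (- int (card A) * (int (card T) - int (card A))) * mm A (T - A) * mm S A)"
  have "dpow opE k v (S, T) = (\<Sum>A | A \<subseteq> (\<lambda>(S, T). T - S) (S, T) \<and> card A = k.
     G (S, T) A * v ((\<lambda>(S, T) A. (S \<union> A, T - A)) (S, T) A))"
    unfolding opE_def
  proof (rule dpow_elem_op[where C = finite2 and r = "\<lambda>t A. qv powi (- int (card A)) * mm {t} A * mm {t} A"
        and M = "\<lambda>(S, T) A. (S \<union> A, T - A)"], goal_cases)
    \<comment> \<open>The hypothesis \<open>G\<close>: moving t first and then A gives the weight of
      moving \<open>insert t A\<close>, with a surplus \<open>q^(-|A|)\<close> times the square of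
      \<open>mm {t} A\<close>. The surplus is the ratio \<open>r\<close>.\<close>
    case (7 \<sigma> t A)
    obtain S T where [simp]: "\<sigma> = (S, T)" by fastforce
    have *: "finite S" "finite T" "t \<in> T" "t \<notin> S" "t \<notin> A" "A \<subseteq> T" "A \<inter> S = {}" "finite A"
      using 7 by (auto simp: finite2_def)
    have d: "T - {t} - A = T - insert t A" by auto
    have T: "T - {t} = (T - insert t A) \<union> A" using * by auto
    have m1: "mm {t} (T - {t}) = mm {t} (T - insert t A) * mm {t} A"
      unfolding T using * by (intro mm_Un_right) auto
    have m2: "mm (insert t S) A = mm {t} A * mm S A" using * by (intro mm_insert_left) auto
    have m3: "mm (insert t A) (T - insert t A) = mm {t} (T - insert t A) * mm A (T - insert t A)"
      using * by (intro mm_insert_left) auto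
    have m4: "mm S (insert t A) = mm S {t} * mm S A" using * by (intro mm_insert_right) auto
    have c: "int (card (T - {t})) = int (card T) - 1" using * by (intro int_card_remove)
    have e: "(1 - int (card T)) + (- int (card A) * (int (card T) - 1 - int (card A)))
        = (- int (card (insert t A)) * (int (card T) - int (card (insert t A)))) + (- int (card A))"
      using * by (simp add: algebra_simps)
    show ?case
      using arg_cong[OF e, of "\<lambda>n. qv powi n * (mm {t} (T - insert t A) * mm {t} A * mm S {t} * mm A (T - insert t A) * mm {t} A * mm S A)"]
      by (simp only: \<open>\<sigma> = (S, T)\<close> G_def prod.case d m1 m2 m3 m4 c powi_add[OF qv_nonzero]) (simp only: ac_simps)
  next
    case (8 A)
    then show ?case using sum_gt by simp
  qed (auto simp: finite2_def G_def assms)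
  then show ?thesis by (simp add: G_def)
qed

lemma dpow_opF:
  assumes "finite S" "finite T"
  shows "dpow opF k v (S, T) = (\<Sum>B | B \<subseteq> S - T \<and> card B = k.
    qv powi (- int k * (int (card S) - int k)) * mm (S - B) B * mm B T * v (S - B, T \<union> B))"
proof -
  define G where "G = (\<lambda>(S, T) B. qv powi (- int (card B) * (int (card S) - int (card B))) * mm (S - B) B * mm B T)"
  have "dpow opF k v (S, T) = (\<Sum>B | B \<subseteq> (\<lambda>(S, T). S - T) (S, T) \<and> card B = k.
     G (S, T) B * v ((\<lambda>(S, T) B. (S - B, T \<union> B)) (S, T) B))"
    unfolding opF_def
  proof (rule dpow_elem_op[where C = finite2 and r = "\<lambda>t A. qv powi (- int (card A)) * mm A {t} * mm A {t}"
        and M = "\<lambda>(S, T) B. (S - B, T \<union> B)"], goal_cases)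
    case (7 \<sigma> t A)
    obtain S T where [simp]: "\<sigma> = (S, T)" by fastforce
    have *: "finite S" "finite T" "t \<in> S" "t \<notin> T" "t \<notin> A" "A \<subseteq> S" "A \<inter> T = {}" "finite A"
      using 7 by (auto simp: finite2_def)
    have d: "S - {t} - A = S - insert t A" by auto
    have S: "S - {t} = (S - insert t A) \<union> A" using * by auto
    have m1: "mm (S - {t}) {t} = mm (S - insert t A) {t} * mm A {t}"
      unfolding S using * by (intro mm_Un_left) auto
    have m2: "mm A (insert t T) = mm A {t} * mm A T" using * by (intro mm_insert_right) auto
    have m3: "mm (S - insert t A) (insert t A) = mm (S - insert t A) {t} * mm (S - insert t A) A"
      using * by (intro mm_insert_right) auto
    have m4: "mm (insert t A) T = mm {t} T * mm A T" using * by (intro mm_insert_left) auto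
    have c: "int (card (S - {t})) = int (card S) - 1" using * by (intro int_card_remove)
    have e: "(1 - int (card S)) + (- int (card A) * (int (card S) - 1 - int (card A)))
        = (- int (card (insert t A)) * (int (card S) - int (card (insert t A)))) + (- int (card A))"
      using * by (simp add: algebra_simps)
    show ?case
      using arg_cong[OF e, of "\<lambda>n. qv powi n * (mm (S - insert t A) {t} * mm A {t} * mm {t} T * mm (S - insert t A) A * mm A {t} * mm A T)"]
      by (simp only: \<open>\<sigma> = (S, T)\<close> G_def prod.case d m1 m2 m3 m4 c powi_add[OF qv_nonzero]) (simp only: ac_simps)
  next
    case (8 A)
    then show ?case using sum_lt by simp
  qed (auto simp: finite2_def G_def assms)
  then show ?thesis by (simp add: G_def)
qed

section \<open>Simultaneous removal and insertion\<close>

lemma two_rho_insert: "finite A \<Longrightarrow> x \<notin> A \<Longrightarrow> two_rho N (insert x A) = two_rho N {x} + two_rho N A"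
  by (simp add: two_rho_def)

lemma two_rho_Un: "finite A \<Longrightarrow> finite B \<Longrightarrow> A \<inter> B = {} \<Longrightarrow> two_rho N (A \<union> B) = two_rho N A + two_rho N B"
  by (simp add: two_rho_def sum.union_disjoint)

text \<open>The states are now the bottom and the top label of one strand, and an \<open>OP\<close>
  web is read from left to right. Removed and inserted elements belong to both labels. The term with
  \<open>two_rho\<close> in \<open>opY\<close> stems from the cup that creates the middle edge of
  the right strand.\<close>

definition opX :: "sets2 operator" where
  "opX = elem_op (\<lambda>(S, V). S \<inter> V)
     (\<lambda>(S, V) a. qv powi (1 - int (card S)) * mm {a} (S - {a}) * mm {a} (V - {a})) (\<lambda>(S, V) a. (S - {a}, V - {a}))"

definition opY :: "nat \<Rightarrow> sets2 operator" where
  "opY N = elem_op (\<lambda>(S, V). {..<N} - (S \<union> V))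
     (\<lambda>(S, V) c. qv powi (- int (card S) - two_rho N {c}) * mm {c} S * mm {c} V) (\<lambda>(S, V) c. (insert c S, insert c V))"

text \<open>Both moves preserve equality of the sizes, and it identifies the weight N - 2|S| with
  the N - |S| - |V| that the telescoping sum yields.\<close>

definition equal2 :: "nat \<Rightarrow> sets2 set" where
  "equal2 N = {(S, V). S \<subseteq> {..<N} \<and> V \<subseteq> {..<N} \<and> card S = card V}"

lemma equal2_finite: "(S, V) \<in> equal2 N \<Longrightarrow> finite S \<and> finite V"
  by (auto simp: equal2_def intro: finite_subset)

lemma opY_X_comm:
  assumes "(S, V) \<in> equal2 N"
  shows "opY N (opX v) (S, V) = opX (opY N v) (S, V) + qint (int N - 2 * int (card S)) * v (S, V)"
proof -
  have fin: "finite S" "finite V" and sub: "S \<subseteq> {..<N}" "V \<subseteq> {..<N}" and cV: "card V = card S"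
    using assms equal2_finite[OF assms] unfolding equal2_def by auto
  define \<psi> where "\<psi> = (\<lambda>x. qv powi (2 * int x + 2 * int (gt S x) + 2 * int (gt V x) - int (card S) - int (card V) - int N + 1))"
  have 1: "(\<Sum>c\<in>{..<N} - (S \<union> V). (qv powi (- int (card S) - two_rho N {c}) * mm {c} S * mm {c} V) *
      (qv powi (1 - int (card (insert c S))) * mm {c} (insert c S - {c}) * mm {c} (insert c V - {c}))) = sum \<psi> ({..<N} - (S \<union> V))"
  proof (rule sum.cong[OF refl])
    fix c assume c: "c \<in> {..<N} - (S \<union> V)"
    then have e: "2 * int c + 2 * int (gt S c) + 2 * int (gt V c) - int (card S) - int (card V) - int N + 1
        = (- int (card S) - two_rho N {c}) + (1 - int (card (insert c S))) + (2 * int (gt S c) + 2 * int (gt V c))"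
      using fin cV by (simp add: two_rho_def)
    from c have "insert c S - {c} = S" "insert c V - {c} = V" by auto
    then show "(qv powi (- int (card S) - two_rho N {c}) * mm {c} S * mm {c} V) *
      (qv powi (1 - int (card (insert c S))) * mm {c} (insert c S - {c}) * mm {c} (insert c V - {c})) = \<psi> c"
      unfolding \<psi>_def unfolding e unfolding powi_add[OF qv_nonzero] power_even_qv[symmetric] mm_single_left
      by (simp only: ac_simps)
  qed
  have 2: "(\<Sum>a\<in>S \<inter> V. (qv powi (1 - int (card S)) * mm {a} (S - {a}) * mm {a} (V - {a})) *
      (qv powi (- int (card (S - {a})) - two_rho N {a}) * mm {a} (S - {a}) * mm {a} (V - {a})))
     = (\<Sum>a\<in>S \<inter> V. qv\<^sup>2 * \<psi> a)"
  proof (rule sum.cong[OF refl])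
    fix a assume a: "a \<in> S \<inter> V"
    then have e: "2 + (2 * int a + 2 * int (gt S a) + 2 * int (gt V a) - int (card S) - int (card V) - int N + 1)
        = (1 - int (card S)) + (- int (card (S - {a})) - two_rho N {a}) + (2 * int (gt S a) + 2 * int (gt V a))"
      using fin cV int_card_remove[of S a] by (simp add: two_rho_def del: card_Diff_singleton card_Diff_singleton_if)
    have "qv\<^sup>2 * \<psi> a = qv powi (2 + (2 * int a + 2 * int (gt S a) + 2 * int (gt V a) - int (card S) - int (card V) - int N + 1))"
      by (simp only: \<psi>_def powi_add[OF qv_nonzero]) simp
    then show "(qv powi (1 - int (card S)) * mm {a} (S - {a}) * mm {a} (V - {a})) *
      (qv powi (- int (card (S - {a})) - two_rho N {a}) * mm {a} (S - {a}) * mm {a} (V - {a})) = qv\<^sup>2 * \<psi> a"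
      unfolding e unfolding powi_add[OF qv_nonzero] power_even_qv[symmetric] mm_single_left gt_remove
      by (simp only: ac_simps)
  qed
  have "opY N (opX v) (S, V) = opX (opY N v) (S, V)
     + (sum \<psi> ({..<N} - (S \<union> V)) - (\<Sum>a\<in>S \<inter> V. qv\<^sup>2 * \<psi> a)) * v (S, V)"
    unfolding opX_def opY_def
  proof (subst elem_op_comm, goal_cases)
    \<comment> \<open>The two orders differ by the square of \<open>mm {a} {c}\<close> against the
      inverse square of \<open>mm {c} {a}\<close>. The quotient is \<open>q^2\<close> by
      \<open>mm_swap1\<close>, and the change of |S| between the two orders compensates it.\<close>
    case (7 c a)
    then have *: "a \<in> S" "a \<in> V" "c \<notin> S" "c \<notin> V" "a \<noteq> c" by auto
    have i: "insert c S - {a} = insert c (S - {a})" "insert c V - {a} = insert c (V - {a})" using * by auto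
    have cd: "int (card (insert c S)) = int (card S) + 1" "int (card (S - {a})) = int (card S) - 1"
      using fin * by (simp_all only: int_card_remove) simp
    have m1: "mm {a} (insert c (S - {a})) = mm {a} {c} * mm {a} (S - {a})"
       "mm {a} (insert c (V - {a})) = mm {a} {c} * mm {a} (V - {a})"
      using fin * by (auto intro!: mm_insert_right)
    have m2: "mm {c} (S - {a}) = mm {c} S / mm {c} {a}" "mm {c} (V - {a}) = mm {c} V / mm {c} {a}"
      using fin * by (auto intro!: mm_remove_right)
    have "mm {a} {c} = - qv / mm {c} {a}" using mm_swap1[of a c] * by (simp add: field_simps)
    then show ?case
      by (simp only: prod.case i cd m1 m2) (simp add: powi_add power_int_diff power_int_minus field_simps)
  qed (use fin sub 1 2 in auto)
  moreover have "int N - 2 * int (card S) = int N - int (card S) - int (card V)" using cV by simp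
  ultimately show ?thesis unfolding \<psi>_def sum_add_remove[OF sub] by (simp only:)
qed

lemma qsl2_XY: "qsl2 (opY N) opX (\<lambda>(S, V). int N - 2 * int (card S)) (equal2 N)"
proof
  show "linear_op (opY N)" "linear_op opX" by (simp_all add: opX_def opY_def linear_elem_op)
next
  fix \<sigma> v assume "\<sigma> \<in> equal2 N"
  then show "opY N (opX v) \<sigma> = opX (opY N v) \<sigma> + qint (case \<sigma> of (S, V) \<Rightarrow> int N - 2 * int (card S)) * v \<sigma>"
    by (cases \<sigma>) (simp add: opY_X_comm)
next
  fix \<sigma> and u v :: "sets2 \<Rightarrow> qfield" assume \<sigma>: "\<sigma> \<in> equal2 N" and
    eq: "\<And>\<tau>. \<tau> \<in> equal2 N \<Longrightarrow> (case \<tau> of (S, V) \<Rightarrow> int N - 2 * int (card S)) =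
      (case \<sigma> of (S, V) \<Rightarrow> int N - 2 * int (card S)) - 2 \<Longrightarrow> u \<tau> = v \<tau>"
  obtain S V where [simp]: "\<sigma> = (S, V)" by fastforce
  have fin: "finite S" "finite V" using equal2_finite[of S V N] \<sigma> by auto
  have "u (insert c S, insert c V) = v (insert c S, insert c V)" if "c \<in> {..<N} - (S \<union> V)" for c
    using \<sigma> that fin by (intro eq) (auto simp: equal2_def)
  then show "opY N u \<sigma> = opY N v \<sigma>" by (simp add: opY_def elem_op_def)
next
  fix \<sigma> and u v :: "sets2 \<Rightarrow> qfield" assume \<sigma>: "\<sigma> \<in> equal2 N" and
    eq: "\<And>\<tau>. \<tau> \<in> equal2 N \<Longrightarrow> (case \<tau> of (S, V) \<Rightarrow> int N - 2 * int (card S)) =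
      (case \<sigma> of (S, V) \<Rightarrow> int N - 2 * int (card S)) + 2 \<Longrightarrow> u \<tau> = v \<tau>"
  obtain S V where [simp]: "\<sigma> = (S, V)" by fastforce
  have fin: "finite S" "finite V" using equal2_finite[of S V N] \<sigma> by auto
  have "u (S - {a}, V - {a}) = v (S - {a}, V - {a})" if "a \<in> S \<inter> V" for a
  proof (rule eq)
    have "card S > 0" using that fin card_gt_0_iff[of S] by auto
    then show "(S - {a}, V - {a}) \<in> equal2 N"
      "(case (S - {a}, V - {a}) of (S, V) \<Rightarrow> int N - 2 * int (card S)) = (case \<sigma> of (S, V) \<Rightarrow> int N - 2 * int (card S)) + 2"
      using \<sigma> that fin by (auto simp: equal2_def of_nat_diff)
  qed
  then show "opX u \<sigma> = opX v \<sigma>" by (simp add: opX_def elem_op_def)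
qed

lemma dpow_opX:
  assumes "(S, V) \<in> equal2 N"
  shows "dpow opX k v (S, V) = (\<Sum>A | A \<subseteq> S \<inter> V \<and> card A = k.
    qv powi (- int k * (int (card S) - int k)) * mm A (S - A) * mm A (V - A) * v (S - A, V - A))"
proof -
  define G where "G = (\<lambda>(S, V) A. qv powi (- int (card A) * (int (card S) - int (card A))) * mm A (S - A) * mm A (V - A))"
  have "dpow opX k v (S, V) = (\<Sum>A | A \<subseteq> (\<lambda>(S, V). S \<inter> V) (S, V) \<and> card A = k.
     G (S, V) A * v ((\<lambda>(S, V) A. (S - A, V - A)) (S, V) A))"
    unfolding opX_def
  proof (rule dpow_elem_op[where C = "equal2 N" and r = "\<lambda>t A. qv powi (- int (card A)) * mm {t} A * mm {t} A"
        and M = "\<lambda>(S, V) A. (S - A, V - A)"], goal_cases)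
    case (2 \<sigma> a)
    obtain S V where [simp]: "\<sigma> = (S, V)" by fastforce
    have "finite S" "finite V" using 2 equal2_finite[of S V N] by auto
    then show ?case using 2 by (auto simp: equal2_def)
  next
    case (7 \<sigma> t A)
    obtain S V where [simp]: "\<sigma> = (S, V)" by fastforce
    have *: "finite S" "finite V" "t \<in> V" "t \<in> S" "t \<notin> A" "A \<subseteq> V" "A \<subseteq> S" "finite A"
      using 7 equal2_finite[of S V N] finite_subset by auto
    have d: "S - {t} - A = S - insert t A" "V - {t} - A = V - insert t A" by auto
    have S: "S - {t} = (S - insert t A) \<union> A" and V: "V - {t} = (V - insert t A) \<union> A" using * by auto
    have m1: "mm {t} (S - {t}) = mm {t} (S - insert t A) * mm {t} A"
      unfolding S using * by (intro mm_Un_right) auto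
    have m2: "mm {t} (V - {t}) = mm {t} (V - insert t A) * mm {t} A"
      unfolding V using * by (intro mm_Un_right) auto
    have m3: "mm (insert t A) (S - insert t A) = mm {t} (S - insert t A) * mm A (S - insert t A)"
      "mm (insert t A) (V - insert t A) = mm {t} (V - insert t A) * mm A (V - insert t A)"
      using * by (auto intro!: mm_insert_left)
    have c: "int (card (S - {t})) = int (card S) - 1" using * by (intro int_card_remove)
    have e: "(1 - int (card S)) + (- int (card A) * (int (card S) - 1 - int (card A)))
        = (- int (card (insert t A)) * (int (card S) - int (card (insert t A)))) + (- int (card A))"
      using * by (simp add: algebra_simps)
    show ?case
      using arg_cong[OF e, of "\<lambda>n. qv powi n * (mm {t} (S - insert t A) * mm {t} A * mm {t} (V - insert t A) * mm {t} A * mm A (S - insert t A) * mm A (V - insert t A))"]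
      by (simp only: \<open>\<sigma> = (S, V)\<close> G_def prod.case d m1 m2 m3 c powi_add[OF qv_nonzero]) (simp only: ac_simps)
  next
    case (8 A)
    then show ?case using sum_gt by simp
  qed (use assms in \<open>auto simp: G_def dest: equal2_finite\<close>)
  then show ?thesis by (simp add: G_def)
qed

lemma dpow_opY:
  assumes "(S, V) \<in> equal2 N"
  shows "dpow (opY N) k v (S, V) = (\<Sum>C | C \<subseteq> {..<N} - (S \<union> V) \<and> card C = k.
    qv powi (- int k * int (card S) - two_rho N C) * mm C S * mm C V * v (S \<union> C, V \<union> C))"
proof -
  define G where "G = (\<lambda>(S, V) C. qv powi (- int (card C) * int (card S) - two_rho N C) * mm C S * mm C V)"
  have "dpow (opY N) k v (S, V) = (\<Sum>C | C \<subseteq> (\<lambda>(S, V). {..<N} - (S \<union> V)) (S, V) \<and> card C = k.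
     G (S, V) C * v ((\<lambda>(S, V) C. (S \<union> C, V \<union> C)) (S, V) C))"
    unfolding opY_def
  proof (rule dpow_elem_op[where C = "equal2 N" and r = "\<lambda>t A. qv powi (- int (card A)) * mm A {t} * mm A {t}"
        and M = "\<lambda>(S, V) A. (S \<union> A, V \<union> A)"], goal_cases)
    case (2 \<sigma> a)
    obtain S V where [simp]: "\<sigma> = (S, V)" by fastforce
    have "finite S" "finite V" using 2 equal2_finite[of S V N] by auto
    then show ?case using 2 by (auto simp: equal2_def)
  next
    case (7 \<sigma> t A)
    obtain S V where [simp]: "\<sigma> = (S, V)" by fastforce
    have *: "finite S" "finite V" "t \<notin> V" "t \<notin> S" "t \<notin> A" "A \<inter> V = {}" "A \<inter> S = {}" "finite A"
      using 7 equal2_finite[of S V N] finite_subset by auto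
    have m1: "mm A (insert t S) = mm A {t} * mm A S" "mm A (insert t V) = mm A {t} * mm A V"
      using * by (auto intro!: mm_insert_right)
    have m3: "mm (insert t A) S = mm {t} S * mm A S" "mm (insert t A) V = mm {t} V * mm A V"
      using * by (auto intro!: mm_insert_left)
    have c: "int (card (insert t S)) = int (card S) + 1" using * by simp
    have e: "(- int (card S) - two_rho N {t}) + (- int (card A) * (int (card S) + 1) - two_rho N A)
        = (- int (card (insert t A)) * int (card S) - two_rho N (insert t A)) + (- int (card A))"
      using * by (simp add: algebra_simps two_rho_insert[of A t])
    show ?case
      using arg_cong[OF e, of "\<lambda>n. qv powi n * (mm {t} S * mm {t} V * mm A {t} * mm A S * mm A {t} * mm A V)"]
      by (simp only: \<open>\<sigma> = (S, V)\<close> G_def prod.case m1 m3 c powi_add[OF qv_nonzero]) (simp only: ac_simps)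
  next
    case (8 A)
    then show ?case using sum_lt by simp
  qed (use assms in \<open>auto simp: G_def two_rho_def dest: equal2_finite\<close>)
  then show ?thesis by (simp add: G_def)
qed

section \<open>Evaluation of webs\<close>

definition ksets :: "nat \<Rightarrow> nat \<Rightarrow> nat set set" where
  "ksets N k = {S. S \<subseteq> {..<N} \<and> card S = k}"

lemma ksetsD: "S \<in> ksets N k \<Longrightarrow> S \<subseteq> {..<N}" "S \<in> ksets N k \<Longrightarrow> card S = k" "S \<in> ksets N k \<Longrightarrow> finite S"
  by (auto simp: ksets_def intro: finite_subset)

lemma finite_ksets [simp]: "finite (ksets N k)"
  by (simp add: ksets_def)

lemma ksets_subset: "U \<in> ksets N (a + b) \<Longrightarrow> A \<subseteq> U \<Longrightarrow> card A = a \<Longrightarrow> A \<in> ksets N a"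
  by (auto simp: ksets_def)

lemma ksets_Diff: "U \<in> ksets N (a + b) \<Longrightarrow> A \<subseteq> U \<Longrightarrow> card A = a \<Longrightarrow> U - A \<in> ksets N b"
  by (frule ksetsD(3)) (auto simp: ksets_def card_Diff_subset finite_subset)

lemma ksets_Un: "S \<in> ksets N a \<Longrightarrow> T \<in> ksets N b \<Longrightarrow> S \<inter> T = {} \<Longrightarrow> S \<union> T \<in> ksets N (a + b)"
  using ksetsD(3)[of S N a] ksetsD(3)[of T N b] by (auto simp: ksets_def card_Un_disjoint)

lemma states_Nil: "states N [] = {[]}"
  by (simp add: states_def)

lemma states_Cons: "states N (k # ks) = (\<lambda>(S, xs). S # xs) ` (ksets N k \<times> states N ks)"
  by (auto simp: states_def ksets_def set_Cons_def)

lemma finite_states: "finite (states N ks)"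
  by (induction ks) (auto simp: states_Nil states_Cons)

lemma sum_states_Nil: "sum f (states N []) = f []"
  by (simp add: states_Nil)

lemma sum_states_Cons: "sum f (states N (k # ks)) = (\<Sum>S\<in>ksets N k. \<Sum>xs\<in>states N ks. f (S # xs))"
proof -
  have "inj_on (\<lambda>(S, xs). S # xs) (ksets N k \<times> states N ks)" by (auto simp: inj_on_def)
  then show ?thesis
    by (simp only: states_Cons sum.reindex sum.cartesian_product) (simp add: case_prod_beta comp_def)
qed

lemma states_two: "xs \<in> states N [a, b] \<longleftrightarrow> (\<exists>S\<in>ksets N a. \<exists>T\<in>ksets N b. xs = [S, T])"
  by (auto simp: states_Cons states_Nil)

section \<open>Matrices of the elementary web pieces\<close>

lemma web_Merge:
  assumes "length pre = i" "S \<in> ksets N a" "T \<in> ksets N b"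
  shows "web_matrix N ((i, Merge a b) # w) (pre @ S # T # post) ys =
    (if S \<inter> T = {} then mm S T * web_matrix N w (pre @ (S \<union> T) # post) ys else 0)"
proof -
  have "web_matrix N ((i, Merge a b) # w) (pre @ S # T # post) ys
     = (\<Sum>U\<in>ksets N (a + b). entry N (Merge a b) [S, T] [U] * web_matrix N w (pre @ U # post) ys)"
    using assms(1) by (simp add: sum_states_Cons sum_states_Nil numeral_2_eq_2 del: entry.simps)
  also have "\<dots> = (\<Sum>U\<in>ksets N (a + b). if U = S \<union> T then (if S \<inter> T = {} then mm S T * web_matrix N w (pre @ U # post) ys else 0) else 0)"
    by (rule sum.cong) (auto simp: mm_def)
  also have "\<dots> = (if S \<inter> T = {} then mm S T * web_matrix N w (pre @ (S \<union> T) # post) ys else 0)"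
    using ksets_Un[OF assms(2,3)] by (auto simp: sum.delta)
  finally show ?thesis .
qed

text \<open>Rewrites the weight of a split vertex in terms of inversions from S to T, by
  \<open>mm_swap\<close>, which brings it into the shape of the operator weights.\<close>

lemma mm_powi_minus:
  assumes "finite S" "finite T" "S \<inter> T = {}"
  shows "(- 1) ^ (card S * card T) * (- qv) powi (- int (inversions T S))
    = qv powi (- int (card S) * int (card T)) * mm S T"
proof -
  have "mm S T * mm T S = (- qv) ^ (card S * card T)" using mm_swap[OF assms] .
  also have "\<dots> = (- 1) ^ (card S * card T) * qv ^ (card S * card T)" by (rule power_minus)
  finally have "mm T S * mm S T = (- 1) ^ (card S * card T) * qv ^ (card S * card T)" by (simp add: mult.commute)
  then have 1: "(- 1) ^ (card S * card T) / mm T S = mm S T / qv ^ (card S * card T)"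
    by (subst frac_eq_eq) (simp_all add: mult.commute)
  have "qv powi (- int (card S) * int (card T)) = inverse (qv ^ (card S * card T))"
    by (simp only: mult_minus_left power_int_minus of_nat_mult[symmetric] power_int_of_nat)
  moreover have "(- qv) powi (- int (inversions T S)) = inverse (mm T S)"
    by (simp add: power_int_minus mm_def)
  ultimately show ?thesis using 1 by (simp add: divide_inverse mult.commute)
qed

lemma web_Split:
  assumes "length pre = i" "U \<in> ksets N (a + b)"
  shows "web_matrix N ((i, Split a b) # w) (pre @ U # post) ys =
    (\<Sum>A | A \<subseteq> U \<and> card A = a. qv powi (- int a * int b) * mm A (U - A) * web_matrix N w (pre @ A # (U - A) # post) ys)"
proof -
  have "web_matrix N ((i, Split a b) # w) (pre @ U # post) ys
     = (\<Sum>S\<in>ksets N a. \<Sum>T\<in>ksets N b. entry N (Split a b) [U] [S, T] * web_matrix N w (pre @ S # T # post) ys)"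
    using assms(1) by (simp add: sum_states_Cons sum_states_Nil del: entry.simps)
  also have "\<dots> = (\<Sum>S\<in>ksets N a. if S \<subseteq> U then qv powi (- int a * int b) * mm S (U - S) * web_matrix N w (pre @ S # (U - S) # post) ys else 0)"
  proof (rule sum.cong[OF refl])
    fix S assume S: "S \<in> ksets N a"
    have "(\<Sum>T\<in>ksets N b. entry N (Split a b) [U] [S, T] * web_matrix N w (pre @ S # T # post) ys)
      = (\<Sum>T\<in>ksets N b. if T = U - S then (if S \<subseteq> U then qv powi (- int a * int b) * mm S (U - S) * web_matrix N w (pre @ S # (U - S) # post) ys else 0) else 0)"
    proof (rule sum.cong[OF refl])
      fix T assume T: "T \<in> ksets N b"
      have "S \<inter> T = {} \<and> S \<union> T = U \<longleftrightarrow> S \<subseteq> U \<and> T = U - S" by auto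
      then show "entry N (Split a b) [U] [S, T] * web_matrix N w (pre @ S # T # post) ys
        = (if T = U - S then (if S \<subseteq> U then qv powi (- int a * int b) * mm S (U - S) * web_matrix N w (pre @ S # (U - S) # post) ys else 0) else 0)"
        using mm_powi_minus[of S T] ksetsD[OF S] ksetsD[OF T] by auto
    qed
    then show "(\<Sum>T\<in>ksets N b. entry N (Split a b) [U] [S, T] * web_matrix N w (pre @ S # T # post) ys)
      = (if S \<subseteq> U then qv powi (- int a * int b) * mm S (U - S) * web_matrix N w (pre @ S # (U - S) # post) ys else 0)"
      using ksets_Diff[OF assms(2), of S] ksetsD(2)[OF S] by (auto simp: sum.delta)
  qed
  also have "\<dots> = (\<Sum>A | A \<subseteq> U \<and> card A = a. qv powi (- int a * int b) * mm A (U - A) * web_matrix N w (pre @ A # (U - A) # post) ys)"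
    by (subst sum.inter_filter[symmetric]) (use ksetsD(1)[OF assms(2)] in \<open>auto simp: ksets_def intro!: sum.cong\<close>)
  finally show ?thesis .
qed

definition cup_weight :: "nat \<Rightarrow> dir \<Rightarrow> nat set \<Rightarrow> qfield" where
  "cup_weight N d S = (if d = Up then 1 else qv powi (- two_rho N S))"

definition cap_weight :: "nat \<Rightarrow> dir \<Rightarrow> nat set \<Rightarrow> qfield" where
  "cap_weight N d S = (if d = Up then qv powi (two_rho N S) else 1)"

lemma web_WCup:
  assumes "length pre = i"
  shows "web_matrix N ((i, WCup d k) # w) (pre @ post) ys =
    (\<Sum>S\<in>ksets N k. cup_weight N d S * web_matrix N w (pre @ S # S # post) ys)"
proof -
  have "web_matrix N ((i, WCup d k) # w) (pre @ post) ys
     = (\<Sum>S\<in>ksets N k. \<Sum>T\<in>ksets N k. entry N (WCup d k) [] [S, T] * web_matrix N w (pre @ S # T # post) ys)"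
    using assms(1) by (simp add: sum_states_Cons sum_states_Nil del: entry.simps)
  also have "\<dots> = (\<Sum>S\<in>ksets N k. \<Sum>T\<in>ksets N k. if T = S then cup_weight N d S * web_matrix N w (pre @ S # S # post) ys else 0)"
    by (intro sum.cong) (auto simp: cup_weight_def)
  finally show ?thesis by (simp add: sum.delta)
qed

lemma web_WCap:
  assumes "length pre = i"
  shows "web_matrix N ((i, WCap d k) # w) (pre @ S # T # post) ys =
    (if S = T then cap_weight N d S * web_matrix N w (pre @ post) ys else 0)"
  using assms by (simp add: sum_states_Nil numeral_2_eq_2 cap_weight_def)

declare web_matrix.simps(2) [simp del]

section \<open>Matrices of the three families of basic webs\<close>

lemma sum_complement_subsets:
  assumes "finite U" "card U = a + b"
  shows "(\<Sum>A | A \<subseteq> U \<and> card A = a. f A) = (\<Sum>B | B \<subseteq> U \<and> card B = b. f (U - B))"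
proof (rule sum.reindex_bij_witness[of _ "\<lambda>B. U - B" "\<lambda>A. U - A"])
  fix A assume "A \<in> {A. A \<subseteq> U \<and> card A = a}"
  then have A: "A \<subseteq> U" "card A = a" "finite A" using assms finite_subset by auto
  then show "U - (U - A) = A" "U - A \<in> {B. B \<subseteq> U \<and> card B = b}" "f (U - (U - A)) = f A"
    using assms by (auto simp: card_Diff_subset double_diff)
next
  fix B assume "B \<in> {B. B \<subseteq> U \<and> card B = b}"
  then have B: "B \<subseteq> U" "card B = b" "finite B" using assms finite_subset by auto
  then show "U - (U - B) = B" "U - B \<in> {A. A \<subseteq> U \<and> card A = a}"
    using assms by (auto simp: card_Diff_subset double_diff)
qed

text \<open>The lower rung carries a k-set A from the right strand to the left, the upper one a
  k-set B back. The disjointness required by the merge vertices is the range of summation in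
  \<open>dpow_opE\<close> and \<open>dpow_opF\<close>.\<close>

lemma web_UP:
  assumes "k \<le> j" "S \<in> ksets N j" "T \<in> ksets N j"
  shows "web_matrix N (basic_web UP j k) [S, T] [S', T'] = dpow opE k (dpow opF k (delta (S', T'))) (S, T)"
proof -
  note S = ksetsD[OF assms(2)] and T = ksetsD[OF assms(3)]
  have T': "T \<in> ksets N (k + (j - k))" using assms by simp
  have "web_matrix N (basic_web UP j k) [S, T] [S', T'] =
     (\<Sum>A | A \<subseteq> T \<and> card A = k. qv powi (- int k * int (j - k)) * mm A (T - A) *
       web_matrix N [(0, Merge j k), (0, Split j k), (1, Merge k (j - k))] [S, A, T - A] [S', T'])"
    using web_Split[OF _ T', of "[S]" 1 "[(0, Merge j k), (0, Split j k), (1, Merge k (j - k))]" "[]"] by simp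
  also have "\<dots> = (\<Sum>A | A \<subseteq> T \<and> card A = k. if S \<inter> A = {} then
      qv powi (- int k * (int (card T) - int k)) * mm A (T - A) * mm S A * dpow opF k (delta (S', T')) (S \<union> A, T - A) else 0)"
  proof (rule sum.cong[OF refl])
    fix A assume A: "A \<in> {A. A \<subseteq> T \<and> card A = k}"
    then have Ak: "A \<in> ksets N k" and TA: "T - A \<in> ksets N (j - k)"
      using ksets_subset[OF T'] ksets_Diff[OF T'] by auto
    have *: "web_matrix N [(0, Merge j k), (0, Split j k), (1, Merge k (j - k))] [S, A, T - A] [S', T']
      = mm S A * dpow opF k (delta (S', T')) (S \<union> A, T - A)" if dj: "S \<inter> A = {}"
    proof -
      have SA: "S \<union> A \<in> ksets N (j + k)" using ksets_Un[OF assms(2) Ak dj] .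
      note SA' = ksetsD[OF SA]
      have "web_matrix N [(0, Merge j k), (0, Split j k), (1, Merge k (j - k))] [S, A, T - A] [S', T']
        = mm S A * web_matrix N [(0, Split j k), (1, Merge k (j - k))] [S \<union> A, T - A] [S', T']"
        using web_Merge[of "[]" 0 S N j A k "[(0, Split j k), (1, Merge k (j - k))]" "[T - A]"] assms Ak dj by simp
      also have "web_matrix N [(0, Split j k), (1, Merge k (j - k))] [S \<union> A, T - A] [S', T']
        = (\<Sum>P | P \<subseteq> S \<union> A \<and> card P = j. qv powi (- int j * int k) * mm P (S \<union> A - P) *
            web_matrix N [(1, Merge k (j - k))] [P, S \<union> A - P, T - A] [S', T'])"
        using web_Split[OF _ SA, of "[]" 0 "[(1, Merge k (j - k))]" "[T - A]" "[S', T']"] by simp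
      \<comment> \<open>The split names the part P that stays on the left strand, the operator the
        part that moves; hence the passage to complements.\<close>
      also have "\<dots> = (\<Sum>B | B \<subseteq> S \<union> A \<and> card B = k. qv powi (- int j * int k) * mm (S \<union> A - B) B *
            web_matrix N [(1, Merge k (j - k))] [S \<union> A - B, B, T - A] [S', T'])"
        by (subst sum_complement_subsets[OF SA'(3,2)]) (auto intro!: sum.cong simp: double_diff)
      also have "\<dots> = (\<Sum>B | B \<subseteq> S \<union> A \<and> card B = k. if B \<inter> (T - A) = {} then qv powi (- int j * int k) * mm (S \<union> A - B) B *
            mm B (T - A) * delta (S', T') (S \<union> A - B, T - A \<union> B) else 0)"
      proof (rule sum.cong[OF refl])
        fix B assume B: "B \<in> {B. B \<subseteq> S \<union> A \<and> card B = k}"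
        then have "B \<in> ksets N k" using SA'(1) by (auto simp: ksets_def)
        then show "qv powi (- int j * int k) * mm (S \<union> A - B) B * web_matrix N [(1, Merge k (j - k))] [S \<union> A - B, B, T - A] [S', T']
          = (if B \<inter> (T - A) = {} then qv powi (- int j * int k) * mm (S \<union> A - B) B *
            mm B (T - A) * delta (S', T') (S \<union> A - B, T - A \<union> B) else 0)"
          using web_Merge[of "[S \<union> A - B]" 1 B N k "T - A" "j - k" "[]" "[]" "[S', T']"] TA
          by (auto simp: delta_def Un_commute)
      qed
      also have "\<dots> = (\<Sum>B | B \<subseteq> S \<union> A - (T - A) \<and> card B = k. qv powi (- int j * int k) * mm (S \<union> A - B) B *
            mm B (T - A) * delta (S', T') (S \<union> A - B, T - A \<union> B))"
        by (subst sum.inter_filter[symmetric]) (use SA' in \<open>auto intro!: sum.cong\<close>)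
      also have "\<dots> = dpow opF k (delta (S', T')) (S \<union> A, T - A)"
        by (subst dpow_opF) (use SA' T in \<open>auto intro!: sum.cong simp: mult.commute\<close>)
      finally show ?thesis .
    qed
    show "qv powi (- int k * int (j - k)) * mm A (T - A) *
       web_matrix N [(0, Merge j k), (0, Split j k), (1, Merge k (j - k))] [S, A, T - A] [S', T'] =
      (if S \<inter> A = {} then
      qv powi (- int k * (int (card T) - int k)) * mm A (T - A) * mm S A * dpow opF k (delta (S', T')) (S \<union> A, T - A) else 0)"
    proof (cases "S \<inter> A = {}")
      case True
      then show ?thesis unfolding *[OF True] using T(2) assms(1) by (simp add: of_nat_diff)
    next
      case False
      then show ?thesis
        using web_Merge[of "[]" 0 S N j A k "[(0, Split j k), (1, Merge k (j - k))]" "[T - A]" "[S', T']"] assms Ak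
        by simp
    qed
  qed
  also have "\<dots> = dpow opE k (dpow opF k (delta (S', T'))) (S, T)"
    unfolding dpow_opE[OF S(3) T(3)]
    by (subst sum.inter_filter[symmetric]) (use T in \<open>auto intro!: sum.cong\<close>)
  finally show ?thesis .
qed

text \<open>With the NW edge bent down and the SE edge bent up, the square becomes a pair of strands
  from (y1, x1) to (y2, x2) with two rungs. These rungs are the vertical edges of the square, which
  explains the label j - k; the cup and the cap leave the power of q.\<close>

lemma web_RI:
  assumes "k \<le> j" "x1 \<in> ksets N j" "x2 \<in> ksets N j" "y1 \<in> ksets N j"
  shows "web_matrix N (basic_web RI j k) [x1, x2] [y1, y2] =
    qv powi (two_rho N x2 - two_rho N y1) * dpow opF (j - k) (dpow opE (j - k) (delta (y2, x2))) (y1, x1)"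
proof -
  define r where "r = j - k"
  have jk: "j = k + r" using assms(1) by (simp add: r_def)
  define w3 where "w3 = [(2::nat, Split r j), (3, WCap Up j), (1, Merge k r)]"
  define w2 where "w2 = (2, Merge r j) # w3"
  define w1 where "w1 = (1, Split k r) # w2"
  note x1 = ksetsD[OF assms(2)]
  have rest: "web_matrix N w1 [D, D, x1, x2] [y1, y2] =
     (if D = y1 then qv powi (two_rho N x2) * dpow opF r (dpow opE r (delta (y2, x2))) (y1, x1) else 0)"
    if D: "D \<in> ksets N j" for D
  proof -
    note D' = ksetsD[OF D]
    have Dk: "D \<in> ksets N (k + r)" using D jk by simp
    have last: "web_matrix N w3 [D, D - B, U, x2] [y1, y2] = (if D = y1 then qv powi (two_rho N x2) *
       dpow opE r (delta (y2, x2)) (D - B, U) else 0)"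
      if B: "B \<subseteq> D" "card B = r" and U: "U \<in> ksets N (r + j)" for B U
    proof -
      note U' = ksetsD[OF U]
      have DB: "D - B \<in> ksets N k" using ksets_Diff[of D N r k B] B D jk by (simp add: add.commute)
      have "web_matrix N w3 [D, D - B, U, x2] [y1, y2]
        = (\<Sum>P | P \<subseteq> U \<and> card P = r. qv powi (- int r * int j) * mm P (U - P) *
             web_matrix N [(3, WCap Up j), (1, Merge k r)] [D, D - B, P, U - P, x2] [y1, y2])"
        using web_Split[OF _ U, of "[D, D - B]" 2 "[(3, WCap Up j), (1, Merge k r)]" "[x2]" "[y1, y2]"]
        by (simp add: w3_def)
      also have "\<dots> = (\<Sum>P | P \<subseteq> U \<and> card P = r. if (D - B) \<inter> P = {} then qv powi (- int r * int j) * mm P (U - P) *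
             (if D = y1 then qv powi (two_rho N x2) * (mm (D - B) P * delta (y2, x2) (D - B \<union> P, U - P)) else 0) else 0)"
      proof (rule sum.cong[OF refl])
        fix P assume "P \<in> {P. P \<subseteq> U \<and> card P = r}"
        then have P: "P \<in> ksets N r" using U' by (auto simp: ksets_def)
        show "qv powi (- int r * int j) * mm P (U - P) *
             web_matrix N [(3, WCap Up j), (1, Merge k r)] [D, D - B, P, U - P, x2] [y1, y2] =
           (if (D - B) \<inter> P = {} then qv powi (- int r * int j) * mm P (U - P) *
             (if D = y1 then qv powi (two_rho N x2) * (mm (D - B) P * delta (y2, x2) (D - B \<union> P, U - P)) else 0) else 0)"
          using web_WCap[of "[D, D - B, P]" 3 N Up j "[(1, Merge k r)]" "U - P" x2 "[]" "[y1, y2]"]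
            web_Merge[of "[D]" 1 "D - B" N k P r "[]" "[]" "[y1, y2]"] P DB
          by (auto simp: delta_def cap_weight_def)
      qed
      also have "\<dots> = (\<Sum>P | P \<subseteq> U - (D - B) \<and> card P = r. qv powi (- int r * int j) * mm P (U - P) *
             (if D = y1 then qv powi (two_rho N x2) * (mm (D - B) P * delta (y2, x2) (D - B \<union> P, U - P)) else 0))"
        by (subst sum.inter_filter[symmetric]) (use U' in \<open>auto intro!: sum.cong\<close>)
      also have "\<dots> = (if D = y1 then qv powi (two_rho N x2) * dpow opE r (delta (y2, x2)) (D - B, U) else 0)"
        using D' U' dpow_opE[of "D - B" U r "delta (y2, x2)"]
        by (cases "D = y1") (simp_all add: sum_distrib_left algebra_simps)
      finally show ?thesis .
    qed
    have "web_matrix N w1 [D, D, x1, x2] [y1, y2] =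
       (\<Sum>A | A \<subseteq> D \<and> card A = k. qv powi (- int k * int r) * mm A (D - A) * web_matrix N w2 [D, A, D - A, x1, x2] [y1, y2])"
      using web_Split[OF _ Dk, of "[D]" 1 w2 "[x1, x2]" "[y1, y2]"] by (simp add: w1_def)
    also have "\<dots> = (\<Sum>B | B \<subseteq> D \<and> card B = r. qv powi (- int k * int r) * mm (D - B) B * web_matrix N w2 [D, D - B, B, x1, x2] [y1, y2])"
      by (subst sum_complement_subsets[OF D'(3), of _ r]) (use D' jk in \<open>auto intro!: sum.cong simp: double_diff\<close>)
    also have "\<dots> = (\<Sum>B | B \<subseteq> D \<and> card B = r. if B \<inter> x1 = {} then qv powi (- int k * int r) * mm (D - B) B * mm B x1 *
       (if D = y1 then qv powi (two_rho N x2) * dpow opE r (delta (y2, x2)) (D - B, x1 \<union> B) else 0) else 0)"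
    proof (rule sum.cong[OF refl])
      fix B assume "B \<in> {B. B \<subseteq> D \<and> card B = r}"
      then have B: "B \<subseteq> D" "card B = r" "B \<in> ksets N r" using D' by (auto simp: ksets_def)
      show "qv powi (- int k * int r) * mm (D - B) B * web_matrix N w2 [D, D - B, B, x1, x2] [y1, y2] =
        (if B \<inter> x1 = {} then qv powi (- int k * int r) * mm (D - B) B * mm B x1 *
       (if D = y1 then qv powi (two_rho N x2) * dpow opE r (delta (y2, x2)) (D - B, x1 \<union> B) else 0) else 0)"
        using web_Merge[of "[D, D - B]" 2 B N r x1 j w3 "[x2]" "[y1, y2]"] B(3) assms(2)
          last[OF B(1,2), of "B \<union> x1"] ksets_Un[OF B(3) assms(2)]
        by (auto simp: w2_def Un_commute)
    qed
    also have "\<dots> = (\<Sum>B | B \<subseteq> D - x1 \<and> card B = r. qv powi (- int k * int r) * mm (D - B) B * mm B x1 *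
       (if D = y1 then qv powi (two_rho N x2) * dpow opE r (delta (y2, x2)) (D - B, x1 \<union> B) else 0))"
      by (subst sum.inter_filter[symmetric]) (use D' in \<open>auto intro!: sum.cong\<close>)
    also have "\<dots> = (if D = y1 then qv powi (two_rho N x2) * dpow opF r (dpow opE r (delta (y2, x2))) (y1, x1) else 0)"
      using D' x1 jk dpow_opF[of D x1 r "dpow opE r (delta (y2, x2))"]
      by (cases "D = y1") (simp_all add: sum_distrib_left algebra_simps)
    finally show ?thesis .
  qed
  have "web_matrix N (basic_web RI j k) [x1, x2] [y1, y2] =
     (\<Sum>D\<in>ksets N j. cup_weight N Dn D * web_matrix N w1 [D, D, x1, x2] [y1, y2])"
    using web_WCup[of "[]" 0 N Dn j w1 "[x1, x2]" "[y1, y2]"]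
    by (simp add: w1_def w2_def w3_def r_def)
  also have "\<dots> = (\<Sum>D\<in>ksets N j. if D = y1 then qv powi (- two_rho N y1) * (qv powi (two_rho N x2) *
      dpow opF r (dpow opE r (delta (y2, x2))) (y1, x1)) else 0)"
    by (rule sum.cong) (auto simp: rest cup_weight_def)
  also have "\<dots> = qv powi (two_rho N x2 - two_rho N y1) * dpow opF r (dpow opE r (delta (y2, x2))) (y1, x1)"
  proof -
    have "qv powi (two_rho N x2 - two_rho N y1) = qv powi (- two_rho N y1) * qv powi (two_rho N x2)"
      by (simp add: powi_add[symmetric])
    then show ?thesis using assms(4) by (simp only: sum.delta[OF finite_ksets] mult.assoc if_True)
  qed
  finally show ?thesis by (simp only: r_def)
qed

text \<open>Read sideways: the left strand, labelled x1 below and y1 above, keeps a common part A of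
  size j - k in its middle edge, the rest crosses on the two rungs, and the right strand adds a
  common part C of size j - k to it. So A is removed by X and C inserted by Y.\<close>

lemma web_OP:
  assumes "k \<le> j" "x1 \<in> ksets N j" "x2 \<in> ksets N j" "y1 \<in> ksets N j" "y2 \<in> ksets N j"
  shows "web_matrix N (basic_web OP j k) [x1, x2] [y1, y2] =
    qv powi (two_rho N x2) * dpow opX (j - k) (dpow (opY N) (j - k) (delta (x2, y2))) (x1, y1)"
proof -
  define r where "r = j - k"
  have jk: "j = r + k" using assms(1) by (simp add: r_def)
  define w5 where "w5 = [(1::nat, WCap Dn r), (0, Merge r k)]"
  define w4 where "w4 = (2, WCup Up j) # (2, Split r k) # w5"
  define w3 where "w3 = (2, WCap Up j) # w4"
  define w2 where "w2 = (2, Merge r k) # w3"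
  define w1 where "w1 = (1, WCup Dn r) # w2"
  note x1 = ksetsD[OF assms(2)] and y1 = ksetsD[OF assms(4)] and y2 = ksetsD[OF assms(5)]
  have x1': "x1 \<in> ksets N (r + k)" using assms jk by simp
  \<comment> \<open>The part of the web above the cap that ends the incoming right strand; its
    entries do not involve x1 and x2.\<close>
  have upper: "web_matrix N w4 [A, C] [y1, y2] = (if A \<subseteq> y1 \<and> C \<subseteq> y2 \<and> y2 - C = y1 - A
      then qv powi (- int r * int k) * mm C (y1 - A) * mm A (y1 - A) else 0)"
    if A: "A \<in> ksets N r" and C: "C \<in> ksets N r" for A C
  proof -
    have D: "web_matrix N ((2, Split r k) # w5) [A, C, D, D] [y1, y2] =
       (if D = y2 then (if A \<subseteq> y1 \<and> C \<subseteq> y2 \<and> y2 - C = y1 - A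
      then qv powi (- int r * int k) * mm C (y1 - A) * mm A (y1 - A) else 0) else 0)" if D: "D \<in> ksets N j" for D
    proof -
      note D' = ksetsD[OF D]
      have D2: "D \<in> ksets N (r + k)" using D jk by simp
      have "web_matrix N ((2, Split r k) # w5) [A, C, D, D] [y1, y2] =
        (\<Sum>P | P \<subseteq> D \<and> card P = r. qv powi (- int r * int k) * mm P (D - P) * web_matrix N w5 [A, C, P, D - P, D] [y1, y2])"
        using web_Split[OF _ D2, of "[A, C]" 2 w5 "[D]" "[y1, y2]"] by simp
      also have "\<dots> = (\<Sum>P | P \<subseteq> D \<and> card P = r. if P = C then
         (if A \<inter> (D - C) = {} \<and> A \<union> (D - C) = y1 \<and> D = y2 then qv powi (- int r * int k) * mm C (D - C) * mm A (D - C) else 0) else 0)"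
      proof (rule sum.cong[OF refl])
        fix P assume "P \<in> {P. P \<subseteq> D \<and> card P = r}"
        then have "D - P \<in> ksets N k" using ksets_Diff[OF D2] by auto
        then show "qv powi (- int r * int k) * mm P (D - P) * web_matrix N w5 [A, C, P, D - P, D] [y1, y2] =
          (if P = C then
         (if A \<inter> (D - C) = {} \<and> A \<union> (D - C) = y1 \<and> D = y2 then qv powi (- int r * int k) * mm C (D - C) * mm A (D - C) else 0) else 0)"
          using web_WCap[of "[A]" 1 N Dn r "[(0, Merge r k)]" C P "[D - P, D]" "[y1, y2]"]
            web_Merge[of "[]" 0 A N r "D - P" k "[]" "[D]" "[y1, y2]"] A
          by (cases "A \<inter> (D - C) = {}"; cases "P = C") (auto simp: w5_def cap_weight_def)
      qed
      also have "\<dots> = (if C \<subseteq> D then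
         (if A \<inter> (D - C) = {} \<and> A \<union> (D - C) = y1 \<and> D = y2 then qv powi (- int r * int k) * mm C (D - C) * mm A (D - C) else 0) else 0)"
        using D' ksetsD(2)[OF C] by (subst sum.delta) auto
      also have "\<dots> = (if D = y2 then (if A \<subseteq> y1 \<and> C \<subseteq> y2 \<and> y2 - C = y1 - A
      then qv powi (- int r * int k) * mm C (y1 - A) * mm A (y1 - A) else 0) else 0)"
      proof -
        have "A \<inter> (D - C) = {} \<and> A \<union> (D - C) = y1 \<longleftrightarrow> A \<subseteq> y1 \<and> D - C = y1 - A" by auto
        then show ?thesis by auto
      qed
      finally show ?thesis .
    qed
    have "web_matrix N w4 [A, C] [y1, y2] = (\<Sum>D\<in>ksets N j. cup_weight N Up D * web_matrix N ((2, Split r k) # w5) [A, C, D, D] [y1, y2])"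
      using web_WCup[of "[A, C]" 2 N Up j "(2, Split r k) # w5" "[]" "[y1, y2]"] by (simp add: w4_def)
    also have "\<dots> = (\<Sum>D\<in>ksets N j. if D = y2 then (if A \<subseteq> y1 \<and> C \<subseteq> y2 \<and> y2 - C = y1 - A
      then qv powi (- int r * int k) * mm C (y1 - A) * mm A (y1 - A) else 0) else 0)"
      by (rule sum.cong) (auto simp: D cup_weight_def)
    finally show ?thesis using assms(5) by simp
  qed
  have "web_matrix N (basic_web OP j k) [x1, x2] [y1, y2] =
     (\<Sum>A | A \<subseteq> x1 \<and> card A = r. qv powi (- int r * int k) * mm A (x1 - A) * web_matrix N w1 [A, x1 - A, x2] [y1, y2])"
    using web_Split[OF _ x1', of "[]" 0 w1 "[x2]" "[y1, y2]"]
    by (simp add: w1_def w2_def w3_def w4_def w5_def r_def)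
  also have "\<dots> = (\<Sum>A | A \<subseteq> x1 \<and> card A = r. if A \<subseteq> y1 then qv powi (two_rho N x2) * (qv powi (- int r * (int (card x1) - int r)) * mm A (x1 - A) *
      mm A (y1 - A) * dpow (opY N) r (delta (x2, y2)) (x1 - A, y1 - A)) else 0)"
  proof (rule sum.cong[OF refl])
    fix A assume "A \<in> {A. A \<subseteq> x1 \<and> card A = r}"
    then have A: "A \<in> ksets N r" and B: "x1 - A \<in> ksets N k" and A': "A \<subseteq> x1" "card A = r"
      using ksets_subset[OF x1'] ksets_Diff[OF x1'] by auto
    have kk: "int k = int (card x1) - int r" using x1 jk by simp
    have "web_matrix N w1 [A, x1 - A, x2] [y1, y2] = (\<Sum>C\<in>ksets N r. cup_weight N Dn C * web_matrix N w2 [A, C, C, x1 - A, x2] [y1, y2])"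
      using web_WCup[of "[A]" 1 N Dn r w2 "[x1 - A, x2]" "[y1, y2]"] by (simp add: w1_def)
    also have "\<dots> = (\<Sum>C\<in>ksets N r. if C \<inter> (x1 - A) = {} \<and> C \<union> (x1 - A) = x2 \<and> A \<subseteq> y1 \<and> C \<subseteq> y2 \<and> y2 - C = y1 - A then
       qv powi (two_rho N x2) * (qv powi (- int r * int k - two_rho N C) * mm C (x1 - A) * mm C (y1 - A) * mm A (y1 - A)) else 0)"
    proof (rule sum.cong[OF refl])
      fix C assume C: "C \<in> ksets N r"
      show "cup_weight N Dn C * web_matrix N w2 [A, C, C, x1 - A, x2] [y1, y2] =
        (if C \<inter> (x1 - A) = {} \<and> C \<union> (x1 - A) = x2 \<and> A \<subseteq> y1 \<and> C \<subseteq> y2 \<and> y2 - C = y1 - A then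
       qv powi (two_rho N x2) * (qv powi (- int r * int k - two_rho N C) * mm C (x1 - A) * mm C (y1 - A) * mm A (y1 - A)) else 0)"
        using web_Merge[of "[A, C]" 2 C N r "x1 - A" k w3 "[x2]" "[y1, y2]"] C B
          web_WCap[of "[A, C]" 2 N Up j w4 "C \<union> (x1 - A)" x2 "[]" "[y1, y2]"]
          upper[OF A C]
        by (auto simp: w2_def w3_def cup_weight_def cap_weight_def power_int_diff power_int_minus field_simps)
    qed
    finally have 1: "web_matrix N w1 [A, x1 - A, x2] [y1, y2] = \<dots>" .
    show "qv powi (- int r * int k) * mm A (x1 - A) * web_matrix N w1 [A, x1 - A, x2] [y1, y2] =
      (if A \<subseteq> y1 then qv powi (two_rho N x2) * (qv powi (- int r * (int (card x1) - int r)) * mm A (x1 - A) *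
      mm A (y1 - A) * dpow (opY N) r (delta (x2, y2)) (x1 - A, y1 - A)) else 0)"
    proof (cases "A \<subseteq> y1")
      case True
      have y1A: "y1 - A \<in> ksets N k" using ksets_Diff[of y1 N r k A] assms(4) jk True A' by simp
      have e2: "(x1 - A, y1 - A) \<in> equal2 N" using B y1A by (auto simp: equal2_def ksets_def)
      have "dpow (opY N) r (delta (x2, y2)) (x1 - A, y1 - A) =
        (\<Sum>C\<in>ksets N r. if C \<inter> (x1 - A \<union> (y1 - A)) = {} then qv powi (- int r * int k - two_rho N C) * mm C (x1 - A) * mm C (y1 - A) *
          delta (x2, y2) (x1 - A \<union> C, y1 - A \<union> C) else 0)"
        unfolding dpow_opY[OF e2] ksetsD(2)[OF B]
        by (subst sum.inter_filter[symmetric]) (auto simp: ksets_def intro!: sum.cong)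
      also have "\<dots> = (\<Sum>C\<in>ksets N r. if C \<inter> (x1 - A) = {} \<and> C \<union> (x1 - A) = x2 \<and> A \<subseteq> y1 \<and> C \<subseteq> y2 \<and> y2 - C = y1 - A then
         qv powi (- int r * int k - two_rho N C) * mm C (x1 - A) * mm C (y1 - A) else 0)"
      proof (rule sum.cong[OF refl])
        fix C
        have "C \<inter> (x1 - A \<union> (y1 - A)) = {} \<and> x1 - A \<union> C = x2 \<and> y1 - A \<union> C = y2 \<longleftrightarrow>
          C \<inter> (x1 - A) = {} \<and> C \<union> (x1 - A) = x2 \<and> A \<subseteq> y1 \<and> C \<subseteq> y2 \<and> y2 - C = y1 - A"
          using True by auto
        then show "(if C \<inter> (x1 - A \<union> (y1 - A)) = {} then qv powi (- int r * int k - two_rho N C) * mm C (x1 - A) * mm C (y1 - A) *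
          delta (x2, y2) (x1 - A \<union> C, y1 - A \<union> C) else 0) =
          (if C \<inter> (x1 - A) = {} \<and> C \<union> (x1 - A) = x2 \<and> A \<subseteq> y1 \<and> C \<subseteq> y2 \<and> y2 - C = y1 - A then
         qv powi (- int r * int k - two_rho N C) * mm C (x1 - A) * mm C (y1 - A) else 0)"
          unfolding delta_def by auto
      qed
      finally have "web_matrix N w1 [A, x1 - A, x2] [y1, y2] = qv powi (two_rho N x2) * mm A (y1 - A) *
          dpow (opY N) r (delta (x2, y2)) (x1 - A, y1 - A)"
        unfolding 1 by (simp add: sum_distrib_left if_distrib ac_simps cong: if_cong)
      then show ?thesis using True by (simp add: kk ac_simps)
    next
      case False
      then show ?thesis unfolding 1 by simp
    qed
  qed
  also have "\<dots> = qv powi (two_rho N x2) * dpow opX r (dpow (opY N) r (delta (x2, y2))) (x1, y1)"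
  proof -
    have "(x1, y1) \<in> equal2 N" using x1 y1 by (auto simp: equal2_def)
    from dpow_opX[OF this] show ?thesis
      by (subst sum.inter_filter[symmetric]) (use x1 in \<open>auto intro!: sum.cong simp: sum_distrib_left\<close>)
  qed
  finally show ?thesis by (simp only: r_def)
qed

section \<open>Gluing of webs\<close>

declare basic_web.simps [simp del]

lemma qsl2_FE: "qsl2 opE opF (\<lambda>\<sigma>. - (case \<sigma> of (S, T) \<Rightarrow> int (card S) - int (card T))) (sum2 N m)"
  by (rule qsl2.swap[OF qsl2_EF])

lemma ksets_sum2: "S \<in> ksets N j \<Longrightarrow> T \<in> ksets N j \<Longrightarrow> (S, T) \<in> sum2 N (j + j)"
  by (auto simp: ksets_def sum2_def)

lemma ksets_equal2: "S \<in> ksets N j \<Longrightarrow> T \<in> ksets N j \<Longrightarrow> (S, T) \<in> equal2 N"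
  by (auto simp: ksets_def equal2_def)

lemma FE_matrix:
  assumes "S \<in> ksets N j" "T \<in> ksets N j"
  shows "dpow opF a (dpow opE a v) (S, T) = (\<Sum>\<tau>\<in>ksets N j \<times> ksets N j. dpow opF a (dpow opE a (delta \<tau>)) (S, T) * v \<tau>)"
  by (rule qsl2.dpow_QP_matrix[OF qsl2_FE[of N "j + j"]]) (use assms in \<open>auto simp: ksets_def sum2_def\<close>)

lemma XY_matrix:
  assumes "S \<in> ksets N j" "T \<in> ksets N j"
  shows "dpow opX a (dpow (opY N) a v) (S, T) = (\<Sum>\<tau>\<in>ksets N j \<times> ksets N j. dpow opX a (dpow (opY N) a (delta \<tau>)) (S, T) * v \<tau>)"
  by (rule qsl2.dpow_QP_matrix[OF qsl2_XY[of N]]) (use assms in \<open>auto simp: ksets_def equal2_def\<close>)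

lemma subsets_card_empty: "finite S \<Longrightarrow> S' \<subseteq> S \<Longrightarrow> card S < k \<Longrightarrow> {A. A \<subseteq> S' \<and> card A = k} = {}"
  by (metis (mono_tags, lifting) Collect_empty_eq card_mono subset_trans linorder_not_le)

lemma two_rho_Diff: "finite S \<Longrightarrow> A \<subseteq> S \<Longrightarrow> two_rho N S = two_rho N (S - A) + two_rho N A"
  by (simp add: two_rho_def sum.subset_diff)

lemma dpow_opF_0: "S \<in> ksets N j \<Longrightarrow> T \<in> ksets N j \<Longrightarrow> h > j \<Longrightarrow> dpow opF h v (S, T) = 0"
  by (simp only: dpow_opF[OF ksetsD(3) ksetsD(3)] subsets_card_empty[OF ksetsD(3) Diff_subset] ksetsD(2) sum.empty)

lemma dpow_opX_0: "S \<in> ksets N j \<Longrightarrow> T \<in> ksets N j \<Longrightarrow> h > j \<Longrightarrow> dpow opX h v (S, T) = 0"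
  by (simp only: dpow_opX[OF ksets_equal2] subsets_card_empty[OF ksetsD(3) Int_lower1] ksetsD(2) sum.empty)

text \<open>The commutation formula is indexed by the number s of cancelled pairs, the web basis by
  h, where j - h = a + b - s. Divided powers beyond j vanish, so h may run over 0, ..., j.\<close>

lemma sum_glue_reindex:
  fixes a b j :: nat
  assumes "\<And>h. h > j \<Longrightarrow> f h = (0::qfield)"
  shows "(\<Sum>s\<le>min a b. g s (a + b - s) * f (a + b - s)) =
    (\<Sum>h\<le>j. (if a \<le> j - h \<and> b \<le> j - h \<and> j - h \<le> a + b then g (a + b - (j - h)) (j - h) else 0) * f (j - h))"
proof -
  have "(\<Sum>s\<le>min a b. g s (a + b - s) * f (a + b - s))
      = (\<Sum>h\<in>{max a b..a + b}. g (a + b - h) h * f h)"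
    by (rule sum.reindex_bij_witness[of _ "\<lambda>h. a + b - h" "\<lambda>s. a + b - s"]) auto
  also have "\<dots> = (\<Sum>h\<in>{max a b..a + b} \<inter> {..j}. g (a + b - h) h * f h)"
    by (rule sum.mono_neutral_right) (auto simp: assms)
  also have "\<dots> = (\<Sum>h\<le>j. (if a \<le> h \<and> b \<le> h \<and> h \<le> a + b then g (a + b - h) h else 0) * f h)"
    by (rule sum.mono_neutral_cong_left) auto
  also have "\<dots> = (\<Sum>h\<le>j. (if a \<le> j - h \<and> b \<le> j - h \<and> j - h \<le> a + b then g (a + b - (j - h)) (j - h) else 0) * f (j - h))"
    by (rule sum.reindex_bij_witness[of _ "\<lambda>h. j - h" "\<lambda>h. j - h"]) auto
  finally show ?thesis .
qed

text \<open>In the bent reading both webs are products F E, and the sum over the glued labels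
  composes them, the cup and cap weights cancelling the powers of q at the seam. All labels have
  size j, so the weight is 0 and the coefficient is independent of N.\<close>

lemma glue_RI_RI:
  assumes "k \<le> j" "l \<le> j" and x: "x1 \<in> ksets N j" "x2 \<in> ksets N j" "y1 \<in> ksets N j" "y2 \<in> ksets N j"
  shows "(\<Sum>U\<in>ksets N j. \<Sum>V\<in>ksets N j. cup_weight N Dn U * cap_weight N Up V *
      (web_matrix N (basic_web RI j k) [x1, U] [y1, V] * web_matrix N (basic_web RI j l) [U, x2] [V, y2]))
    = (\<Sum>h\<le>j. glue_coeff (int (j - k + (j - l))) (j - k) (j - l) (j - h) * web_matrix N (basic_web RI j h) [x1, x2] [y1, y2])"
proof -
  define a b where "a = j - k" and "b = j - l"
  define v where "v = delta (y2, x2)"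
  define w where "w = qv powi (two_rho N x2 - two_rho N y1)"
  have "(\<Sum>U\<in>ksets N j. \<Sum>V\<in>ksets N j. cup_weight N Dn U * cap_weight N Up V *
      (web_matrix N (basic_web RI j k) [x1, U] [y1, V] * web_matrix N (basic_web RI j l) [U, x2] [V, y2]))
    = (\<Sum>V\<in>ksets N j. \<Sum>U\<in>ksets N j. w * (dpow opF a (dpow opE a (delta (V, U))) (y1, x1) * dpow opF b (dpow opE b v) (V, U)))"
  proof (subst sum.swap, intro sum.cong refl)
    fix U V assume U: "U \<in> ksets N j" and V: "V \<in> ksets N j"
    have 1: "cup_weight N Dn U * cap_weight N Up V * (qv powi (two_rho N U - two_rho N y1) * qv powi (two_rho N x2 - two_rho N V)) = w"
      unfolding w_def cup_weight_def cap_weight_def by (simp add: powi_add[symmetric])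
    have "cup_weight N Dn U * cap_weight N Up V *
      (web_matrix N (basic_web RI j k) [x1, U] [y1, V] * web_matrix N (basic_web RI j l) [U, x2] [V, y2])
      = (cup_weight N Dn U * cap_weight N Up V * (qv powi (two_rho N U - two_rho N y1) * qv powi (two_rho N x2 - two_rho N V))) *
        (dpow opF a (dpow opE a (delta (V, U))) (y1, x1) * dpow opF b (dpow opE b v) (V, U))"
      unfolding web_RI[OF assms(1) x(1) U x(3)] web_RI[OF assms(2) U x(2) V] a_def b_def v_def by (simp only: ac_simps)
    then show "cup_weight N Dn U * cap_weight N Up V *
      (web_matrix N (basic_web RI j k) [x1, U] [y1, V] * web_matrix N (basic_web RI j l) [U, x2] [V, y2])
      = w * (dpow opF a (dpow opE a (delta (V, U))) (y1, x1) * dpow opF b (dpow opE b v) (V, U))"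
      unfolding 1 .
  qed
  also have "\<dots> = w * dpow opF a (dpow opE a (dpow opF b (dpow opE b v))) (y1, x1)"
    unfolding FE_matrix[OF x(3,1), of a "dpow opF b (dpow opE b v)"]
    by (simp add: sum_distrib_left sum.cartesian_product case_prod_beta)
  also have "dpow opF a (dpow opE a (dpow opF b (dpow opE b v))) (y1, x1) =
     (\<Sum>s\<le>min a b. (qbinom (int (a + b)) s * qbinom (int (a + b - s)) a * qbinom (int (a + b - s)) b) *
        dpow opF (a + b - s) (dpow opE (a + b - s) v) (y1, x1))"
    using qsl2.dpow_QPQP[OF qsl2_FE ksets_sum2[OF x(3,1)], of a b v] ksetsD(2)[OF x(1)] ksetsD(2)[OF x(3)] by simp
  also have "\<dots> = (\<Sum>h\<le>j. (if a \<le> j - h \<and> b \<le> j - h \<and> j - h \<le> a + b then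
       qbinom (int (a + b)) (a + b - (j - h)) * qbinom (int (j - h)) a * qbinom (int (j - h)) b else 0) *
        dpow opF (j - h) (dpow opE (j - h) v) (y1, x1))"
    by (rule sum_glue_reindex[of j "\<lambda>h. dpow opF h (dpow opE h v) (y1, x1)"
          "\<lambda>s h. qbinom (int (a + b)) s * qbinom (int h) a * qbinom (int h) b"]) (rule dpow_opF_0[OF x(3,1)])
  finally show ?thesis
    unfolding sum_distrib_left
  proof (rule trans, intro sum.cong refl)
    fix h assume "h \<in> {..j}"
    then have h: "h \<le> j" by simp
    show "w * ((if a \<le> j - h \<and> b \<le> j - h \<and> j - h \<le> a + b then
       qbinom (int (a + b)) (a + b - (j - h)) * qbinom (int (j - h)) a * qbinom (int (j - h)) b else 0) * dpow opF (j - h) (dpow opE (j - h) v) (y1, x1)) =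
      glue_coeff (int (j - k + (j - l))) (j - k) (j - l) (j - h) * web_matrix N (basic_web RI j h) [x1, x2] [y1, y2]"
      unfolding web_RI[OF h x(1,2,3)] glue_coeff_def a_def b_def v_def w_def by (simp only: mult.left_commute)
  qed
qed

text \<open>The same with X and Y. Here the weight is N - 2j, and this is how a = \<open>q^N\<close>
  enters the coefficient.\<close>

lemma glue_OP_OP:
  assumes "k \<le> j" "l \<le> j" and x: "x1 \<in> ksets N j" "x2 \<in> ksets N j" "y1 \<in> ksets N j" "y2 \<in> ksets N j"
  shows "(\<Sum>U\<in>ksets N j. \<Sum>V\<in>ksets N j. cup_weight N Dn U * cap_weight N Dn V *
      (web_matrix N (basic_web OP j k) [x1, U] [y1, V] * web_matrix N (basic_web OP j l) [U, x2] [V, y2]))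
    = (\<Sum>h\<le>j. glue_coeff (int N - 2 * int j + int (j - k + (j - l))) (j - k) (j - l) (j - h) * web_matrix N (basic_web OP j h) [x1, x2] [y1, y2])"
proof -
  define a b where "a = j - k" and "b = j - l"
  define v where "v = delta (x2, y2)"
  define w where "w = qv powi two_rho N x2"
  have "(\<Sum>U\<in>ksets N j. \<Sum>V\<in>ksets N j. cup_weight N Dn U * cap_weight N Dn V *
      (web_matrix N (basic_web OP j k) [x1, U] [y1, V] * web_matrix N (basic_web OP j l) [U, x2] [V, y2]))
    = (\<Sum>U\<in>ksets N j. \<Sum>V\<in>ksets N j. w * (dpow opX a (dpow (opY N) a (delta (U, V))) (x1, y1) * dpow opX b (dpow (opY N) b v) (U, V)))"
  proof (intro sum.cong refl)
    fix U V assume U: "U \<in> ksets N j" and V: "V \<in> ksets N j"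
    have 1: "cup_weight N Dn U * cap_weight N Dn V * (qv powi two_rho N U * qv powi two_rho N x2) = w"
      unfolding w_def cup_weight_def cap_weight_def by (simp add: powi_add[symmetric])
    have "cup_weight N Dn U * cap_weight N Dn V *
      (web_matrix N (basic_web OP j k) [x1, U] [y1, V] * web_matrix N (basic_web OP j l) [U, x2] [V, y2])
      = (cup_weight N Dn U * cap_weight N Dn V * (qv powi two_rho N U * qv powi two_rho N x2)) *
        (dpow opX a (dpow (opY N) a (delta (U, V))) (x1, y1) * dpow opX b (dpow (opY N) b v) (U, V))"
      unfolding web_OP[OF assms(1) x(1) U x(3) V] web_OP[OF assms(2) U x(2) V x(4)] a_def b_def v_def by (simp only: ac_simps)
    then show "cup_weight N Dn U * cap_weight N Dn V *
      (web_matrix N (basic_web OP j k) [x1, U] [y1, V] * web_matrix N (basic_web OP j l) [U, x2] [V, y2])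
      = w * (dpow opX a (dpow (opY N) a (delta (U, V))) (x1, y1) * dpow opX b (dpow (opY N) b v) (U, V))"
      unfolding 1 .
  qed
  also have "\<dots> = w * dpow opX a (dpow (opY N) a (dpow opX b (dpow (opY N) b v))) (x1, y1)"
    unfolding XY_matrix[OF x(1,3), of a "dpow opX b (dpow (opY N) b v)"]
    by (simp add: sum_distrib_left sum.cartesian_product case_prod_beta)
  also have "dpow opX a (dpow (opY N) a (dpow opX b (dpow (opY N) b v))) (x1, y1) =
     (\<Sum>s\<le>min a b. (qbinom (int N - 2 * int j + int (a + b)) s * qbinom (int (a + b - s)) a * qbinom (int (a + b - s)) b) *
        dpow opX (a + b - s) (dpow (opY N) (a + b - s) v) (x1, y1))"
    using qsl2.dpow_QPQP[OF qsl2_XY ksets_equal2[OF x(1,3)], of a b v] ksetsD(2)[OF x(1)] by (simp add: add.assoc)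
  also have "\<dots> = (\<Sum>h\<le>j. (if a \<le> j - h \<and> b \<le> j - h \<and> j - h \<le> a + b then
       qbinom (int N - 2 * int j + int (a + b)) (a + b - (j - h)) * qbinom (int (j - h)) a * qbinom (int (j - h)) b else 0) *
        dpow opX (j - h) (dpow (opY N) (j - h) v) (x1, y1))"
    by (rule sum_glue_reindex[of j "\<lambda>h. dpow opX h (dpow (opY N) h v) (x1, y1)"
          "\<lambda>s h. qbinom (int N - 2 * int j + int (a + b)) s * qbinom (int h) a * qbinom (int h) b"]) (rule dpow_opX_0[OF x(1,3)])
  finally show ?thesis
    unfolding sum_distrib_left
  proof (rule trans, intro sum.cong refl)
    fix h assume "h \<in> {..j}"
    then have h: "h \<le> j" by simp
    show "w * ((if a \<le> j - h \<and> b \<le> j - h \<and> j - h \<le> a + b then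
       qbinom (int N - 2 * int j + int (a + b)) (a + b - (j - h)) * qbinom (int (j - h)) a * qbinom (int (j - h)) b else 0) * dpow opX (j - h) (dpow (opY N) (j - h) v) (x1, y1)) =
      glue_coeff (int N - 2 * int j + int (j - k + (j - l))) (j - k) (j - l) (j - h) * web_matrix N (basic_web OP j h) [x1, x2] [y1, y2]"
      unfolding web_OP[OF h x(1,2,3,4)] glue_coeff_def a_def b_def v_def w_def by (simp only: mult.left_commute)
  qed
qed

text \<open>What is left of a \<open>UP\<close> web after removing the part of the left strand that
  runs straight through: A is merged with S, and the union is split into B and T.\<close>

definition merge_split :: "nat \<Rightarrow> nat set \<Rightarrow> nat set \<Rightarrow> sets2 \<Rightarrow> qfield" where
  "merge_split j S T = (\<lambda>(A, B). if A \<inter> S = {} \<and> B \<inter> T = {} \<and> S \<union> A = T \<union> B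
     then qv powi (- int (card A) * int j) * mm A S * mm B T else 0)"

text \<open>Brings \<open>UP\<close> into the sideways reading of \<open>OP\<close>: the part P of
  size j - l is common to the bottom and top labels of the left strand and is removed by X. In this
  form it can be composed with an \<open>OP\<close> web on its left.\<close>

lemma web_UP_merge_split:
  assumes "l \<le> j" "U \<in> ksets N j" "x2 \<in> ksets N j" "V \<in> ksets N j" "y2 \<in> ksets N j"
  shows "web_matrix N (basic_web UP j l) [U, x2] [V, y2] = dpow opX (j - l) (merge_split j x2 y2) (U, V)"
proof -
  note U = ksetsD[OF assms(2)] and x2 = ksetsD[OF assms(3)] and V = ksetsD[OF assms(4)] and y2 = ksetsD[OF assms(5)]
  define v where "v = delta (V, y2)"
  \<comment> \<open>At weight 0 the two rungs change places, so the left strand gives elements away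
    first and its middle edge is P, of label j - l.\<close>
  have "web_matrix N (basic_web UP j l) [U, x2] [V, y2] = dpow opF l (dpow opE l v) (U, x2)"
    unfolding web_UP[OF assms(1,2,3)] v_def
    using qsl2.dpow_comm_weight0[OF qsl2_EF ksets_sum2[OF assms(2,3)], of l "delta (V, y2)"] U x2 by simp
  also have "\<dots> = (\<Sum>A | A \<subseteq> U - x2 \<and> card A = l. qv powi (- int l * (int j - int l)) * mm (U - A) A * mm A x2 *
      dpow opE l v (U - A, x2 \<union> A))"
    using dpow_opF[OF U(3) x2(3)] U by simp
  also have "\<dots> = (\<Sum>A | A \<subseteq> U \<and> card A = l. if A \<inter> x2 = {} then qv powi (- int l * (int j - int l)) * mm (U - A) A * mm A x2 *
      dpow opE l v (U - A, x2 \<union> A) else 0)"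
    by (subst sum.inter_filter[symmetric]) (use U in \<open>auto intro!: sum.cong\<close>)
  also have "\<dots> = (\<Sum>P | P \<subseteq> U \<and> card P = j - l. if (U - P) \<inter> x2 = {} then qv powi (- int l * (int j - int l)) * mm P (U - P) * mm (U - P) x2 *
      dpow opE l v (P, x2 \<union> (U - P)) else 0)"
    by (subst sum_complement_subsets[OF U(3), of l "j - l"]) (use U assms(1) in \<open>auto intro!: sum.cong simp: double_diff\<close>)
  also have "\<dots> = (\<Sum>P | P \<subseteq> U \<and> card P = j - l. if P \<subseteq> V then qv powi (- int (j - l) * (int j - int (j - l))) * mm P (U - P) * mm P (V - P) *
      merge_split j x2 y2 (U - P, V - P) else 0)"
  proof (rule sum.cong[OF refl])
    fix P assume "P \<in> {P. P \<subseteq> U \<and> card P = j - l}"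
    then have P: "P \<subseteq> U" "card P = j - l" "finite P" using U finite_subset by auto
    have UP: "card (U - P) = l" using P U assms(1) by (simp add: card_Diff_subset)
    have e1: "- int (j - l) * (int j - int (j - l)) = - int l * (int j - int l)"
      using assms(1) by (simp add: of_nat_diff algebra_simps)
    show "(if (U - P) \<inter> x2 = {} then qv powi (- int l * (int j - int l)) * mm P (U - P) * mm (U - P) x2 *
      dpow opE l v (P, x2 \<union> (U - P)) else 0) =
      (if P \<subseteq> V then qv powi (- int (j - l) * (int j - int (j - l))) * mm P (U - P) * mm P (V - P) *
      merge_split j x2 y2 (U - P, V - P) else 0)"
    proof (cases "(U - P) \<inter> x2 = {}")
      case True
      have c: "card (x2 \<union> (U - P)) = j + l"
        using True x2 U P UP by (subst card_Un_disjoint) auto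
      have "dpow opE l v (P, x2 \<union> (U - P)) = (\<Sum>A | A \<subseteq> x2 \<union> (U - P) - P \<and> card A = l.
         if A = V - P then (if P \<subseteq> V \<and> x2 \<union> (U - P) - (V - P) = y2 then qv powi (- int l * int j) * mm (V - P) y2 * mm P (V - P) else 0) else 0)"
        unfolding dpow_opE[OF P(3) finite_UnI[OF x2(3) finite_Diff[OF U(3)]]] c
      proof (rule sum.cong[OF refl])
        fix A assume "A \<in> {A. A \<subseteq> x2 \<union> (U - P) - P \<and> card A = l}"
        then have "P \<union> A = V \<longleftrightarrow> P \<subseteq> V \<and> A = V - P" by auto
        then show "qv powi (- int l * (int (j + l) - int l)) * mm A (x2 \<union> (U - P) - A) * mm P A * v (P \<union> A, x2 \<union> (U - P) - A) =
          (if A = V - P then (if P \<subseteq> V \<and> x2 \<union> (U - P) - (V - P) = y2 then qv powi (- int l * int j) * mm (V - P) y2 * mm P (V - P) else 0) else 0)"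
          by (auto simp: v_def delta_def)
      qed
      also have "\<dots> = (if V - P \<subseteq> x2 \<union> (U - P) - P \<and> card (V - P) = l then
         (if P \<subseteq> V \<and> x2 \<union> (U - P) - (V - P) = y2 then qv powi (- int l * int j) * mm (V - P) y2 * mm P (V - P) else 0) else 0)"
        using x2 U by (subst sum.delta) auto
      also have "\<dots> = (if P \<subseteq> V \<and> (V - P) \<inter> y2 = {} \<and> x2 \<union> (U - P) = y2 \<union> (V - P)
          then qv powi (- int l * int j) * mm (V - P) y2 * mm P (V - P) else 0)"
      proof -
        have c: "card (V - P) = l" if "P \<subseteq> V" using that P V assms(1) by (simp add: card_Diff_subset)
        have "V - P \<subseteq> x2 \<union> (U - P) - P \<and> x2 \<union> (U - P) - (V - P) = y2 \<longleftrightarrow> (V - P) \<inter> y2 = {} \<and> x2 \<union> (U - P) = y2 \<union> (V - P)"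
          by auto
        then show ?thesis using c
          by (cases "P \<subseteq> V"; cases "(V - P) \<inter> y2 = {} \<and> x2 \<union> (U - P) = y2 \<union> (V - P)") (simp_all only: simp_thms if_True if_False if_cancel, auto)
      qed
      finally show ?thesis unfolding e1
        using True by (simp add: merge_split_def UP mult.commute)
    qed (simp add: merge_split_def)
  qed
  also have "\<dots> = dpow opX (j - l) (merge_split j x2 y2) (U, V)"
    unfolding dpow_opX[OF ksets_equal2[OF assms(2,4)]] U(2)
    by (subst sum.inter_filter[symmetric]) (use U in \<open>auto intro!: sum.cong\<close>)
  finally show ?thesis .
qed

text \<open>An inserted element c runs through the merged edge W = \<open>x2 \<union> B\<close> and
  has to avoid W. Summing its weights over the complement of W evaluates a loop of label 1 that is
  merged into and split off an edge of label |W|, which gives [N - |W|], where |W| = j +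
  |B|.\<close>

lemma opY_merge_split:
  assumes "(B, B') \<in> equal2 N" and x: "x2 \<in> ksets N j" "y2 \<in> ksets N j"
  shows "opY N (merge_split j x2 y2) (B, B') = qint (int N - int j - int (card B)) * merge_split j x2 y2 (B, B')"
proof -
  have fin: "finite B" "finite B'" using assms(1) equal2_finite by blast+
  have sub: "B \<subseteq> {..<N}" "B' \<subseteq> {..<N}" using assms(1) by (auto simp: equal2_def)
  note x2 = ksetsD[OF x(1)] and y2 = ksetsD[OF x(2)]
  have opY: "opY N (merge_split j x2 y2) (B, B') = (\<Sum>c\<in>{..<N} - (B \<union> B').
      qv powi (- int (card B) - two_rho N {c}) * mm {c} B * mm {c} B' * merge_split j x2 y2 (insert c B, insert c B'))"
    by (simp add: opY_def elem_op_def)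
  show ?thesis
  proof (cases "B \<inter> x2 = {} \<and> B' \<inter> y2 = {} \<and> x2 \<union> B = y2 \<union> B'")
    case True
    define W where "W = x2 \<union> B"
    have W': "W = y2 \<union> B'" using True by (simp add: W_def)
    have cW: "card W = j + card B" unfolding W_def using True x2 fin by (subst card_Un_disjoint) auto
    have WN: "W \<subseteq> {..<N}" unfolding W_def using x2 sub by auto
    have "opY N (merge_split j x2 y2) (B, B') = (\<Sum>c\<in>{..<N} - W.
       qv powi (2 * int c + 2 * int (gt W c) - int (card W) - int N + 1) * merge_split j x2 y2 (B, B'))"
      unfolding opY
    proof (rule sum.mono_neutral_cong_right)
      show "\<forall>c\<in>{..<N} - (B \<union> B') - ({..<N} - W). qv powi (- int (card B) - two_rho N {c}) * mm {c} B * mm {c} B' *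
           merge_split j x2 y2 (insert c B, insert c B') = 0"
        using W_def by (auto simp: merge_split_def)
    next
      fix c assume c: "c \<in> {..<N} - W"
      then have nc: "c \<notin> B" "c \<notin> B'" "c \<notin> x2" "c \<notin> y2" using W_def W' by auto
      have m1: "mm (insert c B) x2 = mm {c} x2 * mm B x2" using nc fin x2 by (intro mm_insert_left) auto
      have m2: "mm (insert c B') y2 = mm {c} y2 * mm B' y2" using nc fin y2 by (intro mm_insert_left) auto
      have m3: "mm {c} W = mm {c} x2 * mm {c} B" unfolding W_def using True x2 fin by (intro mm_Un_right) auto
      have m4: "mm {c} W = mm {c} y2 * mm {c} B'" unfolding W' using True y2 fin by (intro mm_Un_right) auto
      have z: "merge_split j x2 y2 (insert c B, insert c B') =
          qv powi (- int (card B + 1) * int j) * (mm {c} x2 * mm B x2) * (mm {c} y2 * mm B' y2)"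
        using True nc fin by (auto simp: merge_split_def m1 m2)
      have z0: "merge_split j x2 y2 (B, B') = qv powi (- int (card B) * int j) * mm B x2 * mm B' y2"
        using True by (simp add: merge_split_def)
      have e: "(- int (card B) - two_rho N {c}) + (- int (card B + 1) * int j) + 2 * int (gt W c)
         = (2 * int c + 2 * int (gt W c) - int (card W) - int N + 1) + (- int (card B) * int j)"
        by (simp add: cW two_rho_def algebra_simps)
      have "qv powi (- int (card B) - two_rho N {c}) * mm {c} B * mm {c} B' * merge_split j x2 y2 (insert c B, insert c B')
        = (qv powi (- int (card B) - two_rho N {c}) * qv powi (- int (card B + 1) * int j) *
            ((mm {c} x2 * mm {c} B) * (mm {c} y2 * mm {c} B'))) * (mm B x2 * mm B' y2)"
        unfolding z by (simp only: ac_simps)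
      also have "(mm {c} x2 * mm {c} B) * (mm {c} y2 * mm {c} B') = qv powi (2 * int (gt W c))"
        unfolding m3[symmetric] m4[symmetric] by (simp only: mm_single_left power_even_qv)
      also have "qv powi (- int (card B) - two_rho N {c}) * qv powi (- int (card B + 1) * int j) * qv powi (2 * int (gt W c))
         = qv powi (2 * int c + 2 * int (gt W c) - int (card W) - int N + 1) * qv powi (- int (card B) * int j)"
        unfolding powi_add[OF qv_nonzero, symmetric] e ..
      finally show "qv powi (- int (card B) - two_rho N {c}) * mm {c} B * mm {c} B' * merge_split j x2 y2 (insert c B, insert c B')
        = qv powi (2 * int c + 2 * int (gt W c) - int (card W) - int N + 1) * merge_split j x2 y2 (B, B')"
        unfolding z0 by (simp only: ac_simps)
    qed (use W_def W' in auto)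
    also have "\<dots> = qint (int N - int (card W)) * merge_split j x2 y2 (B, B')"
      unfolding sum_distrib_right[symmetric] sum_complement[OF WN] ..
    finally show ?thesis by (simp add: cW algebra_simps)
  next
    case False
    have "merge_split j x2 y2 (insert c B, insert c B') = 0" if "c \<notin> B \<union> B'" for c
    proof -
      have "\<not> (insert c B \<inter> x2 = {} \<and> insert c B' \<inter> y2 = {} \<and> x2 \<union> insert c B = y2 \<union> insert c B')"
        using False that by blast
      then show ?thesis by (simp only: merge_split_def prod.case if_False)
    qed
    moreover have "merge_split j x2 y2 (B, B') = 0"
      using False by (simp only: merge_split_def prod.case if_False)
    ultimately show ?thesis unfolding opY by simp
  qed
qed

text \<open>Each inserted element enlarges B by one, so the scalars of successive steps are
  consecutive quantum integers.\<close>

lemma dpow_opY_merge_split: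
  assumes "x2 \<in> ksets N j" "y2 \<in> ksets N j"
  shows "(B, B') \<in> equal2 N \<Longrightarrow> dpow (opY N) c (merge_split j x2 y2) (B, B')
    = qbinom (int N - int j - int (card B)) c * merge_split j x2 y2 (B, B')"
proof (induction c arbitrary: B B')
  case (Suc c)
  interpret qsl2 "opY N" opX "\<lambda>(S, V). int N - 2 * int (card S)" "equal2 N" by (rule qsl2_XY)
  define n where "n = int N - int j - int (card B)"
  have "qint (int (Suc c)) * dpow (opY N) (Suc c) (merge_split j x2 y2) (B, B')
     = opY N (dpow (opY N) c (merge_split j x2 y2)) (B, B')"
    by (simp only: dpow_Suc[OF linP])
  also have "\<dots> = opY N (\<lambda>\<tau>. qbinom (n - 1) c * merge_split j x2 y2 \<tau>) (B, B')"
  proof (rule congP[OF Suc.prems])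
    fix \<tau> assume \<tau>: "\<tau> \<in> equal2 N" "(case \<tau> of (S, V) \<Rightarrow> int N - 2 * int (card S)) = (case (B, B') of (S, V) \<Rightarrow> int N - 2 * int (card S)) - 2"
    obtain S V where [simp]: "\<tau> = (S, V)" by fastforce
    from \<tau>(2) have "int N - int j - int (card S) = n - 1" by (simp add: n_def)
    then show "dpow (opY N) c (merge_split j x2 y2) \<tau> = qbinom (n - 1) c * merge_split j x2 y2 \<tau>"
      using Suc.IH[of S V] \<tau>(1) by simp
  qed
  also have "\<dots> = qbinom (n - 1) c * (qint n * merge_split j x2 y2 (B, B'))"
    by (simp only: linear_op_scale[OF linP] opY_merge_split[OF Suc.prems assms] n_def)
  also have "\<dots> = qint (int (Suc c)) * (qbinom n (Suc c) * merge_split j x2 y2 (B, B'))"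
    unfolding mult.assoc[symmetric] qbinom_Suc' by (simp only: mult.commute)
  finally show ?case
    unfolding n_def[symmetric] by (metis (no_types, lifting) mult_cancel_left qint_eq_0_iff of_nat_eq_0_iff nat.distinct(1))
qed simp

text \<open>\<open>dpow_QPQ\<close> commutes the operators as before; then the remaining power of Y
  meets \<open>merge_split\<close>, on which it acts by a scalar. This scalar is the third binomial,
  and it depends on N as does the first.\<close>

lemma glue_OP_UP:
  assumes kl: "k \<le> j" "l \<le> j" and x: "x1 \<in> ksets N j" "x2 \<in> ksets N j" "y1 \<in> ksets N j" "y2 \<in> ksets N j"
  shows "(\<Sum>U\<in>ksets N j. \<Sum>V\<in>ksets N j. cup_weight N Dn U * cap_weight N Dn V *
      (web_matrix N (basic_web OP j k) [x1, U] [y1, V] * web_matrix N (basic_web UP j l) [U, x2] [V, y2]))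
    = (\<Sum>h\<le>j. (if h \<le> k \<and> h \<le> l \<and> k + l \<le> j + h then
        qbinom (int N - int k - int l) (j + h - (k + l)) * qbinom (int (j - h)) (j - k) *
        qbinom (int N - int j - int h) (l - h) else 0) * web_matrix N (basic_web UP j h) [x1, x2] [y1, y2])"
proof -
  define a b where "a = j - k" and "b = j - l"
  define v where "v = merge_split j x2 y2"
  have "(\<Sum>U\<in>ksets N j. \<Sum>V\<in>ksets N j. cup_weight N Dn U * cap_weight N Dn V *
      (web_matrix N (basic_web OP j k) [x1, U] [y1, V] * web_matrix N (basic_web UP j l) [U, x2] [V, y2]))
    = (\<Sum>U\<in>ksets N j. \<Sum>V\<in>ksets N j. dpow opX a (dpow (opY N) a (delta (U, V))) (x1, y1) * dpow opX b v (U, V))"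
  proof (intro sum.cong refl)
    fix U V assume U: "U \<in> ksets N j" and V: "V \<in> ksets N j"
    have 1: "cup_weight N Dn U * cap_weight N Dn V * qv powi two_rho N U = 1"
      unfolding cup_weight_def cap_weight_def by (simp add: powi_add[symmetric])
    have "cup_weight N Dn U * cap_weight N Dn V *
      (web_matrix N (basic_web OP j k) [x1, U] [y1, V] * web_matrix N (basic_web UP j l) [U, x2] [V, y2])
      = (cup_weight N Dn U * cap_weight N Dn V * qv powi two_rho N U) *
        (dpow opX a (dpow (opY N) a (delta (U, V))) (x1, y1) * dpow opX b v (U, V))"
      unfolding web_OP[OF kl(1) x(1) U x(3) V] web_UP_merge_split[OF kl(2) U x(2) V x(4)] a_def b_def v_def by (simp only: ac_simps)
    then show "cup_weight N Dn U * cap_weight N Dn V *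
      (web_matrix N (basic_web OP j k) [x1, U] [y1, V] * web_matrix N (basic_web UP j l) [U, x2] [V, y2])
      = dpow opX a (dpow (opY N) a (delta (U, V))) (x1, y1) * dpow opX b v (U, V)"
      unfolding 1 by simp
  qed
  also have "\<dots> = dpow opX a (dpow (opY N) a (dpow opX b v)) (x1, y1)"
    unfolding XY_matrix[OF x(1,3), of a "dpow opX b v"]
    by (simp add: sum.cartesian_product case_prod_beta)
  also have "\<dots> = (\<Sum>s\<le>min a b. (qbinom (int N - 2 * int j + int (a + b)) s * qbinom (int (a + b - s)) a *
       qbinom (int N - int j - (int j - int (a + b - s))) (a - s)) * dpow opX (a + b - s) v (x1, y1))"
    unfolding qsl2.dpow_QPQ[OF qsl2_XY ksets_equal2[OF x(1,3)]]
  proof (rule sum.cong[OF refl])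
    fix s assume "s \<in> {..min a b}"
    let ?n = "qbinom (int N - int j - (int j - int (a + b - s))) (a - s)"
    interpret qsl2 "opY N" opX "\<lambda>(S, V). int N - 2 * int (card S)" "equal2 N" by (rule qsl2_XY)
    have "dpow opX (a + b - s) (dpow (opY N) (a - s) v) (x1, y1) = dpow opX (a + b - s) (\<lambda>\<tau>. ?n * v \<tau>) (x1, y1)"
    proof (rule cong_dpowQ[OF ksets_equal2[OF x(1,3)]])
      fix \<tau> assume \<tau>: "\<tau> \<in> equal2 N" "(case \<tau> of (S, V) \<Rightarrow> int N - 2 * int (card S)) =
        (case (x1, y1) of (S, V) \<Rightarrow> int N - 2 * int (card S)) + 2 * int (a + b - s)"
      obtain S V where [simp]: "\<tau> = (S, V)" by fastforce
      \<comment> \<open>The scalar is taken at the states read by the power of X, where the left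
        strand has lost a + b - s elements.\<close>
      have "int (card S) = int j - int (a + b - s)" using \<tau>(2) ksetsD(2)[OF x(1)] by simp
      then show "dpow (opY N) (a - s) v \<tau> = ?n * v \<tau>"
        using dpow_opY_merge_split[OF x(2,4), of S V "a - s"] \<tau>(1) by (simp add: v_def)
    qed
    also have "\<dots> = ?n * dpow opX (a + b - s) v (x1, y1)"
      by (simp only: linear_op_scale[OF linear_op_dpow[OF linQ]])
    finally show "qbinom ((case (x1, y1) of (S, V) \<Rightarrow> int N - 2 * int (card S)) + int a + int b) s * qbinom (int (a + b - s)) a *
        dpow opX (a + b - s) (dpow (opY N) (a - s) v) (x1, y1) =
      qbinom (int N - 2 * int j + int (a + b)) s * qbinom (int (a + b - s)) a * ?n * dpow opX (a + b - s) v (x1, y1)"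
      using ksetsD(2)[OF x(1)] by (simp add: ac_simps)
  qed
  also have "\<dots> = (\<Sum>h\<le>j. (if a \<le> j - h \<and> b \<le> j - h \<and> j - h \<le> a + b then
       qbinom (int N - 2 * int j + int (a + b)) (a + b - (j - h)) * qbinom (int (j - h)) a *
       qbinom (int N - int j - (int j - int (j - h))) (a - (a + b - (j - h))) else 0) *
        dpow opX (j - h) v (x1, y1))"
    by (rule sum_glue_reindex[of j "\<lambda>h. dpow opX h v (x1, y1)"
          "\<lambda>s h. qbinom (int N - 2 * int j + int (a + b)) s * qbinom (int h) a * qbinom (int N - int j - (int j - int h)) (a - s)"])
      (rule dpow_opX_0[OF x(1,3)])
  also have "\<dots> = (\<Sum>h\<le>j. (if h \<le> k \<and> h \<le> l \<and> k + l \<le> j + h then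
        qbinom (int N - int k - int l) (j + h - (k + l)) * qbinom (int (j - h)) (j - k) *
        qbinom (int N - int j - int h) (l - h) else 0) * web_matrix N (basic_web UP j h) [x1, x2] [y1, y2])"
  proof (rule sum.cong[OF refl])
    fix h assume "h \<in> {..j}"
    then have h: "h \<le> j" by simp
    have c: "a \<le> j - h \<and> b \<le> j - h \<and> j - h \<le> a + b \<longleftrightarrow> h \<le> k \<and> h \<le> l \<and> k + l \<le> j + h"
      unfolding a_def b_def using kl h by linarith
    have n: "int N - 2 * int j + int (a + b) = int N - int k - int l" "int N - int j - (int j - int (j - h)) = int N - int j - int h"
      "a + b - (j - h) = j + h - (k + l)"
      unfolding a_def b_def using kl h by (simp_all add: of_nat_diff)
    have m: "a - (j + h - (k + l)) = l - h" if "h \<le> k \<and> h \<le> l \<and> k + l \<le> j + h"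
      unfolding a_def using kl h that by simp
    show "(if a \<le> j - h \<and> b \<le> j - h \<and> j - h \<le> a + b then
       qbinom (int N - 2 * int j + int (a + b)) (a + b - (j - h)) * qbinom (int (j - h)) a *
       qbinom (int N - int j - (int j - int (j - h))) (a - (a + b - (j - h))) else 0) *
        dpow opX (j - h) v (x1, y1) = (if h \<le> k \<and> h \<le> l \<and> k + l \<le> j + h then
        qbinom (int N - int k - int l) (j + h - (k + l)) * qbinom (int (j - h)) (j - k) *
        qbinom (int N - int j - int h) (l - h) else 0) * web_matrix N (basic_web UP j h) [x1, x2] [y1, y2]"
      unfolding c n web_UP_merge_split[OF h x] v_def[symmetric] using m by (auto simp: a_def)
  qed
  finally show ?thesis .
qed

section \<open>Rotation of webs\<close>

text \<open>In the bent reading both sides are the same pair of rungs in opposite order, and the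
  order does not matter at weight 0.\<close>

lemma rotate_RI:
  assumes "k \<le> j" and x: "x1 \<in> ksets N j" "x2 \<in> ksets N j" "y1 \<in> ksets N j" "y2 \<in> ksets N j"
  shows "web_matrix N (basic_web RI j k) [x2, y2] [x1, y1]
    = qv powi (two_rho N y2 - two_rho N x1) * web_matrix N (basic_web UP j (j - k)) [x1, x2] [y1, y2]"
  unfolding web_RI[OF assms(1) x(2,4,1)] web_UP[OF diff_le_self x(1,2)]
  using qsl2.dpow_comm_weight0[OF qsl2_EF ksets_sum2[OF x(1,2)], of "j - k"] ksetsD(2)[OF x(1)] ksetsD(2)[OF x(2)] by simp

text \<open>As a double sum over the removed set A and the inserted set C, the entry is symmetric
  under the half turn of the labels with A and C exchanged. Only the \<open>two_rho\<close> terms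
  see the difference.\<close>

lemma rotate_OP:
  assumes "k \<le> j" and x: "x1 \<in> ksets N j" "x2 \<in> ksets N j" "y1 \<in> ksets N j" "y2 \<in> ksets N j"
  shows "qv powi (two_rho N y1) * web_matrix N (basic_web OP j k) [x1, x2] [y1, y2]
    = qv powi (two_rho N x1) * web_matrix N (basic_web OP j k) [y2, y1] [x2, x1]"
proof -
  define r where "r = j - k"
  have explicit: "dpow opX r (dpow (opY N) r (delta (x2, y2))) (x1, y1) =
      (\<Sum>A\<in>ksets N r. \<Sum>C\<in>ksets N r. if A \<subseteq> x1 \<and> A \<subseteq> y1 \<and> C \<subseteq> x2 \<and> C \<subseteq> y2 \<and> x1 - A = x2 - C \<and> y1 - A = y2 - C then
        qv powi (- 2 * int r * (int j - int r) - two_rho N C) * mm A (x1 - A) * mm A (y1 - A) * mm C (x1 - A) * mm C (y1 - A) else 0)"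
    if x: "x1 \<in> ksets N j" "x2 \<in> ksets N j" "y1 \<in> ksets N j" "y2 \<in> ksets N j" for x1 x2 y1 y2
  proof -
    note x1 = ksetsD[OF x(1)] and y1 = ksetsD[OF x(3)]
    have "dpow opX r (dpow (opY N) r (delta (x2, y2))) (x1, y1) =
       (\<Sum>A\<in>ksets N r. if A \<subseteq> x1 \<inter> y1 then qv powi (- int r * (int j - int r)) * mm A (x1 - A) * mm A (y1 - A) *
          dpow (opY N) r (delta (x2, y2)) (x1 - A, y1 - A) else 0)"
      unfolding dpow_opX[OF ksets_equal2[OF x(1,3)]] x1(2)
      by (subst sum.inter_filter[symmetric]) (use x1 in \<open>auto simp: ksets_def intro!: sum.cong\<close>)
    also have "\<dots> = (\<Sum>A\<in>ksets N r. \<Sum>C\<in>ksets N r. if A \<subseteq> x1 \<and> A \<subseteq> y1 \<and> C \<subseteq> x2 \<and> C \<subseteq> y2 \<and> x1 - A = x2 - C \<and> y1 - A = y2 - C then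
        qv powi (- 2 * int r * (int j - int r) - two_rho N C) * mm A (x1 - A) * mm A (y1 - A) * mm C (x1 - A) * mm C (y1 - A) else 0)"
    proof (rule sum.cong[OF refl])
      fix A assume A: "A \<in> ksets N r"
      show "(if A \<subseteq> x1 \<inter> y1 then qv powi (- int r * (int j - int r)) * mm A (x1 - A) * mm A (y1 - A) *
          dpow (opY N) r (delta (x2, y2)) (x1 - A, y1 - A) else 0) =
        (\<Sum>C\<in>ksets N r. if A \<subseteq> x1 \<and> A \<subseteq> y1 \<and> C \<subseteq> x2 \<and> C \<subseteq> y2 \<and> x1 - A = x2 - C \<and> y1 - A = y2 - C then
        qv powi (- 2 * int r * (int j - int r) - two_rho N C) * mm A (x1 - A) * mm A (y1 - A) * mm C (x1 - A) * mm C (y1 - A) else 0)"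
      proof (cases "A \<subseteq> x1 \<inter> y1")
        case True
        have r: "r \<le> j" by (simp add: r_def)
        have k: "x1 - A \<in> ksets N (j - r)" "y1 - A \<in> ksets N (j - r)"
          using ksets_Diff[of _ N r "j - r" A] x True r ksetsD(2)[OF A] by auto
        have kk: "int (j - r) = int j - int r" using r by simp
        have "dpow (opY N) r (delta (x2, y2)) (x1 - A, y1 - A) = (\<Sum>C\<in>ksets N r. if C \<subseteq> {..<N} - (x1 - A \<union> (y1 - A)) then
            qv powi (- int r * (int j - int r) - two_rho N C) * mm C (x1 - A) * mm C (y1 - A) * delta (x2, y2) (x1 - A \<union> C, y1 - A \<union> C) else 0)"
          unfolding dpow_opY[OF ksets_equal2[OF k]] ksetsD(2)[OF k(1)] kk
          by (subst sum.inter_filter[symmetric]) (auto simp: ksets_def intro!: sum.cong)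
        also have "\<dots> = (\<Sum>C\<in>ksets N r. if A \<subseteq> x1 \<and> A \<subseteq> y1 \<and> C \<subseteq> x2 \<and> C \<subseteq> y2 \<and> x1 - A = x2 - C \<and> y1 - A = y2 - C then
            qv powi (- int r * (int j - int r) - two_rho N C) * mm C (x1 - A) * mm C (y1 - A) else 0)"
        proof (rule sum.cong[OF refl])
          fix C assume C: "C \<in> ksets N r"
          have "C \<subseteq> {..<N} - (x1 - A \<union> (y1 - A)) \<and> (x1 - A \<union> C, y1 - A \<union> C) = (x2, y2) \<longleftrightarrow>
             A \<subseteq> x1 \<and> A \<subseteq> y1 \<and> C \<subseteq> x2 \<and> C \<subseteq> y2 \<and> x1 - A = x2 - C \<and> y1 - A = y2 - C"
            using True ksetsD(1)[OF C] by auto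
          then show "(if C \<subseteq> {..<N} - (x1 - A \<union> (y1 - A)) then
            qv powi (- int r * (int j - int r) - two_rho N C) * mm C (x1 - A) * mm C (y1 - A) * delta (x2, y2) (x1 - A \<union> C, y1 - A \<union> C) else 0)
            = (if A \<subseteq> x1 \<and> A \<subseteq> y1 \<and> C \<subseteq> x2 \<and> C \<subseteq> y2 \<and> x1 - A = x2 - C \<and> y1 - A = y2 - C then
            qv powi (- int r * (int j - int r) - two_rho N C) * mm C (x1 - A) * mm C (y1 - A) else 0)"
            unfolding delta_def by (smt (verit) mult.right_neutral mult_zero_right)
        qed
        finally have *: "dpow (opY N) r (delta (x2, y2)) (x1 - A, y1 - A) = \<dots>" .
        have e: "qv powi (- 2 * int r * (int j - int r) - two_rho N C) = qv powi (- int r * (int j - int r)) * qv powi (- int r * (int j - int r) - two_rho N C)" for C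
          unfolding powi_add[OF qv_nonzero, symmetric] by (simp add: algebra_simps)
        show ?thesis using True unfolding * e
          by (simp add: sum_distrib_left if_distrib ac_simps cong: if_cong)
      next
        case False
        then show ?thesis by (subst sum.neutral) auto
      qed
    qed
    finally show ?thesis .
  qed
  have "qv powi (two_rho N y1) * (qv powi (two_rho N x2) * dpow opX r (dpow (opY N) r (delta (x2, y2))) (x1, y1)) =
     qv powi (two_rho N x1) * (qv powi (two_rho N y1) * dpow opX r (dpow (opY N) r (delta (y1, x1))) (y2, x2))"
    unfolding explicit[OF x] explicit[OF x(4,3,2,1)] sum_distrib_left
  proof (subst sum.swap, intro sum.cong refl)
    fix A C assume A: "A \<in> ksets N r" and C: "C \<in> ksets N r"
    note A' = ksetsD[OF A] and C' = ksetsD[OF C]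
    show "qv powi (two_rho N y1) * (qv powi (two_rho N x2) *
        (if A \<subseteq> x1 \<and> A \<subseteq> y1 \<and> C \<subseteq> x2 \<and> C \<subseteq> y2 \<and> x1 - A = x2 - C \<and> y1 - A = y2 - C then
          qv powi (- 2 * int r * (int j - int r) - two_rho N C) * mm A (x1 - A) * mm A (y1 - A) * mm C (x1 - A) * mm C (y1 - A) else 0)) =
       qv powi (two_rho N x1) * (qv powi (two_rho N y1) *
        (if C \<subseteq> y2 \<and> C \<subseteq> x2 \<and> A \<subseteq> y1 \<and> A \<subseteq> x1 \<and> y2 - C = y1 - A \<and> x2 - C = x1 - A then
          qv powi (- 2 * int r * (int j - int r) - two_rho N A) * mm C (y2 - C) * mm C (x2 - C) * mm A (y2 - C) * mm A (x2 - C) else 0))"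
    proof (cases "A \<subseteq> x1 \<and> A \<subseteq> y1 \<and> C \<subseteq> x2 \<and> C \<subseteq> y2 \<and> x1 - A = x2 - C \<and> y1 - A = y2 - C")
      case True
      \<comment> \<open>\<open>x1 - A\<close> and \<open>x2 - C\<close> are the same set, the label
        of the lower rung; so the labels x1 and x2 differ in weight exactly as A and C do.\<close>
      have rx1: "two_rho N x1 = two_rho N (x1 - A) + two_rho N A"
        using True by (intro two_rho_Diff ksetsD(3)[OF x(1)]) auto
      have rx2: "two_rho N x2 = two_rho N (x1 - A) + two_rho N C"
        using True two_rho_Diff[OF ksetsD(3)[OF x(2)], of C N] by simp
      have "two_rho N x2 + (- 2 * int r * (int j - int r) - two_rho N C) = two_rho N x1 + (- 2 * int r * (int j - int r) - two_rho N A)"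
        by (simp add: rx1 rx2)
      then have "qv powi two_rho N x2 * qv powi (- 2 * int r * (int j - int r) - two_rho N C) =
          qv powi two_rho N x1 * qv powi (- 2 * int r * (int j - int r) - two_rho N A)"
        unfolding powi_add[OF qv_nonzero, symmetric] by (rule arg_cong)
      from arg_cong[OF this, of "\<lambda>u. u * (qv powi two_rho N y1 * mm A (x1 - A) * mm A (y1 - A) * mm C (x1 - A) * mm C (y1 - A))"]
      show ?thesis using True by (simp only: if_True simp_thms) (simp only: ac_simps)
    next
      case False
      then have F2: "\<not> (C \<subseteq> y2 \<and> C \<subseteq> x2 \<and> A \<subseteq> y1 \<and> A \<subseteq> x1 \<and> y2 - C = y1 - A \<and> x2 - C = x1 - A)" by auto
      show ?thesis by (simp only: if_not_P[OF False] if_not_P[OF F2] mult_zero_right)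
    qed
  qed
  then show ?thesis
    by (simp only: web_OP[OF assms(1) x] web_OP[OF assms(1) x(4,3,2,1)] r_def)
qed

text \<open>Webs commute with the torus: in a nonzero entry every element occurs equally often at
  the bottom and at the top. This removes the power of q produced by a full turn.\<close>

lemma web_UP_weight:
  assumes "k \<le> j" and x: "x1 \<in> ksets N j" "x2 \<in> ksets N j" "y1 \<in> ksets N j" "y2 \<in> ksets N j"
    and nz: "web_matrix N (basic_web UP j k) [x1, x2] [y1, y2] \<noteq> 0"
  shows "two_rho N x1 + two_rho N x2 = two_rho N y1 + two_rho N y2"
proof -
  note x1 = ksetsD[OF x(1)] and x2 = ksetsD[OF x(2)] and y1 = ksetsD[OF x(3)] and y2 = ksetsD[OF x(4)]
  from nz have "dpow opX (j - k) (merge_split j x2 y2) (x1, y1) \<noteq> 0"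
    by (simp only: web_UP_merge_split[OF assms(1) x] not_False_eq_True)
  then obtain P where P: "P \<subseteq> x1 \<inter> y1" and "merge_split j x2 y2 (x1 - P, y1 - P) \<noteq> 0"
    unfolding dpow_opX[OF ksets_equal2[OF x(1,3)]]
    by (smt (verit, ccfv_SIG) mem_Collect_eq mult_zero_right sum.not_neutral_contains_not_neutral)
  then have m: "(x1 - P) \<inter> x2 = {}" "(y1 - P) \<inter> y2 = {}" "x2 \<union> (x1 - P) = y2 \<union> (y1 - P)"
    by (auto simp: merge_split_def split: if_splits)
  have fP: "finite P" using P x1(3) finite_subset by blast
  have "two_rho N x1 = two_rho N (x1 - P) + two_rho N P" "two_rho N y1 = two_rho N (y1 - P) + two_rho N P"
    using P x1(3) y1(3) by (auto intro!: two_rho_Diff)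
  moreover have "two_rho N x2 + two_rho N (x1 - P) = two_rho N y2 + two_rho N (y1 - P)"
    using two_rho_Un[of x2 "x1 - P" N] two_rho_Un[of y2 "y1 - P" N] m x1(3) x2(3) y1(3) y2(3) by (simp add: Int_commute)
  ultimately show ?thesis by simp
qed

section \<open>Finite \<open>q\<close>-series\<close>

lemma qfac_0 [simp]: "qfac 0 = 1"
  by (simp add: qfac_def)

lemma qfac_Suc: "qfac (Suc k) = (1 - qv ^ (2 * Suc k)) * qfac k"
  by (simp add: qfac_def atLeastAtMostSuc_conv)

lemma qfac_nonzero [simp]: "qfac k \<noteq> 0"
proof -
  have "1 - qv ^ (2 * i) \<noteq> 0" if "i \<in> {1..k}" for i
  proof
    assume "1 - qv ^ (2 * i) = 0"
    then have "qv ^ (2 * i) = 1" by simp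
    then show False using that by (subst (asm) qv_power_eq_1_iff) simp
  qed
  then show ?thesis by (simp add: qfac_def)
qed

text \<open>The Gaussian binomial to base \<open>q^2\<close>; \<open>qbinom_qb\<close> converts the
  balanced ones into it.\<close>

definition qb :: "nat \<Rightarrow> nat \<Rightarrow> qfield" where
  "qb n k = (if k \<le> n then qfac n / (qfac k * qfac (n - k)) else 0)"

lemma qb_0 [simp]: "qb n 0 = 1"
  by (simp add: qb_def)

lemma qb_Pascal: "qb (Suc n) (Suc k) = qb n (Suc k) + qv ^ (2 * (n - k)) * qb n k"
proof (cases "k < n")
  case True
  then obtain r where n: "n = Suc (k + r)" using less_iff_Suc_add by auto
  define A B where "A = qv ^ (2 * Suc r)" and "B = qv ^ (2 * Suc k)"
  have AB: "qv ^ (2 * Suc n) = A * B" unfolding A_def B_def n by (simp only: power_add[symmetric]) (simp add: algebra_simps)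
  have nz: "1 - A \<noteq> 0" "1 - B \<noteq> 0"
    using qfac_nonzero[of "Suc r"] qfac_nonzero[of "Suc k"] unfolding qfac_Suc A_def B_def by auto
  have 1: "qb (Suc n) (Suc k) = (1 - A * B) * qfac n / ((1 - B) * qfac k * ((1 - A) * qfac r))"
    unfolding qb_def qfac_Suc AB using n by (simp add: qfac_Suc A_def B_def)
  have 2: "qb n (Suc k) = qfac n / ((1 - B) * qfac k * qfac r)"
    unfolding qb_def using n by (simp add: qfac_Suc B_def)
  have 3: "qb n k = qfac n / (qfac k * ((1 - A) * qfac r))"
    unfolding qb_def using n by (simp add: qfac_Suc A_def)
  have 4: "qv ^ (2 * (n - k)) = A" using n by (simp add: A_def)
  show ?thesis unfolding 1 2 3 4 using nz by (simp add: divide_simps) (simp add: algebra_simps)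
next
  case False
  then show ?thesis by (cases "k = n") (auto simp: qb_def)
qed

lemma qb_sym: "k \<le> n \<Longrightarrow> qb n (n - k) = qb n k"
  by (simp add: qb_def mult.commute)

lemma qb_Pascal': "qb (Suc n) (Suc k) = qv ^ (2 * Suc k) * qb n (Suc k) + qb n k"
proof (cases "k < n")
  case True
  then have e: "n - k = Suc (n - Suc k)" by simp
  have "qb (Suc n) (Suc k) = qb (Suc n) (Suc (n - Suc k))"
    using qb_sym[of "Suc k" "Suc n"] True e by simp
  also have "\<dots> = qb n (n - k) + qv ^ (2 * (n - (n - Suc k))) * qb n (n - Suc k)"
    unfolding qb_Pascal e ..
  also have "\<dots> = qb n k + qv ^ (2 * Suc k) * qb n (Suc k)"
    using qb_sym[of k n] qb_sym[of "Suc k" n] True by simp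
  finally show ?thesis by simp
next
  case False
  then show ?thesis by (cases "k = n") (auto simp: qb_def)
qed

text \<open>Induction on m with \<open>qb_Pascal'\<close>. Its first term reproduces the sum for m
  and x up to the factor \<open>q^(2x)\<close>, its second term is the sum for m and x - 1 after an
  index shift; together they are the Pascal rule for m + n.\<close>

lemma qb_Vandermonde: "qb (m + n) x = (\<Sum>a\<le>x. qv ^ (2 * ((m - a) * (x - a))) * qb m a * qb n (x - a))"
proof (induction m arbitrary: x)
  case 0
  have "(\<Sum>a\<le>x. qv ^ (2 * ((0 - a) * (x - a))) * qb 0 a * qb n (x - a)) = (\<Sum>a\<le>x. if a = 0 then qb n x else 0)"
    by (rule sum.cong) (auto simp: qb_def)
  then show ?case by simp
next
  case (Suc m)
  show ?case
  proof (cases x)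
    case (Suc y)
    define f where "f = (\<lambda>a. qv ^ (2 * ((Suc m - a) * (x - a))) * qb n (x - a))"
    have "(\<Sum>a\<le>x. qv ^ (2 * ((Suc m - a) * (x - a))) * qb (Suc m) a * qb n (x - a)) = (\<Sum>a\<le>x. f a * qb (Suc m) a)"
      unfolding f_def by (rule sum.cong) (auto simp: ac_simps)
    also have "\<dots> = f 0 + (\<Sum>a\<le>y. f (Suc a) * qb (Suc m) (Suc a))"
      unfolding Suc sum.atMost_Suc_shift by simp
    also have "\<dots> = (f 0 + (\<Sum>a\<le>y. f (Suc a) * (qv ^ (2 * Suc a) * qb m (Suc a)))) + (\<Sum>a\<le>y. f (Suc a) * qb m a)"
      by (simp only: qb_Pascal' distrib_left sum.distrib add.assoc)
    also have "f 0 + (\<Sum>a\<le>y. f (Suc a) * (qv ^ (2 * Suc a) * qb m (Suc a))) = (\<Sum>a\<le>x. f a * (qv ^ (2 * a) * qb m a))"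
      unfolding Suc sum.atMost_Suc_shift by simp
    also have "\<dots> = (\<Sum>a\<le>x. qv ^ (2 * x) * (qv ^ (2 * ((m - a) * (x - a))) * qb m a * qb n (x - a)))"
    proof (rule sum.cong[OF refl])
      fix a assume a: "a \<in> {..x}"
      show "f a * (qv ^ (2 * a) * qb m a) = qv ^ (2 * x) * (qv ^ (2 * ((m - a) * (x - a))) * qb m a * qb n (x - a))"
      \<comment> \<open>For a > m the truncated subtraction would spoil the exponent, but then
        \<open>qb m a\<close> is 0.\<close>
      proof (cases "a \<le> m")
        case True
        then have "(Suc m - a) * (x - a) + a = x + (m - a) * (x - a)" using a by (simp add: Suc_diff_le)
        then have "2 * ((Suc m - a) * (x - a)) + 2 * a = 2 * x + 2 * ((m - a) * (x - a))" by linarith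
        then have "qv ^ (2 * ((Suc m - a) * (x - a))) * qv ^ (2 * a) = qv ^ (2 * x) * qv ^ (2 * ((m - a) * (x - a)))"
          by (simp only: power_add[symmetric])
        from arg_cong[OF this, of "\<lambda>u. u * (qb m a * qb n (x - a))"] show ?thesis
          unfolding f_def by (simp only: ac_simps)
      qed (simp add: qb_def)
    qed
    also have "\<dots> = qv ^ (2 * x) * qb (m + n) x"
      unfolding Suc.IH by (simp only: sum_distrib_left)
    also have "(\<Sum>a\<le>y. f (Suc a) * qb m a) = qb (m + n) y"
      unfolding Suc.IH f_def using Suc by (intro sum.cong) (auto simp: ac_simps)
    finally show ?thesis using qb_Pascal'[of "m + n" y] Suc by simp
  qed simp
qed

section \<open>Pochhammer symbols to base \<open>q^2\<close>\<close>

definition poch :: "qfield \<Rightarrow> nat \<Rightarrow> qfield" where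
  "poch x n = (\<Prod>i<n. 1 - x * qv ^ (2 * i))"

lemma poch_0 [simp]: "poch x 0 = 1"
  by (simp add: poch_def)

lemma poch_add: "poch x (m + n) = poch x m * poch (x * qv ^ (2 * m)) n"
proof -
  have "(\<Prod>i<m + n. 1 - x * qv ^ (2 * i)) = (\<Prod>i<m. 1 - x * qv ^ (2 * i)) * (\<Prod>i<n. 1 - x * qv ^ (2 * (m + i)))"
    by (induction n) (simp_all add: mult.assoc)
  then show ?thesis
    unfolding poch_def by (simp add: algebra_simps power_add)
qed

lemma poch_qfac: "poch (qv ^ 2) n = qfac n"
proof (induction n)
  case (Suc n)
  have "qv ^ 2 * qv ^ (2 * n) = qv ^ (2 * Suc n)" by (simp only: power_add[symmetric]) simp
  with Suc show ?case unfolding qfac_Suc by (simp add: poch_def mult.commute)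
qed simp

text \<open>The finite q-binomial theorem. The second term of the Pascal rule is
  \<open>- x q^(2n)\<close> times the sum for n, which is the contribution of the last factor of the
  product.\<close>

lemma poch_expand: "poch x n = (\<Sum>a\<le>n. qb n a * (- x) ^ a * qv ^ (a * (a - 1)))"
proof (induction n)
  case (Suc n)
  define f where "f = (\<lambda>a. (- x) ^ a * qv ^ (a * (a - 1)))"
  have "(\<Sum>a\<le>Suc n. qb (Suc n) a * (- x) ^ a * qv ^ (a * (a - 1))) = f 0 + (\<Sum>a\<le>n. qb (Suc n) (Suc a) * f (Suc a))"
    unfolding sum.atMost_Suc_shift by (simp add: f_def mult.assoc)
  also have "\<dots> = (f 0 + (\<Sum>a\<le>n. qb n (Suc a) * f (Suc a))) + (\<Sum>a\<le>n. qv ^ (2 * (n - a)) * qb n a * f (Suc a))"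
    by (simp only: qb_Pascal distrib_right sum.distrib add.assoc)
  also have "f 0 + (\<Sum>a\<le>n. qb n (Suc a) * f (Suc a)) = (\<Sum>a\<le>Suc n. qb n a * f a)"
    unfolding sum.atMost_Suc_shift by simp
  also have "\<dots> = (\<Sum>a\<le>n. qb n a * f a)" by (simp add: qb_def)
  also have "\<dots> = poch x n" unfolding Suc.IH f_def by (simp add: mult.assoc)
  also have "(\<Sum>a\<le>n. qv ^ (2 * (n - a)) * qb n a * f (Suc a)) = (\<Sum>a\<le>n. (- x * qv ^ (2 * n)) * (qb n a * f a))"
  proof (rule sum.cong[OF refl])
    fix a assume a: "a \<in> {..n}"
    have "2 * (n - a) + Suc a * a = 2 * n + a * (a - 1)" using a by (cases a) (auto simp: algebra_simps)
    then have "qv ^ (2 * (n - a)) * qv ^ (Suc a * a) = qv ^ (2 * n) * qv ^ (a * (a - 1))" by (simp only: power_add[symmetric])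
    from arg_cong[OF this, of "\<lambda>u. u * (qb n a * (- x) ^ Suc a)"]
    have "qv ^ (2 * (n - a)) * qb n a * ((- x) ^ Suc a * qv ^ (Suc a * a)) = ((- x) * qv ^ (2 * n)) * (qb n a * ((- x) ^ a * qv ^ (a * (a - 1))))"
      by (simp only: ac_simps power_Suc)
    then show "qv ^ (2 * (n - a)) * qb n a * f (Suc a) = (- x * qv ^ (2 * n)) * (qb n a * f a)"
      unfolding f_def diff_Suc_1 .
  qed
  also have "\<dots> = (- x * qv ^ (2 * n)) * poch x n"
    unfolding Suc.IH f_def by (simp add: sum_distrib_left mult.assoc)
  finally show ?case by (simp add: poch_def algebra_simps)
qed simp

section \<open>Sums over finitely supported vectors\<close>

text \<open>Vectors are functions that vanish outside \<open>I\<close>, so each has a single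
  representative and sums over sets of vectors work for index sets of any type, in particular for
  products and doubled sets.\<close>

definition vect :: "'i set \<Rightarrow> ('i \<Rightarrow> nat) set" where
  "vect I = {d. \<forall>i. i \<notin> I \<longrightarrow> d i = 0}"

definition below :: "'i set \<Rightarrow> ('i \<Rightarrow> nat) \<Rightarrow> ('i \<Rightarrow> nat) set" where
  "below I d = {u \<in> vect I. \<forall>i\<in>I. u i \<le> d i}"

definition pf :: "'i set \<Rightarrow> ('i \<Rightarrow> nat) \<Rightarrow> qfield" where
  "pf I d = (\<Prod>i\<in>I. qfac (d i))"

lemma pf_nonzero [simp]: "pf I d \<noteq> 0"
  by (cases "finite I") (simp_all add: pf_def)

lemma pf_empty [simp]: "pf {} d = 1"
  by (simp add: pf_def)

lemma pf_insert: "finite I \<Longrightarrow> i \<notin> I \<Longrightarrow> pf (insert i I) d = qfac (d i) * pf I d"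
  by (simp add: pf_def)

lemma pf_cong: "(\<And>i. i \<in> I \<Longrightarrow> d i = e i) \<Longrightarrow> pf I d = pf I e"
  by (simp add: pf_def)

lemma finite_below: "finite I \<Longrightarrow> finite (below I d)"
proof -
  assume "finite I"
  then have "finite {f. \<forall>x. (x \<in> I \<longrightarrow> f x \<in> {..sum d I}) \<and> (x \<notin> I \<longrightarrow> f x = 0)}"
    by (intro finite_set_of_finite_funs) auto
  then show ?thesis
    by (rule finite_subset[rotated]) (use \<open>finite I\<close> in \<open>auto simp: below_def vect_def intro: order_trans[OF _ member_le_sum]\<close>)
qed

lemma finite_vect_sum: "finite I \<Longrightarrow> finite {d \<in> vect I. sum d I = n}"
proof -
  assume "finite I"
  then have "finite {f. \<forall>x. (x \<in> I \<longrightarrow> f x \<in> {..n}) \<and> (x \<notin> I \<longrightarrow> f x = 0)}"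
    by (intro finite_set_of_finite_funs) auto
  then show ?thesis
    by (rule finite_subset[rotated]) (use \<open>finite I\<close> in \<open>auto simp: vect_def intro: member_le_sum\<close>)
qed

lemma sum_below_insert:
  assumes "finite I" "i \<notin> I"
  shows "(\<Sum>u\<in>below (insert i I) d. f u) = (\<Sum>a\<le>d i. \<Sum>u\<in>below I d. f (u(i := a)))"
  unfolding sum.cartesian_product
  by (rule sum.reindex_bij_witness[of _ "\<lambda>(a, u). u(i := a)" "\<lambda>u. (u i, u(i := 0))"])
    (use assms in \<open>auto simp: below_def vect_def fun_eq_iff\<close>)

lemma sum_upd: "i \<notin> I \<Longrightarrow> sum (u(i := a)) I = sum u I"
  by (rule sum.cong) auto

lemma pf_upd: "i \<notin> I \<Longrightarrow> pf I (u(i := a)) = pf I u"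
  by (rule pf_cong) auto

text \<open>The q-Vandermonde identity applied to one index after another. The form Q depends on the
  order of adjoining the indices, but only its existence is of interest, as it disappears into the
  quiver matrix.\<close>

lemma multi_Vandermonde:
  assumes "finite I"
  shows "\<exists>Q :: 'i \<Rightarrow> 'i \<Rightarrow> int. \<forall>d x. qb (sum d I) x / pf I d =
    (\<Sum>u\<in>below I d. if sum u I = x then
       qv powi (\<Sum>p\<in>I. \<Sum>r\<in>I. int (u p) * Q p r * int (d r - u r)) / (pf I u * pf I (\<lambda>p. d p - u p)) else 0)"
  using assms
proof (induction I)
  case empty
  have "below {} d = {\<lambda>_. 0}" for d :: "'i \<Rightarrow> nat" by (auto simp: below_def vect_def)
  then show ?case by (auto simp: qb_def)
next
  case (insert i I)
  then obtain Q where Q: "\<And>d x. qb (sum d I) x / pf I d =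
    (\<Sum>u\<in>below I d. if sum u I = x then
       qv powi (\<Sum>p\<in>I. \<Sum>r\<in>I. int (u p) * Q p r * int (d r - u r)) / (pf I u * pf I (\<lambda>p. d p - u p)) else 0)" by blast
  \<comment> \<open>The Vandermonde exponent 2 (d_i - a) |u| couples the earlier entries of u with
    the remainder at the new index i, so i occurs in the second place only.\<close>
  define Q' where "Q' = (\<lambda>p r. if p = i then 0 else if r = i then 2 else Q p r)"
  show ?case
  proof (intro exI[of _ Q'] allI)
    fix d :: "'i \<Rightarrow> nat" and x :: nat
    define G where "G = (\<lambda>u. qv powi (\<Sum>p\<in>I. \<Sum>r\<in>I. int (u p) * Q p r * int (d r - u r)) / (pf I u * pf I (\<lambda>p. d p - u p)))"
    have expo: "(\<Sum>p\<in>insert i I. \<Sum>r\<in>insert i I. int ((u(i := a)) p) * Q' p r * int (d r - (u(i := a)) r))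
       = int (2 * ((d i - a) * sum u I)) + (\<Sum>p\<in>I. \<Sum>r\<in>I. int (u p) * Q p r * int (d r - u r))" for u a
    proof -
      have "(\<Sum>p\<in>insert i I. \<Sum>r\<in>insert i I. int ((u(i := a)) p) * Q' p r * int (d r - (u(i := a)) r))
        = (\<Sum>p\<in>I. \<Sum>r\<in>insert i I. int (u p) * Q' p r * int (d r - (u(i := a)) r))"
      proof -
        have "(\<Sum>r\<in>insert i I. int ((u(i := a)) i) * Q' i r * int (d r - (u(i := a)) r)) = 0" by (simp add: Q'_def)
        moreover have "(\<Sum>p\<in>I. \<Sum>r\<in>insert i I. int ((u(i := a)) p) * Q' p r * int (d r - (u(i := a)) r))
          = (\<Sum>p\<in>I. \<Sum>r\<in>insert i I. int (u p) * Q' p r * int (d r - (u(i := a)) r))"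
          using insert(2) by (intro sum.cong) auto
        ultimately show ?thesis using insert(1,2) by (subst sum.insert) auto
      qed
      also have "\<dots> = (\<Sum>p\<in>I. 2 * int (d i - a) * int (u p) + (\<Sum>r\<in>I. int (u p) * Q p r * int (d r - u r)))"
      proof (rule sum.cong[OF refl])
        fix p assume p: "p \<in> I"
        have "(\<Sum>r\<in>I. int (u p) * Q' p r * int (d r - (u(i := a)) r)) = (\<Sum>r\<in>I. int (u p) * Q p r * int (d r - u r))"
          using insert(2) p by (intro sum.cong) (auto simp: Q'_def)
        then show "(\<Sum>r\<in>insert i I. int (u p) * Q' p r * int (d r - (u(i := a)) r)) =
           2 * int (d i - a) * int (u p) + (\<Sum>r\<in>I. int (u p) * Q p r * int (d r - u r))"
          using insert(1,2) p by (subst sum.insert) (auto simp: Q'_def)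
      qed
      also have "\<dots> = int (2 * ((d i - a) * sum u I)) + (\<Sum>p\<in>I. \<Sum>r\<in>I. int (u p) * Q p r * int (d r - u r))"
        by (simp add: sum.distrib sum_distrib_left mult.assoc)
      finally show ?thesis .
    qed
    have "(\<Sum>u\<in>below (insert i I) d. if sum u (insert i I) = x then
       qv powi (\<Sum>p\<in>insert i I. \<Sum>r\<in>insert i I. int (u p) * Q' p r * int (d r - u r)) /
         (pf (insert i I) u * pf (insert i I) (\<lambda>p. d p - u p)) else 0)
      = (\<Sum>a\<le>d i. \<Sum>u\<in>below I d. if a + sum u I = x then qv ^ (2 * ((d i - a) * sum u I)) / (qfac a * qfac (d i - a)) * G u else 0)"
      unfolding sum_below_insert[OF insert(1,2)]
    proof (intro sum.cong refl)
      fix a :: nat and u :: "'i \<Rightarrow> nat"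
      have s: "sum (u(i := a)) (insert i I) = a + sum u I" using insert by (simp add: sum_upd del: fun_upd_apply) simp
      have p1: "pf (insert i I) (u(i := a)) = qfac a * pf I u"
        unfolding pf_insert[OF insert(1,2)] pf_upd[OF insert(2)] by simp
      have p2: "pf (insert i I) (\<lambda>p. d p - (u(i := a)) p) = qfac (d i - a) * pf I (\<lambda>p. d p - u p)"
        using insert by (subst pf_insert) (auto intro!: pf_cong)
      show "(if sum (u(i := a)) (insert i I) = x then
         qv powi (\<Sum>p\<in>insert i I. \<Sum>r\<in>insert i I. int ((u(i := a)) p) * Q' p r * int (d r - (u(i := a)) r)) /
         (pf (insert i I) (u(i := a)) * pf (insert i I) (\<lambda>p. d p - (u(i := a)) p)) else 0) =
        (if a + sum u I = x then qv ^ (2 * ((d i - a) * sum u I)) / (qfac a * qfac (d i - a)) * G u else 0)"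
        unfolding expo s p1 p2 G_def powi_add[OF qv_nonzero] power_int_of_nat by simp
    qed
    also have "\<dots> = (\<Sum>a\<le>d i. if a \<le> x then qv ^ (2 * ((d i - a) * (x - a))) / (qfac a * qfac (d i - a)) *
         (qb (sum d I) (x - a) / pf I d) else 0)"
    proof (rule sum.cong[OF refl])
      fix a
      have "(\<Sum>u\<in>below I d. if a + sum u I = x then qv ^ (2 * ((d i - a) * sum u I)) / (qfac a * qfac (d i - a)) * G u else 0)
        = (\<Sum>u\<in>below I d. if a \<le> x then qv ^ (2 * ((d i - a) * (x - a))) / (qfac a * qfac (d i - a)) * (if sum u I = x - a then G u else 0) else 0)"
        by (rule sum.cong) auto
      then show "(\<Sum>u\<in>below I d. if a + sum u I = x then qv ^ (2 * ((d i - a) * sum u I)) / (qfac a * qfac (d i - a)) * G u else 0)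
        = (if a \<le> x then qv ^ (2 * ((d i - a) * (x - a))) / (qfac a * qfac (d i - a)) * (qb (sum d I) (x - a) / pf I d) else 0)"
        unfolding Q G_def by (simp add: sum_distrib_left)
    qed
    also have "\<dots> = (\<Sum>a\<in>{..d i} \<inter> {..x}. qv ^ (2 * ((d i - a) * (x - a))) * qb (d i) a / qfac (d i) * (qb (sum d I) (x - a) / pf I d))"
      by (rule sum.mono_neutral_cong_right) (auto simp: qb_def)
    also have "\<dots> = (\<Sum>a\<le>x. qv ^ (2 * ((d i - a) * (x - a))) * qb (d i) a / qfac (d i) * (qb (sum d I) (x - a) / pf I d))"
      by (rule sum.mono_neutral_left) (auto simp: qb_def)
    also have "\<dots> = (\<Sum>a\<le>x. qv ^ (2 * ((d i - a) * (x - a))) * qb (d i) a * qb (sum d I) (x - a)) / (qfac (d i) * pf I d)"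
      by (simp add: sum_divide_distrib)
    also have "\<dots> = qb (sum d (insert i I)) x / pf (insert i I) d"
      using insert(1,2) by (simp add: qb_Vandermonde[symmetric] pf_insert)
    finally show "qb (sum d (insert i I)) x / pf (insert i I) d = (\<Sum>u\<in>below (insert i I) d. if sum u (insert i I) = x then
       qv powi (\<Sum>p\<in>insert i I. \<Sum>r\<in>insert i I. int (u p) * Q' p r * int (d r - u r)) /
         (pf (insert i I) u * pf (insert i I) (\<lambda>p. d p - u p)) else 0)" ..
  qed
qed

text \<open>\<open>poch_add\<close> splits the symbol into one factor per index, with x shifted by
  \<open>q^(2n)\<close> past the n units already treated, and \<open>poch_expand\<close> opens each
  factor. At x = \<open>q^2\<close> this absorbs the factors (q^2)_n.\<close>

lemma multi_poch:
  assumes "finite I"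
  shows "\<exists>Q :: 'i \<Rightarrow> 'i \<Rightarrow> int. \<forall>d x. poch x (sum d I) / pf I d =
    (\<Sum>u\<in>below I d. (- x * inverse qv) ^ sum u I *
       qv powi ((\<Sum>p\<in>I. int (u p) * int (u p)) + (\<Sum>p\<in>I. \<Sum>r\<in>I. int (u p) * Q p r * int (d r))) / (pf I u * pf I (\<lambda>p. d p - u p)))"
  using assms
proof (induction I)
  case empty
  have "below {} d = {\<lambda>_. 0}" for d :: "'i \<Rightarrow> nat" by (auto simp: below_def vect_def)
  then show ?case by auto
next
  case (insert i I)
  then obtain Q where Q: "\<And>d x. poch x (sum d I) / pf I d =
    (\<Sum>u\<in>below I d. (- x * inverse qv) ^ sum u I *
       qv powi ((\<Sum>p\<in>I. int (u p) * int (u p)) + (\<Sum>p\<in>I. \<Sum>r\<in>I. int (u p) * Q p r * int (d r))) / (pf I u * pf I (\<lambda>p. d p - u p)))" by blast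
  \<comment> \<open>The shift of x by \<open>q^(2n)\<close>, n being the sum of the earlier entries
    of d, yields the exponent 2na; so now i stands in the first place.\<close>
  define Q' where "Q' = (\<lambda>p r. if p = i then (if r = i then 0 else 2) else if r = i then 0 else Q p r)"
  show ?case
  proof (intro exI[of _ Q'] allI)
    fix d :: "'i \<Rightarrow> nat" and x :: qfield
    define G where "G = (\<lambda>u. (- x * inverse qv) ^ sum u I *
       qv powi ((\<Sum>p\<in>I. int (u p) * int (u p)) + (\<Sum>p\<in>I. \<Sum>r\<in>I. int (u p) * Q p r * int (d r))) / (pf I u * pf I (\<lambda>p. d p - u p)))"
    define n where "n = sum d I"
    have expo: "(\<Sum>p\<in>insert i I. int ((u(i := a)) p) * int ((u(i := a)) p)) + (\<Sum>p\<in>insert i I. \<Sum>r\<in>insert i I. int ((u(i := a)) p) * Q' p r * int (d r))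
       = int (2 * n * a + a * a) + ((\<Sum>p\<in>I. int (u p) * int (u p)) + (\<Sum>p\<in>I. \<Sum>r\<in>I. int (u p) * Q p r * int (d r)))" for u a
    proof -
      have "(\<Sum>r\<in>insert i I. int ((u(i := a)) i) * Q' i r * int (d r)) = int (2 * n * a)"
      proof -
        have "(\<Sum>r\<in>I. int ((u(i := a)) i) * Q' i r * int (d r)) = (\<Sum>r\<in>I. 2 * int a * int (d r))"
          using insert(2) by (intro sum.cong) (auto simp: Q'_def)
        then show ?thesis using insert(1,2) by (subst sum.insert) (auto simp: Q'_def n_def sum_distrib_left mult.commute mult.left_commute)
      qed
      moreover have "(\<Sum>p\<in>I. \<Sum>r\<in>insert i I. int ((u(i := a)) p) * Q' p r * int (d r)) = (\<Sum>p\<in>I. \<Sum>r\<in>I. int (u p) * Q p r * int (d r))"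
      proof (rule sum.cong[OF refl])
        fix p assume p: "p \<in> I"
        have "(\<Sum>r\<in>I. int ((u(i := a)) p) * Q' p r * int (d r)) = (\<Sum>r\<in>I. int (u p) * Q p r * int (d r))"
          using insert(2) p by (intro sum.cong) (auto simp: Q'_def)
        then show "(\<Sum>r\<in>insert i I. int ((u(i := a)) p) * Q' p r * int (d r)) = (\<Sum>r\<in>I. int (u p) * Q p r * int (d r))"
          using insert(1,2) p by (subst sum.insert) (auto simp: Q'_def)
      qed
      moreover have "(\<Sum>p\<in>I. int ((u(i := a)) p) * int ((u(i := a)) p)) = (\<Sum>p\<in>I. int (u p) * int (u p))"
        using insert(2) by (intro sum.cong) auto
      ultimately show ?thesis using insert(1,2) by (simp add: algebra_simps)
    qed
    have "(\<Sum>u\<in>below (insert i I) d. (- x * inverse qv) ^ sum u (insert i I) *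
       qv powi ((\<Sum>p\<in>insert i I. int (u p) * int (u p)) + (\<Sum>p\<in>insert i I. \<Sum>r\<in>insert i I. int (u p) * Q' p r * int (d r))) /
         (pf (insert i I) u * pf (insert i I) (\<lambda>p. d p - u p)))
      = (\<Sum>a\<le>d i. \<Sum>u\<in>below I d. (- x * inverse qv) ^ a * qv ^ (2 * n * a + a * a) / (qfac a * qfac (d i - a)) * G u)"
      unfolding sum_below_insert[OF insert(1,2)]
    proof (intro sum.cong refl)
      fix a :: nat and u :: "'i \<Rightarrow> nat"
      have s: "sum (u(i := a)) (insert i I) = a + sum u I" using insert by (simp add: sum_upd del: fun_upd_apply) simp
      have p1: "pf (insert i I) (u(i := a)) = qfac a * pf I u"
        unfolding pf_insert[OF insert(1,2)] pf_upd[OF insert(2)] by simp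
      have p2: "pf (insert i I) (\<lambda>p. d p - (u(i := a)) p) = qfac (d i - a) * pf I (\<lambda>p. d p - u p)"
        using insert by (subst pf_insert) (auto intro!: pf_cong)
      show "(- x * inverse qv) ^ sum (u(i := a)) (insert i I) *
         qv powi ((\<Sum>p\<in>insert i I. int ((u(i := a)) p) * int ((u(i := a)) p)) + (\<Sum>p\<in>insert i I. \<Sum>r\<in>insert i I. int ((u(i := a)) p) * Q' p r * int (d r))) /
         (pf (insert i I) (u(i := a)) * pf (insert i I) (\<lambda>p. d p - (u(i := a)) p)) =
        (- x * inverse qv) ^ a * qv ^ (2 * n * a + a * a) / (qfac a * qfac (d i - a)) * G u"
        unfolding expo s p1 p2 G_def powi_add[OF qv_nonzero, of "int (2 * n * a + a * a)"] power_int_of_nat power_add[of "- x * inverse qv"] by (simp add: ac_simps)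
    qed
    also have "\<dots> = (\<Sum>a\<le>d i. (- x * inverse qv) ^ a * qv ^ (2 * n * a + a * a) / (qfac a * qfac (d i - a))) * (\<Sum>u\<in>below I d. G u)"
      by (simp only: sum_distrib_left sum_distrib_right) (rule sum.swap)
    also have "(\<Sum>u\<in>below I d. G u) = poch x n / pf I d"
      unfolding G_def n_def Q ..
    also have "(\<Sum>a\<le>d i. (- x * inverse qv) ^ a * qv ^ (2 * n * a + a * a) / (qfac a * qfac (d i - a))) = poch (x * qv ^ (2 * n)) (d i) / qfac (d i)"
      unfolding poch_expand sum_divide_distrib
    proof (rule sum.cong[OF refl])
      fix a assume a: "a \<in> {..d i}"
      have aa: "qv ^ (a * a) = qv ^ (a * (a - 1)) * qv ^ a"
        unfolding power_add[symmetric] by (cases a) (simp_all add: algebra_simps)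
      have e: "inverse qv ^ a * qv ^ (a * a) = qv ^ (a * (a - 1))"
        unfolding aa power_inverse by simp
      have "(- x * inverse qv) ^ a * qv ^ (2 * n * a + a * a) = (- x) ^ a * (qv ^ (2 * n)) ^ a * (inverse qv ^ a * qv ^ (a * a))"
        unfolding power_mult_distrib power_add power_mult[of qv "2 * n" a] by (simp only: ac_simps)
      also have "\<dots> = (- (x * qv ^ (2 * n))) ^ a * qv ^ (a * (a - 1))"
        unfolding e by (simp only: power_mult_distrib[symmetric] mult_minus_left)
      finally show "(- x * inverse qv) ^ a * qv ^ (2 * n * a + a * a) / (qfac a * qfac (d i - a)) =
         qb (d i) a * (- (x * qv ^ (2 * n))) ^ a * qv ^ (a * (a - 1)) / qfac (d i)"
        using a by (simp add: qb_def)
    qed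
    finally show "poch x (sum d (insert i I)) / pf (insert i I) d = (\<Sum>u\<in>below (insert i I) d. (- x * inverse qv) ^ sum u (insert i I) *
       qv powi ((\<Sum>p\<in>insert i I. int (u p) * int (u p)) + (\<Sum>p\<in>insert i I. \<Sum>r\<in>insert i I. int (u p) * Q' p r * int (d r))) /
         (pf (insert i I) u * pf (insert i I) (\<lambda>p. d p - u p)))"
      using insert(1,2) by (simp add: pf_insert n_def[symmetric] add.commute[of "d i"] poch_add)
  qed
qed

section \<open>Linear and quadratic exponents\<close>

definition lin :: "'i set \<Rightarrow> (('i \<Rightarrow> nat) \<Rightarrow> int) \<Rightarrow> bool" where
  "lin J l \<longleftrightarrow> (\<exists>c. \<forall>e. l e = (\<Sum>p\<in>J. c p * int (e p)))"

text \<open>Linear terms are excluded on purpose: in a quiver form they occur only as exponents of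
  -q and of a.\<close>

definition quad :: "'i set \<Rightarrow> (('i \<Rightarrow> nat) \<Rightarrow> int) \<Rightarrow> bool" where
  "quad J b \<longleftrightarrow> (\<exists>Q. \<forall>e. b e = (\<Sum>p\<in>J. \<Sum>r\<in>J. int (e p) * Q p r * int (e r)))"

lemma lin_0: "lin J (\<lambda>e. 0)"
  unfolding lin_def by (rule exI[of _ "\<lambda>_. 0"]) simp

lemma lin_component: "finite J \<Longrightarrow> p \<in> J \<Longrightarrow> lin J (\<lambda>e. int (e p))"
  unfolding lin_def by (rule exI[of _ "\<lambda>r. if r = p then 1 else 0"]) (simp add: if_distrib[of "\<lambda>x. x * _"] sum.delta cong: if_cong)

lemma lin_add: "lin J l \<Longrightarrow> lin J m \<Longrightarrow> lin J (\<lambda>e. l e + m e)"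
  unfolding lin_def
proof (elim exE)
  fix c d assume "\<forall>e. l e = (\<Sum>p\<in>J. c p * int (e p))" "\<forall>e. m e = (\<Sum>p\<in>J. d p * int (e p))"
  then show "\<exists>c. \<forall>e. l e + m e = (\<Sum>p\<in>J. c p * int (e p))"
    by (intro exI[of _ "\<lambda>p. c p + d p"]) (simp add: sum.distrib distrib_right)
qed

lemma lin_cmult: "lin J l \<Longrightarrow> lin J (\<lambda>e. k * l e)"
  unfolding lin_def
proof (elim exE)
  fix c assume "\<forall>e. l e = (\<Sum>p\<in>J. c p * int (e p))"
  then show "\<exists>c. \<forall>e. k * l e = (\<Sum>p\<in>J. c p * int (e p))"
    by (intro exI[of _ "\<lambda>p. k * c p"]) (simp add: sum_distrib_left mult.assoc)
qed

lemma lin_uminus: "lin J l \<Longrightarrow> lin J (\<lambda>e. - l e)"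
  using lin_cmult[of J l "- 1"] by simp

lemma lin_diff: "lin J l \<Longrightarrow> lin J m \<Longrightarrow> lin J (\<lambda>e. l e - m e)"
  using lin_add[OF _ lin_uminus, of J l m] by simp

lemma lin_sum: "(\<And>x. x \<in> X \<Longrightarrow> lin J (l x)) \<Longrightarrow> lin J (\<lambda>e. \<Sum>x\<in>X. l x e)"
  by (induction X rule: infinite_finite_induct) (auto intro: lin_0 lin_add)

lemma lin_sum_subset: "finite J \<Longrightarrow> R \<subseteq> J \<Longrightarrow> lin J (\<lambda>e. int (sum e R))"
  unfolding of_nat_sum by (intro lin_sum lin_component) auto

lemma quad_0: "quad J (\<lambda>e. 0)"
  unfolding quad_def by (rule exI[of _ "\<lambda>_ _. 0"]) simp

lemma quad_add: "quad J l \<Longrightarrow> quad J m \<Longrightarrow> quad J (\<lambda>e. l e + m e)"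
  unfolding quad_def
proof (elim exE)
  fix c d assume "\<forall>e. l e = (\<Sum>p\<in>J. \<Sum>r\<in>J. int (e p) * c p r * int (e r))"
    "\<forall>e. m e = (\<Sum>p\<in>J. \<Sum>r\<in>J. int (e p) * d p r * int (e r))"
  then show "\<exists>c. \<forall>e. l e + m e = (\<Sum>p\<in>J. \<Sum>r\<in>J. int (e p) * c p r * int (e r))"
    by (intro exI[of _ "\<lambda>p r. c p r + d p r"]) (simp add: sum.distrib distrib_right distrib_left)
qed

lemma quad_cmult: "quad J l \<Longrightarrow> quad J (\<lambda>e. k * l e)"
  unfolding quad_def
proof (elim exE)
  fix c assume "\<forall>e. l e = (\<Sum>p\<in>J. \<Sum>r\<in>J. int (e p) * c p r * int (e r))"
  then show "\<exists>c. \<forall>e. k * l e = (\<Sum>p\<in>J. \<Sum>r\<in>J. int (e p) * c p r * int (e r))"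
    by (intro exI[of _ "\<lambda>p r. k * c p r"]) (simp add: sum_distrib_left ac_simps)
qed

lemma quad_uminus: "quad J l \<Longrightarrow> quad J (\<lambda>e. - l e)"
  using quad_cmult[of J l "- 1"] by simp

lemma quad_diff: "quad J l \<Longrightarrow> quad J m \<Longrightarrow> quad J (\<lambda>e. l e - m e)"
  using quad_add[OF _ quad_uminus, of J l m] by simp

lemma quad_sum: "(\<And>x. x \<in> X \<Longrightarrow> quad J (l x)) \<Longrightarrow> quad J (\<lambda>e. \<Sum>x\<in>X. l x e)"
  by (induction X rule: infinite_finite_induct) (auto intro: quad_0 quad_add)

lemma quad_mult: "lin J l \<Longrightarrow> lin J m \<Longrightarrow> quad J (\<lambda>e. l e * m e)"
  unfolding lin_def quad_def
proof (elim exE)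
  fix c d assume "\<forall>e. l e = (\<Sum>p\<in>J. c p * int (e p))" "\<forall>e. m e = (\<Sum>p\<in>J. d p * int (e p))"
  then show "\<exists>Q. \<forall>e. l e * m e = (\<Sum>p\<in>J. \<Sum>r\<in>J. int (e p) * Q p r * int (e r))"
    by (intro exI[of _ "\<lambda>p r. c p * d r"]) (simp add: sum_product ac_simps)
qed

lemma lin_comp:
  assumes "lin I l" "\<And>p. p \<in> I \<Longrightarrow> lin J (\<lambda>e. int (L e p))"
  shows "lin J (\<lambda>e. l (L e))"
proof -
  obtain c where "\<And>e. l e = (\<Sum>p\<in>I. c p * int (e p))" using assms(1) unfolding lin_def by blast
  then show ?thesis using assms(2) by (simp add: lin_sum lin_cmult)
qed

lemma quad_comp:
  assumes "quad I b" "\<And>p. p \<in> I \<Longrightarrow> lin J (\<lambda>e. int (L e p))"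
  shows "quad J (\<lambda>e. b (L e))"
proof -
  obtain Q where "\<And>e. b e = (\<Sum>p\<in>I. \<Sum>r\<in>I. int (e p) * Q p r * int (e r))" using assms(1) unfolding quad_def by blast
  moreover have "quad J (\<lambda>e. \<Sum>p\<in>I. \<Sum>r\<in>I. int (L e p) * Q p r * int (L e r))"
  proof (intro quad_sum)
    fix p r assume "p \<in> I" "r \<in> I"
    then have "quad J (\<lambda>e. Q p r * (int (L e p) * int (L e r)))" by (intro quad_cmult quad_mult assms(2))
    then show "quad J (\<lambda>e. int (L e p) * Q p r * int (L e r))" by (simp add: ac_simps)
  qed
  ultimately show ?thesis by simp
qed

text \<open>
  The monomials of a quiver form at \<open>a = q\<^sup>N\<close>. The parity of the linear part of the exponent of
  \<open>q\<close> has to agree with the sign.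
\<close>

definition qmono :: "'i set \<Rightarrow> (nat \<Rightarrow> ('i \<Rightarrow> nat) \<Rightarrow> qfield) \<Rightarrow> bool" where
  "qmono J \<omega> \<longleftrightarrow> (\<exists>s a b. lin J s \<and> lin J a \<and> quad J b \<and>
     \<omega> = (\<lambda>N e. (- qv) powi s e * qv powi (int N * a e + b e)))"

lemma qmonoI:
  assumes "lin J s" "lin J a" "quad J b" "\<And>N e. \<omega> N e = (- qv) powi s e * qv powi (int N * a e + b e)"
  shows "qmono J \<omega>"
  unfolding qmono_def using assms by blast

lemma mono_mult: "qmono J \<omega> \<Longrightarrow> qmono J \<omega>' \<Longrightarrow> qmono J (\<lambda>N e. \<omega> N e * \<omega>' N e)"
  unfolding qmono_def
proof (elim exE conjE)
  fix s a b s' a' b'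
  assume *: "lin J s" "lin J a" "quad J b" "\<omega> = (\<lambda>N e. (- qv) powi s e * qv powi (int N * a e + b e))"
    "lin J s'" "lin J a'" "quad J b'" "\<omega>' = (\<lambda>N e. (- qv) powi s' e * qv powi (int N * a' e + b' e))"
  show "\<exists>s a b. lin J s \<and> lin J a \<and> quad J b \<and>
     (\<lambda>N e. \<omega> N e * \<omega>' N e) = (\<lambda>N e. (- qv) powi s e * qv powi (int N * a e + b e))"
    by (intro exI[of _ "\<lambda>e. s e + s' e"] exI[of _ "\<lambda>e. a e + a' e"] exI[of _ "\<lambda>e. b e + b' e"] conjI lin_add quad_add *)
      (simp add: * fun_eq_iff powi_add distrib_left ac_simps)
qed

text \<open>Applied to the margins of a table and to \<open>base\<close>, both linear in the new
  indices, so that the monomials of given forms pull back to monomials.\<close>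

lemma mono_comp:
  assumes "qmono I \<omega>" "\<And>p. p \<in> I \<Longrightarrow> lin J (\<lambda>e. int (L e p))"
  shows "qmono J (\<lambda>N e. \<omega> N (L e))"
proof -
  obtain s a b where *: "lin I s" "lin I a" "quad I b" "\<omega> = (\<lambda>N e. (- qv) powi s e * qv powi (int N * a e + b e))"
    using assms(1) unfolding qmono_def by blast
  show ?thesis
    by (rule qmonoI[OF lin_comp[OF *(1) assms(2)] lin_comp[OF *(2) assms(2)] quad_comp[OF *(3) assms(2)]]) (simp_all add: *(4))
qed

lemma mono_quad: "quad J b \<Longrightarrow> qmono J (\<lambda>N e. qv powi b e)"
  by (rule qmonoI[OF lin_0 lin_0, of _ b]) auto

lemma mono_a: "lin J a \<Longrightarrow> qmono J (\<lambda>N e. qv powi (int N * a e))"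
  by (rule qmonoI[OF lin_0 _ quad_0, of _ a]) auto

section \<open>Sums over tables with given margins\<close>

definition tables :: "'i set \<Rightarrow> 'j set \<Rightarrow> ('i \<Rightarrow> nat) \<Rightarrow> ('j \<Rightarrow> nat) \<Rightarrow> ('i \<times> 'j \<Rightarrow> nat) set" where
  "tables I J d c = {e \<in> vect (I \<times> J). (\<forall>p\<in>I. (\<Sum>r\<in>J. e (p, r)) = d p) \<and> (\<forall>r\<in>J. (\<Sum>p\<in>I. e (p, r)) = c r)}"

lemma tables_sum: "e \<in> tables I J d c \<Longrightarrow> sum e (I \<times> J) = sum d I"
proof -
  assume "e \<in> tables I J d c"
  moreover have "sum e (I \<times> J) = (\<Sum>p\<in>I. \<Sum>r\<in>J. e (p, r))" by (simp add: sum.cartesian_product)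
  ultimately show ?thesis by (simp add: tables_def)
qed

lemma finite_tables: "finite I \<Longrightarrow> finite J \<Longrightarrow> finite (tables I J d c)"
proof -
  assume "finite I" "finite J"
  then have "finite {e \<in> vect (I \<times> J). sum e (I \<times> J) = sum d I}" by (intro finite_vect_sum) auto
  moreover have "tables I J d c \<subseteq> {e \<in> vect (I \<times> J). sum e (I \<times> J) = sum d I}"
    using tables_sum by (fastforce simp: tables_def)
  ultimately show ?thesis by (rule finite_subset[rotated])
qed

lemma pf_Times: "pf (I \<times> J) e = (\<Prod>r\<in>J. pf I (\<lambda>p. e (p, r)))"
  unfolding pf_def by (subst prod.swap) (simp add: prod.cartesian_product)

text \<open>Induction on the columns. The column of j is some u \<le> d with sum c j, chosen by
  \<open>multi_Vandermonde\<close>, and the rest is a table with row sums d - u. Since d - u is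
  itself a vector of row sums of the rest, the exponent becomes a quadratic form in the entries
  alone, independent of d and c.\<close>

lemma contingency:
  assumes "finite I" "finite J"
  shows "\<exists>b. quad (I \<times> J) b \<and> (\<forall>d c. sum d I = sum c J \<longrightarrow>
     qfac (sum d I) / (pf I d * pf J c) = (\<Sum>e\<in>tables I J d c. qv powi b e / pf (I \<times> J) e))"
  using assms(2)
proof (induction J)
  case empty
  have "qfac (sum d I) / (pf I d * pf {} c) = (\<Sum>e\<in>tables I {} d c. qv powi 0 / pf (I \<times> {}) e)"
    if "sum d I = sum c {}" for d :: "'a \<Rightarrow> nat" and c :: "'b \<Rightarrow> nat"
  proof -
    from that have d: "\<forall>p\<in>I. d p = 0" using assms(1) by simp
    then have "tables I {} d c = {\<lambda>_. 0}" by (auto simp: tables_def vect_def)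
    moreover have "pf I d = 1" using d by (simp add: pf_def)
    ultimately show ?thesis using that by simp
  qed
  then show ?case using quad_0 by blast
next
  case (insert j J)
  then obtain b where b: "quad (I \<times> J) b" "\<And>d c. sum d I = sum c J \<Longrightarrow>
     qfac (sum d I) / (pf I d * pf J c) = (\<Sum>e\<in>tables I J d c. qv powi b e / pf (I \<times> J) e)" by blast
  obtain Q where Q: "\<And>d x. qb (sum d I) x / pf I d =
    (\<Sum>u\<in>below I d. if sum u I = x then
       qv powi (\<Sum>p\<in>I. \<Sum>r\<in>I. int (u p) * Q p r * int (d r - u r)) / (pf I u * pf I (\<lambda>p. d p - u p)) else 0)"
    using multi_Vandermonde[OF assms(1)] by blast
  \<comment> \<open>The column of j is overwritten by zeros, so that what remains is again a
    representative in \<open>vect\<close>.\<close>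
  define cut where "cut = (\<lambda>e::'a \<times> 'b \<Rightarrow> nat. \<lambda>(p, r). if r = j then 0 else e (p, r))"
  define b' where "b' = (\<lambda>e. (\<Sum>p\<in>I. \<Sum>r\<in>I. int (e (p, j)) * Q p r * int (\<Sum>k\<in>J. e (r, k))) + b (cut e))"
  have fin: "finite (I \<times> insert j J)" using assms insert by auto
  have "quad (I \<times> insert j J) b'"
    unfolding b'_def
  proof (intro quad_add quad_sum)
    fix p r assume pr: "p \<in> I" "r \<in> I"
    have "lin (I \<times> insert j J) (\<lambda>e. int (\<Sum>k\<in>J. e (r, k)))"
      unfolding of_nat_sum using pr fin by (intro lin_sum lin_component) auto
    then have "quad (I \<times> insert j J) (\<lambda>e. Q p r * (int (e (p, j)) * int (\<Sum>k\<in>J. e (r, k))))"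
      using pr fin by (intro quad_cmult quad_mult lin_component) auto
    then show "quad (I \<times> insert j J) (\<lambda>e. int (e (p, j)) * Q p r * int (\<Sum>k\<in>J. e (r, k)))" by (simp add: ac_simps)
  next
    show "quad (I \<times> insert j J) (\<lambda>e. b (cut e))"
    proof (rule quad_comp[OF b(1)])
      fix q assume q: "q \<in> I \<times> J"
      then have "cut e q = e q" for e using insert(2) by (auto simp: cut_def)
      then show "lin (I \<times> insert j J) (\<lambda>e. int (cut e q))" using q fin by (auto intro: lin_component)
    qed
  qed
  moreover have "qfac (sum d I) / (pf I d * pf (insert j J) c) = (\<Sum>e\<in>tables I (insert j J) d c. qv powi b' e / pf (I \<times> insert j J) e)"
    if s: "sum d I = sum c (insert j J)" for d c
  proof -
    have sd: "sum d I = c j + sum c J" using s insert(1,2) by simp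
    have "qfac (sum d I) / (pf I d * pf (insert j J) c) = qb (sum d I) (c j) / pf I d * (qfac (sum c J) / pf J c)"
      using sd insert(1,2) by (simp add: qb_def pf_insert)
    also have "\<dots> = (\<Sum>u\<in>{u \<in> below I d. sum u I = c j}. qv powi (\<Sum>p\<in>I. \<Sum>r\<in>I. int (u p) * Q p r * int (d r - u r)) / pf I u *
       (qfac (sum c J) / (pf I (\<lambda>p. d p - u p) * pf J c)))"
      unfolding Q sum_distrib_right
      by (subst sum.inter_filter[OF finite_below[OF assms(1)]]) (auto intro!: sum.cong)
    also have "\<dots> = (\<Sum>u\<in>{u \<in> below I d. sum u I = c j}. \<Sum>e\<in>tables I J (\<lambda>p. d p - u p) c.
       qv powi (\<Sum>p\<in>I. \<Sum>r\<in>I. int (u p) * Q p r * int (d r - u r)) / pf I u * (qv powi b e / pf (I \<times> J) e))"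
    proof (rule sum.cong[OF refl])
      fix u assume u: "u \<in> {u \<in> below I d. sum u I = c j}"
      then have "sum (\<lambda>p. d p - u p) I = sum d I - sum u I"
        by (intro sum_subtractf_nat) (auto simp: below_def)
      then have e: "sum (\<lambda>p. d p - u p) I = sum c J" using u sd by simp
      show "qv powi (\<Sum>p\<in>I. \<Sum>r\<in>I. int (u p) * Q p r * int (d r - u r)) / pf I u *
         (qfac (sum c J) / (pf I (\<lambda>p. d p - u p) * pf J c)) = (\<Sum>e\<in>tables I J (\<lambda>p. d p - u p) c.
         qv powi (\<Sum>p\<in>I. \<Sum>r\<in>I. int (u p) * Q p r * int (d r - u r)) / pf I u * (qv powi b e / pf (I \<times> J) e))"
        using b(2)[OF e] unfolding e by (simp only: sum_distrib_left[symmetric])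
    qed
    also have "\<dots> = (\<Sum>(u, e)\<in>Sigma {u \<in> below I d. sum u I = c j} (\<lambda>u. tables I J (\<lambda>p. d p - u p) c).
       qv powi (\<Sum>p\<in>I. \<Sum>r\<in>I. int (u p) * Q p r * int (d r - u r)) / pf I u * (qv powi b e / pf (I \<times> J) e))"
      using assms(1) insert(1) finite_below[OF assms(1), of d] by (subst sum.Sigma) (auto intro: finite_tables)
    also have "\<dots> = (\<Sum>e\<in>tables I (insert j J) d c. qv powi b' e / pf (I \<times> insert j J) e)"
    proof (rule sum.reindex_bij_witness[of _ "\<lambda>e. (\<lambda>p. e (p, j), cut e)" "\<lambda>(u, e) (p, r). if r = j then u p else e (p, r)"])
      fix x assume "x \<in> Sigma {u \<in> below I d. sum u I = c j} (\<lambda>u. tables I J (\<lambda>p. d p - u p) c)"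
      then obtain u e where x: "x = (u, e)" and u: "u \<in> vect I" "\<And>p. p \<in> I \<Longrightarrow> u p \<le> d p" "sum u I = c j"
        and e: "e \<in> vect (I \<times> J)" "\<And>p. p \<in> I \<Longrightarrow> (\<Sum>r\<in>J. e (p, r)) = d p - u p" "\<And>r. r \<in> J \<Longrightarrow> (\<Sum>p\<in>I. e (p, r)) = c r"
        by (auto simp: below_def tables_def)
      define f where "f = (\<lambda>(p, r). if r = j then u p else e (p, r))"
      have ej: "e (p, j) = 0" for p using e(1) insert(2) by (auto simp: vect_def)
      have fJ: "f (p, r) = e (p, r)" if "r \<in> J" for p r using that insert(2) by (auto simp: f_def)
      have fj: "f (p, j) = u p" for p by (simp add: f_def)
      have cf: "cut f = e" using ej by (auto simp: cut_def f_def fun_eq_iff)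
      show "(\<lambda>p. (case x of (u, e) \<Rightarrow> \<lambda>(p, r). if r = j then u p else e (p, r)) (p, j),
          cut (case x of (u, e) \<Rightarrow> \<lambda>(p, r). if r = j then u p else e (p, r))) = x"
        unfolding x prod.case using cf by (simp add: f_def)
      show "(case x of (u, e) \<Rightarrow> \<lambda>(p, r). if r = j then u p else e (p, r)) \<in> tables I (insert j J) d c"
        unfolding x prod.case f_def[symmetric] tables_def
      proof (intro CollectI conjI ballI)
        show "f \<in> vect (I \<times> insert j J)" using u(1) e(1) by (auto simp: vect_def f_def)
      next
        fix p assume "p \<in> I"
        then show "(\<Sum>r\<in>insert j J. f (p, r)) = d p"
          using insert(1,2) u(2)[of p] e(2)[of p] by (simp add: fj fJ)
      next
        fix r assume "r \<in> insert j J"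
        then show "(\<Sum>p\<in>I. f (p, r)) = c r" using u(3) e(3) by (auto simp: fj fJ)
      qed
      have du: "d r - u r = (\<Sum>k\<in>J. f (r, k))" if "r \<in> I" for r using e(2)[OF that] by (simp add: fJ)
      have pf: "pf (I \<times> insert j J) f = pf I u * pf (I \<times> J) e"
        unfolding pf_Times using insert(1,2) by (simp add: fj fJ)
      show "qv powi b' (case x of (u, e) \<Rightarrow> \<lambda>(p, r). if r = j then u p else e (p, r)) /
          pf (I \<times> insert j J) (case x of (u, e) \<Rightarrow> \<lambda>(p, r). if r = j then u p else e (p, r)) =
        (case x of (u, e) \<Rightarrow> qv powi (\<Sum>p\<in>I. \<Sum>r\<in>I. int (u p) * Q p r * int (d r - u r)) / pf I u * (qv powi b e / pf (I \<times> J) e))"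
        unfolding x prod.case f_def[symmetric] pf b'_def cf by (simp add: fj du powi_add)
    next
      fix e assume e: "e \<in> tables I (insert j J) d c"
      then have ev: "e \<in> vect (I \<times> insert j J)" and er: "\<And>p. p \<in> I \<Longrightarrow> e (p, j) + (\<Sum>r\<in>J. e (p, r)) = d p"
        and ec: "\<And>r. r \<in> insert j J \<Longrightarrow> (\<Sum>p\<in>I. e (p, r)) = c r"
        using insert(1,2) by (auto simp: tables_def)
      show "(case (\<lambda>p. e (p, j), cut e) of (u, e) \<Rightarrow> \<lambda>(p, r). if r = j then u p else e (p, r)) = e"
        by (auto simp: cut_def fun_eq_iff)
      have cJ: "cut e (p, r) = e (p, r)" if "r \<in> J" for p r using that insert(2) by (auto simp: cut_def)
      have "(\<lambda>p. e (p, j)) \<in> below I d" using ev er by (auto simp: below_def vect_def) (metis le_add1)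
      moreover have "cut e \<in> tables I J (\<lambda>p. d p - e (p, j)) c"
        unfolding tables_def
      proof (intro CollectI conjI ballI)
        show "cut e \<in> vect (I \<times> J)" using ev by (auto simp: vect_def cut_def)
      next
        fix p assume "p \<in> I"
        then show "(\<Sum>r\<in>J. cut e (p, r)) = d p - e (p, j)" using er[of p] by (simp add: cJ)
      next
        fix r assume "r \<in> J"
        then show "(\<Sum>p\<in>I. cut e (p, r)) = c r" using ec by (simp add: cJ)
      qed
      ultimately show "(\<lambda>p. e (p, j), cut e) \<in> Sigma {u \<in> below I d. sum u I = c j} (\<lambda>u. tables I J (\<lambda>p. d p - u p) c)"
        using ec by auto
    qed
    finally show ?thesis .
  qed
  ultimately show ?case by blast
qed

definition cut :: "'i set \<Rightarrow> ('i \<Rightarrow> nat) \<Rightarrow> 'i \<Rightarrow> nat" where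
  "cut I f = (\<lambda>p. if p \<in> I then f p else 0)"

lemma cut_vect [simp]: "cut I f \<in> vect I"
  by (simp add: cut_def vect_def)

lemma sum_cut: "A \<subseteq> I \<Longrightarrow> sum (cut I f) A = sum f A"
  by (rule sum.cong) (auto simp: cut_def)

lemma pf_cut: "A \<subseteq> I \<Longrightarrow> pf A (cut I f) = pf A f"
  by (rule pf_cong) (auto simp: cut_def)

lemma pf_Un: "finite I \<Longrightarrow> finite I' \<Longrightarrow> I \<inter> I' = {} \<Longrightarrow> pf (I \<union> I') f = pf I f * pf I' f"
  by (simp add: pf_def prod.union_disjoint)

text \<open>A vector on a disjoint union is a pair of vectors, its two restrictions extended by
  zero.\<close>

lemma sum_vect_split:
  assumes "I \<inter> I' = {}"
  shows "(\<Sum>f | f \<in> vect (I \<union> I') \<and> P (cut I f) \<and> R (cut I' f). g (cut I f) * h (cut I' f)) =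
    (\<Sum>f | f \<in> vect I \<and> P f. g f) * (\<Sum>f | f \<in> vect I' \<and> R f. h f :: qfield)"
  unfolding sum_product sum.cartesian_product
proof (rule sum.reindex_bij_witness[of _ "\<lambda>(f, f') p. if p \<in> I then f p else f' p" "\<lambda>f. (cut I f, cut I' f)"])
  fix f assume "f \<in> {f \<in> vect (I \<union> I'). P (cut I f) \<and> R (cut I' f)}"
  then show "(case (cut I f, cut I' f) of (f, f') \<Rightarrow> \<lambda>p. if p \<in> I then f p else f' p) = f"
    "(cut I f, cut I' f) \<in> {f \<in> vect I. P f} \<times> {f \<in> vect I'. R f}"
    by (auto simp: cut_def vect_def fun_eq_iff)
next
  fix x assume "x \<in> {f \<in> vect I. P f} \<times> {f \<in> vect I'. R f}"
  then obtain f f' where x: "x = (f, f')" "f \<in> vect I" "P f" "f' \<in> vect I'" "R f'" by auto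
  have "cut I (\<lambda>p. if p \<in> I then f p else f' p) = f" "cut I' (\<lambda>p. if p \<in> I then f p else f' p) = f'"
    using x assms by (auto simp: cut_def vect_def fun_eq_iff)
  then show "(cut I (case x of (f, f') \<Rightarrow> \<lambda>p. if p \<in> I then f p else f' p), cut I' (case x of (f, f') \<Rightarrow> \<lambda>p. if p \<in> I then f p else f' p)) = x"
    "(case x of (f, f') \<Rightarrow> \<lambda>p. if p \<in> I then f p else f' p) \<in> {f \<in> vect (I \<union> I'). P (cut I f) \<and> R (cut I' f)}"
    using x by (auto simp: vect_def)
qed auto

text \<open>A table is built in two stages. First the parts u_p of the rows that go into the columns
  of A2 are chosen, with sum h over A1 and the rest of their total over B1; this gives the two
  binomials. Then \<open>contingency\<close> fills the columns of A2 with row sums u and those of B2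
  with row sums d1 - u, independently.\<close>

theorem block_tables:
  fixes A1 B1 :: "'a set" and A2 B2 :: "'b set"
  assumes fin: "finite A1" "finite B1" "finite A2" "finite B2" and dis: "A1 \<inter> B1 = {}" "A2 \<inter> B2 = {}"
  defines "I1 \<equiv> A1 \<union> B1" and "I2 \<equiv> A2 \<union> B2"
  shows "\<exists>b. quad (I1 \<times> I2) b \<and> (\<forall>d1 d2 h. sum d1 I1 = sum d2 I2 \<longrightarrow>
    (if h \<le> sum d2 A2 then qb (sum d1 A1) h * qb (sum d1 B1) (sum d2 A2 - h) * qfac (sum d2 A2) * qfac (sum d2 B2) /
       (pf I1 d1 * pf I2 d2) else 0) =
    (\<Sum>e | e \<in> tables I1 I2 d1 d2 \<and> sum e (A1 \<times> A2) = h. qv powi b e / pf (I1 \<times> I2) e))"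
proof -
  have finI: "finite I1" "finite I2" using fin by (auto simp: I1_def I2_def)
  obtain Q where Q: "\<And>d x. qb (sum d A1) x / pf A1 d =
    (\<Sum>u\<in>below A1 d. if sum u A1 = x then
       qv powi (\<Sum>p\<in>A1. \<Sum>r\<in>A1. int (u p) * Q p r * int (d r - u r)) / (pf A1 u * pf A1 (\<lambda>p. d p - u p)) else 0)"
    using multi_Vandermonde[OF fin(1)] by blast
  obtain R where R: "\<And>d x. qb (sum d B1) x / pf B1 d =
    (\<Sum>u\<in>below B1 d. if sum u B1 = x then
       qv powi (\<Sum>p\<in>B1. \<Sum>r\<in>B1. int (u p) * R p r * int (d r - u r)) / (pf B1 u * pf B1 (\<lambda>p. d p - u p)) else 0)"
    using multi_Vandermonde[OF fin(2)] by blast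
  obtain bA where bA: "quad (I1 \<times> A2) bA" "\<And>d c. sum d I1 = sum c A2 \<Longrightarrow>
     qfac (sum d I1) / (pf I1 d * pf A2 c) = (\<Sum>e\<in>tables I1 A2 d c. qv powi bA e / pf (I1 \<times> A2) e)"
    using contingency[OF finI(1) fin(3)] by blast
  obtain bB where bB: "quad (I1 \<times> B2) bB" "\<And>d c. sum d I1 = sum c B2 \<Longrightarrow>
     qfac (sum d I1) / (pf I1 d * pf B2 c) = (\<Sum>e\<in>tables I1 B2 d c. qv powi bB e / pf (I1 \<times> B2) e)"
    using contingency[OF finI(1) fin(4)] by blast
  define uu where "uu = (\<lambda>(e::'a \<times> 'b \<Rightarrow> nat) p. if p \<in> I1 then \<Sum>k\<in>A2. e (p, k) else 0)"
  define vv where "vv = (\<lambda>(e::'a \<times> 'b \<Rightarrow> nat) p. \<Sum>k\<in>B2. e (p, k))"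
  define \<beta> where "\<beta> = (\<lambda>u v::'a \<Rightarrow> nat. (\<Sum>p\<in>A1. \<Sum>r\<in>A1. int (u p) * Q p r * int (v r)) + (\<Sum>p\<in>B1. \<Sum>r\<in>B1. int (u p) * R p r * int (v r)))"
  define b where "b = (\<lambda>e. \<beta> (uu e) (vv e) + (bA (cut (I1 \<times> A2) e) + bB (cut (I1 \<times> B2) e)))"
  have finII: "finite (I1 \<times> I2)" using finI by simp
  have linu: "lin (I1 \<times> I2) (\<lambda>e. int (uu e p))" if "p \<in> I1" for p
    unfolding uu_def of_nat_sum using that finII by (auto intro!: lin_sum lin_component simp: I2_def of_nat_sum)
  have linv: "lin (I1 \<times> I2) (\<lambda>e. int (vv e p))" if "p \<in> I1" for p
    unfolding vv_def of_nat_sum using that finII by (auto intro!: lin_sum lin_component simp: I2_def)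
  have quadb: "quad (I1 \<times> I2) b"
    unfolding b_def \<beta>_def
  proof (intro quad_add quad_sum)
    have *: "quad (I1 \<times> I2) (\<lambda>e. int (uu e p) * c * int (vv e r))" if "p \<in> I1" "r \<in> I1" for c p r
    proof -
      have "quad (I1 \<times> I2) (\<lambda>e. c * (int (uu e p) * int (vv e r)))"
        using that by (intro quad_cmult quad_mult linu linv)
      then show ?thesis by (simp add: ac_simps)
    qed
    show "p \<in> A1 \<Longrightarrow> r \<in> A1 \<Longrightarrow> quad (I1 \<times> I2) (\<lambda>e. int (uu e p) * Q p r * int (vv e r))"
      "p \<in> B1 \<Longrightarrow> r \<in> B1 \<Longrightarrow> quad (I1 \<times> I2) (\<lambda>e. int (uu e p) * R p r * int (vv e r))" for p r
      by (rule *; simp add: I1_def)+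
    have **: "lin (I1 \<times> I2) (\<lambda>e. int (cut S e q))" if "q \<in> S" "S \<subseteq> I1 \<times> I2" for q S
      using that finII by (auto simp: cut_def intro: lin_component)
    show "quad (I1 \<times> I2) (\<lambda>e. bA (cut (I1 \<times> A2) e))"
      by (rule quad_comp[OF bA(1)], rule **) (auto simp: I2_def)
    show "quad (I1 \<times> I2) (\<lambda>e. bB (cut (I1 \<times> B2) e))"
      by (rule quad_comp[OF bB(1)], rule **) (auto simp: I2_def)
  qed
  show ?thesis
  proof (intro exI[of _ b] conjI allI impI quadb)
    fix d1 :: "'a \<Rightarrow> nat" and d2 :: "'b \<Rightarrow> nat" and h assume sd: "sum d1 I1 = sum d2 I2"
    define l where "l = sum d2 A2"
    have sI2: "sum d2 I2 = l + sum d2 B2" unfolding I2_def l_def using fin dis by (intro sum.union_disjoint) auto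
    define U where "U = {u. u \<in> vect I1 \<and> (cut A1 u \<in> below A1 d1 \<and> sum (cut A1 u) A1 = h) \<and> (cut B1 u \<in> below B1 d1 \<and> h + sum (cut B1 u) B1 = l)}"
    have Ubelow: "u \<in> below I1 d1" if "u \<in> U" for u
      using that by (auto simp: U_def below_def I1_def cut_def)
    have finU: "finite U" using Ubelow finite_below[OF finI(1)] finite_subset[of U] by blast
    define S where "S = {e. e \<in> tables I1 I2 d1 d2 \<and> sum e (A1 \<times> A2) = h}"
    have finS: "finite S" unfolding S_def using finite_tables[OF finI] by simp
    \<comment> \<open>The fibre over u is the product of two sets of tables, one for each block of
      columns, so the sum over it factors.\<close>
    have part: "{e \<in> S. uu e = u} = {e. e \<in> vect (I1 \<times> A2 \<union> I1 \<times> B2) \<and> cut (I1 \<times> A2) e \<in> tables I1 A2 u d2 \<and>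
         cut (I1 \<times> B2) e \<in> tables I1 B2 (\<lambda>p. d1 p - u p) d2}" if u: "u \<in> U" for u
    proof (intro equalityI subsetI)
      fix e assume e: "e \<in> {e \<in> S. uu e = u}"
      then have ue: "u = uu e" and ev: "e \<in> vect (I1 \<times> I2)" and er: "\<And>p. p \<in> I1 \<Longrightarrow> (\<Sum>r\<in>I2. e (p, r)) = d1 p"
        and ec: "\<And>r. r \<in> I2 \<Longrightarrow> (\<Sum>p\<in>I1. e (p, r)) = d2 r" by (auto simp: S_def tables_def)
      have cA: "cut (I1 \<times> A2) e (p, r) = e (p, r)" if "p \<in> I1" "r \<in> A2" for p r using that by (simp add: cut_def)
      have cB: "cut (I1 \<times> B2) e (p, r) = e (p, r)" if "p \<in> I1" "r \<in> B2" for p r using that by (simp add: cut_def)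
      have rs: "(\<Sum>r\<in>I2. e (p, r)) = (\<Sum>r\<in>A2. e (p, r)) + (\<Sum>r\<in>B2. e (p, r))" for p
        unfolding I2_def using fin dis by (intro sum.union_disjoint) auto
      show "e \<in> {e. e \<in> vect (I1 \<times> A2 \<union> I1 \<times> B2) \<and> cut (I1 \<times> A2) e \<in> tables I1 A2 u d2 \<and>
         cut (I1 \<times> B2) e \<in> tables I1 B2 (\<lambda>p. d1 p - u p) d2}"
        unfolding tables_def using ev ec er
        by (auto simp: cA cB ue uu_def I2_def vect_def cut_def rs[unfolded I2_def] simp flip: er)
    next
      fix e assume "e \<in> {e. e \<in> vect (I1 \<times> A2 \<union> I1 \<times> B2) \<and> cut (I1 \<times> A2) e \<in> tables I1 A2 u d2 \<and>
         cut (I1 \<times> B2) e \<in> tables I1 B2 (\<lambda>p. d1 p - u p) d2}"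
      then have ev: "e \<in> vect (I1 \<times> A2 \<union> I1 \<times> B2)"
        and tA: "\<And>p. p \<in> I1 \<Longrightarrow> (\<Sum>r\<in>A2. e (p, r)) = u p" "\<And>r. r \<in> A2 \<Longrightarrow> (\<Sum>p\<in>I1. e (p, r)) = d2 r"
        and tB: "\<And>p. p \<in> I1 \<Longrightarrow> (\<Sum>r\<in>B2. e (p, r)) = d1 p - u p" "\<And>r. r \<in> B2 \<Longrightarrow> (\<Sum>p\<in>I1. e (p, r)) = d2 r"
        by (auto simp: tables_def cut_def)
      have ul: "u p \<le> d1 p" if "p \<in> I1" for p using Ubelow[OF u] that by (auto simp: below_def)
      have "uu e = u" using tA(1) u by (auto simp: uu_def fun_eq_iff U_def vect_def)
      moreover have "e \<in> tables I1 I2 d1 d2"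
        unfolding tables_def
      proof (intro CollectI conjI ballI)
        show "e \<in> vect (I1 \<times> I2)" using ev by (auto simp: vect_def I2_def)
      next
        fix p assume p: "p \<in> I1"
        have "(\<Sum>r\<in>I2. e (p, r)) = (\<Sum>r\<in>A2. e (p, r)) + (\<Sum>r\<in>B2. e (p, r))"
          unfolding I2_def using fin dis by (intro sum.union_disjoint) auto
        then show "(\<Sum>r\<in>I2. e (p, r)) = d1 p" using tA(1) tB(1) ul p by simp
      next
        fix r assume "r \<in> I2"
        then show "(\<Sum>p\<in>I1. e (p, r)) = d2 r" using tA(2) tB(2) by (auto simp: I2_def)
      qed
      moreover have "sum e (A1 \<times> A2) = h"
      proof -
        have "sum e (A1 \<times> A2) = (\<Sum>p\<in>A1. \<Sum>r\<in>A2. e (p, r))" by (simp add: sum.cartesian_product)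
        also have "\<dots> = sum u A1" by (rule sum.cong) (auto simp: tA I1_def)
        also have "\<dots> = h" using u by (simp add: U_def sum_cut)
        finally show ?thesis .
      qed
      ultimately show "e \<in> {e \<in> S. uu e = u}" by (simp add: S_def)
    qed
    have uuS: "uu ` S \<subseteq> U"
    proof
      fix u assume "u \<in> uu ` S"
      then obtain e where ue: "u = uu e" and ev: "e \<in> vect (I1 \<times> I2)" and er: "\<And>p. p \<in> I1 \<Longrightarrow> (\<Sum>r\<in>I2. e (p, r)) = d1 p"
        and ec: "\<And>r. r \<in> I2 \<Longrightarrow> (\<Sum>p\<in>I1. e (p, r)) = d2 r" and eh: "sum e (A1 \<times> A2) = h" by (auto simp: S_def tables_def)
      have le: "u p \<le> d1 p" if "p \<in> I1" for p
      proof -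
        have "(\<Sum>r\<in>A2. e (p, r)) \<le> (\<Sum>r\<in>I2. e (p, r))" using finI by (intro sum_mono2) (auto simp: I2_def)
        then show ?thesis using er[OF that] that by (simp add: ue uu_def)
      qed
      have "sum u A1 = (\<Sum>p\<in>A1. \<Sum>r\<in>A2. e (p, r))" by (rule sum.cong) (auto simp: ue uu_def I1_def)
      then have 1: "sum u A1 = h" using eh by (simp add: sum.cartesian_product)
      have "sum u I1 = (\<Sum>p\<in>I1. \<Sum>r\<in>A2. e (p, r))" by (rule sum.cong) (auto simp: ue uu_def)
      also have "\<dots> = (\<Sum>r\<in>A2. \<Sum>p\<in>I1. e (p, r))" by (rule sum.swap)
      also have "\<dots> = l" unfolding l_def by (rule sum.cong) (auto simp: ec I2_def)
      finally have "sum u A1 + sum u B1 = l" unfolding I1_def using fin dis by (subst (asm) sum.union_disjoint) auto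
      then show "u \<in> U" using 1 le by (auto simp: U_def sum_cut below_def ue vect_def uu_def I1_def cut_def)
    qed
    have inner: "(\<Sum>e\<in>{e \<in> S. uu e = u}. qv powi b e / pf (I1 \<times> I2) e) =
       (qv powi \<beta> u (\<lambda>p. d1 p - u p) / (pf I1 u * pf I1 (\<lambda>p. d1 p - u p))) * (qfac l * qfac (sum d2 B2) / (pf A2 d2 * pf B2 d2))" if u: "u \<in> U" for u
    proof -
      have ul: "u p \<le> d1 p" if "p \<in> I1" for p using Ubelow[OF u] that by (auto simp: below_def)
      have su: "sum u I1 = l"
      proof -
        have "sum u I1 = sum u A1 + sum u B1" unfolding I1_def using fin dis by (intro sum.union_disjoint) auto
        then show ?thesis using u by (simp add: U_def sum_cut)
      qed
      have "sum (\<lambda>p. d1 p - u p) I1 = sum d1 I1 - sum u I1" by (rule sum_subtractf_nat) (rule ul)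
      then have sv: "sum (\<lambda>p. d1 p - u p) I1 = sum d2 B2" using su sd sI2 by simp
      have disAB: "I1 \<times> A2 \<inter> I1 \<times> B2 = {}" using dis by auto
      have I12: "I1 \<times> I2 = I1 \<times> A2 \<union> I1 \<times> B2" by (auto simp: I2_def)
      have "(\<Sum>e\<in>{e \<in> S. uu e = u}. qv powi b e / pf (I1 \<times> I2) e) = (\<Sum>e\<in>{e \<in> S. uu e = u}. qv powi \<beta> u (\<lambda>p. d1 p - u p) *
         ((qv powi bA (cut (I1 \<times> A2) e) / pf (I1 \<times> A2) (cut (I1 \<times> A2) e)) * (qv powi bB (cut (I1 \<times> B2) e) / pf (I1 \<times> B2) (cut (I1 \<times> B2) e))))"
      proof (rule sum.cong[OF refl])
        fix e assume e: "e \<in> {e \<in> S. uu e = u}"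
        have "vv e p = d1 p - u p" if "p \<in> I1" for p
        proof -
          have "(\<Sum>r\<in>B2. cut (I1 \<times> B2) e (p, r)) = d1 p - u p" using e that unfolding part[OF u] by (auto simp: tables_def)
          moreover have "(\<Sum>r\<in>B2. cut (I1 \<times> B2) e (p, r)) = vv e p" unfolding vv_def using that by (intro sum.cong) (auto simp: cut_def)
          ultimately show ?thesis by simp
        qed
        then have "\<beta> u (vv e) = \<beta> u (\<lambda>p. d1 p - u p)" by (auto simp: \<beta>_def I1_def intro!: arg_cong2[of _ _ _ _ "(+)"] sum.cong)
        then have "b e = \<beta> u (\<lambda>p. d1 p - u p) + (bA (cut (I1 \<times> A2) e) + bB (cut (I1 \<times> B2) e))" using e by (simp add: b_def)
        moreover have "pf (I1 \<times> I2) e = pf (I1 \<times> A2) (cut (I1 \<times> A2) e) * pf (I1 \<times> B2) (cut (I1 \<times> B2) e)"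
          unfolding I12 using pf_Un[OF _ _ disAB, of e] finI fin by (simp add: pf_cut)
        ultimately show "qv powi b e / pf (I1 \<times> I2) e = qv powi \<beta> u (\<lambda>p. d1 p - u p) *
         ((qv powi bA (cut (I1 \<times> A2) e) / pf (I1 \<times> A2) (cut (I1 \<times> A2) e)) * (qv powi bB (cut (I1 \<times> B2) e) / pf (I1 \<times> B2) (cut (I1 \<times> B2) e)))"
          by (simp add: powi_add)
      qed
      also have "\<dots> = qv powi \<beta> u (\<lambda>p. d1 p - u p) * ((\<Sum>e | e \<in> vect (I1 \<times> A2) \<and> e \<in> tables I1 A2 u d2. qv powi bA e / pf (I1 \<times> A2) e) *
          (\<Sum>e | e \<in> vect (I1 \<times> B2) \<and> e \<in> tables I1 B2 (\<lambda>p. d1 p - u p) d2. qv powi bB e / pf (I1 \<times> B2) e))"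
        unfolding part[OF u] sum_distrib_left[symmetric]
        by (subst sum_vect_split[OF disAB, where P = "\<lambda>e. e \<in> tables I1 A2 u d2" and R = "\<lambda>e. e \<in> tables I1 B2 (\<lambda>p. d1 p - u p) d2"
              and g = "\<lambda>e. qv powi bA e / pf (I1 \<times> A2) e" and h = "\<lambda>e. qv powi bB e / pf (I1 \<times> B2) e"]) simp
      also have "{e. e \<in> vect (I1 \<times> A2) \<and> e \<in> tables I1 A2 u d2} = tables I1 A2 u d2" by (auto simp: tables_def)
      also have "{e. e \<in> vect (I1 \<times> B2) \<and> e \<in> tables I1 B2 (\<lambda>p. d1 p - u p) d2} = tables I1 B2 (\<lambda>p. d1 p - u p) d2" by (auto simp: tables_def)
      also have "(\<Sum>e\<in>tables I1 A2 u d2. qv powi bA e / pf (I1 \<times> A2) e) = qfac l / (pf I1 u * pf A2 d2)"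
        using bA(2)[of u d2] su by (simp add: l_def)
      also have "(\<Sum>e\<in>tables I1 B2 (\<lambda>p. d1 p - u p) d2. qv powi bB e / pf (I1 \<times> B2) e) =
          qfac (sum d2 B2) / (pf I1 (\<lambda>p. d1 p - u p) * pf B2 d2)"
        using bB(2)[of "\<lambda>p. d1 p - u p" d2] sv by simp
      finally show ?thesis by (simp add: ac_simps)
    qed
    have "(\<Sum>e\<in>S. qv powi b e / pf (I1 \<times> I2) e) = (\<Sum>u\<in>U. \<Sum>e\<in>{e \<in> S. uu e = u}. qv powi b e / pf (I1 \<times> I2) e)"
      by (rule sum.group[OF finS finU uuS, symmetric])
    also have "\<dots> = (\<Sum>u\<in>U. qv powi \<beta> u (\<lambda>p. d1 p - u p) / (pf I1 u * pf I1 (\<lambda>p. d1 p - u p))) * (qfac l * qfac (sum d2 B2) / (pf A2 d2 * pf B2 d2))"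
      by (simp only: inner sum_distrib_right cong: sum.cong)
    also have "(\<Sum>u\<in>U. qv powi \<beta> u (\<lambda>p. d1 p - u p) / (pf I1 u * pf I1 (\<lambda>p. d1 p - u p))) =
       (if h \<le> l then qb (sum d1 A1) h / pf A1 d1 * (qb (sum d1 B1) (l - h) / pf B1 d1) else 0)"
    proof -
      define g where "g = (\<lambda>u. qv powi (\<Sum>p\<in>A1. \<Sum>r\<in>A1. int (u p) * Q p r * int (d1 r - u r)) / (pf A1 u * pf A1 (\<lambda>p. d1 p - u p)))"
      define g' where "g' = (\<lambda>u. qv powi (\<Sum>p\<in>B1. \<Sum>r\<in>B1. int (u p) * R p r * int (d1 r - u r)) / (pf B1 u * pf B1 (\<lambda>p. d1 p - u p)))"
      have "qv powi \<beta> u (\<lambda>p. d1 p - u p) / (pf I1 u * pf I1 (\<lambda>p. d1 p - u p)) = g (cut A1 u) * g' (cut B1 u)" for u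
      proof -
        have 1: "g (cut A1 u) = g u"
          unfolding g_def pf_cut[OF subset_refl] by (rule arg_cong2[of _ _ _ _ "(/)"], rule arg_cong[of _ _ "\<lambda>n. qv powi n"], intro sum.cong refl)
            (auto simp: cut_def intro!: pf_cong)
        have 2: "g' (cut B1 u) = g' u"
          unfolding g'_def pf_cut[OF subset_refl] by (rule arg_cong2[of _ _ _ _ "(/)"], rule arg_cong[of _ _ "\<lambda>n. qv powi n"], intro sum.cong refl)
            (auto simp: cut_def intro!: pf_cong)
        show ?thesis unfolding 1 2 unfolding g_def g'_def I1_def pf_Un[OF fin(1,2) dis(1)] \<beta>_def powi_add[OF qv_nonzero] by (simp add: ac_simps)
      qed
      then have "(\<Sum>u\<in>U. qv powi \<beta> u (\<lambda>p. d1 p - u p) / (pf I1 u * pf I1 (\<lambda>p. d1 p - u p))) = (\<Sum>u\<in>U. g (cut A1 u) * g' (cut B1 u))" by simp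
      also have "\<dots> = (\<Sum>u | u \<in> vect A1 \<and> (u \<in> below A1 d1 \<and> sum u A1 = h). g u) * (\<Sum>u | u \<in> vect B1 \<and> (u \<in> below B1 d1 \<and> h + sum u B1 = l). g' u)"
        unfolding U_def I1_def by (rule sum_vect_split[OF dis(1)])
      also have "(\<Sum>u | u \<in> vect A1 \<and> (u \<in> below A1 d1 \<and> sum u A1 = h). g u) = qb (sum d1 A1) h / pf A1 d1"
        unfolding Q by (subst sum.inter_filter[OF finite_below[OF fin(1)], symmetric]) (auto intro!: sum.cong simp: g_def below_def)
      also have "(\<Sum>u | u \<in> vect B1 \<and> (u \<in> below B1 d1 \<and> h + sum u B1 = l). g' u) = (if h \<le> l then qb (sum d1 B1) (l - h) / pf B1 d1 else 0)"
      proof (cases "h \<le> l")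
        case True
        then show ?thesis
          unfolding R by (simp, subst sum.inter_filter[OF finite_below[OF fin(2)], symmetric]) (auto intro!: sum.cong simp: g'_def below_def)
      next
        case False
        then have "{u. u \<in> vect B1 \<and> (u \<in> below B1 d1 \<and> h + sum u B1 = l)} = {}" by auto
        then show ?thesis using False by simp
      qed
      finally show ?thesis by simp
    qed
    finally show "(if h \<le> sum d2 A2 then qb (sum d1 A1) h * qb (sum d1 B1) (sum d2 A2 - h) * qfac (sum d2 A2) * qfac (sum d2 B2) /
       (pf I1 d1 * pf I2 d2) else 0) =
      (\<Sum>e | e \<in> tables I1 I2 d1 d2 \<and> sum e (A1 \<times> A2) = h. qv powi b e / pf (I1 \<times> I2) e)"
      unfolding S_def[symmetric] by (simp add: l_def I1_def I2_def pf_Un[OF fin(1,2) dis(1)] pf_Un[OF fin(3,4) dis(2)])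
  qed
qed

section \<open>Absorbing a Pochhammer symbol\<close>

text \<open>
  \<open>(p, False)\<close> and \<open>(p, True)\<close> carry \<open>\<beta>\<^sub>p\<close> and \<open>\<alpha>\<^sub>p\<close> of the expansion of a Pochhammer symbol, \<open>base\<close> gives
  \<open>d\<^sub>p = \<alpha>\<^sub>p + \<beta>\<^sub>p\<close>.
\<close>

definition doubled :: "'i set \<Rightarrow> 'i set \<Rightarrow> ('i \<times> bool) set" where
  "doubled I R = I \<times> {False} \<union> R \<times> {True}"

definition base :: "'i set \<Rightarrow> ('i \<times> bool \<Rightarrow> nat) \<Rightarrow> 'i \<Rightarrow> nat" where
  "base R f = (\<lambda>p. f (p, False) + (if p \<in> R then f (p, True) else 0))"

lemma finite_doubled: "finite I \<Longrightarrow> R \<subseteq> I \<Longrightarrow> finite (doubled I R)"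
  by (auto simp: doubled_def intro: finite_subset)

lemma card_doubled: "finite I \<Longrightarrow> R \<subseteq> I \<Longrightarrow> card (doubled I R) = card I + card R"
proof -
  assume "finite I" "R \<subseteq> I"
  then have "finite R" by (rule rev_finite_subset)
  with \<open>finite I\<close> show ?thesis
    unfolding doubled_def by (subst card_Un_disjoint) (auto simp: card_cartesian_product)
qed

lemma lin_base:
  assumes "finite I" "R \<subseteq> I" "p \<in> I"
  shows "lin (doubled I R) (\<lambda>f. int (base R f p))"
  using finite_doubled[OF assms(1,2)] assms(3)
  by (cases "p \<in> R") (auto intro!: lin_add lin_component simp: doubled_def base_def)

lemma base_vect: "R \<subseteq> I \<Longrightarrow> f \<in> vect (doubled I R) \<Longrightarrow> base R f \<in> vect I"
  by (auto simp: base_def vect_def doubled_def)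

text \<open>The preimage under the projection that forgets the copy. It transports active indices,
  and the range of a second Pochhammer symbol, to the doubled set.\<close>

definition lift :: "'i set \<Rightarrow> 'i set \<Rightarrow> 'i set \<Rightarrow> ('i \<times> bool) set" where
  "lift I R A = {q \<in> doubled I R. fst q \<in> A}"

lemma lift_doubled: "A \<subseteq> I \<Longrightarrow> R \<subseteq> I \<Longrightarrow> lift I R A = doubled A (A \<inter> R)"
  by (auto simp: lift_def doubled_def)

lemma lift_subset: "lift I R A \<subseteq> doubled I R"
  by (auto simp: lift_def)

lemma lift_self: "R \<subseteq> I \<Longrightarrow> lift I R I = doubled I R"
  by (auto simp: lift_def doubled_def)

lemma sum_Times_single: "sum f (A \<times> {b}) = (\<Sum>p\<in>A. f (p, b))"
proof -
  have "(\<Sum>p\<in>A. \<Sum>c\<in>{b}. f (p, c)) = sum f (A \<times> {b})"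
    unfolding sum.cartesian_product by (rule sum.cong) auto
  then show ?thesis by simp
qed

lemma sum_base:
  assumes "finite I" "R \<subseteq> I" "A \<subseteq> I"
  shows "sum (base R f) A = sum f (lift I R A)"
proof -
  have fin: "finite A" using assms finite_subset by auto
  have "sum f (lift I R A) = sum f (A \<times> {False}) + sum f ((A \<inter> R) \<times> {True})"
    unfolding lift_doubled[OF assms(3,2)] doubled_def using fin by (intro sum.union_disjoint) auto
  also have "\<dots> = (\<Sum>p\<in>A. f (p, False)) + (\<Sum>p\<in>A \<inter> R. f (p, True))"
    by (simp add: sum_Times_single)
  also have "(\<Sum>p\<in>A \<inter> R. f (p, True)) = (\<Sum>p\<in>A. if p \<in> R then f (p, True) else 0)"
    using fin by (rule sum.inter_restrict)
  finally show ?thesis by (simp add: base_def sum.distrib)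
qed

text \<open>Entries in R are split into \<alpha> + \<beta> by \<open>multi_poch\<close>, the others
  keep their denominators. The fibre of \<open>base\<close> over e is parametrised by the vectors
  \<alpha> \<le> e.\<close>

lemma absorb:
  assumes fin: "finite I" and R: "R \<subseteq> I"
  shows "\<exists>b. quad (doubled I R) b \<and> (\<forall>e\<in>vect I. \<forall>x. poch x (sum e R) / pf I e =
    (\<Sum>f | f \<in> vect (doubled I R) \<and> base R f = e.
       (- x * inverse qv) ^ sum f (R \<times> {True}) * qv powi b f / pf (doubled I R) f))"
proof -
  have finR: "finite R" using fin R by (rule rev_finite_subset)
  obtain Q where Q: "\<And>d x. poch x (sum d R) / pf R d =
    (\<Sum>u\<in>below R d. (- x * inverse qv) ^ sum u R *
       qv powi ((\<Sum>p\<in>R. int (u p) * int (u p)) + (\<Sum>p\<in>R. \<Sum>r\<in>R. int (u p) * Q p r * int (d r))) / (pf R u * pf R (\<lambda>p. d p - u p)))"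
    using multi_poch[OF finR] by blast
  define b where "b = (\<lambda>f. (\<Sum>p\<in>R. int (f (p, True)) * int (f (p, True))) +
     (\<Sum>p\<in>R. \<Sum>r\<in>R. int (f (p, True)) * Q p r * int (base R f r)))"
  have fin2: "finite (doubled I R)" using finite_doubled[OF fin R] .
  have quadb: "quad (doubled I R) b"
    unfolding b_def
  proof (intro quad_add quad_sum)
    fix p assume p: "p \<in> R"
    then have l: "lin (doubled I R) (\<lambda>f. int (f (p, True)))"
      using fin2 by (intro lin_component) (auto simp: doubled_def)
    then show "quad (doubled I R) (\<lambda>f. int (f (p, True)) * int (f (p, True)))" by (intro quad_mult)
    fix r assume r: "r \<in> R"
    have "quad (doubled I R) (\<lambda>f. Q p r * (int (f (p, True)) * int (base R f r)))"
      using r R by (intro quad_cmult quad_mult l lin_base[OF fin R]) auto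
    then show "quad (doubled I R) (\<lambda>f. int (f (p, True)) * Q p r * int (base R f r))" by (simp add: ac_simps)
  qed
  show ?thesis
  proof (intro exI[of _ b] conjI quadb ballI allI)
    fix e x assume e: "e \<in> vect I"
    have "pf I e = pf R e * pf (I - R) e"
      using pf_Un[of R "I - R" e] fin finR R by (simp add: Un_absorb1)
    then have "poch x (sum e R) / pf I e = poch x (sum e R) / pf R e / pf (I - R) e" by simp
    also have "\<dots> = (\<Sum>u\<in>below R e. (- x * inverse qv) ^ sum u R *
       qv powi ((\<Sum>p\<in>R. int (u p) * int (u p)) + (\<Sum>p\<in>R. \<Sum>r\<in>R. int (u p) * Q p r * int (e r))) / (pf R u * pf R (\<lambda>p. e p - u p)) / pf (I - R) e)"
      unfolding Q by (rule sum_divide_distrib)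
    also have "\<dots> = (\<Sum>f | f \<in> vect (doubled I R) \<and> base R f = e.
       (- x * inverse qv) ^ sum f (R \<times> {True}) * qv powi b f / pf (doubled I R) f)"
    proof (rule sum.reindex_bij_witness[of _ "\<lambda>f p. f (p, True)" "\<lambda>u (p, t). if t then u p else e p - u p"])
      fix u assume u: "u \<in> below R e"
      define f where "f = (\<lambda>(p, t). if t then u p else e p - u p)"
      have u0: "u p = 0" if "p \<notin> R" for p using u that by (auto simp: below_def vect_def)
      have fT: "f (p, True) = u p" and fF: "f (p, False) = e p - u p" for p by (simp_all add: f_def)
      have bf: "base R f = e" using u by (auto simp: base_def fT fF below_def vect_def fun_eq_iff)
      show "(\<lambda>p. (case (p, True) of (p, t) \<Rightarrow> if t then u p else e p - u p)) = u" by simp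
      show "(\<lambda>(p, t). if t then u p else e p - u p) \<in> {f \<in> vect (doubled I R). base R f = e}"
        using bf e u0 unfolding f_def[symmetric] by (auto simp: vect_def doubled_def f_def)
      have sf: "sum f (R \<times> {True}) = sum u R"
        by (simp add: sum_Times_single fT)
      have pff: "pf (doubled I R) f = pf R u * pf R (\<lambda>p. e p - u p) * pf (I - R) e"
      proof -
        have "pf (doubled I R) f = pf (I \<times> {False}) f * pf (R \<times> {True}) f"
          unfolding doubled_def using fin finR by (intro pf_Un) auto
        also have "pf (I \<times> {False}) f = pf I (\<lambda>p. e p - u p)" by (simp add: pf_Times fF)
        also have "\<dots> = pf R (\<lambda>p. e p - u p) * pf (I - R) (\<lambda>p. e p - u p)"
          using pf_Un[of R "I - R" "\<lambda>p. e p - u p"] fin finR R by (simp add: Un_absorb1)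
        also have "pf (I - R) (\<lambda>p. e p - u p) = pf (I - R) e" by (rule pf_cong) (simp add: u0)
        also have "pf (R \<times> {True}) f = pf R u" by (simp add: pf_Times fT)
        finally show ?thesis by (simp add: ac_simps)
      qed
      show "(- x * inverse qv) ^ sum (\<lambda>(p, t). if t then u p else e p - u p) (R \<times> {True}) *
          qv powi b (\<lambda>(p, t). if t then u p else e p - u p) / pf (doubled I R) (\<lambda>(p, t). if t then u p else e p - u p) =
        (- x * inverse qv) ^ sum u R *
       qv powi ((\<Sum>p\<in>R. int (u p) * int (u p)) + (\<Sum>p\<in>R. \<Sum>r\<in>R. int (u p) * Q p r * int (e r))) / (pf R u * pf R (\<lambda>p. e p - u p)) / pf (I - R) e"
        unfolding f_def[symmetric] sf pff b_def fT bf by simp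
    next
      fix f assume f: "f \<in> {f \<in> vect (doubled I R). base R f = e}"
      then have fv: "f \<in> vect (doubled I R)" and ef: "e = base R f" by auto
      have fT: "f (p, True) = 0" if "p \<notin> R" for p using fv that by (auto simp: vect_def doubled_def)
      show "(\<lambda>(p, t). if t then f (p, True) else e p - f (p, True)) = f"
        unfolding ef base_def using fT by (auto simp: fun_eq_iff)
      show "(\<lambda>p. f (p, True)) \<in> below R e"
        unfolding ef using fT by (auto simp: below_def vect_def base_def)
    qed
    finally show "poch x (sum e R) / pf I e = (\<Sum>f | f \<in> vect (doubled I R) \<and> base R f = e.
       (- x * inverse qv) ^ sum f (R \<times> {True}) * qv powi b f / pf (doubled I R) f)" .
  qed
qed

text \<open>The offset 2 in the argument keeps the result a monomial. It makes \<open>-x/q\<close>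
  equal to -q times a power of q; raised to the sum of the \<alpha>, that power has an exponent
  consisting of N times a linear form and a quadratic form.\<close>

lemma absorb_mono:
  assumes fin: "finite I" and R: "R \<subseteq> I" and \<omega>: "qmono I \<omega>" and y: "lin I y"
  shows "\<exists>\<omega>'. qmono (doubled I R) \<omega>' \<and> (\<forall>N. \<forall>e\<in>vect I.
    \<omega> N e * poch (qv powi (int N * n0 + y e + 2)) (sum e R) / pf I e =
    (\<Sum>f | f \<in> vect (doubled I R) \<and> base R f = e. \<omega>' N f / pf (doubled I R) f))"
proof -
  obtain b where b: "quad (doubled I R) b" "\<And>e x. e \<in> vect I \<Longrightarrow> poch x (sum e R) / pf I e =
    (\<Sum>f | f \<in> vect (doubled I R) \<and> base R f = e.
       (- x * inverse qv) ^ sum f (R \<times> {True}) * qv powi b f / pf (doubled I R) f)"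
    using absorb[OF fin R] by blast
  define n where "n = (\<lambda>f::'a \<times> bool \<Rightarrow> nat. int (sum f (R \<times> {True})))"
  have linn: "lin (doubled I R) n"
    unfolding n_def using finite_doubled[OF fin R] by (rule lin_sum_subset) (auto simp: doubled_def)
  define \<omega>' where "\<omega>' = (\<lambda>N f. \<omega> N (base R f) * ((- qv) powi n f * qv powi (int N * (n0 * n f) + (n f * y (base R f) + b f))))"
  have "qmono (doubled I R) \<omega>'"
    unfolding \<omega>'_def
  proof (rule mono_mult)
    show "qmono (doubled I R) (\<lambda>N f. \<omega> N (base R f))"
      by (rule mono_comp[OF \<omega> lin_base[OF fin R]])
    show "qmono (doubled I R) (\<lambda>N f. (- qv) powi n f * qv powi (int N * (n0 * n f) + (n f * y (base R f) + b f)))"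
      by (rule qmonoI[OF linn lin_cmult[OF linn] quad_add[OF quad_mult[OF linn lin_comp[OF y lin_base[OF fin R]]] b(1)]]) simp_all
  qed
  moreover have "\<omega> N e * poch (qv powi (int N * n0 + y e + 2)) (sum e R) / pf I e =
    (\<Sum>f | f \<in> vect (doubled I R) \<and> base R f = e. \<omega>' N f / pf (doubled I R) f)" if e: "e \<in> vect I" for N e
  proof -
    have "\<omega> N e * poch (qv powi (int N * n0 + y e + 2)) (sum e R) / pf I e = \<omega> N e * (poch (qv powi (int N * n0 + y e + 2)) (sum e R) / pf I e)" by simp
    also have "\<dots> = (\<Sum>f | f \<in> vect (doubled I R) \<and> base R f = e. \<omega>' N f / pf (doubled I R) f)"
      unfolding b(2)[OF e] sum_distrib_left
    proof (rule sum.cong[OF refl])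
      fix f assume f: "f \<in> {f \<in> vect (doubled I R). base R f = e}"
      define m where "m = sum f (R \<times> {True})"
      have "- (qv powi (int N * n0 + y e + 2)) * inverse qv = (- qv) * qv powi (int N * n0 + y e)"
        by (simp add: powi_add power2_eq_square)
      then have "(- (qv powi (int N * n0 + y e + 2)) * inverse qv) ^ m = (- qv) powi int m * qv powi ((int N * n0 + y e) * int m)"
        by (simp only: power_mult_distrib power_int_mult power_int_of_nat)
      also have "(int N * n0 + y e) * int m = int N * (n0 * n f) + n f * y (base R f)"
        using f by (simp add: n_def m_def algebra_simps)
      finally show "\<omega> N e * ((- (qv powi (int N * n0 + y e + 2)) * inverse qv) ^ sum f (R \<times> {True}) * qv powi b f / pf (doubled I R) f) =
         \<omega>' N f / pf (doubled I R) f"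
        using f unfolding m_def[symmetric] \<omega>'_def n_def
        by (simp add: m_def powi_add ac_simps)
    qed
    finally show ?thesis .
  qed
  ultimately show ?thesis by blast
qed

text \<open>The second symbol is absorbed over the already doubled set, with the lift of R2 as its
  range. Entries in both ranges thus end up with four copies.\<close>

lemma absorb_twice:
  assumes fin: "finite I" and R: "R1 \<subseteq> I" "R2 \<subseteq> I" and \<omega>: "qmono I \<omega>" and y: "lin I y1" "lin I y2"
  defines "I' \<equiv> doubled I R1" and "R' \<equiv> lift I R1 R2"
  shows "\<exists>\<omega>'. qmono (doubled I' R') \<omega>' \<and> (\<forall>N. \<forall>e\<in>vect I.
    \<omega> N e * poch (qv powi (int N * n1 + y1 e + 2)) (sum e R1) * poch (qv powi (int N * n2 + y2 e + 2)) (sum e R2) / pf I e =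
    (\<Sum>f | f \<in> vect (doubled I' R') \<and> base R1 (base R' f) = e. \<omega>' N f / pf (doubled I' R') f))"
proof -
  have fin': "finite I'" unfolding I'_def using fin R(1) by (rule finite_doubled)
  have R': "R' \<subseteq> I'" unfolding I'_def R'_def by (rule lift_subset)
  obtain \<omega>1 where \<omega>1: "qmono I' \<omega>1" "\<And>N e. e \<in> vect I \<Longrightarrow>
    \<omega> N e * poch (qv powi (int N * n1 + y1 e + 2)) (sum e R1) / pf I e =
    (\<Sum>f | f \<in> vect I' \<and> base R1 f = e. \<omega>1 N f / pf I' f)"
    using absorb_mono[OF fin R(1) \<omega> y(1), of n1] unfolding I'_def by blast
  have y2': "lin I' (\<lambda>f. y2 (base R1 f))" unfolding I'_def by (rule lin_comp[OF y(2) lin_base[OF fin R(1)]])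
  obtain \<omega>2 where \<omega>2: "qmono (doubled I' R') \<omega>2" "\<And>N e. e \<in> vect I' \<Longrightarrow>
    \<omega>1 N e * poch (qv powi (int N * n2 + y2 (base R1 e) + 2)) (sum e R') / pf I' e =
    (\<Sum>f | f \<in> vect (doubled I' R') \<and> base R' f = e. \<omega>2 N f / pf (doubled I' R') f)"
    using absorb_mono[OF fin' R' \<omega>1(1) y2', of n2] by blast
  have "\<omega> N e * poch (qv powi (int N * n1 + y1 e + 2)) (sum e R1) * poch (qv powi (int N * n2 + y2 e + 2)) (sum e R2) / pf I e =
    (\<Sum>f | f \<in> vect (doubled I' R') \<and> base R1 (base R' f) = e. \<omega>2 N f / pf (doubled I' R') f)" if e: "e \<in> vect I" for N e
  proof -
    have finF: "finite {f \<in> vect I'. base R1 f = e}"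
      by (rule finite_subset[OF _ finite_vect_sum[OF fin', of "sum e I"]])
        (use sum_base[OF fin R(1) subset_refl] lift_self[OF R(1)] in \<open>auto simp: I'_def\<close>)
    have finG: "finite {f \<in> vect (doubled I' R'). base R1 (base R' f) = e}"
    proof (rule finite_subset[OF _ finite_vect_sum[OF finite_doubled[OF fin' R'], of "sum e I"]], rule subsetI)
      fix f assume f: "f \<in> {f \<in> vect (doubled I' R'). base R1 (base R' f) = e}"
      have "sum f (doubled I' R') = sum (base R' f) I'" using sum_base[OF fin' R' subset_refl] lift_self[OF R'] by simp
      also have "\<dots> = sum (base R1 (base R' f)) I" using sum_base[OF fin R(1) subset_refl] lift_self[OF R(1)] by (simp add: I'_def)
      finally show "f \<in> {f \<in> vect (doubled I' R'). sum f (doubled I' R') = sum e I}" using f by simp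
    qed
    have "\<omega> N e * poch (qv powi (int N * n1 + y1 e + 2)) (sum e R1) * poch (qv powi (int N * n2 + y2 e + 2)) (sum e R2) / pf I e =
      (\<Sum>f | f \<in> vect I' \<and> base R1 f = e. \<omega>1 N f / pf I' f) * poch (qv powi (int N * n2 + y2 e + 2)) (sum e R2)"
      by (simp only: \<omega>1(2)[OF e, of N, symmetric] times_divide_eq_left)
    also have "\<dots> = (\<Sum>f | f \<in> vect I' \<and> base R1 f = e. \<Sum>g | g \<in> vect (doubled I' R') \<and> base R' g = f. \<omega>2 N g / pf (doubled I' R') g)"
      unfolding sum_distrib_right
    proof (rule sum.cong[OF refl])
      fix f assume f: "f \<in> {f \<in> vect I'. base R1 f = e}"
      then have "sum e R2 = sum f R'" using sum_base[OF fin R(1,2), of f] by (simp add: R'_def)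
      then show "\<omega>1 N f / pf I' f * poch (qv powi (int N * n2 + y2 e + 2)) (sum e R2) =
         (\<Sum>g | g \<in> vect (doubled I' R') \<and> base R' g = f. \<omega>2 N g / pf (doubled I' R') g)"
        using f \<omega>2(2)[of f N] by auto
    qed
    also have "\<dots> = (\<Sum>f\<in>{f \<in> vect I'. base R1 f = e}. \<Sum>g\<in>{g \<in> {g \<in> vect (doubled I' R'). base R1 (base R' g) = e}. base R' g = f}. \<omega>2 N g / pf (doubled I' R') g)"
      by (intro sum.cong refl) auto
    also have "\<dots> = (\<Sum>g\<in>{g \<in> vect (doubled I' R'). base R1 (base R' g) = e}. \<omega>2 N g / pf (doubled I' R') g)"
      by (rule sum.group[OF finG finF]) (auto intro: base_vect[OF R'])
    finally show ?thesis .
  qed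
  with \<omega>2(1) show ?thesis by blast
qed

section \<open>Quiver forms as sums over finitely supported vectors\<close>

lemma at_rank_superset:
  assumes "finite K" "Poly_Mapping.keys p \<subseteq> K"
  shows "at_rank N p = (\<Sum>n\<in>K. Poly_Mapping.lookup p n * qv powi (int N * n))"
  unfolding at_rank_def using assms by (intro sum.mono_neutral_left) (auto simp: in_keys_iff)

lemma at_rank_add: "at_rank N (p + r) = at_rank N p + at_rank N r"
proof -
  let ?K = "Poly_Mapping.keys p \<union> Poly_Mapping.keys r"
  have "at_rank N s = (\<Sum>n\<in>?K. Poly_Mapping.lookup s n * qv powi (int N * n))" if "s \<in> {p, r, p + r}" for s
    using that keys_add[of p r] by (intro at_rank_superset) auto
  then show ?thesis by (simp add: lookup_add distrib_right sum.distrib)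
qed

lemma at_rank_0 [simp]: "at_rank N 0 = 0"
  by (simp add: at_rank_def)

lemma at_rank_sum: "at_rank N (\<Sum>x\<in>X. p x) = (\<Sum>x\<in>X. at_rank N (p x))"
  by (induction X rule: infinite_finite_induct) (simp_all add: at_rank_add)

lemma at_rank_single: "at_rank N (Poly_Mapping.single n c) = c * qv powi (int N * n)"
  by (subst at_rank_superset[of "{n}"]) simp_all

text \<open>The coefficient of a form over an arbitrary finite index set. The numerators of the two
  multinomials and the extra factor depend only on j and k and are taken out of the sum, leaving one
  denominator \<open>pf\<close>.\<close>

definition form_sum :: "nat \<Rightarrow> (nat \<Rightarrow> nat \<Rightarrow> qfield) \<Rightarrow> 'i set \<Rightarrow> 'i set \<Rightarrow> (('i \<Rightarrow> nat) \<Rightarrow> qfield) \<Rightarrow> nat \<Rightarrow> nat \<Rightarrow> qfield" where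
  "form_sum c extra I A \<omega> j k = (\<Sum>d | d \<in> vect I \<and> sum d I = j \<and> sum d A = k. \<omega> d / pf I d) *
     (qfac k * qfac (j - k) * extra k (j - k) / qfac j ^ c)"

definition quiver_mono :: "quiver_data \<Rightarrow> nat \<Rightarrow> (nat \<Rightarrow> nat) \<Rightarrow> qfield" where
  "quiver_mono D N d = (-qv) powi (\<Sum>i<num_indices D. vecS D i * int (d i)) *
     qv powi (int N * (\<Sum>i<num_indices D. vecA D i * int (d i)) +
       (\<Sum>i<num_indices D. \<Sum>l<num_indices D. int (d i) * matQ D i l * int (d l)))"

lemma mono_quiver_mono: "qmono {..<num_indices D} (quiver_mono D)"
  by (rule qmonoI[of _ "\<lambda>d. \<Sum>i<num_indices D. vecS D i * int (d i)" "\<lambda>d. \<Sum>i<num_indices D. vecA D i * int (d i)"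
        "\<lambda>d. \<Sum>i<num_indices D. \<Sum>l<num_indices D. int (d i) * matQ D i l * int (d l)"])
    (auto simp: lin_def quad_def quiver_mono_def)

lemma qmultinomial_map: "qmultinomial (map f [a..<b]) = qfac (sum f {a..<b}) / pf {a..<b} f"
  using prod.distinct_set_conv_list[of "[a..<b]" "\<lambda>i. qfac (f i)"]
  by (simp add: qmultinomial_def pf_def interv_sum_list_conv_sum_set_nat comp_def)

text \<open>\<open>homfly\<close> sees coefficients only through their values at a =
  \<open>q^N\<close>, so all forms are compared there, with no need to argue about Laurent
  polynomials in a.\<close>

lemma at_rank_quiver_coeff:
  "at_rank N (quiver_coeff c extra D j k) = form_sum c extra {..<num_indices D} {..<active D} (quiver_mono D N) j k"
proof -
  define m r where "m = active D" and "r = num_indices D"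
  have mr: "m \<le> r" by (simp add: m_def r_def num_indices_def)
  define G where "G = (\<lambda>d. ((- qv) powi lin_form r (vecS D) d * qv powi quad_form r (matQ D) d *
           qmultinomial (take m d) * qmultinomial (drop m d) *
           extra (sum_list (take m d)) (sum_list (drop m d)) / qfac (sum_list d) ^ c) * qv powi (int N * lin_form r (vecA D) d))"
  have "at_rank N (quiver_coeff c extra D j k) = (\<Sum>d \<in> {d. length d = r \<and> sum_list d = j \<and> sum_list (take m d) = k}. G d)"
    by (simp add: quiver_coeff_def Let_def at_rank_sum at_rank_single G_def m_def r_def)
  also have "\<dots> = (\<Sum>f | f \<in> vect {..<r} \<and> sum f {..<r} = j \<and> sum f {..<m} = k. G (map f [0..<r]))"
  proof (rule sum.reindex_bij_witness[of _ "\<lambda>f. map f [0..<r]" "\<lambda>d i. if i < r then d ! i else 0"])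
    fix d assume d: "d \<in> {d. length d = r \<and> sum_list d = j \<and> sum_list (take m d) = k}"
    then have md: "map (\<lambda>i. if i < r then d ! i else 0) [0..<r] = d" by (intro nth_equalityI) auto
    then show "map (\<lambda>i. if i < r then d ! i else 0) [0..<r] = d" .
    have "sum_list d = (\<Sum>i<r. d ! i)" using d by (simp add: sum_list_sum_nth atLeast0LessThan)
    moreover have "sum_list (take m d) = (\<Sum>i<m. d ! i)" using d mr by (simp add: sum_list_sum_nth atLeast0LessThan)
    ultimately show "(\<lambda>i. if i < r then d ! i else 0) \<in> {f. f \<in> vect {..<r} \<and> sum f {..<r} = j \<and> sum f {..<m} = k}"
      using d mr by (auto simp: vect_def intro!: sum.cong)
    show "G (map (\<lambda>i. if i < r then d ! i else 0) [0..<r]) = G d" unfolding md ..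
  next
    fix f assume f: "f \<in> {f. f \<in> vect {..<r} \<and> sum f {..<r} = j \<and> sum f {..<m} = k}"
    then show "(\<lambda>i. if i < r then map f [0..<r] ! i else 0) = f" by (auto simp: vect_def fun_eq_iff)
    show "map f [0..<r] \<in> {d. length d = r \<and> sum_list d = j \<and> sum_list (take m d) = k}"
      using f mr by (simp add: take_map interv_sum_list_conv_sum_set_nat atLeast0LessThan)
  qed
  also have "\<dots> = (\<Sum>f | f \<in> vect {..<r} \<and> sum f {..<r} = j \<and> sum f {..<m} = k. quiver_mono D N f / pf {..<r} f *
      (qfac k * qfac (j - k) * extra k (j - k) / qfac j ^ c))"
  proof (rule sum.cong[OF refl])
    fix f assume f: "f \<in> {f. f \<in> vect {..<r} \<and> sum f {..<r} = j \<and> sum f {..<m} = k}"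
    have u: "{..<r} = {..<m} \<union> {m..<r}" using mr by auto
    have s: "sum f {..<r} = sum f {..<m} + sum f {m..<r}" unfolding u by (rule sum.union_disjoint) auto
    have p: "pf {..<r} f = pf {..<m} f * pf {m..<r} f" unfolding u by (rule pf_Un) auto
    have l: "lin_form r v (map f [0..<r]) = (\<Sum>i<r. v i * int (f i))" for v
      unfolding lin_form_def by (rule sum.cong) auto
    have qf: "quad_form r M (map f [0..<r]) = (\<Sum>i<r. \<Sum>l<r. int (f i) * M i l * int (f l))" for M
      unfolding quad_form_def by (intro sum.cong) auto
    have t: "take m (map f [0..<r]) = map f [0..<m]" "drop m (map f [0..<r]) = map f [m..<r]"
      using mr by (simp_all add: take_map drop_map)
    have sl: "sum_list (map f [a..<b]) = sum f {a..<b}" for a b by (simp add: interv_sum_list_conv_sum_set_nat)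
    have jk: "sum f {m..<r} = j - k" "sum f {0..<m} = k" "sum f {0..<r} = j" using f s by (auto simp: atLeast0LessThan)
    show "G (map f [0..<r]) = quiver_mono D N f / pf {..<r} f * (qfac k * qfac (j - k) * extra k (j - k) / qfac j ^ c)"
      unfolding G_def t qmultinomial_map sl jk l qf quiver_mono_def r_def[symmetric] p powi_add[OF qv_nonzero]
      by (simp add: atLeast0LessThan ac_simps)
  qed
  finally show ?thesis
    unfolding form_sum_def sum_distrib_right m_def r_def .
qed

text \<open>Enumerate I with the indices of A first and read off the linear and quadratic exponents.
  The data do not depend on N, c, j or the extra factor, as the quantifiers express.\<close>

lemma quiver_of_form:
  assumes fin: "finite I" and A: "A \<subseteq> I" and \<omega>: "qmono I \<omega>"
  shows "\<exists>D. active D = card A \<and> inactive D = card (I - A) \<and>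
    (\<forall>N c extra j k. at_rank N (quiver_coeff c extra D j k) = form_sum c extra I A (\<omega> N) j k)"
proof -
  obtain s a b where sab: "\<And>N e. \<omega> N e = (-qv) powi (\<Sum>p\<in>I. s p * int (e p)) *
     qv powi (int N * (\<Sum>p\<in>I. a p * int (e p)) + (\<Sum>p\<in>I. \<Sum>r\<in>I. int (e p) * b p r * int (e r)))"
  proof -
    obtain s a b where *: "lin I s" "lin I a" "quad I b" "\<omega> = (\<lambda>N e. (-qv) powi s e * qv powi (int N * a e + b e))"
      using \<omega> unfolding qmono_def by blast
    obtain s' where s': "\<And>e. s e = (\<Sum>p\<in>I. s' p * int (e p))" using *(1) unfolding lin_def by blast
    obtain a' where a': "\<And>e. a e = (\<Sum>p\<in>I. a' p * int (e p))" using *(2) unfolding lin_def by blast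
    obtain b' where b': "\<And>e. b e = (\<Sum>p\<in>I. \<Sum>r\<in>I. int (e p) * b' p r * int (e r))" using *(3) unfolding quad_def by blast
    show thesis by (rule that[of s' a' b']) (simp only: *(4) s' a' b')
  qed
  define m n where "m = card A" and "n = card (I - A)"
  have finA: "finite A" using fin A finite_subset by auto
  obtain g1 where g1: "bij_betw g1 {0..<m} A" using ex_bij_betw_nat_finite[OF finA] unfolding m_def by blast
  obtain g2 where g2: "bij_betw g2 {0..<n} (I - A)" using ex_bij_betw_nat_finite[of "I - A"] fin unfolding n_def by blast
  define g where "g = (\<lambda>i. if i < m then g1 i else g2 (i - m))"
  have gA: "bij_betw g {..<m} A"
    using g1 bij_betw_cong[of "{..<m}" g g1 A] by (simp add: g_def atLeast0LessThan)
  have "bij_betw (\<lambda>i. i - m) {m..<m + n} {0..<n}"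
    by (rule bij_betw_byWitness[of _ "\<lambda>i. i + m"]) auto
  from bij_betw_trans[OF this g2] have gB: "bij_betw g {m..<m + n} (I - A)"
    using bij_betw_cong[of "{m..<m + n}" g "g2 \<circ> (\<lambda>i. i - m)" "I - A"] by (simp add: g_def)
  have u: "{..<m + n} = {..<m} \<union> {m..<m + n}" by auto
  have gI: "bij_betw g {..<m + n} I"
    using bij_betw_combine[OF gA gB] A unfolding u by (simp add: Un_absorb1)
  define gi where "gi = inv_into {..<m + n} g"
  have gig: "gi (g i) = i" if "i < m + n" for i
    using gI that unfolding gi_def by (intro inv_into_f_f) (auto simp: bij_betw_def)
  have ggi: "g (gi p) = p" "gi p < m + n" if "p \<in> I" for p
    using gI that unfolding gi_def bij_betw_def by (auto simp: f_inv_into_f)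
  have gin: "g i \<in> I" if "i < m + n" for i using gI that by (auto simp: bij_betw_def)
  define D where "D = \<lparr>active = m, inactive = n, vecS = (\<lambda>i. s (g i)), vecA = (\<lambda>i. a (g i)), matQ = (\<lambda>i l. b (g i) (g l))\<rparr>"
  have r: "num_indices D = m + n" by (simp add: D_def num_indices_def)
  have "at_rank N (quiver_coeff c extra D j k) = form_sum c extra I A (\<omega> N) j k" for N c extra j k
  proof -
    have "(\<Sum>d | d \<in> vect {..<m + n} \<and> sum d {..<m + n} = j \<and> sum d {..<m} = k. quiver_mono D N d / pf {..<m + n} d)
        = (\<Sum>e | e \<in> vect I \<and> sum e I = j \<and> sum e A = k. \<omega> N e / pf I e)"
    proof (rule sum.reindex_bij_witness[of _ "\<lambda>e i. if i < m + n then e (g i) else 0" "\<lambda>d p. if p \<in> I then d (gi p) else 0"])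
      fix d assume d: "d \<in> {d. d \<in> vect {..<m + n} \<and> sum d {..<m + n} = j \<and> sum d {..<m} = k}"
      define e where "e = (\<lambda>p. if p \<in> I then d (gi p) else 0)"
      have eg: "e (g i) = d i" if "i < m + n" for i using gin[OF that] gig[OF that] by (simp add: e_def)
      show "(\<lambda>i. if i < m + n then (if g i \<in> I then d (gi (g i)) else 0) else 0) = d"
        using d gin gig by (auto simp: vect_def fun_eq_iff)
      have sI: "(\<Sum>p\<in>I. h p) = (\<Sum>i<m + n. h (g i))" for h :: "'a \<Rightarrow> nat" using sum.reindex_bij_betw[OF gI, of h] by simp
      have sA: "(\<Sum>p\<in>A. h p) = (\<Sum>i<m. h (g i))" for h :: "'a \<Rightarrow> nat" using sum.reindex_bij_betw[OF gA, of h] by simp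
      have sZ: "(\<Sum>p\<in>I. h p) = (\<Sum>i<m + n. h (g i))" for h :: "'a \<Rightarrow> int" using sum.reindex_bij_betw[OF gI, of h] by simp
      have "sum e I = sum d {..<m + n}" unfolding sI by (rule sum.cong) (auto simp: eg)
      moreover have "sum e A = sum d {..<m}" unfolding sA by (rule sum.cong) (auto simp: eg)
      moreover have "e \<in> vect I" by (simp add: e_def vect_def)
      ultimately show "(\<lambda>p. if p \<in> I then d (gi p) else 0) \<in> {e. e \<in> vect I \<and> sum e I = j \<and> sum e A = k}"
        using d unfolding e_def[symmetric] by simp
      have pI: "pf I e = pf {..<m + n} d"
        unfolding pf_def prod.reindex_bij_betw[OF gI, symmetric] by (rule prod.cong) (auto simp: eg)
      have "\<omega> N e = quiver_mono D N d"
      proof -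
        have "(\<Sum>i<m + n. s (g i) * int (e (g i))) = (\<Sum>i<m + n. vecS D i * int (d i))"
          "(\<Sum>i<m + n. a (g i) * int (e (g i))) = (\<Sum>i<m + n. vecA D i * int (d i))"
          "(\<Sum>i<m + n. \<Sum>l<m + n. int (e (g i)) * b (g i) (g l) * int (e (g l))) = (\<Sum>i<m + n. \<Sum>l<m + n. int (d i) * matQ D i l * int (d l))"
          by (auto intro!: sum.cong simp: eg D_def)
        then show ?thesis unfolding sab quiver_mono_def r sZ by simp
      qed
      then show "\<omega> N (\<lambda>p. if p \<in> I then d (gi p) else 0) / pf I (\<lambda>p. if p \<in> I then d (gi p) else 0) = quiver_mono D N d / pf {..<m + n} d"
        unfolding e_def[symmetric] pI by simp
    next
      fix e assume e: "e \<in> {e. e \<in> vect I \<and> sum e I = j \<and> sum e A = k}"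
      define d where "d = (\<lambda>i. if i < m + n then e (g i) else 0)"
      show "(\<lambda>p. if p \<in> I then (if gi p < m + n then e (g (gi p)) else 0) else 0) = e"
        using e ggi by (auto simp: vect_def fun_eq_iff)
      have "sum d {..<m + n} = sum e I" unfolding sum.reindex_bij_betw[OF gI, symmetric] by (rule sum.cong) (auto simp: d_def)
      moreover have "sum d {..<m} = sum e A" unfolding sum.reindex_bij_betw[OF gA, symmetric] by (rule sum.cong) (auto simp: d_def)
      moreover have "d \<in> vect {..<m + n}" by (simp add: d_def vect_def)
      ultimately show "(\<lambda>i. if i < m + n then e (g i) else 0) \<in> {d. d \<in> vect {..<m + n} \<and> sum d {..<m + n} = j \<and> sum d {..<m} = k}"
        using e unfolding d_def[symmetric] by simp
    qed
    then show ?thesis unfolding at_rank_quiver_coeff r form_sum_def by (simp add: D_def)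
  qed
  then show ?thesis by (intro exI[of _ D]) (simp add: D_def m_def n_def)
qed

text \<open>The former inactive indices are declared active; since the total is j, an activity k
  becomes j - k. This matches the reindexing of webs under a quarter turn.\<close>

lemma quiver_swap:
  "\<exists>D'. active D' = inactive D \<and> inactive D' = active D \<and> (\<forall>N c extra j. \<forall>k\<le>j.
     at_rank N (quiver_coeff c (\<lambda>s t. extra t s) D' j k) = at_rank N (quiver_coeff c extra D j (j - k)))"
proof -
  define m r where "m = active D" and "r = num_indices D"
  have mr: "m \<le> r" by (simp add: m_def r_def num_indices_def)
  have c: "card ({..<r} - {m..<r}) = m" using mr by (subst card_Diff_subset) auto
  have "{m..<r} \<subseteq> {..<r}" by auto
  from quiver_of_form[OF finite_lessThan this mono_quiver_mono[of D, folded r_def]]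
  obtain D' where D': "active D' = r - m" "inactive D' = m"
    "\<And>N c extra j k. at_rank N (quiver_coeff c extra D' j k) = form_sum c extra {..<r} {m..<r} (quiver_mono D N) j k"
    unfolding c by auto
  have "at_rank N (quiver_coeff c (\<lambda>s t. extra t s) D' j k) = at_rank N (quiver_coeff c extra D j (j - k))" if k: "k \<le> j" for N c extra j k
  proof -
    have "sum d {..<r} = sum d {..<m} + sum d {m..<r}" for d :: "nat \<Rightarrow> nat"
      using sum.union_disjoint[of "{..<m}" "{m..<r}" d] mr by (simp add: ivl_disj_un ivl_disj_int)
    then have "{d \<in> vect {..<r}. sum d {..<r} = j \<and> sum d {m..<r} = k} = {d \<in> vect {..<r}. sum d {..<r} = j \<and> sum d {..<m} = j - k}"
      using k by auto
    then show ?thesis using k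
      unfolding D'(3) unfolding at_rank_quiver_coeff form_sum_def m_def[symmetric] r_def[symmetric] by (simp add: mult.commute)
  qed
  then show ?thesis using D'(1,2) by (intro exI[of _ D']) (simp add: m_def r_def num_indices_def)
qed

section \<open>Products of quiver forms\<close>

text \<open>Each table has exactly one pair of margins, so the sums over both index vectors and over
  their tables merge into one free sum over the entries.\<close>

lemma sum_tables_margins:
  assumes fin: "finite I" "finite J"
  shows "(\<Sum>d | d \<in> vect I \<and> sum d I = j. \<Sum>c | c \<in> vect J \<and> sum c J = j. \<Sum>e | e \<in> tables I J d c \<and> P e. g e d c)
    = (\<Sum>e | e \<in> vect (I \<times> J) \<and> sum e (I \<times> J) = j \<and> P e.
        g e (\<lambda>p. if p \<in> I then \<Sum>r\<in>J. e (p, r) else 0) (\<lambda>r. if r \<in> J then \<Sum>p\<in>I. e (p, r) else 0) :: qfield)"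
proof -
  define rs where "rs = (\<lambda>(e::'a \<times> 'b \<Rightarrow> nat) p. if p \<in> I then \<Sum>r\<in>J. e (p, r) else 0)"
  define cs where "cs = (\<lambda>(e::'a \<times> 'b \<Rightarrow> nat) r. if r \<in> J then \<Sum>p\<in>I. e (p, r) else 0)"
  have s1: "sum (rs e) I = sum e (I \<times> J)" for e
  proof -
    have "sum (rs e) I = (\<Sum>p\<in>I. \<Sum>r\<in>J. e (p, r))" by (rule sum.cong) (auto simp: rs_def)
    then show ?thesis by (simp add: sum.cartesian_product)
  qed
  have s2: "sum (cs e) J = sum e (I \<times> J)" for e
  proof -
    have "sum (cs e) J = (\<Sum>r\<in>J. \<Sum>p\<in>I. e (p, r))" by (rule sum.cong) (auto simp: cs_def)
    also have "\<dots> = (\<Sum>p\<in>I. \<Sum>r\<in>J. e (p, r))" by (rule sum.swap)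
    finally show ?thesis by (simp add: sum.cartesian_product)
  qed
  have t: "e \<in> tables I J d c \<longleftrightarrow> e \<in> vect (I \<times> J) \<and> rs e = d \<and> cs e = c" if "d \<in> vect I" "c \<in> vect J" for e d c
    using that by (auto simp: tables_def rs_def cs_def vect_def fun_eq_iff)
  let ?S = "Sigma {d \<in> vect I. sum d I = j} (\<lambda>d. {c \<in> vect J. sum c J = j})"
  have "(\<Sum>d | d \<in> vect I \<and> sum d I = j. \<Sum>c | c \<in> vect J \<and> sum c J = j. \<Sum>e | e \<in> tables I J d c \<and> P e. g e d c)
    = (\<Sum>x\<in>?S. \<Sum>e | e \<in> tables I J (fst x) (snd x) \<and> P e. g e (fst x) (snd x))"
    using finite_vect_sum[OF fin(1)] finite_vect_sum[OF fin(2)] by (subst sum.Sigma) (auto simp: case_prod_beta)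
  also have "\<dots> = (\<Sum>x\<in>?S. \<Sum>e | e \<in> {e. e \<in> vect (I \<times> J) \<and> sum e (I \<times> J) = j \<and> P e} \<and> (rs e, cs e) = x. g e (rs e) (cs e))"
  proof (rule sum.cong[OF refl])
    fix x assume x: "x \<in> ?S"
    then obtain d c where dc: "x = (d, c)" "d \<in> vect I" "c \<in> vect J" "sum d I = j" by auto
    have "e \<in> tables I J d c \<longleftrightarrow> e \<in> vect (I \<times> J) \<and> sum e (I \<times> J) = j \<and> rs e = d \<and> cs e = c" for e
      using t[OF dc(2,3), of e] s1[of e] dc(4) by auto
    then have "{e. e \<in> tables I J (fst x) (snd x) \<and> P e} = {e. e \<in> {e. e \<in> vect (I \<times> J) \<and> sum e (I \<times> J) = j \<and> P e} \<and> (rs e, cs e) = x}"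
      unfolding dc(1) by auto
    then show "(\<Sum>e | e \<in> tables I J (fst x) (snd x) \<and> P e. g e (fst x) (snd x)) =
       (\<Sum>e | e \<in> {e. e \<in> vect (I \<times> J) \<and> sum e (I \<times> J) = j \<and> P e} \<and> (rs e, cs e) = x. g e (rs e) (cs e))"
      by (rule sum.cong) auto
  qed
  also have "\<dots> = (\<Sum>e\<in>{e. e \<in> vect (I \<times> J) \<and> sum e (I \<times> J) = j \<and> P e}. g e (rs e) (cs e))"
  proof (rule sum.group)
    show "finite {e. e \<in> vect (I \<times> J) \<and> sum e (I \<times> J) = j \<and> P e}"
      by (rule finite_subset[OF _ finite_vect_sum[of "I \<times> J" j]]) (use fin in auto)
    show "finite ?S" using finite_vect_sum[OF fin(1)] finite_vect_sum[OF fin(2)] by auto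
    show "(\<lambda>e. (rs e, cs e)) ` {e. e \<in> vect (I \<times> J) \<and> sum e (I \<times> J) = j \<and> P e} \<subseteq> ?S"
      using s1 s2 by (auto simp: vect_def rs_def cs_def)
  qed
  finally show ?thesis unfolding rs_def cs_def .
qed

text \<open>The margins are linear in the entries, so the monomials of both forms become monomials
  in the entries; then the two symbols are absorbed. The active indices of the result lie over
  \<open>A1 \<times> A2\<close>, the block with sum h.\<close>

lemma product_form:
  assumes fin: "finite I1" "finite I2" and A: "A1 \<subseteq> I1" "A2 \<subseteq> I2" and \<omega>: "qmono I1 \<omega>1" "qmono I2 \<omega>2"
    and R: "R1 \<subseteq> I1 \<times> I2" "R2 \<subseteq> I1 \<times> I2" and y: "lin (I1 \<times> I2) y1" "lin (I1 \<times> I2) y2" and \<mu>: "qmono (I1 \<times> I2) \<mu>"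
  shows "\<exists>D. num_indices D = card I1 * card I2 + card R1 + card R2 + card (R1 \<inter> R2) \<and>
    (\<forall>N c j h. at_rank N (quiver_coeff c (\<lambda>s t. 1) D j h) =
      (\<Sum>d1 | d1 \<in> vect I1 \<and> sum d1 I1 = j. \<Sum>d2 | d2 \<in> vect I2 \<and> sum d2 I2 = j. \<omega>1 N d1 * \<omega>2 N d2 *
        (\<Sum>e | e \<in> tables I1 I2 d1 d2 \<and> sum e (A1 \<times> A2) = h.
           \<mu> N e * poch (qv powi (int N * n1 + y1 e + 2)) (sum e R1) * poch (qv powi (int N * n2 + y2 e + 2)) (sum e R2) / pf (I1 \<times> I2) e)) *
      (qfac h * qfac (j - h) / qfac j ^ c))"
proof -
  define I where "I = I1 \<times> I2"
  define A where "A = A1 \<times> A2"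
  have finI: "finite I" using fin by (simp add: I_def)
  have AI: "A \<subseteq> I" using A by (auto simp: A_def I_def)
  have RI: "R1 \<subseteq> I" "R2 \<subseteq> I" using R by (auto simp: I_def)
  define rs where "rs = (\<lambda>(e::'a \<times> 'b \<Rightarrow> nat) p. if p \<in> I1 then \<Sum>r\<in>I2. e (p, r) else 0)"
  define cs where "cs = (\<lambda>(e::'a \<times> 'b \<Rightarrow> nat) r. if r \<in> I2 then \<Sum>p\<in>I1. e (p, r) else 0)"
  have linr: "lin I (\<lambda>e. int (rs e p))" if "p \<in> I1" for p
    using that finI by (auto simp: rs_def of_nat_sum I_def intro!: lin_sum lin_component)
  have linc: "lin I (\<lambda>e. int (cs e p))" if "p \<in> I2" for p
    using that finI by (auto simp: cs_def of_nat_sum I_def intro!: lin_sum lin_component)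
  define \<nu> where "\<nu> = (\<lambda>N e. \<omega>1 N (rs e) * \<omega>2 N (cs e) * \<mu> N e)"
  have \<nu>: "qmono I \<nu>"
    unfolding \<nu>_def using mono_comp[OF \<omega>(1), of I rs] mono_comp[OF \<omega>(2), of I cs] linr linc \<mu>
    by (intro mono_mult) (auto simp: I_def)
  define I' R' where "I' = doubled I R1" and "R' = lift I R1 R2"
  define I'' where "I'' = doubled I' R'"
  define bb where "bb = (\<lambda>f. base R1 (base R' f))"
  have fin': "finite I'" unfolding I'_def using finI RI(1) by (rule finite_doubled)
  have R': "R' \<subseteq> I'" unfolding I'_def R'_def by (rule lift_subset)
  have fin'': "finite I''" unfolding I''_def using fin' R' by (rule finite_doubled)
  obtain \<omega>' where \<omega>': "qmono I'' \<omega>'" "\<And>N e. e \<in> vect I \<Longrightarrow>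
    \<nu> N e * poch (qv powi (int N * n1 + y1 e + 2)) (sum e R1) * poch (qv powi (int N * n2 + y2 e + 2)) (sum e R2) / pf I e =
    (\<Sum>f | f \<in> vect I'' \<and> bb f = e. \<omega>' N f / pf I'' f)"
    using absorb_twice[OF finI RI \<nu> y[folded I_def], of n1 n2] unfolding I''_def I'_def R'_def bb_def by blast
  define A'' where "A'' = lift I' R' (lift I R1 A)"
  have A'': "A'' \<subseteq> I''" unfolding A''_def I''_def by (rule lift_subset)
  have sumA: "sum (bb f) A = sum f A''" for f
    unfolding bb_def A''_def
    using sum_base[OF finI RI(1) AI, of "base R' f"] sum_base[OF fin' R', of "lift I R1 A" f] lift_subset[of I R1 A] by (simp add: I'_def)
  have sumI: "sum (bb f) I = sum f I''" for f
    unfolding bb_def I''_def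
    using sum_base[OF finI RI(1) subset_refl, of "base R' f"] sum_base[OF fin' R' subset_refl, of f]
    by (simp add: lift_self[OF RI(1)] lift_self[OF R'] flip: I'_def)
  have bbv: "bb f \<in> vect I" if "f \<in> vect I''" for f
    using that unfolding bb_def I''_def by (intro base_vect[OF RI(1)]) (auto simp: I'_def[symmetric] intro: base_vect[OF R'])
  obtain D where D: "active D = card A''" "inactive D = card (I'' - A'')"
    "\<And>N c extra j k. at_rank N (quiver_coeff c extra D j k) = form_sum c extra I'' A'' (\<omega>' N) j k"
    using quiver_of_form[OF fin'' A'' \<omega>'(1)] by blast
  have "num_indices D = card I''"
    unfolding num_indices_def D(1,2) using fin'' A'' by (metis card_Diff_subset card_mono finite_subset le_add_diff_inverse)
  also have "\<dots> = card I' + card R'" unfolding I''_def using fin' R' by (rule card_doubled)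
  also have "card I' = card I1 * card I2 + card R1"
    unfolding I'_def card_doubled[OF finI RI(1)] by (simp add: I_def card_cartesian_product)
  also have "card R' = card R2 + card (R1 \<inter> R2)"
    unfolding R'_def lift_doubled[OF RI(2,1)] using finI RI by (subst card_doubled) (auto intro: finite_subset simp: Int_commute)
  finally have num: "num_indices D = card I1 * card I2 + card R1 + card R2 + card (R1 \<inter> R2)" by simp
  have "at_rank N (quiver_coeff c (\<lambda>s t. 1) D j h) =
      (\<Sum>d1 | d1 \<in> vect I1 \<and> sum d1 I1 = j. \<Sum>d2 | d2 \<in> vect I2 \<and> sum d2 I2 = j. \<omega>1 N d1 * \<omega>2 N d2 *
        (\<Sum>e | e \<in> tables I1 I2 d1 d2 \<and> sum e (A1 \<times> A2) = h.
           \<mu> N e * poch (qv powi (int N * n1 + y1 e + 2)) (sum e R1) * poch (qv powi (int N * n2 + y2 e + 2)) (sum e R2) / pf (I1 \<times> I2) e)) *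
      (qfac h * qfac (j - h) / qfac j ^ c)" for N c j h
  proof -
    define E where "E = {e. e \<in> vect I \<and> sum e I = j \<and> sum e A = h}"
    have finE: "finite E" unfolding E_def by (rule finite_subset[OF _ finite_vect_sum[OF finI, of j]]) auto
    define F where "F = {f. f \<in> vect I'' \<and> sum f I'' = j \<and> sum f A'' = h}"
    have finF: "finite F" unfolding F_def by (rule finite_subset[OF _ finite_vect_sum[OF fin'', of j]]) auto
    have "(\<Sum>f\<in>F. \<omega>' N f / pf I'' f) = (\<Sum>e\<in>E. \<Sum>f\<in>{f \<in> F. bb f = e}. \<omega>' N f / pf I'' f)"
      by (rule sum.group[OF finF finE, symmetric]) (auto simp: F_def E_def sumA sumI bbv)
    also have "\<dots> = (\<Sum>e\<in>E. \<nu> N e * poch (qv powi (int N * n1 + y1 e + 2)) (sum e R1) * poch (qv powi (int N * n2 + y2 e + 2)) (sum e R2) / pf I e)"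
    proof (rule sum.cong[OF refl])
      fix e assume e: "e \<in> E"
      then have "{f \<in> F. bb f = e} = {f. f \<in> vect I'' \<and> bb f = e}" by (auto simp: F_def E_def simp flip: sumA sumI)
      then show "(\<Sum>f\<in>{f \<in> F. bb f = e}. \<omega>' N f / pf I'' f) =
         \<nu> N e * poch (qv powi (int N * n1 + y1 e + 2)) (sum e R1) * poch (qv powi (int N * n2 + y2 e + 2)) (sum e R2) / pf I e"
        using e by (simp add: \<omega>'(2) E_def)
    qed
    also have "\<dots> = (\<Sum>d1 | d1 \<in> vect I1 \<and> sum d1 I1 = j. \<Sum>d2 | d2 \<in> vect I2 \<and> sum d2 I2 = j.
        \<Sum>e | e \<in> tables I1 I2 d1 d2 \<and> sum e (A1 \<times> A2) = h. \<omega>1 N d1 * \<omega>2 N d2 *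
           (\<mu> N e * poch (qv powi (int N * n1 + y1 e + 2)) (sum e R1) * poch (qv powi (int N * n2 + y2 e + 2)) (sum e R2) / pf (I1 \<times> I2) e))"
      unfolding sum_tables_margins[OF fin] E_def I_def A_def \<nu>_def rs_def cs_def by (intro sum.cong refl) simp
    finally show ?thesis
      unfolding D(3) form_sum_def F_def by (simp add: sum_distrib_left)
  qed
  with num show ?thesis by blast
qed

section \<open>Quantum binomials as Pochhammer symbols\<close>

lemma poch_1: "poch x (Suc 0) = 1 - x"
  by (simp add: poch_def)

lemma qint_poch: "qint n = - (qv powi (- n)) * (1 - qv powi (2 * n)) / (qv - inverse qv)"
proof -
  have "2 * n = n + n" by simp
  then have "- (qv powi (- n)) * (1 - qv powi (2 * n)) = qv powi n - qv powi (- n)"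
    by (simp only: powi_add[OF qv_nonzero]) (simp add: power_int_minus algebra_simps)
  then show ?thesis by (simp add: qint_def)
qed

text \<open>Up to a constant, [m] is a power of q times 1 - \<open>q^(2m)\<close>. The s factors of
  the numerator, taken from the smallest m = n - s + 1 upwards, form the symbol. No sign condition
  on n is imposed, so tops containing N are covered.\<close>

lemma qbinom_poch: "qbinom n s = qv powi (- int s * (n - int s)) * poch (qv powi (2 * (n - int s) + 2)) s / qfac s"
proof (induction s)
  case (Suc s)
  define X where "X = qv powi (2 * (n - int s))"
  define Y where "Y = qv powi (2 * int (Suc s))"
  have nz: "1 - Y \<noteq> 0" unfolding Y_def by (simp del: of_nat_Suc)
  have qq: "qv - inverse qv \<noteq> 0" by (rule qv_diff_nonzero)
  have s0: "qint (int (Suc s)) \<noteq> 0" by (simp del: of_nat_Suc)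
  have p1: "poch X (Suc s) = (1 - X) * poch (qv powi (2 * (n - int s) + 2)) s"
    using poch_add[of X 1 s] by (simp add: poch_1 X_def powi_add)
  have p2: "qfac (Suc s) = (1 - Y) * qfac s"
    unfolding qfac_Suc Y_def by (simp flip: power_int_of_nat)
  have e1: "2 * (n - int (Suc s)) + 2 = 2 * (n - int s)" by simp
  have "qint (int (Suc s)) * qbinom n (Suc s) = qint (n - int s) * qbinom n s" by (rule qbinom_Suc)
  also have "\<dots> = qint (int (Suc s)) * (qv powi (- int (Suc s) * (n - int (Suc s))) * poch X (Suc s) / qfac (Suc s))"
  proof -
    have i1: "qint (n - int s) = - (qv powi (- (n - int s))) * (1 - X) / (qv - inverse qv)" unfolding X_def by (rule qint_poch)
    have i2: "qint (int (Suc s)) = - (qv powi (- int (Suc s))) * (1 - Y) / (qv - inverse qv)" unfolding Y_def by (rule qint_poch)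
    have "- (n - int s) + - int s * (n - int s) = - int (Suc s) + - int (Suc s) * (n - int (Suc s))" by (simp add: algebra_simps)
    then have e: "qv powi (- (n - int s)) * qv powi (- int s * (n - int s)) = qv powi (- int (Suc s)) * qv powi (- int (Suc s) * (n - int (Suc s)))"
      by (simp only: powi_add[OF qv_nonzero, symmetric])
    have "qint (n - int s) * qbinom n s = - (qv powi (- (n - int s)) * qv powi (- int s * (n - int s))) * (1 - X) *
        poch (qv powi (2 * (n - int s) + 2)) s / (qfac s * (qv - inverse qv))"
      unfolding i1 Suc.IH by (simp add: ac_simps)
    also have "\<dots> = qint (int (Suc s)) * (qv powi (- int (Suc s) * (n - int (Suc s))) * poch X (Suc s) / qfac (Suc s))"
    proof -
      have "- (a * b') * x * p / (f * c) = - a * y / c * (b' * (x * p) / (y * f))" if "y \<noteq> 0" for a b' x p f c y :: qfield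
        using that by (simp add: ac_simps)
      from this[OF nz] show ?thesis unfolding e i2 p1 p2 .
    qed
    finally show ?thesis .
  qed
  finally show ?case unfolding e1 X_def[symmetric] using s0 by (metis mult_cancel_left)
qed simp

lemma qbinom_qb: "a \<le> m \<Longrightarrow> qbinom (int m) a = qv powi (- int a * (int m - int a)) * qb m a"
proof -
  assume a: "a \<le> m"
  have "2 * (int m - int a) + 2 = 2 + int (2 * (m - a))" using a by simp
  then have "qv powi (2 * (int m - int a) + 2) = qv ^ 2 * qv ^ (2 * (m - a))"
    by (simp only: powi_add[OF qv_nonzero] power_int_of_nat) simp
  then have "qfac (m - a) * poch (qv powi (2 * (int m - int a) + 2)) a = qfac m"
    using poch_add[of "qv ^ 2" "m - a" a] a by (simp add: poch_qfac)
  then have "poch (qv powi (2 * (int m - int a) + 2)) a = qfac m / qfac (m - a)" by (simp add: field_simps)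
  then show ?thesis using a by (simp add: qbinom_poch qb_def mult.commute)
qed

text \<open>Both sides are the product of s + t quantum integers from [n] downwards over [s]! [t]!.
  In the case OP-UP it fuses the two binomials that contain N into one, so that a single symbol with
  N has to be absorbed.\<close>

lemma qbinom_mult_qbinom: "qbinom n s * qbinom (n - int s) t = qbinom n (s + t) * qbinom (int (s + t)) t"
proof -
  have "(\<Prod>i<s + t. qint (n - int i)) = (\<Prod>i<s. qint (n - int i)) * (\<Prod>i<t. qint (n - int s - int i))"
    by (induction t) (simp_all add: algebra_simps)
  then show ?thesis by (simp add: qbinom_def[of n] qbinom_def[of "n - int s"] qbinom_nat[of t "s + t", simplified])
qed

text \<open>Undoes the sorting by activity: k becomes the sum of the active entries. The guard is
  discharged later, where A is known to be a subset of I.\<close>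

lemma sum_split_index:
  assumes "finite I"
  shows "(\<Sum>k\<le>j. form_sum c extra I A \<omega> j k * g k) =
    (\<Sum>d | d \<in> vect I \<and> sum d I = j. if sum d A \<le> j then
       \<omega> d / pf I d * (qfac (sum d A) * qfac (j - sum d A) * extra (sum d A) (j - sum d A) / qfac j ^ c) * g (sum d A) else 0)"
proof -
  define S where "S = {d \<in> vect I. sum d I = j}"
  have fS: "finite S" unfolding S_def by (rule finite_vect_sum[OF assms])
  define h where "h = (\<lambda>d. \<omega> d / pf I d * (qfac (sum d A) * qfac (j - sum d A) * extra (sum d A) (j - sum d A) / qfac j ^ c) * g (sum d A))"
  have "(\<Sum>k\<le>j. form_sum c extra I A \<omega> j k * g k) = (\<Sum>k\<le>j. \<Sum>d\<in>{d \<in> {d \<in> S. sum d A \<le> j}. sum d A = k}. h d)"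
    unfolding form_sum_def sum_distrib_right h_def S_def by (intro sum.cong refl) auto
  also have "\<dots> = (\<Sum>d\<in>{d \<in> S. sum d A \<le> j}. h d)"
    by (rule sum.group) (use fS in auto)
  also have "\<dots> = (\<Sum>d\<in>S. if sum d A \<le> j then h d else 0)"
    using fS by (rule sum.inter_filter)
  finally show ?thesis unfolding S_def h_def .
qed

text \<open>
  The common part of the gluing formulas: the coefficient of the glued form is a sum over the
  contingency tables whose margins are the two index vectors.
\<close>

lemma product_quiver:
  assumes finite: "finite A1" "finite B1" "finite A2" "finite B2" and dis: "A1 \<inter> B1 = {}" "A2 \<inter> B2 = {}"
    and \<omega>: "qmono (A1 \<union> B1) \<omega>1" "qmono (A2 \<union> B2) \<omega>2"
  defines "I1 \<equiv> A1 \<union> B1" and "I2 \<equiv> A2 \<union> B2"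
  assumes R: "R1 \<subseteq> I1 \<times> I2" "R2 \<subseteq> I1 \<times> I2" and y: "lin (I1 \<times> I2) y1" and \<mu>: "qmono (I1 \<times> I2) \<mu>"
    and scalar: "\<And>N d1 d2 e j h. e \<in> tables I1 I2 d1 d2 \<Longrightarrow> sum d1 I1 = j \<Longrightarrow> sum d2 I2 = j \<Longrightarrow> sum e (A1 \<times> A2) = h \<Longrightarrow>
      \<mu> N e * poch (qv powi (int N * n1 + y1 e + 2)) (sum e R1) * poch (qv ^ 2) (sum e R2) = \<kappa> N j (sum d1 A1) (sum d2 A2) h"
    and G: "\<And>N j k l h. h \<le> j \<Longrightarrow> k \<le> j \<Longrightarrow> l \<le> j \<Longrightarrow>
      (qfac k * qfac (j - k) * extra1 k (j - k)) * (qfac l * qfac (j - l) * extra2 l (j - l)) * G N j k l h =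
      \<kappa> N j k l h * (if h \<le> l then qb k h * qb (j - k) (l - h) * qfac l * qfac (j - l) else 0) * (qfac h * qfac (j - h))"
  shows "\<exists>D. num_indices D = card I1 * card I2 + card R1 + card R2 + card (R1 \<inter> R2) \<and>
    (\<forall>N c1 c2 j. \<forall>h\<le>j. at_rank N (quiver_coeff (c1 + c2) (\<lambda>s t. 1) D j h) =
      (\<Sum>k\<le>j. \<Sum>l\<le>j. form_sum c1 extra1 I1 A1 (\<omega>1 N) j k * form_sum c2 extra2 I2 A2 (\<omega>2 N) j l * G N j k l h))"
proof -
  have fin: "finite I1" "finite I2" using finite by (auto simp: I1_def I2_def)
  have A: "A1 \<subseteq> I1" "A2 \<subseteq> I2" by (auto simp: I1_def I2_def)
  obtain b where b: "quad (I1 \<times> I2) b" "\<And>d1 d2 h. sum d1 I1 = sum d2 I2 \<Longrightarrow>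
    (if h \<le> sum d2 A2 then qb (sum d1 A1) h * qb (sum d1 B1) (sum d2 A2 - h) * qfac (sum d2 A2) * qfac (sum d2 B2) /
       (pf I1 d1 * pf I2 d2) else 0) =
    (\<Sum>e | e \<in> tables I1 I2 d1 d2 \<and> sum e (A1 \<times> A2) = h. qv powi b e / pf (I1 \<times> I2) e)"
    using block_tables[OF finite dis] unfolding I1_def I2_def by blast
  have \<mu>b: "qmono (I1 \<times> I2) (\<lambda>N e. \<mu> N e * qv powi b e)" by (rule mono_mult[OF \<mu> mono_quad[OF b(1)]])
  \<comment> \<open>The second symbol has the constant argument \<open>q^2\<close>, that is n2 = 0
    and the zero form for y2; it equals (q^2)_n for n the sum over R2.\<close>
  obtain D where D: "num_indices D = card I1 * card I2 + card R1 + card R2 + card (R1 \<inter> R2)"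
    "\<And>N c j h. at_rank N (quiver_coeff c (\<lambda>s t. 1) D j h) =
      (\<Sum>d1 | d1 \<in> vect I1 \<and> sum d1 I1 = j. \<Sum>d2 | d2 \<in> vect I2 \<and> sum d2 I2 = j. \<omega>1 N d1 * \<omega>2 N d2 *
        (\<Sum>e | e \<in> tables I1 I2 d1 d2 \<and> sum e (A1 \<times> A2) = h.
           \<mu> N e * qv powi b e * poch (qv powi (int N * n1 + y1 e + 2)) (sum e R1) * poch (qv powi (int N * 0 + 0 + 2)) (sum e R2) / pf (I1 \<times> I2) e)) *
      (qfac h * qfac (j - h) / qfac j ^ c)"
    using product_form[OF fin A \<omega>[folded I1_def I2_def] R y lin_0 \<mu>b, of n1 0] by blast
  have "at_rank N (quiver_coeff (c1 + c2) (\<lambda>s t. 1) D j h) =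
      (\<Sum>k\<le>j. \<Sum>l\<le>j. form_sum c1 extra1 I1 A1 (\<omega>1 N) j k * form_sum c2 extra2 I2 A2 (\<omega>2 N) j l * G N j k l h)" if h: "h \<le> j" for N c1 c2 j h
  proof -
    have "(\<Sum>k\<le>j. \<Sum>l\<le>j. form_sum c1 extra1 I1 A1 (\<omega>1 N) j k * form_sum c2 extra2 I2 A2 (\<omega>2 N) j l * G N j k l h) =
      (\<Sum>k\<le>j. form_sum c1 extra1 I1 A1 (\<omega>1 N) j k * (\<Sum>l\<le>j. form_sum c2 extra2 I2 A2 (\<omega>2 N) j l * G N j k l h))"
      by (simp only: sum_distrib_left mult.assoc)
    also have "\<dots> = (\<Sum>d1 | d1 \<in> vect I1 \<and> sum d1 I1 = j. \<Sum>d2 | d2 \<in> vect I2 \<and> sum d2 I2 = j.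
       \<omega>1 N d1 * \<omega>2 N d2 * ((qfac (sum d1 A1) * qfac (j - sum d1 A1) * extra1 (sum d1 A1) (j - sum d1 A1)) *
         (qfac (sum d2 A2) * qfac (j - sum d2 A2) * extra2 (sum d2 A2) (j - sum d2 A2)) * G N j (sum d1 A1) (sum d2 A2) h) /
         (pf I1 d1 * pf I2 d2) / qfac j ^ (c1 + c2))"
      unfolding sum_split_index[OF fin(1)] sum_split_index[OF fin(2)]
    proof (rule sum.cong[OF refl])
      fix d1 assume d1: "d1 \<in> {d1. d1 \<in> vect I1 \<and> sum d1 I1 = j}"
      then have k: "sum d1 A1 \<le> j" using sum_mono2[OF fin(1) A(1), of d1] by simp
      have l: "sum d2 A2 \<le> j" if "d2 \<in> {d2. d2 \<in> vect I2 \<and> sum d2 I2 = j}" for d2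
        using that sum_mono2[OF fin(2) A(2), of d2] by simp
      show "(if sum d1 A1 \<le> j then \<omega>1 N d1 / pf I1 d1 * (qfac (sum d1 A1) * qfac (j - sum d1 A1) * extra1 (sum d1 A1) (j - sum d1 A1) / qfac j ^ c1) *
        (\<Sum>d | d \<in> vect I2 \<and> sum d I2 = j. if sum d A2 \<le> j then
           \<omega>2 N d / pf I2 d * (qfac (sum d A2) * qfac (j - sum d A2) * extra2 (sum d A2) (j - sum d A2) / qfac j ^ c2) * G N j (sum d1 A1) (sum d A2) h else 0) else 0) =
        (\<Sum>d2 | d2 \<in> vect I2 \<and> sum d2 I2 = j.
       \<omega>1 N d1 * \<omega>2 N d2 * ((qfac (sum d1 A1) * qfac (j - sum d1 A1) * extra1 (sum d1 A1) (j - sum d1 A1)) *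
         (qfac (sum d2 A2) * qfac (j - sum d2 A2) * extra2 (sum d2 A2) (j - sum d2 A2)) * G N j (sum d1 A1) (sum d2 A2) h) /
         (pf I1 d1 * pf I2 d2) / qfac j ^ (c1 + c2))"
        unfolding if_P[OF k] sum_distrib_left
        by (intro sum.cong refl) (simp only: if_P[OF l], simp add: power_add ac_simps)
    qed
    also have "\<dots> = (\<Sum>d1 | d1 \<in> vect I1 \<and> sum d1 I1 = j. \<Sum>d2 | d2 \<in> vect I2 \<and> sum d2 I2 = j. \<omega>1 N d1 * \<omega>2 N d2 *
        (\<Sum>e | e \<in> tables I1 I2 d1 d2 \<and> sum e (A1 \<times> A2) = h.
           \<mu> N e * qv powi b e * poch (qv powi (int N * n1 + y1 e + 2)) (sum e R1) * poch (qv powi (int N * 0 + 0 + 2)) (sum e R2) / pf (I1 \<times> I2) e) *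
        (qfac h * qfac (j - h) / qfac j ^ (c1 + c2)))"
    proof (intro sum.cong refl)
      fix d1 d2 assume "d1 \<in> {d1. d1 \<in> vect I1 \<and> sum d1 I1 = j}" "d2 \<in> {d2. d2 \<in> vect I2 \<and> sum d2 I2 = j}"
      then have d1: "sum d1 I1 = j" and d2: "sum d2 I2 = j" by auto
      define k l where "k = sum d1 A1" and "l = sum d2 A2"
      have s1: "j = k + sum d1 B1" unfolding d1[symmetric] I1_def k_def using finite dis by (intro sum.union_disjoint) auto
      have s2: "j = l + sum d2 B2" unfolding d2[symmetric] I2_def l_def using finite dis by (intro sum.union_disjoint) auto
      have kl: "k \<le> j" "l \<le> j" "sum d1 B1 = j - k" "sum d2 B2 = j - l" using s1 s2 by auto
      have "(\<Sum>e | e \<in> tables I1 I2 d1 d2 \<and> sum e (A1 \<times> A2) = h.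
           \<mu> N e * qv powi b e * poch (qv powi (int N * n1 + y1 e + 2)) (sum e R1) * poch (qv powi (int N * 0 + 0 + 2)) (sum e R2) / pf (I1 \<times> I2) e)
         = (\<Sum>e | e \<in> tables I1 I2 d1 d2 \<and> sum e (A1 \<times> A2) = h. \<kappa> N j k l h * (qv powi b e / pf (I1 \<times> I2) e))"
      proof (rule sum.cong[OF refl])
        fix e assume "e \<in> {e. e \<in> tables I1 I2 d1 d2 \<and> sum e (A1 \<times> A2) = h}"
        then have "\<mu> N e * poch (qv powi (int N * n1 + y1 e + 2)) (sum e R1) * poch (qv ^ 2) (sum e R2) = \<kappa> N j k l h"
          unfolding k_def l_def by (intro scalar d1 d2) auto
        moreover have "qv powi (int N * 0 + 0 + 2) = qv ^ 2" by simp
        ultimately show "\<mu> N e * qv powi b e * poch (qv powi (int N * n1 + y1 e + 2)) (sum e R1) * poch (qv powi (int N * 0 + 0 + 2)) (sum e R2) / pf (I1 \<times> I2) e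
           = \<kappa> N j k l h * (qv powi b e / pf (I1 \<times> I2) e)"
          by (simp add: ac_simps)
      qed
      also have "\<dots> = \<kappa> N j k l h * (if h \<le> l then qb k h * qb (j - k) (l - h) * qfac l * qfac (j - l) / (pf I1 d1 * pf I2 d2) else 0)"
      proof -
        have "sum d1 I1 = sum d2 I2" using d1 d2 by simp
        from b(2)[OF this, of h, folded k_def l_def, unfolded kl(3,4)] show ?thesis
          unfolding sum_distrib_left[symmetric] by (rule arg_cong[OF sym])
      qed
      also have "\<dots> = \<kappa> N j k l h * (if h \<le> l then qb k h * qb (j - k) (l - h) * qfac l * qfac (j - l) else 0) / (pf I1 d1 * pf I2 d2)"
        by simp
      finally have "(\<Sum>e | e \<in> tables I1 I2 d1 d2 \<and> sum e (A1 \<times> A2) = h.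
           \<mu> N e * qv powi b e * poch (qv powi (int N * n1 + y1 e + 2)) (sum e R1) * poch (qv powi (int N * 0 + 0 + 2)) (sum e R2) / pf (I1 \<times> I2) e) *
        (qfac h * qfac (j - h) / qfac j ^ (c1 + c2)) =
        \<kappa> N j k l h * (if h \<le> l then qb k h * qb (j - k) (l - h) * qfac l * qfac (j - l) else 0) * (qfac h * qfac (j - h)) / (pf I1 d1 * pf I2 d2) / qfac j ^ (c1 + c2)"
        by simp
      also have "\<dots> = (qfac k * qfac (j - k) * extra1 k (j - k)) * (qfac l * qfac (j - l) * extra2 l (j - l)) * G N j k l h / (pf I1 d1 * pf I2 d2) / qfac j ^ (c1 + c2)"
        unfolding G[OF h kl(1,2)] ..
      finally show "\<omega>1 N d1 * \<omega>2 N d2 * ((qfac (sum d1 A1) * qfac (j - sum d1 A1) * extra1 (sum d1 A1) (j - sum d1 A1)) *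
         (qfac (sum d2 A2) * qfac (j - sum d2 A2) * extra2 (sum d2 A2) (j - sum d2 A2)) * G N j (sum d1 A1) (sum d2 A2) h) /
         (pf I1 d1 * pf I2 d2) / qfac j ^ (c1 + c2) = \<omega>1 N d1 * \<omega>2 N d2 *
        (\<Sum>e | e \<in> tables I1 I2 d1 d2 \<and> sum e (A1 \<times> A2) = h.
           \<mu> N e * qv powi b e * poch (qv powi (int N * n1 + y1 e + 2)) (sum e R1) * poch (qv powi (int N * 0 + 0 + 2)) (sum e R2) / pf (I1 \<times> I2) e) *
        (qfac h * qfac (j - h) / qfac j ^ (c1 + c2))"
        unfolding k_def l_def by (metis (no_types, lifting) mult.assoc times_divide_eq_right)
    qed
    finally show ?thesis
      unfolding D(2) by (simp only: sum_distrib_right)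
  qed
  with D(1) show ?thesis by blast
qed

text \<open>Let h, x, y, z be the sums over the blocks AA, AB, BA and BB. Then k = h + x, l = h + y
  and j = h + x + y + z. In these variables the gluing coefficients simplify, and each of them is
  linear in the entries.\<close>

lemma block_sums:
  assumes fin: "finite A1" "finite B1" "finite A2" "finite B2" and dis: "A1 \<inter> B1 = {}" "A2 \<inter> B2 = {}"
    and e: "e \<in> tables (A1 \<union> B1) (A2 \<union> B2) d1 d2"
  shows "sum d1 A1 = sum e (A1 \<times> A2) + sum e (A1 \<times> B2)"
    "sum d2 A2 = sum e (A1 \<times> A2) + sum e (B1 \<times> A2)"
    "sum d1 (A1 \<union> B1) = sum e (A1 \<times> A2) + sum e (A1 \<times> B2) + sum e (B1 \<times> A2) + sum e (B1 \<times> B2)"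
    "sum e ((A1 \<union> B1) \<times> (A2 \<union> B2)) = sum d1 (A1 \<union> B1)"
    "sum e (B1 \<times> (A2 \<union> B2)) = sum e (B1 \<times> A2) + sum e (B1 \<times> B2)"
    "sum e ((A1 \<union> B1) \<times> B2) = sum e (A1 \<times> B2) + sum e (B1 \<times> B2)"
    "sum e ((A1 \<union> B1) \<times> A2) = sum e (A1 \<times> A2) + sum e (B1 \<times> A2)"
    "sum e ((A1 \<union> B1) \<times> (A2 \<union> B2) - A1 \<times> A2) = sum e (A1 \<times> B2) + sum e (B1 \<times> A2) + sum e (B1 \<times> B2)"
proof -
  have u1: "sum e (X \<times> (A2 \<union> B2)) = sum e (X \<times> A2) + sum e (X \<times> B2)" if "finite X" for X
    using fin dis that by (simp add: Sigma_Un_distrib2 sum.union_disjoint Times_Int_Times[symmetric] disjoint_iff)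
  have u2: "sum e ((A1 \<union> B1) \<times> X) = sum e (A1 \<times> X) + sum e (B1 \<times> X)" if "finite X" for X
    using fin dis that by (simp add: Sigma_Un_distrib1 sum.union_disjoint disjoint_iff)
  show 5: "sum e (B1 \<times> (A2 \<union> B2)) = sum e (B1 \<times> A2) + sum e (B1 \<times> B2)"
    "sum e ((A1 \<union> B1) \<times> B2) = sum e (A1 \<times> B2) + sum e (B1 \<times> B2)"
    "sum e ((A1 \<union> B1) \<times> A2) = sum e (A1 \<times> A2) + sum e (B1 \<times> A2)"
    using fin by (simp_all add: u1 u2)
  have "sum d1 A1 = (\<Sum>p\<in>A1. \<Sum>r\<in>A2 \<union> B2. e (p, r))" using e by (auto simp: tables_def intro!: sum.cong)
  also have "\<dots> = sum e (A1 \<times> (A2 \<union> B2))" by (simp add: sum.cartesian_product)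
  finally show "sum d1 A1 = sum e (A1 \<times> A2) + sum e (A1 \<times> B2)" using fin by (simp add: u1)
  have "sum d2 A2 = (\<Sum>r\<in>A2. \<Sum>p\<in>A1 \<union> B1. e (p, r))" using e by (auto simp: tables_def intro!: sum.cong)
  also have "\<dots> = (\<Sum>p\<in>A1 \<union> B1. \<Sum>r\<in>A2. e (p, r))" by (rule sum.swap)
  also have "\<dots> = sum e ((A1 \<union> B1) \<times> A2)" by (simp add: sum.cartesian_product)
  finally show "sum d2 A2 = sum e (A1 \<times> A2) + sum e (B1 \<times> A2)" using fin by (simp add: u2)
  show 4: "sum e ((A1 \<union> B1) \<times> (A2 \<union> B2)) = sum d1 (A1 \<union> B1)" using tables_sum[OF e] .
  have t: "sum e ((A1 \<union> B1) \<times> (A2 \<union> B2)) = sum e (A1 \<times> A2) + sum e (A1 \<times> B2) + sum e (B1 \<times> A2) + sum e (B1 \<times> B2)"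
    using fin by (simp add: u1 5)
  then show "sum d1 (A1 \<union> B1) = sum e (A1 \<times> A2) + sum e (A1 \<times> B2) + sum e (B1 \<times> A2) + sum e (B1 \<times> B2)"
    using 4 by simp
  have "sum e ((A1 \<union> B1) \<times> (A2 \<union> B2)) = sum e ((A1 \<union> B1) \<times> (A2 \<union> B2) - A1 \<times> A2) + sum e (A1 \<times> A2)"
    using fin by (intro sum.subset_diff) auto
  then show "sum e ((A1 \<union> B1) \<times> (A2 \<union> B2) - A1 \<times> A2) = sum e (A1 \<times> B2) + sum e (B1 \<times> A2) + sum e (B1 \<times> B2)"
    using t by simp
qed

text \<open>RI-RI is the case n0 = y0 = 0, and OP-OP is n0 = 1, y0 = -2. The extra factors of the
  two forms cancel the denominators (q^2)_(j-k) and (q^2)_(j-l) of the gluing coefficient; what is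
  left is the symbol of the first binomial and one factor (q^2)_(j-h).\<close>

lemma glue_quiver_same:
  fixes n0 y0 :: int
  shows "\<exists>D. num_indices D = (active D1 + 2 * inactive D1) * (active D2 + 2 * inactive D2) \<and>
    (\<forall>N c1 c2 j. \<forall>h\<le>j. at_rank N (quiver_coeff (c1 + c2) (\<lambda>s t. 1) D j h) =
      (\<Sum>k\<le>j. \<Sum>l\<le>j. at_rank N (quiver_coeff c1 (\<lambda>s t. qfac t) D1 j k) * at_rank N (quiver_coeff c2 (\<lambda>s t. qfac t) D2 j l) *
         glue_coeff (int N * n0 + y0 * int j + int (j - k + (j - l))) (j - k) (j - l) (j - h)))"
proof -
  define A1 B1 A2 B2 where "A1 = {..<active D1}" and "B1 = {active D1..<num_indices D1}"
    and "A2 = {..<active D2}" and "B2 = {active D2..<num_indices D2}"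
  define I1 I2 where "I1 = A1 \<union> B1" and "I2 = A2 \<union> B2"
  have I: "{..<num_indices D1} = I1" "{..<num_indices D2} = I2"
    unfolding I1_def I2_def A1_def B1_def A2_def B2_def num_indices_def by auto
  have fin: "finite A1" "finite B1" "finite A2" "finite B2" and dis: "A1 \<inter> B1 = {}" "A2 \<inter> B2 = {}"
    unfolding A1_def B1_def A2_def B2_def by auto
  \<comment> \<open>The sum over R1 is z = j + h - k - l, the length of the symbol with N, and the
    sum over R2 is j - h. The blocks AA, AB, BA, BB get the multiplicities 1, 2, 2, 4, as the
    product of the expanded sizes demands.\<close>
  define R1 R2 where "R1 = B1 \<times> B2" and "R2 = I1 \<times> I2 - A1 \<times> A2"
  have R: "R1 \<subseteq> I1 \<times> I2" "R2 \<subseteq> I1 \<times> I2" by (auto simp: R1_def R2_def I1_def I2_def)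
  have finI: "finite (I1 \<times> I2)" using fin by (simp add: I1_def I2_def)
  have ls: "lin (I1 \<times> I2) (\<lambda>e. int (sum e S))" if "S \<subseteq> I1 \<times> I2" for S
    using finI that by (rule lin_sum_subset)
  have l1: "lin (I1 \<times> I2) (\<lambda>e. int (sum e (B1 \<times> B2)))" "lin (I1 \<times> I2) (\<lambda>e. int (sum e (I1 \<times> I2)))"
    "lin (I1 \<times> I2) (\<lambda>e. int (sum e R2))" "lin (I1 \<times> I2) (\<lambda>e. int (sum e (B1 \<times> I2)))" "lin (I1 \<times> I2) (\<lambda>e. int (sum e (I1 \<times> B2)))"
    by (intro ls; auto simp: I1_def I2_def R2_def)+
  define y1 where "y1 = (\<lambda>e. 2 * (y0 * int (sum e (I1 \<times> I2)) + int (sum e R2)))"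
  have y1: "lin (I1 \<times> I2) y1" unfolding y1_def by (intro lin_cmult lin_add l1)
  \<comment> \<open>The part of the exponent without N that \<open>qbinom_poch\<close> and two uses
    of \<open>qbinom_qb\<close> produce, with the arguments z, j, j - h, j - k, j - l.\<close>
  define \<mu>e where "\<mu>e = (\<lambda>z j x' a b :: int. - z * (y0 * j + x') - a * (x' - a) - b * (x' - b))"
  define \<mu> where "\<mu> = (\<lambda>(N::nat) e. qv powi (int N * (- n0 * int (sum e (B1 \<times> B2)))) *
     qv powi \<mu>e (int (sum e (B1 \<times> B2))) (int (sum e (I1 \<times> I2))) (int (sum e R2)) (int (sum e (B1 \<times> I2))) (int (sum e (I1 \<times> B2))))"
  have \<mu>: "qmono (I1 \<times> I2) \<mu>"
    unfolding \<mu>_def \<mu>e_def by (intro mono_mult mono_a mono_quad quad_diff quad_mult lin_cmult lin_add lin_diff lin_uminus l1)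
  define \<kappa> where "\<kappa> = (\<lambda>N j k l h. qv powi (int N * (- n0 * int (j + h - (k + l)))) *
     qv powi \<mu>e (int (j + h - (k + l))) (int j) (int (j - h)) (int (j - k)) (int (j - l)) *
     poch (qv powi (int N * (2 * n0) + 2 * (y0 * int j + int (j - h)) + 2)) (j + h - (k + l)) * qfac (j - h))"
  have scalar: "\<mu> N e * poch (qv powi (int N * (2 * n0) + y1 e + 2)) (sum e R1) * poch (qv ^ 2) (sum e R2) = \<kappa> N j (sum d1 A1) (sum d2 A2) h"
    if e: "e \<in> tables I1 I2 d1 d2" and d1: "sum d1 I1 = j" and d2: "sum d2 I2 = j" and h: "sum e (A1 \<times> A2) = h" for N d1 d2 e j h
  proof -
    note bs = block_sums[OF fin dis e[unfolded I1_def I2_def], folded I1_def I2_def]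
    have z: "j + h - (sum d1 A1 + sum d2 A2) = sum e (B1 \<times> B2)" and jh: "j - h = sum e R2"
      and jk: "j - sum d1 A1 = sum e (B1 \<times> I2)" and jl: "j - sum d2 A2 = sum e (I1 \<times> B2)" and jj: "sum e (I1 \<times> I2) = j"
      using bs d1 h by (auto simp: R2_def)
    show ?thesis unfolding \<mu>_def \<kappa>_def z jh jk jl jj y1_def R1_def poch_qfac by simp
  qed
  define G where "G = (\<lambda>N j k l h. glue_coeff (int N * n0 + y0 * int j + int (j - k + (j - l))) (j - k) (j - l) (j - h))"
  have GG: "(qfac k * qfac (j - k) * qfac (j - k)) * (qfac l * qfac (j - l) * qfac (j - l)) * G N j k l h =
      \<kappa> N j k l h * (if h \<le> l then qb k h * qb (j - k) (l - h) * qfac l * qfac (j - l) else 0) * (qfac h * qfac (j - h))"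
    if hj: "h \<le> j" and kj: "k \<le> j" and lj: "l \<le> j" for N j k l h
  proof (cases "h \<le> k \<and> h \<le> l \<and> k + l \<le> j + h")
    case True
    then obtain x y where k: "k = h + x" and l: "l = h + y" by (metis le_iff_add)
    then obtain z where j: "j = h + x + y + z" proof -
      have "j = h + x + y + (j - (h + x + y))" using True k l by simp
      then show thesis by (rule that)
    qed
    have s: "j - k = y + z" "j - l = x + z" "j - h = x + y + z" "l - h = y" "j + h - (k + l) = z"
      "y + z + (x + z) - (x + y + z) = z" by (simp_all add: k l j)
    define n where "n = int N * n0 + y0 * int j + int (y + z + (x + z))"
    have nz: "n - int z = int N * n0 + y0 * int j + int (x + y + z)" by (simp add: n_def)
    have q1: "qbinom n z = qv powi (- int z * (n - int z)) * poch (qv powi (2 * (n - int z) + 2)) z / qfac z" by (rule qbinom_poch)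
    have q2: "qbinom (int (x + y + z)) (y + z) = qv powi (- int (y + z) * (int (x + y + z) - int (y + z))) * (qfac (x + y + z) / (qfac (y + z) * qfac x))"
      using qbinom_qb[of "y + z" "x + y + z"] by (simp add: qb_def)
    have q3: "qbinom (int (x + y + z)) (x + z) = qv powi (- int (x + z) * (int (x + y + z) - int (x + z))) * (qfac (x + y + z) / (qfac (x + z) * qfac y))"
      using qbinom_qb[of "x + z" "x + y + z"] by (simp add: qb_def)
    have GN: "G N j k l h = qbinom n z * qbinom (int (x + y + z)) (y + z) * qbinom (int (x + y + z)) (x + z)"
      unfolding G_def s glue_coeff_def n_def by simp
    have e: "- int z * (n - int z) + (- int (y + z) * (int (x + y + z) - int (y + z)) + - int (x + z) * (int (x + y + z) - int (x + z)))
      = int N * (- n0 * int z) + \<mu>e (int z) (int j) (int (x + y + z)) (int (y + z)) (int (x + z))"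
      unfolding nz \<mu>e_def by (simp add: algebra_simps)
    have e': "qv powi (- int z * (n - int z)) * (qv powi (- int (y + z) * (int (x + y + z) - int (y + z))) * qv powi (- int (x + z) * (int (x + y + z) - int (x + z))))
      = qv powi (int N * (- n0 * int z)) * qv powi \<mu>e (int z) (int j) (int (x + y + z)) (int (y + z)) (int (x + z))"
      unfolding powi_add[OF qv_nonzero, symmetric] e ..
    have X: "2 * (n - int z) + 2 = int N * (2 * n0) + 2 * (y0 * int j + int (x + y + z)) + 2" unfolding nz by simp
    have qb1: "qb k h = qfac (h + x) / (qfac h * qfac x)" by (simp add: qb_def k)
    have qb2: "qb (y + z) y = qfac (y + z) / (qfac y * qfac z)" by (simp add: qb_def)
    define P where "P = poch (qv powi (int N * (2 * n0) + 2 * (y0 * int j + int (x + y + z)) + 2)) z"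
    define C where "C = qv powi (int N * (- n0 * int z)) * qv powi \<mu>e (int z) (int j) (int (x + y + z)) (int (y + z)) (int (x + z))"
    have "G N j k l h = C * (P / qfac z * (qfac (x + y + z) / (qfac (y + z) * qfac x)) * (qfac (x + y + z) / (qfac (x + z) * qfac y)))"
      unfolding GN q1 q2 q3 X P_def[symmetric] C_def e'[symmetric] by simp
    moreover have "\<kappa> N j k l h = C * P * qfac (x + y + z)" unfolding \<kappa>_def s P_def C_def ..
    moreover have "h \<le> l" using l by simp
    ultimately show ?thesis
      unfolding s qb1 by (simp add: qb2 k l) (simp add: field_simps)
  next
    case False
    have "G N j k l h = 0"
      unfolding G_def glue_coeff_def using False hj kj lj by (intro if_not_P) linarith
    moreover have "(if h \<le> l then qb k h * qb (j - k) (l - h) * qfac l * qfac (j - l) else 0) = 0"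
      using False kj by (auto simp: qb_def)
    ultimately show ?thesis by simp
  qed
  have c: "card A1 = active D1" "card B1 = inactive D1" "card A2 = active D2" "card B2 = inactive D2"
    by (simp_all add: A1_def B1_def A2_def B2_def num_indices_def)
  have cI: "card I1 = active D1 + inactive D1" "card I2 = active D2 + inactive D2"
    unfolding I1_def I2_def using fin dis by (simp_all add: card_Un_disjoint c)
  have "card R2 = card (I1 \<times> I2) - card (A1 \<times> A2)"
    unfolding R2_def using fin by (intro card_Diff_subset) (auto simp: I1_def I2_def)
  then have cR: "card R1 = inactive D1 * inactive D2" "card R2 = (active D1 + inactive D1) * (active D2 + inactive D2) - active D1 * active D2"
    by (simp_all add: R1_def card_cartesian_product c cI)
  \<comment> \<open>\<open>R1\<close> lies inside \<open>R2\<close>: the entries of the block BB are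
    doubled twice.\<close>
  have RR: "R1 \<inter> R2 = R1" using dis by (auto simp: R1_def R2_def I1_def I2_def)
  obtain D where D: "num_indices D = card I1 * card I2 + card R1 + card R2 + card (R1 \<inter> R2)"
    "\<And>N c1 c2 j h. h \<le> j \<Longrightarrow> at_rank N (quiver_coeff (c1 + c2) (\<lambda>s t. 1) D j h) =
      (\<Sum>k\<le>j. \<Sum>l\<le>j. form_sum c1 (\<lambda>s t. qfac t) I1 A1 (quiver_mono D1 N) j k * form_sum c2 (\<lambda>s t. qfac t) I2 A2 (quiver_mono D2 N) j l * G N j k l h)"
  proof -
    note pq = product_quiver[OF fin dis, folded I1_def I2_def, of "quiver_mono D1" "quiver_mono D2", folded I,
        OF mono_quiver_mono mono_quiver_mono, unfolded I, OF R y1 \<mu>, of "2 * n0" \<kappa> "\<lambda>s t. qfac t" "\<lambda>s t. qfac t" G]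
    have "\<exists>D. num_indices D = card I1 * card I2 + card R1 + card R2 + card (R1 \<inter> R2) \<and>
      (\<forall>N c1 c2 j. \<forall>h\<le>j. at_rank N (quiver_coeff (c1 + c2) (\<lambda>s t. 1) D j h) =
      (\<Sum>k\<le>j. \<Sum>l\<le>j. form_sum c1 (\<lambda>s t. qfac t) I1 A1 (quiver_mono D1 N) j k * form_sum c2 (\<lambda>s t. qfac t) I2 A2 (quiver_mono D2 N) j l * G N j k l h))"
      by (rule pq) (rule scalar GG; assumption)+
    then show thesis using that by blast
  qed
  have "num_indices D = (active D1 + 2 * inactive D1) * (active D2 + 2 * inactive D2)"
    unfolding D(1) RR cI cR by (simp add: algebra_simps)
  then show ?thesis
    using D(2) unfolding at_rank_quiver_coeff I G_def A1_def[symmetric] A2_def[symmetric]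
    by (intro exI[of _ D]) (simp add: at_rank_quiver_coeff)
qed

text \<open>After \<open>qbinom_mult_qbinom\<close> there is one symbol with N, of length y + z = j
  - k, and its denominator cancels. The second symbol to absorb is the extra factor (q^2)_l of the
  active form itself.\<close>

lemma glue_quiver_OP_UP:
  shows "\<exists>D. num_indices D = (active D1 + 2 * inactive D1) * (2 * active D2 + inactive D2) \<and>
    (\<forall>N c1 c2 j. \<forall>h\<le>j. at_rank N (quiver_coeff (c1 + c2) (\<lambda>s t. 1) D j h) =
      (\<Sum>k\<le>j. \<Sum>l\<le>j. at_rank N (quiver_coeff c1 (\<lambda>s t. qfac t) D1 j k) * at_rank N (quiver_coeff c2 (\<lambda>s t. qfac s) D2 j l) *
         (if h \<le> k \<and> h \<le> l \<and> k + l \<le> j + h then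
           qbinom (int N - int k - int l) (j + h - (k + l)) * qbinom (int (j - h)) (j - k) * qbinom (int N - int j - int h) (l - h) else 0)))"
proof -
  define A1 B1 A2 B2 where "A1 = {..<active D1}" and "B1 = {active D1..<num_indices D1}"
    and "A2 = {..<active D2}" and "B2 = {active D2..<num_indices D2}"
  define I1 I2 where "I1 = A1 \<union> B1" and "I2 = A2 \<union> B2"
  have I: "{..<num_indices D1} = I1" "{..<num_indices D2} = I2"
    unfolding I1_def I2_def A1_def B1_def A2_def B2_def num_indices_def by auto
  have fin: "finite A1" "finite B1" "finite A2" "finite B2" and dis: "A1 \<inter> B1 = {}" "A2 \<inter> B2 = {}"
    unfolding A1_def B1_def A2_def B2_def by auto
  \<comment> \<open>The sum over R1 is j - k, the one over R2 is l. The blocks AA, AB, BA, BB get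
    the multiplicities 2, 1, 4, 2: inactive rows and active columns count twice.\<close>
  define R1 R2 where "R1 = B1 \<times> I2" and "R2 = I1 \<times> A2"
  have R: "R1 \<subseteq> I1 \<times> I2" "R2 \<subseteq> I1 \<times> I2" by (auto simp: R1_def R2_def I1_def I2_def)
  have finI: "finite (I1 \<times> I2)" using fin by (simp add: I1_def I2_def)
  have ls: "lin (I1 \<times> I2) (\<lambda>e. int (sum e S))" if "S \<subseteq> I1 \<times> I2" for S
    using finI that by (rule lin_sum_subset)
  have l1: "lin (I1 \<times> I2) (\<lambda>e. int (sum e (B1 \<times> B2)))" "lin (I1 \<times> I2) (\<lambda>e. int (sum e (I1 \<times> I2)))"
    "lin (I1 \<times> I2) (\<lambda>e. int (sum e R1))" "lin (I1 \<times> I2) (\<lambda>e. int (sum e R2))"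
    "lin (I1 \<times> I2) (\<lambda>e. int (sum e (B1 \<times> A2)))" "lin (I1 \<times> I2) (\<lambda>e. int (sum e (A1 \<times> B2)))"
    by (intro ls; auto simp: I1_def I2_def R1_def R2_def)+
  define y1 where "y1 = (\<lambda>e. - 2 * (int (sum e (I1 \<times> I2)) + int (sum e R2)))"
  have y1: "lin (I1 \<times> I2) y1" unfolding y1_def by (intro lin_cmult lin_add l1)
  define \<mu>e where "\<mu>e = (\<lambda>x y z a j l :: int. a * (j + l) - y * z - a * x)"
  define \<mu> where "\<mu> = (\<lambda>(N::nat) e. qv powi (int N * (- int (sum e R1))) *
     qv powi \<mu>e (int (sum e (A1 \<times> B2))) (int (sum e (B1 \<times> A2))) (int (sum e (B1 \<times> B2))) (int (sum e R1)) (int (sum e (I1 \<times> I2))) (int (sum e R2)))"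
  have \<mu>: "qmono (I1 \<times> I2) \<mu>"
    unfolding \<mu>_def \<mu>e_def by (intro mono_mult mono_a mono_quad quad_diff quad_mult lin_add lin_uminus l1)
  define \<kappa> where "\<kappa> = (\<lambda>N j k l h. qv powi (int N * (- int (j - k))) *
     qv powi \<mu>e (int (k - h)) (int (l - h)) (int (j + h - (k + l))) (int (j - k)) (int j) (int l) *
     poch (qv powi (int N * 2 + - 2 * (int j + int l) + 2)) (j - k) * qfac l)"
  have scalar: "\<mu> N e * poch (qv powi (int N * 2 + y1 e + 2)) (sum e R1) * poch (qv ^ 2) (sum e R2) = \<kappa> N j (sum d1 A1) (sum d2 A2) h"
    if e: "e \<in> tables I1 I2 d1 d2" and d1: "sum d1 I1 = j" and d2: "sum d2 I2 = j" and h: "sum e (A1 \<times> A2) = h" for N d1 d2 e j h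
  proof -
    note bs = block_sums[OF fin dis e[unfolded I1_def I2_def], folded I1_def I2_def]
    have z: "j + h - (sum d1 A1 + sum d2 A2) = sum e (B1 \<times> B2)" and kh: "sum d1 A1 - h = sum e (A1 \<times> B2)"
      and lh: "sum d2 A2 - h = sum e (B1 \<times> A2)" and jk: "j - sum d1 A1 = sum e R1" and jj: "sum e (I1 \<times> I2) = j" and l: "sum d2 A2 = sum e R2"
      using bs d1 h by (auto simp: R1_def R2_def)
    show ?thesis unfolding \<mu>_def \<kappa>_def z kh lh jk jj y1_def poch_qfac unfolding l by simp
  qed
  define G where "G = (\<lambda>N j k l h. if h \<le> k \<and> h \<le> l \<and> k + l \<le> j + h then
           qbinom (int N - int k - int l) (j + h - (k + l)) * qbinom (int (j - h)) (j - k) * qbinom (int N - int j - int h) (l - h) else 0)"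
  have GG: "(qfac k * qfac (j - k) * qfac (j - k)) * (qfac l * qfac (j - l) * qfac l) * G N j k l h =
      \<kappa> N j k l h * (if h \<le> l then qb k h * qb (j - k) (l - h) * qfac l * qfac (j - l) else 0) * (qfac h * qfac (j - h))"
    if hj: "h \<le> j" and kj: "k \<le> j" and lj: "l \<le> j" for N j k l h
  proof (cases "h \<le> k \<and> h \<le> l \<and> k + l \<le> j + h")
    case True
    then obtain x y where k: "k = h + x" and l: "l = h + y" by (metis le_iff_add)
    then obtain z where j: "j = h + x + y + z" proof -
      have "j = h + x + y + (j - (h + x + y))" using True k l by simp
      then show thesis by (rule that)
    qed
    have s: "j - k = y + z" "j - l = x + z" "j - h = x + y + z" "l - h = y" "k - h = x" "j + h - (k + l) = z"
      by (simp_all add: k l j)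
    define n where "n = int N - int k - int l"
    have nz: "int N - int j - int h = n - int z" by (simp add: n_def k l j)
    have nyz: "n - int (z + y) = int N - int j - int l" by (simp add: n_def k l j)
    have q1: "qbinom n (z + y) = qv powi (- int (z + y) * (n - int (z + y))) * poch (qv powi (2 * (n - int (z + y)) + 2)) (z + y) / qfac (z + y)" by (rule qbinom_poch)
    have q2: "qbinom (int (z + y)) y = qv powi (- int y * (int (z + y) - int y)) * (qfac (z + y) / (qfac y * qfac z))"
      using qbinom_qb[of y "z + y"] by (simp add: qb_def)
    have q3: "qbinom (int (x + y + z)) (y + z) = qv powi (- int (y + z) * (int (x + y + z) - int (y + z))) * (qfac (x + y + z) / (qfac (y + z) * qfac x))"
      using qbinom_qb[of "y + z" "x + y + z"] by (simp add: qb_def)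
    have GN: "G N j k l h = qbinom n z * qbinom (n - int z) y * qbinom (int (x + y + z)) (y + z)"
      unfolding G_def s nz n_def[symmetric] using True by (simp add: s)
    have e: "- int (z + y) * (n - int (z + y)) + (- int y * (int (z + y) - int y) + - int (y + z) * (int (x + y + z) - int (y + z)))
      = int N * (- int (y + z)) + \<mu>e (int x) (int y) (int z) (int (y + z)) (int j) (int l)"
      unfolding nyz \<mu>e_def by (simp add: algebra_simps)
    have e': "qv powi (- int (z + y) * (n - int (z + y))) * (qv powi (- int y * (int (z + y) - int y)) * qv powi (- int (y + z) * (int (x + y + z) - int (y + z))))
      = qv powi (int N * (- int (y + z))) * qv powi \<mu>e (int x) (int y) (int z) (int (y + z)) (int j) (int l)"
      unfolding powi_add[OF qv_nonzero, symmetric] e ..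
    have X: "2 * (n - int (z + y)) + 2 = int N * 2 + - 2 * (int j + int l) + 2" unfolding nyz by simp
    have qb1: "qb k h = qfac (h + x) / (qfac h * qfac x)" by (simp add: qb_def k)
    have qb2: "qb (y + z) y = qfac (y + z) / (qfac y * qfac z)" by (simp add: qb_def)
    define P where "P = poch (qv powi (int N * 2 + - 2 * (int j + int l) + 2)) (y + z)"
    have P': "poch (qv powi (int N * 2 + - 2 * (int j + int l) + 2)) (z + y) = P" by (simp add: P_def add.commute)
    define C where "C = qv powi (int N * (- int (y + z))) * qv powi \<mu>e (int x) (int y) (int z) (int (y + z)) (int j) (int l)"
    have "G N j k l h = C * (P / qfac (z + y) * (qfac (z + y) / (qfac y * qfac z)) * (qfac (x + y + z) / (qfac (y + z) * qfac x)))"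
      unfolding GN qbinom_mult_qbinom q1 q2 q3 X P' C_def e'[symmetric] by simp
    also have "\<dots> = C * (P / (qfac y * qfac z) * (qfac (x + y + z) / (qfac (y + z) * qfac x)))" by simp
    finally have "G N j k l h = \<dots>" .
    moreover have "\<kappa> N j k l h = C * P * qfac l" unfolding \<kappa>_def s P_def C_def ..
    moreover have "h \<le> l" using l by simp
    ultimately show ?thesis
      unfolding s qb1 by (simp add: qb2 k l) (simp add: field_simps)
  next
    case False
    have "G N j k l h = 0"
      unfolding G_def using False by (intro if_not_P)
    moreover have "(if h \<le> l then qb k h * qb (j - k) (l - h) * qfac l * qfac (j - l) else 0) = 0"
      using False kj by (auto simp: qb_def)
    ultimately show ?thesis by simp
  qed
  have c: "card A1 = active D1" "card B1 = inactive D1" "card A2 = active D2" "card B2 = inactive D2"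
    by (simp_all add: A1_def B1_def A2_def B2_def num_indices_def)
  have cI: "card I1 = active D1 + inactive D1" "card I2 = active D2 + inactive D2"
    unfolding I1_def I2_def using fin dis by (simp_all add: card_Un_disjoint c)
  have RR: "R1 \<inter> R2 = B1 \<times> A2" by (auto simp: R1_def R2_def I1_def I2_def)
  have cR: "card R1 = inactive D1 * (active D2 + inactive D2)" "card R2 = (active D1 + inactive D1) * active D2"
    "card (R1 \<inter> R2) = inactive D1 * active D2"
    unfolding RR by (simp_all add: R1_def R2_def card_cartesian_product c cI)
  obtain D where D: "num_indices D = card I1 * card I2 + card R1 + card R2 + card (R1 \<inter> R2)"
    "\<And>N c1 c2 j h. h \<le> j \<Longrightarrow> at_rank N (quiver_coeff (c1 + c2) (\<lambda>s t. 1) D j h) =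
      (\<Sum>k\<le>j. \<Sum>l\<le>j. form_sum c1 (\<lambda>s t. qfac t) I1 A1 (quiver_mono D1 N) j k * form_sum c2 (\<lambda>s t. qfac s) I2 A2 (quiver_mono D2 N) j l * G N j k l h)"
  proof -
    note pq = product_quiver[OF fin dis, folded I1_def I2_def, of "quiver_mono D1" "quiver_mono D2", folded I,
        OF mono_quiver_mono mono_quiver_mono, unfolded I, OF R y1 \<mu>, of "2" \<kappa> "\<lambda>s t. qfac t" "\<lambda>s t. qfac s" G]
    have "\<exists>D. num_indices D = card I1 * card I2 + card R1 + card R2 + card (R1 \<inter> R2) \<and>
      (\<forall>N c1 c2 j. \<forall>h\<le>j. at_rank N (quiver_coeff (c1 + c2) (\<lambda>s t. 1) D j h) =
      (\<Sum>k\<le>j. \<Sum>l\<le>j. form_sum c1 (\<lambda>s t. qfac t) I1 A1 (quiver_mono D1 N) j k * form_sum c2 (\<lambda>s t. qfac s) I2 A2 (quiver_mono D2 N) j l * G N j k l h))"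
      by (rule pq) (rule scalar GG; assumption)+
    then show thesis using that by blast
  qed
  have "num_indices D = (active D1 + 2 * inactive D1) * (2 * active D2 + inactive D2)"
    unfolding D(1) cI cR by (simp add: algebra_simps)
  then show ?thesis
    using D(2) unfolding at_rank_quiver_coeff I G_def A1_def[symmetric] A2_def[symmetric]
    by (intro exI[of _ D]) (simp add: at_rank_quiver_coeff)
qed

section \<open>Composition of webs and tangle words\<close>

text \<open>Only the number of strands is checked. That is enough, since the intermediate states of
  \<open>web_matrix\<close> range over the output labels of each piece, whatever comes in.\<close>

fun wends :: "nat list \<Rightarrow> wpiece word \<Rightarrow> nat list option" where
  "wends ks [] = Some ks"
| "wends ks ((i, g) # w) = (if i + arity g \<le> length ks
     then wends (take i ks @ out_labels g @ drop (i + arity g) ks) w else None)"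

lemma states_iff: "xs \<in> states N ks \<longleftrightarrow> list_all2 (\<lambda>S k. S \<in> ksets N k) xs ks"
proof (induction ks arbitrary: xs)
  case (Cons k ks)
  then show ?case by (cases xs) (auto simp: states_Cons)
qed (simp add: states_Nil)

lemma states_length: "xs \<in> states N ks \<Longrightarrow> length xs = length ks"
  by (simp add: states_iff list_all2_lengthD)

lemma states_append: "xs \<in> states N ks \<Longrightarrow> ys \<in> states N ls \<Longrightarrow> xs @ ys \<in> states N (ks @ ls)"
  by (simp add: states_iff list_all2_appendI)

lemma states_take: "xs \<in> states N ks \<Longrightarrow> take n xs \<in> states N (take n ks)"
  by (simp add: states_iff list_all2_takeI)

lemma states_drop: "xs \<in> states N ks \<Longrightarrow> drop n xs \<in> states N (drop n ks)"
  by (simp add: states_iff list_all2_dropI)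

lemma shift_Nil [simp]: "shift n [] = []"
  by (simp add: shift_def)

lemma shift_Cons [simp]: "shift n ((i, g) # w) = (n + i, g) # shift n w"
  by (simp add: shift_def)

lemma shift_append: "shift n (v @ w) = shift n v @ shift n w"
  by (simp add: shift_def)

lemma shift_0 [simp]: "shift 0 w = w"
  by (induction w) auto

lemma shift_shift: "shift m (shift n w) = shift (m + n) w"
  by (induction w) (auto simp: add.assoc)

text \<open>Functoriality of the evaluation: the strands L and R pass by unchanged, so a word in the
  middle of a diagram acts by matrix multiplication.\<close>

lemma web_matrix_shift:
  assumes "wends ks w = Some ls" "xs \<in> states N ks"
  shows "web_matrix N (shift (length L) w @ u) (L @ xs @ R) ys =
    (\<Sum>zs\<in>states N ls. web_matrix N w xs zs * web_matrix N u (L @ zs @ R) ys)"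
  using assms
proof (induction w arbitrary: ks xs)
  case Nil
  then have "(\<Sum>zs\<in>states N ls. web_matrix N [] xs zs * web_matrix N u (L @ zs @ R) ys) =
     (\<Sum>zs\<in>states N ls. if zs = xs then web_matrix N u (L @ xs @ R) ys else 0)"
    by (intro sum.cong) auto
  then show ?case using Nil finite_states by (simp add: sum.delta)
next
  case (Cons p w)
  obtain i g where p: "p = (i, g)" by fastforce
  from Cons.prems have i: "i + arity g \<le> length ks" and w: "wends (take i ks @ out_labels g @ drop (i + arity g) ks) w = Some ls"
    by (auto simp: p split: if_splits)
  have len: "length xs = length ks" using Cons.prems(2) by (rule states_length)
  have "web_matrix N (shift (length L) (p # w) @ u) (L @ xs @ R) ys =
     (\<Sum>as\<in>states N (out_labels g). entry N g (take (arity g) (drop i xs)) as *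
        web_matrix N (shift (length L) w @ u) (L @ (take i xs @ as @ drop (i + arity g) xs) @ R) ys)"
    using i len by (simp add: p web_matrix.simps(2))
  also have "\<dots> = (\<Sum>as\<in>states N (out_labels g). entry N g (take (arity g) (drop i xs)) as *
        (\<Sum>zs\<in>states N ls. web_matrix N w (take i xs @ as @ drop (i + arity g) xs) zs * web_matrix N u (L @ zs @ R) ys))"
    by (intro sum.cong refl arg_cong2[of _ _ _ _ "(*)"] Cons.IH[OF w] states_append states_take states_drop Cons.prems(2))
  also have "\<dots> = (\<Sum>zs\<in>states N ls. web_matrix N (p # w) xs zs * web_matrix N u (L @ zs @ R) ys)"
    unfolding p web_matrix.simps(2) sum_distrib_left sum_distrib_right by (subst sum.swap) (simp add: mult.assoc)
  finally show ?case .
qed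

lemma wends_append: "wends ks (u @ v) = Option.bind (wends ks u) (\<lambda>ls. wends ls v)"
  by (induction u arbitrary: ks) auto

lemma wends_shift: "wends ks u = Some ls \<Longrightarrow> wends (L @ ks @ R) (shift (length L) u) = Some (L @ ls @ R)"
proof (induction u arbitrary: ks)
  case (Cons p u)
  obtain i g where p: "p = (i, g)" by fastforce
  from Cons.prems have i: "i + arity g \<le> length ks" and u: "wends (take i ks @ out_labels g @ drop (i + arity g) ks) u = Some ls"
    by (auto simp: p split: if_splits)
  from Cons.IH[OF u] i show ?case by (simp add: p)
qed auto

lemma replicate_replace:
  "i + a \<le> n \<Longrightarrow> take i (replicate n x) @ replicate b x @ drop (i + a) (replicate n x) = replicate (n - a + b) x"
  by (simp add: replicate_add[symmetric])

lemma wends_crossing: "k \<le> j \<Longrightarrow> wends [j, j] (crossing_web j k d e) = Some [j, j]"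
  by (cases d; cases e) (simp_all add: basic_web.simps)

lemma wends_resolve:
  "ends ds w = Some es \<Longrightarrow> (c, u) \<in> set (resolve j w) \<Longrightarrow> wends (replicate (length ds) j) u = Some (replicate (length es) j)"
proof (induction w arbitrary: ds c u)
  case (Cons p w)
  obtain i g where p: "p = (i, g)" by fastforce
  from Cons.prems(1) have i: "i \<le> length ds" "take (length (source g)) (drop i ds) = source g"
    and es: "ends (take i ds @ target g @ drop (i + length (source g)) ds) w = Some es"
    by (auto simp: p split: if_splits)
  from i have li: "i + length (source g) \<le> length ds"
    by (metis length_drop length_take min.absorb_iff2 le_diff_conv2 add.commute min_def nle_le)
  have "length (take i ds @ target g @ drop (i + length (source g)) ds) = length ds - length (source g) + length (target g)"
    using li by simp
  note IH = Cons.IH[OF es, unfolded this]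
  show ?case
  proof (cases g)
    case (Cup d)
    then obtain u' where u: "u = (i, WCup d j) # u'" "(c, u') \<in> set (resolve j w)" using Cons.prems(2) p by auto
    then show ?thesis using IH[OF u(2)] li Cup replicate_replace[of i 0 "length ds" j 2] by (simp add: numeral_2_eq_2)
  next
    case (Cap d)
    then obtain u' where u: "u = (i, WCap d j) # u'" "(c, u') \<in> set (resolve j w)" using Cons.prems(2) p by auto
    then show ?thesis using IH[OF u(2)] li Cap replicate_replace[of i 2 "length ds" j 0] by (simp add: numeral_2_eq_2)
  next
    case (Cross x d e)
    then obtain k c' u' where u: "u = shift i (crossing_web j k d e) @ u'" "k \<le> j" "(c', u') \<in> set (resolve j w)"
      using Cons.prems(2) p by (auto simp: less_Suc_eq_le)
    have "replicate (length ds) j = replicate i j @ [j, j] @ replicate (length ds - (i + 2)) j"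
    proof -
      have "length ds = i + (2 + (length ds - (i + 2)))" using li Cross by simp
      then have "replicate (length ds) j = replicate i j @ replicate 2 j @ replicate (length ds - (i + 2)) j"
        by (metis replicate_add)
      then show ?thesis by (simp add: numeral_2_eq_2)
    qed
    moreover have "wends (replicate i j @ [j, j] @ replicate (length ds - (i + 2)) j) (shift (length (replicate i j)) (crossing_web j k d e))
        = Some (replicate i j @ [j, j] @ replicate (length ds - (i + 2)) j)"
      by (intro wends_shift wends_crossing u)
    ultimately have "wends (replicate (length ds) j) (shift i (crossing_web j k d e)) = Some (replicate (length ds) j)"
      by simp
    moreover have "length ds - length (source g) + length (target g) = length ds" using li Cross by simp
    ultimately show ?thesis using IH[OF u(3)] u(1) by (simp only: wends_append bind.bind_lunit)
  qed
qed auto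

text \<open>The matrix of a bare word, which can be cut between any two layers, unlike that of a
  tangle with its fixed bottom.\<close>

definition word_matrix :: "nat \<Rightarrow> nat \<Rightarrow> piece word \<Rightarrow> nat set list \<Rightarrow> nat set list \<Rightarrow> qfield" where
  "word_matrix N j w xs ys = (\<Sum>(c, u) \<leftarrow> resolve j w. c * web_matrix N u xs ys)"

lemma tangle_matrix_word: "tangle_matrix N j \<tau> = word_matrix N j (snd \<tau>)"
  by (simp add: tangle_matrix_def word_matrix_def fun_eq_iff)

lemma sum_list_concat_map: "(\<Sum>x\<leftarrow>concat (map g ks). f x) = (\<Sum>k\<leftarrow>ks. \<Sum>x\<leftarrow>g k. (f x :: qfield))"
  by (induction ks) auto

lemma sum_list_resolve_Cross:
  "(\<Sum>(c, u) \<leftarrow> resolve j ((i, Cross x d e) # w). c * f u) =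
   (\<Sum>k\<leftarrow>[0..<Suc j]. (- qv) powi (if positive x d e then int k - int j else int j - int k) *
      (\<Sum>(c, u) \<leftarrow> resolve j w. c * f (shift i (crossing_web j k d e) @ u)))"
  unfolding resolve.simps sum_list_concat_map
  by (intro arg_cong[of _ _ sum_list] map_cong refl)
    (simp add: comp_def case_prod_unfold sum_list_const_mult mult.assoc)

text \<open>Resolving crossings is multiplicative. The functional f is arbitrary because the
  induction moves the first piece of the word into it.\<close>

lemma sum_list_resolve_append:
  "(\<Sum>(c, u) \<leftarrow> resolve j (v @ w). c * f u) = (\<Sum>(c, u) \<leftarrow> resolve j v. c * (\<Sum>(c', u') \<leftarrow> resolve j w. c' * f (u @ u')))"
proof (induction v arbitrary: f)
  case (Cons p v)
  obtain i g where p: "p = (i, g)" by fastforce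
  show ?case
  proof (cases g)
    case (Cross x d e)
    then show ?thesis unfolding p append_Cons Cross sum_list_resolve_Cross Cons.IH by simp
  qed (use Cons.IH in \<open>simp_all add: p comp_def case_prod_beta\<close>)
qed simp

lemma sum_list_resolve_shift:
  "(\<Sum>(c, u) \<leftarrow> resolve j (shift n w). c * f u) = (\<Sum>(c, u) \<leftarrow> resolve j w. c * f (shift n u))"
proof (induction w arbitrary: f)
  case (Cons p w)
  obtain i g where p: "p = (i, g)" by fastforce
  show ?case
  proof (cases g)
    case (Cross x d e)
    then show ?thesis unfolding p shift_Cons Cross sum_list_resolve_Cross Cons.IH shift_append shift_shift by simp
  qed (use Cons.IH in \<open>simp_all add: p comp_def case_prod_beta\<close>)
qed simp

lemma sum_list_sum_swap:
  "(\<Sum>(c, u) \<leftarrow> l. c * (\<Sum>z\<in>Z. g u z * h z)) = (\<Sum>z\<in>Z. (\<Sum>(c, u) \<leftarrow> l. c * g u z) * (h z :: qfield))"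
  by (induction l) (auto simp: distrib_right sum.distrib sum_distrib_left mult.assoc)

lemma word_matrix_shift:
  assumes "ends ds w = Some es" "xs \<in> states N (replicate (length ds) j)"
  shows "word_matrix N j (shift (length L) w @ v) (L @ xs @ R) ys =
    (\<Sum>zs\<in>states N (replicate (length es) j). word_matrix N j w xs zs * word_matrix N j v (L @ zs @ R) ys)"
proof -
  have "word_matrix N j (shift (length L) w @ v) (L @ xs @ R) ys =
     (\<Sum>(c, u) \<leftarrow> resolve j w. c * (\<Sum>(c', u') \<leftarrow> resolve j v. c' * web_matrix N (shift (length L) u @ u') (L @ xs @ R) ys))"
    unfolding word_matrix_def sum_list_resolve_append sum_list_resolve_shift[where f = "\<lambda>u. \<Sum>(c', u') \<leftarrow> resolve j v. c' * web_matrix N (u @ u') (L @ xs @ R) ys"] ..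
  also have "\<dots> = (\<Sum>(c, u) \<leftarrow> resolve j w. c * (\<Sum>zs\<in>states N (replicate (length es) j). web_matrix N u xs zs * word_matrix N j v (L @ zs @ R) ys))"
  proof (intro arg_cong[of _ _ sum_list] map_cong refl)
    fix p assume p: "p \<in> set (resolve j w)"
    obtain c u where cu: "p = (c, u)" by fastforce
    have "wends (replicate (length ds) j) u = Some (replicate (length es) j)"
      using wends_resolve[OF assms(1)] p cu by simp
    from web_matrix_shift[OF this assms(2)]
    have "(\<Sum>(c', u') \<leftarrow> resolve j v. c' * web_matrix N (shift (length L) u @ u') (L @ xs @ R) ys) =
       (\<Sum>(c', u') \<leftarrow> resolve j v. c' * (\<Sum>zs\<in>states N (replicate (length es) j). web_matrix N u' (L @ zs @ R) ys * web_matrix N u xs zs))"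
      by (simp only: mult.commute)
    also have "\<dots> = (\<Sum>zs\<in>states N (replicate (length es) j). web_matrix N u xs zs * word_matrix N j v (L @ zs @ R) ys)"
      unfolding sum_list_sum_swap word_matrix_def by (simp only: mult.commute)
    finally show "(case p of (c, u) \<Rightarrow> c * (\<Sum>(c', u') \<leftarrow> resolve j v. c' * web_matrix N (shift (length L) u @ u') (L @ xs @ R) ys)) =
       (case p of (c, u) \<Rightarrow> c * (\<Sum>zs\<in>states N (replicate (length es) j). web_matrix N u xs zs * word_matrix N j v (L @ zs @ R) ys))"
      unfolding cu by simp
  qed
  also have "\<dots> = (\<Sum>zs\<in>states N (replicate (length es) j). word_matrix N j w xs zs * word_matrix N j v (L @ zs @ R) ys)"
    unfolding sum_list_sum_swap word_matrix_def ..
  finally show ?thesis .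
qed

lemma word_Cup:
  assumes "length pre = i"
  shows "word_matrix N j ((i, Cup d) # w) (pre @ post) ys =
    (\<Sum>S\<in>ksets N j. cup_weight N d S * word_matrix N j w (pre @ S # S # post) ys)"
proof -
  have "word_matrix N j ((i, Cup d) # w) (pre @ post) ys =
     (\<Sum>(c, u) \<leftarrow> resolve j w. c * (\<Sum>S\<in>ksets N j. web_matrix N u (pre @ S # S # post) ys * cup_weight N d S))"
    unfolding word_matrix_def by (simp add: comp_def case_prod_unfold web_WCup[OF assms] mult.commute)
  also have "\<dots> = (\<Sum>S\<in>ksets N j. cup_weight N d S * word_matrix N j w (pre @ S # S # post) ys)"
    unfolding sum_list_sum_swap word_matrix_def by (simp only: mult.commute)
  finally show ?thesis .
qed

lemma word_Cap:
  assumes "length pre = i"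
  shows "word_matrix N j [(i, Cap d)] (pre @ S # T # post) ys =
    (if S = T \<and> pre @ post = ys then cap_weight N d S else 0)"
  unfolding word_matrix_def by (simp add: web_WCap[OF assms])

lemma T4_iff: "\<tau> \<in> T4 \<longleftrightarrow> (\<exists>d1 d2 w e1 e2. \<tau> = ([d1, d2], w) \<and> ends [d1, d2] w = Some [e1, e2])"
proof -
  have "length ds = 2 \<longleftrightarrow> (\<exists>a b. ds = [a, b])" for ds :: "dir list"
    by (cases ds rule: list.exhaust; cases "tl ds" rule: list.exhaust) (auto simp: length_Suc_conv numeral_2_eq_2)
  then show ?thesis by (auto simp: T4_def)
qed

lemma ends_append: "ends ds (v @ w) = Option.bind (ends ds v) (\<lambda>es. ends es w)"
  by (induction v arbitrary: ds) auto

lemma ends_shift: "ends ds w = Some es \<Longrightarrow> ends (L @ ds @ R) (shift (length L) w) = Some (L @ es @ R)"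
proof (induction w arbitrary: ds)
  case (Cons p w)
  obtain i g where p: "p = (i, g)" by fastforce
  from Cons.prems have i: "i \<le> length ds" "take (length (source g)) (drop i ds) = source g"
    and es: "ends (take i ds @ target g @ drop (i + length (source g)) ds) w = Some es"
    by (auto simp: p split: if_splits)
  from i have li: "i + length (source g) \<le> length ds"
    by (metis length_drop length_take min.absorb_iff2 le_diff_conv2 add.commute min_def nle_le)
  have "length (source g) - (length ds - i) = 0" using li by simp
  then show ?case using Cons.IH[OF es] i li by (simp add: p)
qed simp

lemma opp_opp [simp]: "opp (opp d) = d"
  by (cases d) auto

text \<open>U is the label of the connecting cup and V that of the cap. Each summand acts on its own
  two strands by \<open>word_matrix_shift\<close>, and the cap forces the two inner top labels to
  agree.\<close>

lemma tangle_add_matrix: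
  assumes "\<tau>1 \<in> T4" "\<tau>2 \<in> T4" and x: "x1 \<in> ksets N j" "x2 \<in> ksets N j" "y1 \<in> ksets N j" "y2 \<in> ksets N j"
  shows "tangle_matrix N j (tangle_add \<tau>1 \<tau>2) [x1, x2] [y1, y2] =
    (\<Sum>U\<in>ksets N j. \<Sum>V\<in>ksets N j. cup_weight N (lower \<tau>1 ! 1) U * cap_weight N (upper \<tau>1 ! 1) V *
       (tangle_matrix N j \<tau>1 [x1, U] [y1, V] * tangle_matrix N j \<tau>2 [U, x2] [V, y2]))"
proof -
  obtain c1 c2 w1 e1 e2 where t1: "\<tau>1 = ([c1, c2], w1)" "ends [c1, c2] w1 = Some [e1, e2]" using assms(1) T4_iff by auto
  obtain d1 d2 w2 f1 f2 where t2: "\<tau>2 = ([d1, d2], w2)" "ends [d1, d2] w2 = Some [f1, f2]" using assms(2) T4_iff by auto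
  have st: "[S, T] \<in> states N (replicate (length [c, d]) j)" if "S \<in> ksets N j" "T \<in> ksets N j" for S T and c d :: dir
    using that by (simp add: states_two numeral_2_eq_2)
  have ssum: "(\<Sum>zs\<in>states N (replicate (length [c, d]) j). f zs) = (\<Sum>S\<in>ksets N j. \<Sum>T\<in>ksets N j. f [S, T])" for f :: "nat set list \<Rightarrow> qfield" and c d :: dir
    by (simp add: sum_states_Cons sum_states_Nil)
  let ?cap = "[(1, Cap e2)]"
  have inner: "word_matrix N j (w1 @ shift 2 w2 @ ?cap) [x1, U, U, x2] [y1, y2] =
     (\<Sum>V\<in>ksets N j. cap_weight N e2 V * (word_matrix N j w1 [x1, U] [y1, V] * word_matrix N j w2 [U, x2] [V, y2]))" if U: "U \<in> ksets N j" for U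
  proof -
    have "word_matrix N j (w1 @ shift 2 w2 @ ?cap) [x1, U, U, x2] [y1, y2] =
      (\<Sum>P\<in>ksets N j. \<Sum>V\<in>ksets N j. word_matrix N j w1 [x1, U] [P, V] * word_matrix N j (shift 2 w2 @ ?cap) [P, V, U, x2] [y1, y2])"
      using word_matrix_shift[OF t1(2) st[OF x(1) U], of "[]" "shift 2 w2 @ ?cap" "[U, x2]" "[y1, y2]"] unfolding ssum by simp
    also have "\<dots> = (\<Sum>P\<in>ksets N j. \<Sum>V\<in>ksets N j. if P = y1 then word_matrix N j w1 [x1, U] [y1, V] * (word_matrix N j w2 [U, x2] [V, y2] * cap_weight N e2 V) else 0)"
    proof (intro sum.cong refl)
      fix P V assume V: "V \<in> ksets N j"
      have "word_matrix N j (shift 2 w2 @ ?cap) [P, V, U, x2] [y1, y2] =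
        (\<Sum>V'\<in>ksets N j. \<Sum>R\<in>ksets N j. word_matrix N j w2 [U, x2] [V', R] * word_matrix N j ?cap [P, V, V', R] [y1, y2])"
        using word_matrix_shift[OF t2(2) st[OF U x(2)], of "[P, V]" ?cap "[]" "[y1, y2]"] unfolding ssum by (simp add: numeral_2_eq_2)
      also have "\<dots> = (\<Sum>V'\<in>ksets N j. \<Sum>R\<in>ksets N j. if R = y2 then (if V' = V then (if P = y1 then word_matrix N j w2 [U, x2] [V, y2] * cap_weight N e2 V else 0) else 0) else 0)"
        using word_Cap[of "[P]" 1 N j e2 V] by (intro sum.cong refl) auto
      also have "\<dots> = (if P = y1 then word_matrix N j w2 [U, x2] [V, y2] * cap_weight N e2 V else 0)"
        using x V by (simp add: sum.delta)
      finally show "word_matrix N j w1 [x1, U] [P, V] * word_matrix N j (shift 2 w2 @ ?cap) [P, V, U, x2] [y1, y2] =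
        (if P = y1 then word_matrix N j w1 [x1, U] [y1, V] * (word_matrix N j w2 [U, x2] [V, y2] * cap_weight N e2 V) else 0)" by simp
    qed
    also have "\<dots> = (\<Sum>V\<in>ksets N j. \<Sum>P\<in>ksets N j. if P = y1 then word_matrix N j w1 [x1, U] [y1, V] * (word_matrix N j w2 [U, x2] [V, y2] * cap_weight N e2 V) else 0)"
      by (rule sum.swap)
    also have "\<dots> = (\<Sum>V\<in>ksets N j. cap_weight N e2 V * (word_matrix N j w1 [x1, U] [y1, V] * word_matrix N j w2 [U, x2] [V, y2]))"
      using x by (simp add: sum.delta ac_simps)
    finally show ?thesis .
  qed
  have "tangle_matrix N j (tangle_add \<tau>1 \<tau>2) [x1, x2] [y1, y2] =
     word_matrix N j ((1, Cup c2) # w1 @ shift 2 w2 @ ?cap) [x1, x2] [y1, y2]"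
    by (simp add: tangle_matrix_word tangle_add_def t1 t2 lower_def upper_def)
  also have "\<dots> = (\<Sum>U\<in>ksets N j. cup_weight N c2 U * word_matrix N j (w1 @ shift 2 w2 @ ?cap) [x1, U, U, x2] [y1, y2])"
    using word_Cup[of "[x1]" 1 N j c2 "w1 @ shift 2 w2 @ ?cap" "[x2]"] by simp
  also have "\<dots> = (\<Sum>U\<in>ksets N j. \<Sum>V\<in>ksets N j. cup_weight N c2 U * cap_weight N e2 V *
       (word_matrix N j w1 [x1, U] [y1, V] * word_matrix N j w2 [U, x2] [V, y2]))"
    by (intro sum.cong refl) (simp only: inner sum_distrib_left mult.assoc)
  finally show ?thesis by (simp add: tangle_matrix_word t1 t2 lower_def upper_def)
qed

lemma tangle_add_ends:
  assumes "\<tau>1 \<in> T4" "\<tau>2 \<in> T4" "gluable \<tau>1 \<tau>2"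
  shows "tangle_add \<tau>1 \<tau>2 \<in> T4" "lower (tangle_add \<tau>1 \<tau>2) = [lower \<tau>1 ! 0, lower \<tau>2 ! 1]"
    "upper (tangle_add \<tau>1 \<tau>2) = [upper \<tau>1 ! 0, upper \<tau>2 ! 1]"
proof -
  obtain c1 c2 w1 e1 e2 where t1: "\<tau>1 = ([c1, c2], w1)" "ends [c1, c2] w1 = Some [e1, e2]" using assms(1) T4_iff by auto
  obtain d1 d2 w2 f1 f2 where t2: "\<tau>2 = ([d1, d2], w2)" "ends [d1, d2] w2 = Some [f1, f2]" using assms(2) T4_iff by auto
  have g: "d1 = opp c2" "f1 = opp e2" using assms(3) by (auto simp: gluable_def t1 t2 lower_def upper_def)
  have a: "tangle_add \<tau>1 \<tau>2 = ([c1, d2], (1, Cup c2) # w1 @ shift 2 w2 @ [(1, Cap e2)])"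
    by (simp add: tangle_add_def t1 t2 lower_def upper_def)
  have 1: "ends [c1, c2, opp c2, d2] w1 = Some [e1, e2, opp c2, d2]"
    using ends_shift[OF t1(2), of "[]" "[opp c2, d2]"] by simp
  have 2: "ends [e1, e2, opp c2, d2] (shift 2 w2) = Some [e1, e2, opp e2, f2]"
    using ends_shift[OF t2(2), of "[e1, e2]" "[]"] g by (simp add: numeral_2_eq_2)
  have "ends [c1, d2] ((1, Cup c2) # w1 @ shift 2 w2 @ [(1, Cap e2)]) = Some [e1, f2]"
    by (simp add: ends_append 1 2)
  then show "tangle_add \<tau>1 \<tau>2 \<in> T4" "lower (tangle_add \<tau>1 \<tau>2) = [lower \<tau>1 ! 0, lower \<tau>2 ! 1]"
    "upper (tangle_add \<tau>1 \<tau>2) = [upper \<tau>1 ! 0, upper \<tau>2 ! 1]"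
    unfolding a T4_def by (auto simp: lower_def upper_def t1 t2)
qed

text \<open>Bending two ends only permutes the four boundary labels. The labels of the cup and the
  cap are fixed by the boundary, so no sum remains, only their weights.\<close>

lemma rotate_matrix:
  assumes "\<tau> \<in> T4" and x: "x1 \<in> ksets N j" "x2 \<in> ksets N j" "y1 \<in> ksets N j" "y2 \<in> ksets N j"
  shows "tangle_matrix N j (rotate_tangle \<tau>) [x1, x2] [y1, y2] =
    cup_weight N (lower \<tau> ! 1) y2 * cap_weight N (opp (upper \<tau> ! 0)) x1 * tangle_matrix N j \<tau> [x2, y2] [x1, y1]"
proof -
  obtain c1 c2 w e1 e2 where t: "\<tau> = ([c1, c2], w)" "ends [c1, c2] w = Some [e1, e2]" using assms(1) T4_iff by auto
  let ?cap = "[(0, Cap (opp e1))]"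
  have inner: "word_matrix N j (shift 1 w @ ?cap) [x1, x2, S, S] [y1, y2] =
     (if S = y2 then cap_weight N (opp e1) x1 * word_matrix N j w [x2, y2] [x1, y1] else 0)" if S: "S \<in> ksets N j" for S
  proof -
    have st: "[x2, S] \<in> states N (replicate (length [c1, c2]) j)" using x S by (simp add: states_two numeral_2_eq_2)
    have "word_matrix N j (shift 1 w @ ?cap) [x1, x2, S, S] [y1, y2] =
      (\<Sum>P\<in>ksets N j. \<Sum>R\<in>ksets N j. word_matrix N j w [x2, S] [P, R] * word_matrix N j ?cap [x1, P, R, S] [y1, y2])"
      using word_matrix_shift[OF t(2) st, of "[x1]" ?cap "[S]" "[y1, y2]"] by (simp add: sum_states_Cons sum_states_Nil)
    also have "\<dots> = (\<Sum>P\<in>ksets N j. \<Sum>R\<in>ksets N j. if R = y1 then (if P = x1 then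
        (if S = y2 then cap_weight N (opp e1) x1 * word_matrix N j w [x2, y2] [x1, y1] else 0) else 0) else 0)"
      using word_Cap[of "[]" 0 N j "opp e1" x1] by (intro sum.cong refl) auto
    also have "\<dots> = (if S = y2 then cap_weight N (opp e1) x1 * word_matrix N j w [x2, y2] [x1, y1] else 0)"
      using x by (simp add: sum.delta)
    finally show ?thesis .
  qed
  have "tangle_matrix N j (rotate_tangle \<tau>) [x1, x2] [y1, y2] = word_matrix N j ((2, Cup c2) # shift 1 w @ ?cap) [x1, x2] [y1, y2]"
    by (simp add: tangle_matrix_word rotate_tangle_def t lower_def upper_def)
  also have "\<dots> = (\<Sum>S\<in>ksets N j. cup_weight N c2 S * word_matrix N j (shift 1 w @ ?cap) [x1, x2, S, S] [y1, y2])"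
    using word_Cup[of "[x1, x2]" 2 N j c2 "shift 1 w @ ?cap" "[]"] by simp
  also have "\<dots> = (\<Sum>S\<in>ksets N j. if S = y2 then cup_weight N c2 y2 * (cap_weight N (opp e1) x1 * word_matrix N j w [x2, y2] [x1, y1]) else 0)"
    by (intro sum.cong refl) (simp only: inner, simp)
  also have "\<dots> = cup_weight N c2 y2 * (cap_weight N (opp e1) x1 * word_matrix N j w [x2, y2] [x1, y1])"
    using x by (simp add: sum.delta)
  finally show ?thesis by (simp add: tangle_matrix_word t lower_def upper_def)
qed

lemma rotate_ends:
  assumes "\<tau> \<in> T4"
  shows "rotate_tangle \<tau> \<in> T4" "lower (rotate_tangle \<tau>) = [opp (upper \<tau> ! 0), lower \<tau> ! 0]"
    "upper (rotate_tangle \<tau>) = [upper \<tau> ! 1, opp (lower \<tau> ! 1)]"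
proof -
  obtain c1 c2 w e1 e2 where t: "\<tau> = ([c1, c2], w)" "ends [c1, c2] w = Some [e1, e2]" using assms(1) T4_iff by auto
  have a: "rotate_tangle \<tau> = ([opp e1, c1], (2, Cup c2) # shift 1 w @ [(0, Cap (opp e1))])"
    by (simp add: rotate_tangle_def t lower_def upper_def)
  have 1: "ends [opp e1, c1, c2, opp c2] (shift 1 w) = Some [opp e1, e1, e2, opp c2]"
    using ends_shift[OF t(2), of "[opp e1]" "[opp c2]"] by simp
  have "ends [opp e1, c1] ((2, Cup c2) # shift 1 w @ [(0, Cap (opp e1))]) = Some [e2, opp c2]"
    by (simp add: ends_append 1[simplified])
  then show "rotate_tangle \<tau> \<in> T4" "lower (rotate_tangle \<tau>) = [opp (upper \<tau> ! 0), lower \<tau> ! 0]"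
    "upper (rotate_tangle \<tau>) = [upper \<tau> ! 1, opp (lower \<tau> ! 1)]"
    unfolding a T4_def by (auto simp: lower_def upper_def t)
qed

section \<open>Arcs of shifted words\<close>

text \<open>
  A word run at positions \<open>L, \<dots>\<close> inside a bigger diagram acts on the arc labels as it does on its
  own, up to an injective renaming \<open>\<phi>\<close>, as long as it is attached to two different arcs \<open>x\<close>, \<open>y\<close>;
  \<open>g\<close> is the effect of the identifications on the labels of the surrounding diagram.
\<close>

definition simulates :: "nat \<Rightarrow> nat list \<Rightarrow> nat list \<Rightarrow> nat list \<Rightarrow> nat \<Rightarrow> nat \<Rightarrow> nat \<Rightarrow> arcs \<Rightarrow> arcs \<Rightarrow> bool" where
  "simulates n0 bs0 L R x y c0 s s' \<longleftrightarrow>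
     (case s of (n, bs, ts, c) \<Rightarrow> case s' of (n', bs', ts', c') \<Rightarrow>
       \<exists>\<phi> g p r. inj_on \<phi> {..<n} \<and> (\<forall>l<n. \<phi> l < n') \<and> n0 \<le> n' \<and> (\<forall>l<n. \<phi> l < n0 \<longrightarrow> \<phi> l \<in> {x, y}) \<and>
         (\<forall>z<n0. z \<notin> {x, y} \<longrightarrow> g z = z) \<and> bs = [p, r] \<and> g x = \<phi> p \<and> g y = \<phi> r \<and>
         set bs \<union> set ts \<subseteq> {..<n} \<and> bs' = map g bs0 \<and> ts' = map g L @ map \<phi> ts @ map g R \<and> c' = c0 + c)"

lemma simulatesI:
  assumes "inj_on \<phi> {..<n}" "\<And>l. l < n \<Longrightarrow> \<phi> l < n'" "n0 \<le> n'" "\<And>l. l < n \<Longrightarrow> \<phi> l < n0 \<Longrightarrow> \<phi> l \<in> {x, y}"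
    "\<And>z. z < n0 \<Longrightarrow> z \<notin> {x, y} \<Longrightarrow> g z = z" "g x = \<phi> p" "g y = \<phi> r" "set [p, r] \<union> set ts \<subseteq> {..<n}"
  shows "simulates n0 bs0 L R x y c0 (n, [p, r], ts, c) (n', map g bs0, map g L @ map \<phi> ts @ map g R, c0 + c)"
  unfolding simulates_def prod.case
  by (rule exI[of _ \<phi>], rule exI[of _ g], rule exI[of _ p], rule exI[of _ r]) (use assms in blast)

lemma trace_layer_simulates:
  assumes sim: "simulates n0 bs0 L R x y c0 (n, bs, ts, c) s'" and small: "set bs0 \<union> set L \<union> set R \<subseteq> {..<n0}"
    and i: "i + length (source g) \<le> length ts"
  shows "simulates n0 bs0 L R x y c0 (trace_layer (i, g) (n, bs, ts, c)) (trace_layer (length L + i, g) s')"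
proof -
  obtain n' bs' ts' c' where s': "s' = (n', bs', ts', c')" by (metis prod_cases4)
  from sim[unfolded simulates_def s' prod.case] obtain \<phi> h p r where
    inj: "inj_on \<phi> {..<n}" and lt: "\<And>l. l < n \<Longrightarrow> \<phi> l < n'" and n0: "n0 \<le> n'"
    and xy: "\<And>l. l < n \<Longrightarrow> \<phi> l < n0 \<Longrightarrow> \<phi> l \<in> {x, y}" and h: "\<And>z. z < n0 \<Longrightarrow> z \<notin> {x, y} \<Longrightarrow> h z = z"
    and bs: "bs = [p, r]" and hx: "h x = \<phi> p" and hy: "h y = \<phi> r" and ln: "set bs \<union> set ts \<subseteq> {..<n}"
    and bs': "bs' = map h bs0" and ts': "ts' = map h L @ map \<phi> ts @ map h R" and c': "c' = c0 + c"
    by blast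
  have pr: "p < n" "r < n" using ln bs by auto
  have tn: "l < n" if "l \<in> set ts" for l using ln that by auto
  show ?thesis
  proof (cases g)
    case (Cup d)
    have eq: "map (\<phi>(n := n')) ls = map \<phi> ls" if "set ls \<subseteq> {..<n}" for ls
      using that by (intro map_cong) auto
    have eqt: "map (\<phi>(n := n')) (take i ts @ [n, n] @ drop i ts) = take i (map \<phi> ts) @ [n', n'] @ drop i (map \<phi> ts)"
      using eq[of "take i ts"] eq[of "drop i ts"] ln set_take_subset[of i ts] set_drop_subset[of i ts]
      by (auto simp: take_map drop_map)
    have "trace_layer (length L + i, g) s' = (Suc n', map h bs0, map h L @ map (\<phi>(n := n')) (take i ts @ [n, n] @ drop i ts) @ map h R, c0 + c)"
      using i Cup unfolding eqt by (simp add: s' bs' ts' c')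
    moreover have "trace_layer (i, g) (n, bs, ts, c) = (Suc n, bs, take i ts @ [n, n] @ drop i ts, c)" by (simp add: Cup)
    moreover have "simulates n0 bs0 L R x y c0 (Suc n, [p, r], take i ts @ [n, n] @ drop i ts, c)
        (Suc n', map h bs0, map h L @ map (\<phi>(n := n')) (take i ts @ [n, n] @ drop i ts) @ map h R, c0 + c)"
    proof (rule simulatesI)
      show "inj_on (\<phi>(n := n')) {..<Suc n}"
      proof (rule inj_onI)
        fix k l assume "k \<in> {..<Suc n}" "l \<in> {..<Suc n}" "(\<phi>(n := n')) k = (\<phi>(n := n')) l"
        then show "k = l" using lt[of k] lt[of l] inj
          by (cases "k = n"; cases "l = n") (simp_all add: inj_on_def)
      qed
      show "(\<phi>(n := n')) l < Suc n'" if "l < Suc n" for l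
        using that lt[of l] by (cases "l = n") simp_all
      show "(\<phi>(n := n')) l \<in> {x, y}" if "l < Suc n" "(\<phi>(n := n')) l < n0" for l
        using that xy[of l] n0 by (cases "l = n") simp_all
      show "set [p, r] \<union> set (take i ts @ [n, n] @ drop i ts) \<subseteq> {..<Suc n}"
        using ln bs set_take_subset[of i ts] set_drop_subset[of i ts] by auto
    qed (use n0 h hx hy pr in auto)
    ultimately show ?thesis by (simp only: bs)
  next
    case (Cross o d e)
    then have i2: "Suc i < length ts" using i by simp
    let ?t = "take i ts @ [ts ! Suc i, ts ! i] @ drop (i + 2) ts"
    have "trace_layer (length L + i, g) s' = (n', map h bs0, map h L @ map \<phi> ?t @ map h R, c0 + c)"
      using i2 Cross by (simp add: s' bs' ts' c' nth_append take_map drop_map)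
    moreover have "trace_layer (i, g) (n, bs, ts, c) = (n, bs, ?t, c)" by (simp add: Cross)
    moreover have "set ?t \<subseteq> set ts" using i2 set_take_subset[of i ts] set_drop_subset[of "i + 2" ts] by auto
    moreover from calculation(3) have "set [p, r] \<union> set ?t \<subseteq> {..<n}" using ln bs by auto
    ultimately show ?thesis
      by (simp only: bs) (rule simulatesI[OF inj lt n0 xy h hx hy]; assumption)
  next
    case (Cap d)
    then have i2: "Suc i < length ts" using i by simp
    define u v where "u = ts ! i" and "v = ts ! Suc i"
    let ?t = "take i ts @ drop (i + 2) ts"
    have uv: "u < n" "v < n" using tn i2 by (auto simp: u_def v_def)
    have tsub: "set ?t \<subseteq> set ts" using set_take_subset[of i ts] set_drop_subset[of "i + 2" ts] by auto
    have nth: "ts' ! (length L + i) = \<phi> u" "ts' ! Suc (length L + i) = \<phi> v"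
      using i2 by (simp_all add: ts' nth_append u_def v_def)
    have t': "take (length L + i) ts' @ drop (length L + i + 2) ts' = map h L @ map \<phi> ?t @ map h R"
      using i2 by (simp add: ts' take_map drop_map)
    \<comment> \<open>Injectivity of \<phi> guarantees that the cap closes a component in the big
      diagram exactly if it does so in the small one.\<close>
    have \<phi>uv: "\<phi> u = \<phi> v \<longleftrightarrow> u = v" using inj uv by (auto simp: inj_on_def)
    show ?thesis
    proof (cases "u = v")
      case True
      have "trace_layer (length L + i, g) s' = (n', map h bs0, map h L @ map \<phi> ?t @ map h R, c0 + Suc c)"
        using True nth t' by (simp add: Cap s' bs' c' Let_def)
      moreover have "trace_layer (i, g) (n, bs, ts, c) = (n, bs, ?t, Suc c)" using True by (simp add: Cap u_def v_def)
      moreover have "set [p, r] \<union> set ?t \<subseteq> {..<n}" using ln bs tsub by auto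
      ultimately show ?thesis
        by (simp only: bs) (rule simulatesI[OF inj lt n0 xy h hx hy]; assumption)
    next
      case False
      define f where "f = (\<lambda>z. if z = v then u else z)"
      define f' where "f' = (\<lambda>z. if z = \<phi> v then \<phi> u else z)"
      have ff: "f' (\<phi> l) = \<phi> (f l)" if "l < n" for l
        using inj uv that by (auto simp: f_def f'_def inj_on_def)
      have fn: "f l < n" if "l < n" for l using that uv by (simp add: f_def)
      \<comment> \<open>Labels of the surrounding diagram are never overwritten: the label that
        disappears is x, y or one created by the word itself.\<close>
      have fz: "f' z = z" if "z < n0" "z \<notin> {x, y}" for z
        using xy[OF uv(2)] that by (auto simp: f'_def)
      have mt: "map f' (map \<phi> ?t) = map \<phi> (map f ?t)"
        using tsub tn ff by (auto simp: map_map comp_def)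
      have "trace_layer (length L + i, g) s' = (n', map f' (map h bs0), map f' (map h L @ map \<phi> ?t @ map h R), c0 + c)"
        using False \<phi>uv nth t' by (simp add: Cap s' bs' c' Let_def f'_def)
      also have "\<dots> = (n', map (f' \<circ> h) bs0, map (f' \<circ> h) L @ map \<phi> (map f ?t) @ map (f' \<circ> h) R, c0 + c)"
        unfolding map_append[of f' "map h L"] map_append[of f' "map \<phi> ?t"] mt map_map[of f' h] by (rule refl)
      finally have 1: "trace_layer (length L + i, g) s' = \<dots>" .
      have 2: "trace_layer (i, g) (n, bs, ts, c) = (n, map f bs, map f ?t, c)"
        using False by (simp add: Cap u_def v_def f_def Let_def)
      have "simulates n0 bs0 L R x y c0 (n, [f p, f r], map f ?t, c)
          (n', map (f' \<circ> h) bs0, map (f' \<circ> h) L @ map \<phi> (map f ?t) @ map (f' \<circ> h) R, c0 + c)"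
      proof (rule simulatesI[OF inj lt n0 xy])
        show "(f' \<circ> h) z = z" if "z < n0" "z \<notin> {x, y}" for z using that h fz by simp
        show "(f' \<circ> h) x = \<phi> (f p)" "(f' \<circ> h) y = \<phi> (f r)" using hx hy ff pr by simp_all
        show "set [f p, f r] \<union> set (map f ?t) \<subseteq> {..<n}" using pr fn tn tsub by auto
      qed
      then show ?thesis using 1 2 bs by simp
    qed
  qed
qed

lemma length_trace_layer:
  assumes "i + length (source g) \<le> length ts" "trace_layer (i, g) (n, bs, ts, c) = (n', bs', ts', c')"
  shows "length ts' = length ts - length (source g) + length (target g) \<and> length bs' = length bs"
  using assms by (cases g) (auto simp: Let_def split: if_splits)

lemma ends_Cons:
  assumes "ends ds ((i, g) # w) = Some es"
  shows "i + length (source g) \<le> length ds" "ends (take i ds @ target g @ drop (i + length (source g)) ds) w = Some es"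
proof -
  from assms have i: "i \<le> length ds" "take (length (source g)) (drop i ds) = source g"
    and es: "ends (take i ds @ target g @ drop (i + length (source g)) ds) w = Some es"
    by (auto split: if_splits)
  from i show "i + length (source g) \<le> length ds"
    by (metis length_drop length_take min.absorb_iff2 le_diff_conv2 add.commute min_def nle_le)
  from es show "ends (take i ds @ target g @ drop (i + length (source g)) ds) w = Some es" .
qed

lemma trace_simulates:
  assumes small: "set bs0 \<union> set L \<union> set R \<subseteq> {..<n0}"
  shows "ends ds w = Some es \<Longrightarrow> length (fst (snd (snd s))) = length ds \<Longrightarrow> simulates n0 bs0 L R x y c0 s s' \<Longrightarrow>
    simulates n0 bs0 L R x y c0 (fold trace_layer w s) (fold trace_layer (shift (length L) w) s') \<and>
    length (fst (snd (snd (fold trace_layer w s)))) = length es"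
proof (induction w arbitrary: ds s s')
  case (Cons p w)
  obtain i g where p: "p = (i, g)" by fastforce
  obtain n bs ts c where s: "s = (n, bs, ts, c)" by (metis prod_cases4)
  note e = ends_Cons[OF Cons.prems(1)[unfolded p]]
  have i: "i + length (source g) \<le> length ts" using e(1) Cons.prems(2) s by simp
  obtain n1 bs1 ts1 c1 where s1: "trace_layer (i, g) (n, bs, ts, c) = (n1, bs1, ts1, c1)" by (metis prod_cases4)
  have "length ts1 = length (take i ds @ target g @ drop (i + length (source g)) ds)"
    using length_trace_layer[OF i s1] e(1) Cons.prems(2) s by simp
  moreover have "simulates n0 bs0 L R x y c0 (trace_layer (i, g) s) (trace_layer (length L + i, g) s')"
    unfolding s by (rule trace_layer_simulates[OF Cons.prems(3)[unfolded s] small i])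
  ultimately show ?case
    using Cons.IH[OF e(2), of "trace_layer (i, g) s" "trace_layer (length L + i, g) s'"] by (simp add: p s s1)
qed simp

section \<open>Pairings of the four ends\<close>

lemma count_relabel:
  assumes "u \<noteq> v"
  shows "count_list (map (\<lambda>z. if z = v then u else z) xs) l =
    (if l = v then 0 else if l = u then count_list xs u + count_list xs v else count_list xs l)"
  using assms by (induction xs) auto

lemma trace_counts:
  "ends ds w = Some es \<Longrightarrow> s = (n, bs, ts, c) \<Longrightarrow> length ts = length ds \<Longrightarrow> set bs \<union> set ts \<subseteq> {..<n} \<Longrightarrow>
    (\<And>l. count_list (bs @ ts) l \<in> {0, 2}) \<Longrightarrow>
    (case fold trace_layer w s of (n', bs', ts', c') \<Rightarrow> \<forall>l. count_list (bs' @ ts') l \<in> {0, 2})"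
proof (induction w arbitrary: ds s n bs ts c)
  case (Cons p w)
  obtain i g where p: "p = (i, g)" by fastforce
  note e = ends_Cons[OF Cons.prems(1)[unfolded p]]
  have i: "i + length (source g) \<le> length ts" using e(1) Cons.prems(3) by simp
  obtain n1 bs1 ts1 c1 where s1: "trace_layer (i, g) (n, bs, ts, c) = (n1, bs1, ts1, c1)" by (metis prod_cases4)
  have len: "length ts1 = length (take i ds @ target g @ drop (i + length (source g)) ds)"
    using length_trace_layer[OF i s1] e(1) Cons.prems(3) by simp
  note bound = Cons.prems(4) and count = Cons.prems(5)
  have tsub: "set (take k ts) \<subseteq> set ts" "set (drop k ts) \<subseteq> set ts" for k
    by (rule set_take_subset, rule set_drop_subset)
  have "set bs1 \<union> set ts1 \<subseteq> {..<n1} \<and> (\<forall>l. count_list (bs1 @ ts1) l \<in> {0, 2})"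
  proof (cases g)
    case (Cup d)
    then have r: "n1 = Suc n" "bs1 = bs" "ts1 = take i ts @ [n, n] @ drop i ts" using s1 by auto
    have n: "count_list (bs @ ts) n = 0" using bound by (auto simp: count_list_0_iff)
    have "count_list (bs1 @ ts1) l = count_list (bs @ ts) l + (if l = n then 2 else 0)" for l
    proof -
      have "count_list ts l = count_list (take i ts) l + count_list (drop i ts) l"
        using count_list_append[of "take i ts" "drop i ts" l] by simp
      then show ?thesis by (simp add: r)
    qed
    then have "count_list (bs1 @ ts1) l \<in> {0, 2}" for l using count[of l] n by auto
    moreover have "set bs1 \<union> set ts1 \<subseteq> {..<n1}" using bound tsub[of i] by (auto simp: r)
    ultimately show ?thesis by blast
  next
    case (Cross o d e)
    then have i2: "Suc i < length ts" using i by simp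
    have ts: "ts = take i ts @ [ts ! i, ts ! Suc i] @ drop (i + 2) ts"
      using i2 by (simp add: Cons_nth_drop_Suc)
    have r: "n1 = n" "bs1 = bs" "ts1 = take i ts @ [ts ! Suc i, ts ! i] @ drop (i + 2) ts" using s1 Cross by auto
    have "count_list (bs1 @ ts1) l = count_list (bs @ ts) l" for l
    proof -
      have "count_list ts l = count_list (take i ts @ [ts ! i, ts ! Suc i] @ drop (i + 2) ts) l" using ts by (rule arg_cong)
      then show ?thesis by (simp add: r)
    qed
    then have "count_list (bs1 @ ts1) l \<in> {0, 2}" for l using count[of l] by simp
    moreover have "set ts1 \<subseteq> set ts" using i2 tsub(1)[of i] tsub(2)[of "i + 2"] by (auto simp: r)
    ultimately show ?thesis using bound by (auto simp: r(1,2))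
  next
    case (Cap d)
    then have i2: "Suc i < length ts" using i by simp
    define u v t where "u = ts ! i" and "v = ts ! Suc i" and "t = take i ts @ drop (i + 2) ts"
    have ts: "ts = take i ts @ [u, v] @ drop (i + 2) ts"
      using i2 by (simp add: Cons_nth_drop_Suc u_def v_def)
    have ct: "count_list (bs @ ts) l = count_list (bs @ t) l + (if l = u then 1 else 0) + (if l = v then 1 else 0)" for l
    proof -
      have "count_list ts l = count_list (take i ts @ [u, v] @ drop (i + 2) ts) l" using ts by (rule arg_cong)
      then show ?thesis by (simp add: t_def)
    qed
    have uv: "u < n" "v < n" using i2 bound nth_mem[of i ts] nth_mem[of "Suc i" ts] unfolding u_def v_def
      by (meson Suc_lessD Un_subset_iff lessThan_iff subsetD)+
    have tt: "set t \<subseteq> set ts" using tsub(1)[of i] tsub(2)[of "i + 2"] by (auto simp: t_def)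
    show ?thesis
    proof (cases "u = v")
      case True
      then have r: "n1 = n" "bs1 = bs" "ts1 = t" using s1 Cap by (auto simp: u_def v_def t_def)
      have "count_list (bs1 @ ts1) l \<in> {0, 2}" for l
        using count[of l] ct[of l] True by (auto simp: r split: if_splits)
      moreover have "set bs1 \<union> set ts1 \<subseteq> {..<n1}" using bound tt by (auto simp: r)
      ultimately show ?thesis by blast
    next
      case False
      define f where "f = (\<lambda>z. if z = v then u else z)"
      have r: "n1 = n" "bs1 = map f bs" "ts1 = map f t" using s1 Cap False by (auto simp: u_def v_def t_def f_def Let_def)
      have "count_list (bs1 @ ts1) l = (if l = v then 0 else if l = u then count_list (bs @ t) u + count_list (bs @ t) v else count_list (bs @ t) l)" for l
        using count_relabel[OF False, of "bs @ t" l] by (simp add: r f_def)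
      then have "count_list (bs1 @ ts1) l \<in> {0, 2}" for l
        using count[of l] count[of u] count[of v] ct[of l] ct[of u] ct[of v] False by (auto split: if_splits)
      moreover have "set bs1 \<union> set ts1 \<subseteq> {..<n1}" using bound tt uv by (auto simp: r f_def)
      ultimately show ?thesis by blast
    qed
  qed
  then show ?case
    using Cons.IH[OF e(2) s1 len] Cons.prems(2) by (auto simp: p)
qed simp

text \<open>By \<open>trace_counts\<close> the four end labels form pairs, and there are three
  perfect matchings of four points.\<close>

lemma trace_T4:
  assumes "\<tau> \<in> T4"
  obtains n b0 b1 t0 t1 c where "trace \<tau> = (n, [b0, b1], [t0, t1], c)"
    "b0 = b1 \<and> t0 = t1 \<and> b0 \<noteq> t0 \<or> b0 = t0 \<and> b1 = t1 \<and> b0 \<noteq> b1 \<or> b0 = t1 \<and> b1 = t0 \<and> b0 \<noteq> b1"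
proof -
  obtain d1 d2 w e1 e2 where t: "\<tau> = ([d1, d2], w)" "ends [d1, d2] w = Some [e1, e2]" using assms T4_iff by auto
  have tr: "trace \<tau> = fold trace_layer w (2, [0, 1], [0, 1], 0)"
    by (simp add: trace_def t lower_def numeral_2_eq_2 upt_rec)
  \<comment> \<open>The surrounding diagram is empty. The simulation serves here only to record that
    there are always two bottom labels; the number of top labels comes along with it.\<close>
  have "simulates 2 [] [] [] 0 1 0 (2, [0, 1], [0, 1], 0) (2, [], [0, 1], 0)"
    unfolding simulates_def by (simp only: prod.case) (intro exI[of _ id] exI[of _ 0] exI[of _ 1], auto)
  from trace_simulates[OF _ t(2) _ this] have sim: "simulates 2 [] [] [] 0 1 0 (trace \<tau>) (fold trace_layer (shift 0 w) (2, [], [0, 1], 0))"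
    and len: "length (fst (snd (snd (trace \<tau>)))) = 2" unfolding tr by auto
  obtain n bs ts c where n: "trace \<tau> = (n, bs, ts, c)" by (metis prod_cases4)
  from sim obtain b0 b1 where bs: "bs = [b0, b1]" unfolding n simulates_def by (auto split: prod.splits)
  from len obtain t0 t1 where ts: "ts = [t0, t1]" unfolding n by (auto simp: length_Suc_conv numeral_2_eq_2)
  have "count_list ([0, 1] @ [0, 1::nat]) l \<in> {0, 2}" for l by auto
  from trace_counts[OF t(2) refl _ _ this, of 2 0] have "\<forall>l. count_list (bs @ ts) l \<in> {0, 2}"
    unfolding tr[symmetric] n by auto
  then have cl: "count_list [b0, b1, t0, t1] l = 0 \<or> count_list [b0, b1, t0, t1] l = 2" for l by (simp add: bs ts)
  have "b0 = b1 \<and> t0 = t1 \<and> b0 \<noteq> t0 \<or> b0 = t0 \<and> b1 = t1 \<and> b0 \<noteq> b1 \<or> b0 = t1 \<and> b1 = t0 \<and> b0 \<noteq> b1"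
    using cl[of b0] cl[of b1] cl[of t0] by (auto split: if_splits)
  with n bs ts show thesis using that by blast
qed

lemma trace_shifted:
  assumes \<tau>: "\<tau> \<in> T4" and tr: "trace \<tau> = (n, [b0, b1], [t0, t1], c)" and xy: "x \<noteq> y" "x < n0" "y < n0"
    and small: "set bs0 \<union> set L \<union> set R \<subseteq> {..<n0}"
  obtains \<phi> g m where "fold trace_layer (shift (length L) (snd \<tau>)) (n0, bs0, L @ [x, y] @ R, c0) =
      (m, map g bs0, map g L @ [\<phi> t0, \<phi> t1] @ map g R, c0 + c)"
    "inj_on \<phi> {b0, b1, t0, t1}" "g x = \<phi> b0" "g y = \<phi> b1" "\<And>z. z < n0 \<Longrightarrow> z \<notin> {x, y} \<Longrightarrow> g z = z"
    "\<And>l. l \<in> {b0, b1, t0, t1} \<Longrightarrow> \<phi> l < m" "\<And>l. l \<in> {b0, b1, t0, t1} \<Longrightarrow> \<phi> l < n0 \<Longrightarrow> \<phi> l \<in> {x, y}" "n0 \<le> m"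
proof -
  obtain d1 d2 w e1 e2 where t: "\<tau> = ([d1, d2], w)" "ends [d1, d2] w = Some [e1, e2]" using \<tau> T4_iff by auto
  have tr': "fold trace_layer w (2, [0, 1], [0, 1], 0) = (n, [b0, b1], [t0, t1], c)"
    unfolding tr[symmetric] by (simp add: trace_def t lower_def numeral_2_eq_2 upt_rec)
  have start: "simulates n0 bs0 L R x y c0 (2, [0, 1], [0, 1], 0) (n0, bs0, L @ [x, y] @ R, c0)"
    unfolding simulates_def prod.case
    by (intro exI[of _ "\<lambda>l. if l = 0 then x else y"] exI[of _ id] exI[of _ 0] exI[of _ 1])
      (use xy in \<open>auto simp: inj_on_def less_2_cases_iff\<close>)
  have "simulates n0 bs0 L R x y c0 (n, [b0, b1], [t0, t1], c) (fold trace_layer (shift (length L) w) (n0, bs0, L @ [x, y] @ R, c0))"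
    using trace_simulates[OF small t(2) _ start] unfolding tr' by simp
  then obtain \<phi> g m where *: "fold trace_layer (shift (length L) w) (n0, bs0, L @ [x, y] @ R, c0) =
      (m, map g bs0, map g L @ map \<phi> [t0, t1] @ map g R, c0 + c)"
    and **: "inj_on \<phi> {..<n}" "\<forall>l<n. \<phi> l < m" "n0 \<le> m" "\<forall>l<n. \<phi> l < n0 \<longrightarrow> \<phi> l \<in> {x, y}"
      "\<forall>z<n0. z \<notin> {x, y} \<longrightarrow> g z = z" "g x = \<phi> b0" "g y = \<phi> b1" "set [b0, b1] \<union> set [t0, t1] \<subseteq> {..<n}"
    unfolding simulates_def prod.case by (auto split: prod.splits)
  have sub: "{b0, b1, t0, t1} \<subseteq> {..<n}" using **(8) by auto
  show thesis
    using that[of m g \<phi>] * ** sub inj_on_subset[OF **(1) sub] by (auto simp: t)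
qed

lemma trace_rotate:
  assumes \<tau>: "\<tau> \<in> T4" and tr: "trace \<tau> = (n, [b0, b1], [t0, t1], c)"
  obtains \<psi> m where "trace (rotate_tangle \<tau>) = (m, [\<psi> t0, \<psi> b0], [\<psi> t1, \<psi> b1], c)" "inj_on \<psi> {b0, b1, t0, t1}"
proof -
  obtain \<phi> g m where f: "fold trace_layer (shift (length [0::nat]) (snd \<tau>)) (3, [0, 1], [0] @ [1, 2] @ [2], 0) =
      (m, map g [0, 1], map g [0] @ [\<phi> t0, \<phi> t1] @ map g [2], 0 + c)"
    and inj: "inj_on \<phi> {b0, b1, t0, t1}" and g: "g 1 = \<phi> b0" "g 2 = \<phi> b1" "\<And>z. z < 3 \<Longrightarrow> z \<notin> {1, 2} \<Longrightarrow> g z = z"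
    and small: "\<And>l. l \<in> {b0, b1, t0, t1} \<Longrightarrow> \<phi> l < 3 \<Longrightarrow> \<phi> l \<in> {1, 2}"
    by (rule trace_shifted[OF \<tau> tr, of 1 2 3 "[0, 1]" "[0]" "[2]" 0]) auto
  have g0: "g 0 = 0" using g(3)[of 0] by simp
  \<comment> \<open>The final cap joins the strand bent down from NW, labelled 0, to the arc of
    \<open>t0\<close> and lets 0 survive. Since 0 is not a value of \<phi> on the end labels,
    injectivity is kept.\<close>
  define \<psi> where "\<psi> = (\<lambda>l. if \<phi> l = \<phi> t0 then 0 else \<phi> l)"
  have nz: "\<phi> l \<noteq> 0" if "l \<in> {b0, b1, t0, t1}" for l using small[OF that] by (cases "\<phi> l") auto
  have "trace (rotate_tangle \<tau>) = trace_layer (0, Cap (opp (upper \<tau> ! 0))) (m, [0, \<phi> b0], [0, \<phi> t0, \<phi> t1, \<phi> b1], c)"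
    using f g g0 by (simp add: trace_def rotate_tangle_def lower_def numeral_2_eq_2 numeral_3_eq_3 upt_rec)
  also have "\<dots> = (m, [\<psi> t0, \<psi> b0], [\<psi> t1, \<psi> b1], c)"
    using nz[of t0] by (simp add: \<psi>_def Let_def)
  finally have 1: "trace (rotate_tangle \<tau>) = \<dots>" .
  have "inj_on \<psi> {b0, b1, t0, t1}"
    using inj nz unfolding inj_on_def \<psi>_def by (metis)
  with 1 show thesis by (rule that)
qed

lemma closed_components_rotate: "\<tau> \<in> T4 \<Longrightarrow> closed_components (rotate_tangle \<tau>) = closed_components \<tau>"
  by (rule trace_T4, assumption, rule trace_rotate, assumption, assumption) (simp add: closed_components_def)

lemma connects_rotate:
  assumes "\<tau> \<in> T4"
  shows "connects_vertically (rotate_tangle \<tau>) \<longleftrightarrow> connects_horizontally \<tau>"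
    "connects_horizontally (rotate_tangle \<tau>) \<longleftrightarrow> connects_vertically \<tau>"
proof -
  obtain n b0 b1 t0 t1 c where tr: "trace \<tau> = (n, [b0, b1], [t0, t1], c)" by (rule trace_T4[OF assms])
  obtain \<psi> m where r: "trace (rotate_tangle \<tau>) = (m, [\<psi> t0, \<psi> b0], [\<psi> t1, \<psi> b1], c)" "inj_on \<psi> {b0, b1, t0, t1}"
    by (rule trace_rotate[OF assms tr])
  then show "connects_vertically (rotate_tangle \<tau>) \<longleftrightarrow> connects_horizontally \<tau>"
    "connects_horizontally (rotate_tangle \<tau>) \<longleftrightarrow> connects_vertically \<tau>"
    using inj_on_eq_iff[OF r(2), of b0 b1] inj_on_eq_iff[OF r(2), of t0 t1]
      inj_on_eq_iff[OF r(2), of t0 b0] inj_on_eq_iff[OF r(2), of t1 b1]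
    by (auto simp: connects_vertically_def connects_horizontally_def bot_arc_def top_arc_def tr r(1))
qed

lemma connects_exclusive:
  assumes "\<tau> \<in> T4"
  shows "\<not> (connects_vertically \<tau> \<and> connects_horizontally \<tau>)" "\<not> (connects_vertically \<tau> \<and> connects_diagonally \<tau>)"
    "\<not> (connects_horizontally \<tau> \<and> connects_diagonally \<tau>)"
proof -
  obtain n b0 b1 t0 t1 c where "trace \<tau> = (n, [b0, b1], [t0, t1], c)"
    "b0 = b1 \<and> t0 = t1 \<and> b0 \<noteq> t0 \<or> b0 = t0 \<and> b1 = t1 \<and> b0 \<noteq> b1 \<or> b0 = t1 \<and> b1 = t0 \<and> b0 \<noteq> b1"
    by (rule trace_T4[OF assms])
  then show "\<not> (connects_vertically \<tau> \<and> connects_horizontally \<tau>)" "\<not> (connects_vertically \<tau> \<and> connects_diagonally \<tau>)"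
    "\<not> (connects_horizontally \<tau> \<and> connects_diagonally \<tau>)"
    by (auto simp: connects_vertically_def connects_horizontally_def connects_diagonally_def bot_arc_def top_arc_def)
qed

text \<open>The arc of the first tangle between its top ends does not reach the cup, so the cap
  joins it to a different arc, of the second tangle. Hence gluing closes no component, which could
  happen for vertical arcs.\<close>

lemma closed_components_add:
  assumes \<tau>: "\<tau>1 \<in> T4" "\<tau>2 \<in> T4" and h: "connects_horizontally \<tau>1"
  shows "closed_components (tangle_add \<tau>1 \<tau>2) = closed_components \<tau>1 + closed_components \<tau>2"
proof -
  obtain n b0 b1 t0 t1 c where tr1: "trace \<tau>1 = (n, [b0, b1], [t0, t1], c)"
    and cases: "b0 = b1 \<and> t0 = t1 \<and> b0 \<noteq> t0 \<or> b0 = t0 \<and> b1 = t1 \<and> b0 \<noteq> b1 \<or> b0 = t1 \<and> b1 = t0 \<and> b0 \<noteq> b1"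
    by (rule trace_T4[OF \<tau>(1)])
  from cases h have b: "b1 = b0" "t1 = t0" "b0 \<noteq> t0"
    by (auto simp: connects_horizontally_def bot_arc_def top_arc_def tr1)
  obtain n' d0 d1 s0 s1 c' where tr2: "trace \<tau>2 = (n', [d0, d1], [s0, s1], c')" by (rule trace_T4[OF \<tau>(2)])
  obtain \<phi> g m where f: "fold trace_layer (shift (length ([]::nat list)) (snd \<tau>1)) (3, [0, 1], [] @ [0, 2] @ [2, 1], 0) =
      (m, map g [0, 1], map g [] @ [\<phi> t0, \<phi> t1] @ map g [2, 1], 0 + c)"
    and inj: "inj_on \<phi> {b0, b1, t0, t1}" and g: "g 0 = \<phi> b0" "g 2 = \<phi> b1" "\<And>z. z < 3 \<Longrightarrow> z \<notin> {0, 2} \<Longrightarrow> g z = z"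
    and lt: "\<And>l. l \<in> {b0, b1, t0, t1} \<Longrightarrow> \<phi> l < m"
    and small: "\<And>l. l \<in> {b0, b1, t0, t1} \<Longrightarrow> \<phi> l < 3 \<Longrightarrow> \<phi> l \<in> {0, 2}" and m: "3 \<le> m"
    by (rule trace_shifted[OF \<tau>(1) tr1, of 0 2 3 "[0, 1]" "[]" "[2, 1]" 0]) auto
  have g1: "g 1 = 1" using g(3)[of 1] by simp
  have ne1: "\<phi> b0 \<noteq> 1" "\<phi> t0 \<noteq> 1" using small[of b0] small[of t0] by auto
  have ne: "\<phi> t0 \<noteq> \<phi> b0" using inj b by (auto simp: inj_on_def)
  obtain \<phi>' g' m' where f': "fold trace_layer (shift (length [\<phi> t0, \<phi> t0]) (snd \<tau>2)) (m, [\<phi> b0, 1], [\<phi> t0, \<phi> t0] @ [\<phi> b0, 1] @ [], c) =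
      (m', map g' [\<phi> b0, 1], map g' [\<phi> t0, \<phi> t0] @ [\<phi>' s0, \<phi>' s1] @ map g' [], c + c')"
    and g': "\<And>z. z < m \<Longrightarrow> z \<notin> {\<phi> b0, 1} \<Longrightarrow> g' z = z"
    and small': "\<And>l. l \<in> {d0, d1, s0, s1} \<Longrightarrow> \<phi>' l < m \<Longrightarrow> \<phi>' l \<in> {\<phi> b0, 1}"
  proof (rule trace_shifted[OF \<tau>(2) tr2, of "\<phi> b0" 1 m "[\<phi> b0, 1]" "[\<phi> t0, \<phi> t0]" "[]" c], goal_cases)
    case 5
    show ?case by (rule 5(1)[OF 5(2) 5(6) 5(8)])
  qed (use ne1 lt m in auto)
  have gt: "g' (\<phi> t0) = \<phi> t0" using g'[of "\<phi> t0"] lt[of t0] ne ne1 by auto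
  have nes: "\<phi> t0 \<noteq> \<phi>' s0" using small'[of s0] lt[of t0] ne ne1 by auto
  have 1: "fold trace_layer (snd \<tau>1) (3, [0, 1], [0, 2, 2, 1], 0) = (m, [\<phi> b0, 1], [\<phi> t0, \<phi> t0, \<phi> b0, 1], c)"
    using f g g1 b by simp
  have 2: "fold trace_layer (shift 2 (snd \<tau>2)) (m, [\<phi> b0, 1], [\<phi> t0, \<phi> t0, \<phi> b0, 1], c) =
      (m', map g' [\<phi> b0, 1], [\<phi> t0, \<phi> t0, \<phi>' s0, \<phi>' s1], c + c')"
    using f' gt by (simp add: numeral_2_eq_2)
  have "trace (tangle_add \<tau>1 \<tau>2) = trace_layer (1, Cap (upper \<tau>1 ! 1)) (fold trace_layer (shift 2 (snd \<tau>2))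
     (fold trace_layer (snd \<tau>1) (trace_layer (1, Cup (lower \<tau>1 ! 1)) (2, [0, 1], [0, 1], 0))))"
    by (simp add: trace_def tangle_add_def lower_def upt_rec numeral_2_eq_2)
  also have "trace_layer (1, Cup (lower \<tau>1 ! 1)) (2, [0, 1], [0, 1], 0) = (3, [0, 1], [0, 2, 2, 1], 0)" by simp
  finally have "trace (tangle_add \<tau>1 \<tau>2) = trace_layer (1, Cap (upper \<tau>1 ! 1)) (m', map g' [\<phi> b0, 1], [\<phi> t0, \<phi> t0, \<phi>' s0, \<phi>' s1], c + c')"
    unfolding 1 2 .
  then show ?thesis using nes by (simp add: closed_components_def tr1 tr2 Let_def)
qed

section \<open>Quiver forms and rotation\<close>

lemma homfly_iff:
  "homfly X j \<tau> c \<longleftrightarrow> (\<forall>\<^sub>F N in sequentially. \<forall>x1\<in>ksets N j. \<forall>x2\<in>ksets N j. \<forall>y1\<in>ksets N j. \<forall>y2\<in>ksets N j.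
     tangle_matrix N j \<tau> [x1, x2] [y1, y2] = (\<Sum>k\<le>j. at_rank N (c k) * web_matrix N (basic_web X j k) [x1, x2] [y1, y2]))"
proof -
  have "states N [j, j] = (\<lambda>(S, T). [S, T]) ` (ksets N j \<times> ksets N j)" for N
    by (auto simp: states_two)
  then show ?thesis by (simp add: homfly_def)
qed

lemma qv_powi_cancel: "qv powi m * u = v \<longleftrightarrow> u = qv powi (- m) * v"
proof -
  have "qv powi (- m) * qv powi m = 1" "qv powi m * qv powi (- m) = 1"
    by (simp_all add: power_int_minus)
  then show ?thesis by (auto simp: mult.assoc[symmetric])
qed

lemma boundary_type_ends: "boundary_type X \<tau> \<longleftrightarrow> \<tau> \<in> T4 \<and> lower \<tau> = bottom_dirs X \<and> upper \<tau> = top_dirs X"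
  by (cases X) (auto simp: boundary_type_def bT4_def)

lemma boundary_rotate_RI: "boundary_type RI \<tau> \<Longrightarrow> boundary_type UP (rotate_tangle \<tau>)"
  by (simp add: boundary_type_ends rotate_ends)

text \<open>The powers of q in \<open>rotate_matrix\<close> and \<open>rotate_RI\<close> agree and
  cancel, so both expansions are the same equations with permuted labels; k turns into j - k as for
  the webs.\<close>

lemma homfly_rotate_RI:
  assumes b: "boundary_type RI \<tau>" and c: "\<And>N k. k \<le> j \<Longrightarrow> at_rank N (c' k) = at_rank N (c (j - k))"
  shows "homfly UP j (rotate_tangle \<tau>) c \<longleftrightarrow> homfly RI j \<tau> c'"
proof -
  have \<tau>: "\<tau> \<in> T4" "lower \<tau> = [Up, Dn]" "upper \<tau> = [Dn, Up]" using b by (simp_all add: boundary_type_ends)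
  have "tangle_matrix N j (rotate_tangle \<tau>) [x1, x2] [y1, y2] = (\<Sum>k\<le>j. at_rank N (c k) * web_matrix N (basic_web UP j k) [x1, x2] [y1, y2])
      \<longleftrightarrow> tangle_matrix N j \<tau> [x2, y2] [x1, y1] = (\<Sum>k\<le>j. at_rank N (c' k) * web_matrix N (basic_web RI j k) [x2, y2] [x1, y1])"
    if x: "x1 \<in> ksets N j" "x2 \<in> ksets N j" "y1 \<in> ksets N j" "y2 \<in> ksets N j" for N x1 x2 y1 y2
  proof -
    have "(\<Sum>k\<le>j. at_rank N (c k) * web_matrix N (basic_web UP j k) [x1, x2] [y1, y2])
        = (\<Sum>k\<le>j. at_rank N (c (j - k)) * web_matrix N (basic_web UP j (j - k)) [x1, x2] [y1, y2])"
      by (rule sum.reindex_bij_witness[of _ "\<lambda>k. j - k" "\<lambda>k. j - k"]) auto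
    then have "qv powi (two_rho N y2 - two_rho N x1) * (\<Sum>k\<le>j. at_rank N (c k) * web_matrix N (basic_web UP j k) [x1, x2] [y1, y2])
        = (\<Sum>k\<le>j. at_rank N (c' k) * web_matrix N (basic_web RI j k) [x2, y2] [x1, y1])"
      by (simp add: sum_distrib_left rotate_RI[OF _ x] c mult.left_commute)
    from this[unfolded qv_powi_cancel] have "(\<Sum>k\<le>j. at_rank N (c k) * web_matrix N (basic_web UP j k) [x1, x2] [y1, y2]) =
        qv powi (two_rho N x1 - two_rho N y2) * (\<Sum>k\<le>j. at_rank N (c' k) * web_matrix N (basic_web RI j k) [x2, y2] [x1, y1])"
      by (simp only: minus_diff_eq)
    moreover have "tangle_matrix N j (rotate_tangle \<tau>) [x1, x2] [y1, y2] =
        qv powi (two_rho N x1 - two_rho N y2) * tangle_matrix N j \<tau> [x2, y2] [x1, y1]"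
      by (simp add: rotate_matrix[OF \<tau>(1) x] \<tau>(2,3) cup_weight_def cap_weight_def power_int_diff power_int_minus divide_simps)
    ultimately show ?thesis by simp
  qed
  then have "(\<forall>x1\<in>ksets N j. \<forall>x2\<in>ksets N j. \<forall>y1\<in>ksets N j. \<forall>y2\<in>ksets N j.
      tangle_matrix N j (rotate_tangle \<tau>) [x1, x2] [y1, y2] = (\<Sum>k\<le>j. at_rank N (c k) * web_matrix N (basic_web UP j k) [x1, x2] [y1, y2]))
    \<longleftrightarrow> (\<forall>x1\<in>ksets N j. \<forall>x2\<in>ksets N j. \<forall>y1\<in>ksets N j. \<forall>y2\<in>ksets N j.
      tangle_matrix N j \<tau> [x1, x2] [y1, y2] = (\<Sum>k\<le>j. at_rank N (c' k) * web_matrix N (basic_web RI j k) [x1, x2] [y1, y2]))" for N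
    by meson
  then show ?thesis unfolding homfly_iff by presburger
qed

lemma form_rotate_RI:
  assumes b: "boundary_type RI \<tau>"
  shows "(\<exists>D. active_quiver_form UP (rotate_tangle \<tau>) D) \<longleftrightarrow> (\<exists>D. inactive_quiver_form RI \<tau> D)"
proof
  have cc: "closed_components (rotate_tangle \<tau>) = closed_components \<tau>"
    using b by (simp add: boundary_type_ends closed_components_rotate)
  {
    assume "\<exists>D. active_quiver_form UP (rotate_tangle \<tau>) D"
    then obtain D where D: "active_quiver_form UP (rotate_tangle \<tau>) D" ..
    \<comment> \<open>Exchanging active and inactive indices turns the extra factor in |d_a| into
      the one in |d_i|.\<close>
    obtain D' where D': "active D' = inactive D" "inactive D' = active D"
      "\<And>N c j k extra. k \<le> j \<Longrightarrow> at_rank N (quiver_coeff c (\<lambda>s t. extra t s) D' j k) = at_rank N (quiver_coeff c extra D j (j - k))"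
      using quiver_swap[of D] by blast
    have "homfly RI j \<tau> (quiver_coeff (closed_components \<tau>) (\<lambda>s t. qfac t) D' j)" for j
      using D cc homfly_rotate_RI[OF b, of j "quiver_coeff (closed_components \<tau>) (\<lambda>s t. qfac t) D' j" "quiver_coeff (closed_components \<tau>) (\<lambda>s t. qfac s) D j"] D'(3)[of _ j _ _ "\<lambda>s t. qfac s"]
      by (simp add: active_quiver_form_def form_with_def)
    then show "\<exists>D. inactive_quiver_form RI \<tau> D"
      using D D'(1,2) b by (intro exI[of _ D']) (auto simp: inactive_quiver_form_def active_quiver_form_def form_with_def num_indices_def)
  next
    assume "\<exists>D. inactive_quiver_form RI \<tau> D"
    then obtain D where D: "inactive_quiver_form RI \<tau> D" ..
    obtain D' where D': "active D' = inactive D" "inactive D' = active D"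
      "\<And>N c j k extra. k \<le> j \<Longrightarrow> at_rank N (quiver_coeff c (\<lambda>s t. extra t s) D' j k) = at_rank N (quiver_coeff c extra D j (j - k))"
      using quiver_swap[of D] by blast
    have "at_rank N (quiver_coeff c (\<lambda>s t. qfac t) D j k) = at_rank N (quiver_coeff c (\<lambda>s t. qfac s) D' j (j - k))" if "k \<le> j" for N c j k
      using D'(3)[of "j - k" j N c "\<lambda>s t. qfac t"] that by simp
    then have "homfly UP j (rotate_tangle \<tau>) (quiver_coeff (closed_components \<tau>) (\<lambda>s t. qfac s) D' j)" for j
      using D homfly_rotate_RI[OF b, of j "quiver_coeff (closed_components \<tau>) (\<lambda>s t. qfac t) D j" "quiver_coeff (closed_components \<tau>) (\<lambda>s t. qfac s) D' j"]
      by (simp add: inactive_quiver_form_def form_with_def)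
    then show "\<exists>D. active_quiver_form UP (rotate_tangle \<tau>) D"
      using D D'(1,2) boundary_rotate_RI[OF b] cc by (intro exI[of _ D']) (auto simp: inactive_quiver_form_def active_quiver_form_def form_with_def num_indices_def)
  }
qed

text \<open>Four quarter turns produce a longer word than the given one, so forms are transferred
  through the matrices. These differ by a power of q whose exponent is the difference of total
  weights below and above, which vanishes wherever some web entry is nonzero.\<close>

lemma rotate4_UP:
  assumes b: "boundary_type UP \<tau>"
  shows "boundary_type RI ((rotate_tangle ^^ 3) \<tau>)" "boundary_type UP ((rotate_tangle ^^ 4) \<tau>)"
    and "r \<in> {1, 2} \<Longrightarrow> (rotate_tangle ^^ r) \<tau> \<notin> bT4"
    and "active_quiver_form UP ((rotate_tangle ^^ 4) \<tau>) D \<Longrightarrow> active_quiver_form UP \<tau> D"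
proof -
  have r0: "\<tau> \<in> T4" "lower \<tau> = [Up, Up]" "upper \<tau> = [Up, Up]" using b by (simp_all add: boundary_type_ends)
  define \<tau>1 where "\<tau>1 = rotate_tangle \<tau>"
  have r1: "\<tau>1 \<in> T4" "lower \<tau>1 = [Dn, Up]" "upper \<tau>1 = [Up, Dn]" using rotate_ends[OF r0(1)] r0 by (simp_all add: \<tau>1_def)
  define \<tau>2 where "\<tau>2 = rotate_tangle \<tau>1"
  have r2: "\<tau>2 \<in> T4" "lower \<tau>2 = [Dn, Dn]" "upper \<tau>2 = [Dn, Dn]" using rotate_ends[OF r1(1)] r1 by (simp_all add: \<tau>2_def)
  define \<tau>3 where "\<tau>3 = rotate_tangle \<tau>2"
  have r3: "\<tau>3 \<in> T4" "lower \<tau>3 = [Up, Dn]" "upper \<tau>3 = [Dn, Up]" using rotate_ends[OF r2(1)] r2 by (simp_all add: \<tau>3_def)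
  define \<tau>4 where "\<tau>4 = rotate_tangle \<tau>3"
  have r4: "\<tau>4 \<in> T4" "lower \<tau>4 = [Up, Up]" "upper \<tau>4 = [Up, Up]" using rotate_ends[OF r3(1)] r3 by (simp_all add: \<tau>4_def)
  have it: "(rotate_tangle ^^ 2) \<tau> = \<tau>2" "(rotate_tangle ^^ 3) \<tau> = \<tau>3" "(rotate_tangle ^^ 4) \<tau> = \<tau>4"
    by (simp_all add: \<tau>4_def \<tau>3_def \<tau>2_def \<tau>1_def eval_nat_numeral)
  show "boundary_type RI ((rotate_tangle ^^ 3) \<tau>)" "boundary_type UP ((rotate_tangle ^^ 4) \<tau>)"
    using r3 r4 by (simp_all add: it boundary_type_ends)
  show "r \<in> {1, 2} \<Longrightarrow> (rotate_tangle ^^ r) \<tau> \<notin> bT4"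
    using r1 r2 it(1) by (auto simp: bT4_def \<tau>1_def)
  assume D: "active_quiver_form UP ((rotate_tangle ^^ 4) \<tau>) D"
  have cc: "closed_components \<tau>4 = closed_components \<tau>"
    unfolding \<tau>4_def closed_components_rotate[OF r3(1)] unfolding \<tau>3_def closed_components_rotate[OF r2(1)]
    unfolding \<tau>2_def closed_components_rotate[OF r1(1)] unfolding \<tau>1_def closed_components_rotate[OF r0(1)] by (rule refl)
  have "homfly UP j \<tau> c" if h: "homfly UP j \<tau>4 c" for j c
    using h unfolding homfly_iff
  proof (rule eventually_mono, intro ballI)
    fix N x1 x2 y1 y2 assume x: "x1 \<in> ksets N j" "x2 \<in> ksets N j" "y1 \<in> ksets N j" "y2 \<in> ksets N j"
      and h: "\<forall>x1\<in>ksets N j. \<forall>x2\<in>ksets N j. \<forall>y1\<in>ksets N j. \<forall>y2\<in>ksets N j.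
        tangle_matrix N j \<tau>4 [x1, x2] [y1, y2] = (\<Sum>k\<le>j. at_rank N (c k) * web_matrix N (basic_web UP j k) [x1, x2] [y1, y2])"
    let ?w = "\<lambda>N. two_rho N x1 + two_rho N x2 - two_rho N y1 - two_rho N y2"
    let ?S = "\<Sum>k\<le>j. at_rank N (c k) * web_matrix N (basic_web UP j k) [x1, x2] [y1, y2]"
    have "tangle_matrix N j \<tau>4 [x1, x2] [y1, y2] = qv powi (two_rho N x1 - two_rho N y2) * tangle_matrix N j \<tau>3 [x2, y2] [x1, y1]"
      by (simp add: \<tau>4_def rotate_matrix[OF r3(1) x] r3(2,3) cup_weight_def cap_weight_def power_int_diff power_int_minus divide_simps)
    moreover have "tangle_matrix N j \<tau>3 [x2, y2] [x1, y1] = qv powi (two_rho N x2 - two_rho N y1) * tangle_matrix N j \<tau>2 [y2, y1] [x2, x1]"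
      by (simp add: \<tau>3_def rotate_matrix[OF r2(1) x(2,4,1,3)] r2(2,3) cup_weight_def cap_weight_def power_int_diff power_int_minus divide_simps)
    moreover have "tangle_matrix N j \<tau>2 [y2, y1] [x2, x1] = tangle_matrix N j \<tau>1 [y1, x1] [y2, x2]"
      by (simp add: \<tau>2_def rotate_matrix[OF r1(1) x(4,3,2,1)] r1(2,3) cup_weight_def cap_weight_def)
    moreover have "tangle_matrix N j \<tau>1 [y1, x1] [y2, x2] = tangle_matrix N j \<tau> [x1, x2] [y1, y2]"
      by (simp add: \<tau>1_def rotate_matrix[OF r0(1) x(3,1,4,2)] r0(2,3) cup_weight_def cap_weight_def)
    ultimately have "tangle_matrix N j \<tau>4 [x1, x2] [y1, y2] =
        qv powi (two_rho N x1 - two_rho N y2) * (qv powi (two_rho N x2 - two_rho N y1) * tangle_matrix N j \<tau> [x1, x2] [y1, y2])" by simp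
    also have "\<dots> = qv powi (two_rho N x1 - two_rho N y2 + (two_rho N x2 - two_rho N y1)) * tangle_matrix N j \<tau> [x1, x2] [y1, y2]"
      by (simp add: power_int_add)
    also have "two_rho N x1 - two_rho N y2 + (two_rho N x2 - two_rho N y1) = ?w N" by simp
    finally have eq: "qv powi ?w N * tangle_matrix N j \<tau> [x1, x2] [y1, y2] = ?S" using h x by simp
    show "tangle_matrix N j \<tau> [x1, x2] [y1, y2] = ?S"
    proof (cases "?w N = 0")
      case True
      then show ?thesis using eq by simp
    next
      case False
      \<comment> \<open>Off weight 0 all web entries vanish, and then the equation forces the tangle
        entry to vanish too.\<close>
      then have "?S = 0" using web_UP_weight[OF _ x] by (intro sum.neutral) fastforce
      with eq show ?thesis by (simp add: qv_powi_cancel)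
    qed
  qed
  with D b cc show "active_quiver_form UP \<tau> D"
    by (auto simp: it active_quiver_form_def form_with_def)
qed

text \<open>The half turn of an \<open>OP\<close> tangle has the same boundary type; the two powers
  of q from the rotations are matched by \<open>rotate_OP\<close>.\<close>

lemma rotate2_OP:
  assumes b: "boundary_type OP \<tau>"
  shows "boundary_type OP ((rotate_tangle ^^ 2) \<tau>)" "rotate_tangle \<tau> \<notin> bT4"
    and "inactive_quiver_form OP ((rotate_tangle ^^ 2) \<tau>) D \<Longrightarrow> inactive_quiver_form OP \<tau> D"
proof -
  have r0: "\<tau> \<in> T4" "lower \<tau> = [Up, Dn]" "upper \<tau> = [Up, Dn]" using b by (simp_all add: boundary_type_ends)
  define \<tau>1 where "\<tau>1 = rotate_tangle \<tau>"
  have r1: "\<tau>1 \<in> T4" "lower \<tau>1 = [Dn, Up]" "upper \<tau>1 = [Dn, Up]" using rotate_ends[OF r0(1)] r0 by (simp_all add: \<tau>1_def)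
  define \<tau>2 where "\<tau>2 = rotate_tangle \<tau>1"
  have r2: "\<tau>2 \<in> T4" "lower \<tau>2 = [Up, Dn]" "upper \<tau>2 = [Up, Dn]" using rotate_ends[OF r1(1)] r1 by (simp_all add: \<tau>2_def)
  have it: "(rotate_tangle ^^ 2) \<tau> = \<tau>2" by (simp add: \<tau>2_def \<tau>1_def eval_nat_numeral)
  show "boundary_type OP ((rotate_tangle ^^ 2) \<tau>)" using r2 by (simp add: it boundary_type_ends)
  show "rotate_tangle \<tau> \<notin> bT4" using r1 by (simp add: bT4_def \<tau>1_def)
  assume D: "inactive_quiver_form OP ((rotate_tangle ^^ 2) \<tau>) D"
  have cc: "closed_components \<tau>2 = closed_components \<tau>"
    unfolding \<tau>2_def closed_components_rotate[OF r1(1)] unfolding \<tau>1_def closed_components_rotate[OF r0(1)] by (rule refl)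
  have "homfly OP j \<tau> c" if h: "homfly OP j \<tau>2 c" for j c
    using h unfolding homfly_iff
  proof (rule eventually_mono, intro ballI)
    fix N y2 y1 x2 x1 assume x: "y2 \<in> ksets N j" "y1 \<in> ksets N j" "x2 \<in> ksets N j" "x1 \<in> ksets N j"
      and h: "\<forall>x1\<in>ksets N j. \<forall>x2\<in>ksets N j. \<forall>y1\<in>ksets N j. \<forall>y2\<in>ksets N j.
        tangle_matrix N j \<tau>2 [x1, x2] [y1, y2] = (\<Sum>k\<le>j. at_rank N (c k) * web_matrix N (basic_web OP j k) [x1, x2] [y1, y2])"
    have "tangle_matrix N j \<tau>2 [x1, x2] [y1, y2] = qv powi two_rho N x1 * tangle_matrix N j \<tau>1 [x2, y2] [x1, y1]"
      by (simp add: \<tau>2_def rotate_matrix[OF r1(1) x(4,3,2,1)] r1(2,3) cup_weight_def cap_weight_def)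
    moreover have "tangle_matrix N j \<tau>1 [x2, y2] [x1, y1] = qv powi (- two_rho N y1) * tangle_matrix N j \<tau> [y2, y1] [x2, x1]"
      by (simp add: \<tau>1_def rotate_matrix[OF r0(1) x(3,1,4,2)] r0(2,3) cup_weight_def cap_weight_def)
    ultimately have "qv powi two_rho N x1 * (qv powi (- two_rho N y1) * tangle_matrix N j \<tau> [y2, y1] [x2, x1]) =
        (\<Sum>k\<le>j. at_rank N (c k) * web_matrix N (basic_web OP j k) [x1, x2] [y1, y2])" using h x by simp
    from this[unfolded qv_powi_cancel] have "tangle_matrix N j \<tau> [y2, y1] [x2, x1] =
        qv powi two_rho N y1 * (qv powi (- two_rho N x1) * (\<Sum>k\<le>j. at_rank N (c k) * web_matrix N (basic_web OP j k) [x1, x2] [y1, y2]))"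
      by (simp only: minus_minus)
    also have "\<dots> = (\<Sum>k\<le>j. at_rank N (c k) * (qv powi (- two_rho N x1) * (qv powi two_rho N y1 * web_matrix N (basic_web OP j k) [x1, x2] [y1, y2])))"
      by (simp add: sum_distrib_left mult_ac)
    also have "\<dots> = (\<Sum>k\<le>j. at_rank N (c k) * web_matrix N (basic_web OP j k) [y2, y1] [x2, x1])"
    proof (intro sum.cong refl arg_cong2[where f = "(*)"])
      fix k assume "k \<in> {..j}"
      then have k: "k \<le> j" by simp
      show "qv powi (- two_rho N x1) * (qv powi two_rho N y1 * web_matrix N (basic_web OP j k) [x1, x2] [y1, y2]) =
          web_matrix N (basic_web OP j k) [y2, y1] [x2, x1]"
        unfolding rotate_OP[OF k x(4,3,2,1)] by (rule qv_powi_cancel[THEN iffD2]) simp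
    qed
    finally show "tangle_matrix N j \<tau> [y2, y1] [x2, x1] = (\<Sum>k\<le>j. at_rank N (c k) * web_matrix N (basic_web OP j k) [y2, y1] [x2, x1])" .
  qed
  with D b cc show "inactive_quiver_form OP \<tau> D"
    by (auto simp: it inactive_quiver_form_def form_with_def)
qed

section \<open>Existence of the forms\<close>

lemma has_type_unique:
  assumes "has_type \<tau> t" "has_type \<tau> t'"
  shows "t = t'"
proof -
  have T4: "\<tau> \<in> T4" using assms(1) by (cases t) (auto simp: boundary_type_ends)
  show ?thesis using assms connects_exclusive[OF T4] by (cases t; cases t') (auto simp: boundary_type_ends)
qed

text \<open>The two crossing rules apply only to tangles with diagonal arcs, and the type of a
  tangle is unique; so membership must stem from a form, and of the required kind.\<close>

lemma bQT4_form:
  assumes "\<tau> \<in> bQT4" "has_type \<tau> t" "t \<in> {UP_par, OP_lr, RI_par}"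
  shows "\<exists>D. required_form t \<tau> D"
  using assms(1)
proof cases
  case (form t' D)
  then show ?thesis using has_type_unique[OF form(2) assms(2)] by blast
next
  case (top_crossing t' x)
  then show ?thesis using has_type_unique[OF top_crossing(2) assms(2)] assms(3) by auto
next
  case (right_crossing t' x)
  then show ?thesis using has_type_unique[OF right_crossing(2) assms(2)] assms(3) by auto
qed

lemma bQT4_bT4: "\<tau> \<in> bQT4 \<Longrightarrow> \<tau> \<in> bT4"
  by (erule bQT4.cases) simp_all

lemma rotations_T4: "\<tau> \<in> T4 \<Longrightarrow> (rotate_tangle ^^ r) \<tau> \<in> T4"
  by (induction r) (simp_all add: rotate_ends)

lemma connects_rotations2:
  assumes "\<tau> \<in> T4"
  shows "connects_vertically ((rotate_tangle ^^ 2) \<tau>) \<longleftrightarrow> connects_vertically \<tau>"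
    "connects_horizontally ((rotate_tangle ^^ 2) \<tau>) \<longleftrightarrow> connects_horizontally \<tau>"
  using assms by (simp_all add: numeral_2_eq_2 connects_rotate rotate_ends)

text \<open>The number r of quarter turns is arbitrary, so full turns are peeled off by strong
  induction. Of r = 0, 1, 2, 3 only 0 and 3 have the SW end oriented inward. For r = 3 the form is
  one of type RI, and a further quarter turn makes it one of type UP for the full turn.\<close>

lemma rotate_up_form:
  "has_type \<tau> UP_par \<Longrightarrow> (rotate_tangle ^^ r) \<tau> \<in> bQT4 \<Longrightarrow> \<exists>D. active_quiver_form UP \<tau> D"
proof (induction r arbitrary: \<tau> rule: less_induct)
  case (less r)
  have b: "boundary_type UP \<tau>" and v: "connects_vertically \<tau>" using less.prems(1) by simp_all
  then have T4: "\<tau> \<in> T4" by (simp add: boundary_type_ends)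
  note rot = rotate4_UP[OF b]
  consider "r = 0" | "r \<in> {1, 2}" | "r = 3" | "4 \<le> r" by force
  then show ?case
  proof cases
    case 1
    then show ?thesis using bQT4_form[OF _ less.prems(1)] less.prems(2) by simp
  next
    case 2
    then show ?thesis using rot(3) bQT4_bT4 less.prems(2) by blast
  next
    case 3
    have h: "connects_horizontally ((rotate_tangle ^^ 3) \<tau>)"
      using v T4 connects_rotations2(1)[OF T4] rotations_T4[OF T4, of 2] by (simp add: connects_rotate eval_nat_numeral)
    have "\<exists>D. inactive_quiver_form RI ((rotate_tangle ^^ 3) \<tau>) D"
      using bQT4_form[of _ RI_par] less.prems(2) rot(1) h 3 by fastforce
    then have "\<exists>D. active_quiver_form UP ((rotate_tangle ^^ 4) \<tau>) D"
      using form_rotate_RI[OF rot(1)] by (simp add: eval_nat_numeral)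
    then show ?thesis using rot(4) by blast
  next
    case 4
    have "(rotate_tangle ^^ 4) \<tau> = (rotate_tangle ^^ 2) ((rotate_tangle ^^ 2) \<tau>)"
      by (simp add: eval_nat_numeral)
    then have "has_type ((rotate_tangle ^^ 4) \<tau>) UP_par"
      using rot(2) v connects_rotations2(1)[OF T4] connects_rotations2(1)[OF rotations_T4[OF T4, of 2]] by simp
    moreover have "(rotate_tangle ^^ (r - 4)) ((rotate_tangle ^^ 4) \<tau>) \<in> bQT4"
      using less.prems(2) 4 funpow_add[of "r - 4" 4 rotate_tangle] by simp
    ultimately have "\<exists>D. active_quiver_form UP ((rotate_tangle ^^ 4) \<tau>) D"
      using less.IH[of "r - 4"] 4 by simp
    then show ?thesis using rot(4) by blast
  qed
qed

lemma rotate_op_form: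
  "has_type \<tau> OP_lr \<Longrightarrow> (rotate_tangle ^^ r) \<tau> \<in> bQT4 \<Longrightarrow> \<exists>D. inactive_quiver_form OP \<tau> D"
proof (induction r arbitrary: \<tau> rule: less_induct)
  case (less r)
  have b: "boundary_type OP \<tau>" and v: "connects_horizontally \<tau>" using less.prems(1) by simp_all
  then have T4: "\<tau> \<in> T4" by (simp add: boundary_type_ends)
  note rot = rotate2_OP[OF b]
  consider "r = 0" | "r = 1" | "2 \<le> r" by force
  then show ?case
  proof cases
    case 1
    then show ?thesis using bQT4_form[OF _ less.prems(1)] less.prems(2) by simp
  next
    case 2
    then show ?thesis using rot(2) bQT4_bT4 less.prems(2) by simp
  next
    case 3
    have "has_type ((rotate_tangle ^^ 2) \<tau>) OP_lr"
      using rot(1) v connects_rotations2(2)[OF T4] by simp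
    moreover have "(rotate_tangle ^^ (r - 2)) ((rotate_tangle ^^ 2) \<tau>) \<in> bQT4"
      using less.prems(2) 3 by (metis comp_apply funpow_add le_add_diff_inverse2)
    ultimately have "\<exists>D. inactive_quiver_form OP ((rotate_tangle ^^ 2) \<tau>) D"
      using less.IH[of "r - 2"] 3 by simp
    then show ?thesis using rot(3) by blast
  qed
qed

text \<open>One quarter turn leads to type UP_par, where any number of remaining turns is already
  covered; then the form is turned back.\<close>

lemma rotate_ri_form:
  assumes "has_type \<tau> RI_par" "(rotate_tangle ^^ r) \<tau> \<in> bQT4"
  shows "\<exists>D. inactive_quiver_form RI \<tau> D"
proof (cases r)
  case 0
  then show ?thesis using bQT4_form[OF _ assms(1)] assms(2) by simp
next
  case (Suc s)
  have b: "boundary_type RI \<tau>" and h: "connects_horizontally \<tau>" using assms(1) by simp_all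
  have "has_type (rotate_tangle \<tau>) UP_par"
    using boundary_rotate_RI[OF b] h b by (simp add: connects_rotate boundary_type_ends)
  then have "\<exists>D. active_quiver_form UP (rotate_tangle \<tau>) D"
    using assms(2) Suc by (intro rotate_up_form[of _ s]) (simp_all add: funpow_swap1)
  then show ?thesis using form_rotate_RI[OF b] by simp
qed

text \<open>Membership in \<open>QT4\<close> provides a form for some rotation only, whereas the
  gluing needs one for the tangle as it stands.\<close>

lemma QT4_form:
  assumes "\<tau> \<in> QT4" "has_type \<tau> t" "t \<in> {UP_par, OP_lr, RI_par}"
  shows "\<exists>D. required_form t \<tau> D"
proof -
  obtain r where r: "(rotate_tangle ^^ r) \<tau> \<in> bQT4" using assms(1) by (auto simp: QT4_def)
  from assms(3) consider "t = UP_par" | "t = OP_lr" | "t = RI_par" by blast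
  then show ?thesis
  proof cases
    case 1
    then show ?thesis using rotate_up_form[OF _ r] assms(2) by (simp only: required_form.simps)
  next
    case 2
    then show ?thesis using rotate_op_form[OF _ r] assms(2) by (simp only: required_form.simps)
  next
    case 3
    then show ?thesis using rotate_ri_form[OF _ r] assms(2) by (simp only: required_form.simps)
  qed
qed

section \<open>Gluing\<close>

text \<open>Separates the topology from the algebra: \<open>glue\<close> expresses how the webs
  compose, \<open>coeff\<close> that the data D have the resulting coefficients, and bilinearity of
  the gluing does the rest.\<close>

lemma quiver_form_add:
  assumes form: "form_with e1 X1 \<tau>1 D1" "form_with e2 X2 \<tau>2 D2"
    and "gluable \<tau>1 \<tau>2" "connects_horizontally \<tau>1"
    and X: "bottom_dirs X = [bottom_dirs X1 ! 0, bottom_dirs X2 ! 1]" "top_dirs X = [top_dirs X1 ! 0, top_dirs X2 ! 1]"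
    and num: "num_indices D \<ge> 1"
    and glue: "\<And>N j k l x1 x2 y1 y2. k \<le> j \<Longrightarrow> l \<le> j \<Longrightarrow>
      x1 \<in> ksets N j \<Longrightarrow> x2 \<in> ksets N j \<Longrightarrow> y1 \<in> ksets N j \<Longrightarrow> y2 \<in> ksets N j \<Longrightarrow>
      (\<Sum>U\<in>ksets N j. \<Sum>V\<in>ksets N j. cup_weight N (bottom_dirs X1 ! 1) U * cap_weight N (top_dirs X1 ! 1) V *
        (web_matrix N (basic_web X1 j k) [x1, U] [y1, V] * web_matrix N (basic_web X2 j l) [U, x2] [V, y2]))
      = (\<Sum>h\<le>j. g N j k l h * web_matrix N (basic_web X j h) [x1, x2] [y1, y2])"
    and coeff: "\<And>N c1 c2 j h. h \<le> j \<Longrightarrow> at_rank N (quiver_coeff (c1 + c2) (\<lambda>s t. 1) D j h) =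
      (\<Sum>k\<le>j. \<Sum>l\<le>j. at_rank N (quiver_coeff c1 e1 D1 j k) * at_rank N (quiver_coeff c2 e2 D2 j l) * g N j k l h)"
  shows "quiver_form X (tangle_add \<tau>1 \<tau>2) D"
proof -
  define c1 c2 where "c1 = closed_components \<tau>1" and "c2 = closed_components \<tau>2"
  have t1: "\<tau>1 \<in> T4" "lower \<tau>1 = bottom_dirs X1" "upper \<tau>1 = top_dirs X1"
    and t2: "\<tau>2 \<in> T4" "lower \<tau>2 = bottom_dirs X2" "upper \<tau>2 = top_dirs X2"
    using form by (auto simp: form_with_def boundary_type_ends)
  have cc: "closed_components (tangle_add \<tau>1 \<tau>2) = c1 + c2"
    unfolding c1_def c2_def by (rule closed_components_add[OF t1(1) t2(1) assms(4)])
  have "boundary_type X (tangle_add \<tau>1 \<tau>2)"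
    using tangle_add_ends[OF t1(1) t2(1) assms(3)] X t1 t2 by (simp add: boundary_type_ends)
  moreover have "homfly X j (tangle_add \<tau>1 \<tau>2) (quiver_coeff (c1 + c2) (\<lambda>s t. 1) D j)" for j
  proof -
    define a1 a2 where "a1 = (\<lambda>N k. at_rank N (quiver_coeff c1 e1 D1 j k))"
      and "a2 = (\<lambda>N k. at_rank N (quiver_coeff c2 e2 D2 j k))"
    have "homfly X1 j \<tau>1 (quiver_coeff c1 e1 D1 j)" "homfly X2 j \<tau>2 (quiver_coeff c2 e2 D2 j)"
      using form by (auto simp: form_with_def c1_def c2_def)
    then show ?thesis
      unfolding homfly_iff
    \<comment> \<open>The expansions of the two summands hold for large N only, while the rules
      \<open>glue\<close> and \<open>coeff\<close> hold for every N.\<close>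
    proof (rule eventually_elim2, intro ballI)
      fix N x1 x2 y1 y2 assume x: "x1 \<in> ksets N j" "x2 \<in> ksets N j" "y1 \<in> ksets N j" "y2 \<in> ksets N j"
        and h1: "\<forall>x1\<in>ksets N j. \<forall>x2\<in>ksets N j. \<forall>y1\<in>ksets N j. \<forall>y2\<in>ksets N j. tangle_matrix N j \<tau>1 [x1, x2] [y1, y2] =
          (\<Sum>k\<le>j. at_rank N (quiver_coeff c1 e1 D1 j k) * web_matrix N (basic_web X1 j k) [x1, x2] [y1, y2])"
        and h2: "\<forall>x1\<in>ksets N j. \<forall>x2\<in>ksets N j. \<forall>y1\<in>ksets N j. \<forall>y2\<in>ksets N j. tangle_matrix N j \<tau>2 [x1, x2] [y1, y2] =
          (\<Sum>k\<le>j. at_rank N (quiver_coeff c2 e2 D2 j k) * web_matrix N (basic_web X2 j k) [x1, x2] [y1, y2])"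
      define w where "w = (\<lambda>U V. cup_weight N (bottom_dirs X1 ! 1) U * cap_weight N (top_dirs X1 ! 1) V)"
      define m1 where "m1 = (\<lambda>k U V. web_matrix N (basic_web X1 j k) [x1, U] [y1, V])"
      define m2 where "m2 = (\<lambda>l U V. web_matrix N (basic_web X2 j l) [U, x2] [V, y2])"
      let ?m = "\<lambda>h. web_matrix N (basic_web X j h) [x1, x2] [y1, y2]"
      have "tangle_matrix N j (tangle_add \<tau>1 \<tau>2) [x1, x2] [y1, y2] =
          (\<Sum>U\<in>ksets N j. \<Sum>V\<in>ksets N j. w U V * ((\<Sum>k\<le>j. a1 N k * m1 k U V) * (\<Sum>l\<le>j. a2 N l * m2 l U V)))"
        unfolding tangle_add_matrix[OF t1(1) t2(1) x]
        by (intro sum.cong refl) (simp add: h1 h2 x t1 w_def a1_def a2_def m1_def m2_def)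
      also have "\<dots> = (\<Sum>U\<in>ksets N j. \<Sum>V\<in>ksets N j. \<Sum>k\<le>j. \<Sum>l\<le>j. a1 N k * a2 N l * (w U V * (m1 k U V * m2 l U V)))"
        unfolding sum_product unfolding sum_distrib_left by (simp add: mult_ac)
      also have "\<dots> = (\<Sum>k\<le>j. \<Sum>l\<le>j. a1 N k * a2 N l * (\<Sum>U\<in>ksets N j. \<Sum>V\<in>ksets N j. w U V * (m1 k U V * m2 l U V)))"
        unfolding sum_distrib_left
        by (subst (2) sum.swap, subst sum.swap, intro sum.cong refl, subst (2) sum.swap, subst sum.swap, rule refl)
      also have "\<dots> = (\<Sum>k\<le>j. \<Sum>l\<le>j. a1 N k * a2 N l * (\<Sum>h\<le>j. g N j k l h * ?m h))"
        unfolding w_def m1_def m2_def using glue[OF _ _ x] by (intro sum.cong refl) simp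
      also have "\<dots> = (\<Sum>k\<le>j. \<Sum>l\<le>j. \<Sum>h\<le>j. a1 N k * a2 N l * g N j k l h * ?m h)"
        by (simp add: sum_distrib_left mult_ac)
      also have "\<dots> = (\<Sum>h\<le>j. \<Sum>k\<le>j. \<Sum>l\<le>j. a1 N k * a2 N l * g N j k l h * ?m h)"
        by (subst (2) sum.swap, subst sum.swap, rule refl)
      also have "\<dots> = (\<Sum>h\<le>j. at_rank N (quiver_coeff (c1 + c2) (\<lambda>s t. 1) D j h) * ?m h)"
        by (intro sum.cong refl) (simp add: coeff a1_def a2_def sum_distrib_right)
      finally show "tangle_matrix N j (tangle_add \<tau>1 \<tau>2) [x1, x2] [y1, y2] = \<dots>" .
    qed
  qed
  ultimately show ?thesis unfolding quiver_form_def form_with_def cc using num by blast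
qed

lemma active_expand:
  "active (expand_active D) = 2 * active D" "inactive (expand_active D) = inactive D"
  "active (expand_inactive D) = active D" "inactive (expand_inactive D) = 2 * inactive D"
  by (simp_all add: expand_active_def expand_inactive_def expand_block_def Let_def)

text \<open>The sum has type RI, UP or OP in the cases RI-RI, OP-UP and OP-OP. The sizes agree with
  the expanded forms because \<open>expand\<close> doubles exactly the block whose extra factor has
  to be absorbed.\<close>

lemma quiver_form_sum:
  assumes "gluable \<tau>1 \<tau>2" "has_type \<tau>1 t1"
    and t: "(t1, t2) \<in> {(RI_par, RI_par), (OP_lr, UP_par), (OP_lr, OP_lr)}"
    and form: "required_form t1 \<tau>1 D1" "required_form t2 \<tau>2 D2"
  shows "\<exists>X D. quiver_form X (tangle_add \<tau>1 \<tau>2) D \<and>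
    num_indices D = num_indices (expand t1 D1) * num_indices (expand t2 D2)"
proof -
  have h: "connects_horizontally \<tau>1" using assms(2) t by auto
  have n: "num_indices D1 \<ge> 1" "num_indices D2 \<ge> 1"
    using form t by (auto simp: active_quiver_form_def inactive_quiver_form_def form_with_def)
  note defs = active_quiver_form_def inactive_quiver_form_def
  from t consider (ri) "t1 = RI_par" "t2 = RI_par" | (opup) "t1 = OP_lr" "t2 = UP_par" | (op) "t1 = OP_lr" "t2 = OP_lr" by auto
  then show ?thesis
  proof cases
    case ri
    obtain D where D: "num_indices D = (active D1 + 2 * inactive D1) * (active D2 + 2 * inactive D2)"
      "\<And>N c1 c2 j h. h \<le> j \<Longrightarrow> at_rank N (quiver_coeff (c1 + c2) (\<lambda>s t. 1) D j h) =
        (\<Sum>k\<le>j. \<Sum>l\<le>j. at_rank N (quiver_coeff c1 (\<lambda>s t. qfac t) D1 j k) * at_rank N (quiver_coeff c2 (\<lambda>s t. qfac t) D2 j l) *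
          glue_coeff (int N * 0 + 0 * int j + int (j - k + (j - l))) (j - k) (j - l) (j - h))"
      using glue_quiver_same[of D1 D2 0 0] by blast
    have "1 \<le> num_indices D" unfolding D(1) using n by (auto simp: num_indices_def Suc_le_eq)
    then have "quiver_form RI (tangle_add \<tau>1 \<tau>2) D"
      using form ri by (intro quiver_form_add[OF _ _ assms(1) h _ _ _ _ D(2)]) (auto simp: defs glue_RI_RI)
    then show ?thesis using D(1) ri by (auto simp: num_indices_def active_expand)
  next
    case op
    obtain D where D: "num_indices D = (active D1 + 2 * inactive D1) * (active D2 + 2 * inactive D2)"
      "\<And>N c1 c2 j h. h \<le> j \<Longrightarrow> at_rank N (quiver_coeff (c1 + c2) (\<lambda>s t. 1) D j h) =
        (\<Sum>k\<le>j. \<Sum>l\<le>j. at_rank N (quiver_coeff c1 (\<lambda>s t. qfac t) D1 j k) * at_rank N (quiver_coeff c2 (\<lambda>s t. qfac t) D2 j l) *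
          glue_coeff (int N * 1 + -2 * int j + int (j - k + (j - l))) (j - k) (j - l) (j - h))"
      using glue_quiver_same[of D1 D2 1 "-2"] by blast
    have "1 \<le> num_indices D" unfolding D(1) using n by (auto simp: num_indices_def Suc_le_eq)
    then have "quiver_form OP (tangle_add \<tau>1 \<tau>2) D"
      using form op by (intro quiver_form_add[OF _ _ assms(1) h _ _ _ _ D(2)]) (auto simp: defs glue_OP_OP)
    then show ?thesis using D(1) op by (auto simp: num_indices_def active_expand)
  next
    case opup
    obtain D where D: "num_indices D = (active D1 + 2 * inactive D1) * (2 * active D2 + inactive D2)"
      "\<And>N c1 c2 j h. h \<le> j \<Longrightarrow> at_rank N (quiver_coeff (c1 + c2) (\<lambda>s t. 1) D j h) =
        (\<Sum>k\<le>j. \<Sum>l\<le>j. at_rank N (quiver_coeff c1 (\<lambda>s t. qfac t) D1 j k) * at_rank N (quiver_coeff c2 (\<lambda>s t. qfac s) D2 j l) *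
          (if h \<le> k \<and> h \<le> l \<and> k + l \<le> j + h then
           qbinom (int N - int k - int l) (j + h - (k + l)) * qbinom (int (j - h)) (j - k) * qbinom (int N - int j - int h) (l - h) else 0))"
      using glue_quiver_OP_UP[of D1 D2] by blast
    have "1 \<le> num_indices D" unfolding D(1) using n by (auto simp: num_indices_def Suc_le_eq)
    then have "quiver_form UP (tangle_add \<tau>1 \<tau>2) D"
      using form opup by (intro quiver_form_add[OF _ _ assms(1) h _ _ _ _ D(2)]) (auto simp: defs intro: glue_OP_UP)
    then show ?thesis using D(1) opup by (auto simp: num_indices_def active_expand)
  qed
qed

theorem proposition3p15:
  fixes \<tau>1 \<tau>2 :: tangle and t1 t2 :: rtype
  assumes "\<tau>1 \<in> QT4" and "\<tau>2 \<in> QT4"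
    and "gluable \<tau>1 \<tau>2"
    and "has_type \<tau>1 t1" and "has_type \<tau>2 t2"
    and "(t1, t2) \<in> {(RI_par, RI_par), (OP_lr, UP_par), (OP_lr, OP_lr)}"
  shows "(\<exists>D1. required_form t1 \<tau>1 D1) \<and> (\<exists>D2. required_form t2 \<tau>2 D2) \<and>
    (\<forall>D1 D2 a1 i1 a2 i2.
       required_form t1 \<tau>1 D1 \<longrightarrow> required_form t2 \<tau>2 D2 \<longrightarrow>
       a1 = active (expand t1 D1) \<longrightarrow> i1 = inactive (expand t1 D1) \<longrightarrow>
       a2 = active (expand t2 D2) \<longrightarrow> i2 = inactive (expand t2 D2) \<longrightarrow>
       (\<exists>X D. quiver_form X (tangle_add \<tau>1 \<tau>2) D \<and>
          num_indices D = (a1 + i1) * (a2 + i2)))"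
proof (intro conjI allI impI)
  show "\<exists>D1. required_form t1 \<tau>1 D1" using assms(6) by (intro QT4_form[OF assms(1,4)]) auto
  show "\<exists>D2. required_form t2 \<tau>2 D2" using assms(6) by (intro QT4_form[OF assms(2,5)]) auto
next
  fix D1 D2 a1 i1 a2 i2
  assume "required_form t1 \<tau>1 D1" "required_form t2 \<tau>2 D2"
    and "a1 = active (expand t1 D1)" "i1 = inactive (expand t1 D1)" "a2 = active (expand t2 D2)" "i2 = inactive (expand t2 D2)"
  then show "\<exists>X D. quiver_form X (tangle_add \<tau>1 \<tau>2) D \<and> num_indices D = (a1 + i1) * (a2 + i2)"
    using quiver_form_sum[OF assms(3,4,6)] by (simp add: num_indices_def)
qed

end
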